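(* Let $K$ be a field of characteristic $0$ and let $\pi$ be a group. Let $C(\pi)$ be the set of pairs $(G,\theta)$, where $G\subset\pi$ is a subgroup of finite index and $\theta\in H^2(G;K^* )$, and let $D(\pi)$ be the set of isomorphism classes of pairs $(L,i_0)$, where $L$ is a normalized simple crossed $\pi$-algebra over $K$ and $i_0\in L_1$ is a basic idempotent; the group $\pi$ acts on $C(\pi)$ by $\alpha(G,\theta)=(\alpha G\alpha^{-1},\alpha_*(\theta))$ and on $D(\pi)$ by $\alpha(L,i_0)=(L,\varphi_\alpha(i_0))$. Then the formula $(G,\theta)\mapsto(L^{\pi,G,\theta},i_0(\theta))$ defines a $\pi$-equivariant bijection $C(\pi)\to D(\pi)$. Hence $D(\pi)/\pi=C(\pi)/\pi$.
   Context: **Crossed $\pi$-algebras.** A $\pi$-algebra over $K$ is an associative $K$-algebra $L=\bigoplus_{\alpha\in\pi}L_\alpha$ with each $L_\alpha$ a projective $K$-module of finite type, $L_\alpha L_\beta\subset L_{\alpha\beta}$, and a two-sided unit $1_L\in L_1$. A Frobenius $\pi$-algebra is a $\pi$-algebra with a symmetric $K$-bilinear form $\eta:L\otimes L\to K$ such that $\eta(L_\alpha\otimes L_\beta)=0$ if $\alpha\beta\ne1$, $\eta|_{L_\alpha\otimes L_{\alpha^{-1}}}$ is non-degenerate for all $\alpha$, and $\eta(ab,c)=\eta(a,bc)$. A crossed $\pi$-algebra is a Frobenius $\pi$-algebra with a group homomorphism $\varphi:\pi\to\mathrm{Aut}(L)$ such that: each $\varphi_\beta$ is an algebra automorphism preserving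 $\eta$ with $\varphi_\beta(L_\alpha)\subset L_{\beta\alpha\beta^{-1}}$; $\varphi_\beta|_{L_\beta}=\mathrm{id}$; $\varphi_\beta(a)b=ba$ for $a\in L$, $b\in L_\beta$; and for all $\alpha,\beta\in\pi$, $c\in L_{\alpha\beta\alpha^{-1}\beta^{-1}}$, $\mathrm{Tr}(a\mapsto c\varphi_\beta(a):L_\alpha\to L_\alpha)=\mathrm{Tr}(b\mapsto\varphi_{\alpha^{-1}}(cb):L_\beta\to L_\beta)$. Morphisms of crossed $\pi$-algebras are algebra homomorphisms mapping $L_\alpha$ to $L'_\alpha$, preserving the unit and inner product and commuting with $\pi$; an isomorphism of pairs $(L,i_0)$ must preserve the distinguished idempotents. **Semisimplicity.** $L$ is semisimple if the commutative algebra $L_1$ is a direct sum of (finitely many) copies of $K$; the units of these copies are the basic idempotents, they form the set $\mathrm{bas}(L)$, permuted by $\pi$ via $\varphi$. $L$ is simple if it is semisimple and $\pi$ acts transitively on $\mathrm{bas}(L)$. A simple $L$ is normalized if $\eta(i,i)=1$ for $i\in\mathrm{bas}(L)$. **The algebra $L^\theta$.** For a group $G$ and a normalized $2$-cocycle $\{\theta_{\alpha,\beta}\in K^*\}_{\alpha,\beta\in G}$ (so $\theta_{\alpha,\beta}\theta_{\alpha\beta,\gamma}=\theta_{\alpha,\beta\gamma}\theta_{\beta,\gamma}$, $\theta_{1,1}=1$), $L^\theta$ is the crossed $G$-algebra with $L_\alpha=Kl_\alpha$, $l_\alpha l_\beta=\theta_{\alpha,\beta}l_{\alpha\beta}$,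 $\eta(l_\alpha,l_{\alpha^{-1}})=\theta_{\alpha,\alpha^{-1}}$, $\eta(l_\alpha,l_\beta)=0$ for $\beta\neq\alpha^{-1}$, and $\varphi_\beta(l_\alpha)$ determined by $\varphi_\beta(l_\alpha)l_\beta=l_\beta l_\alpha$. Its isomorphism class depends only on the class $\theta\in H^2(G;K^* )$. **Transfer.** For a subgroup $G\subset\pi$ of finite index and a crossed $G$-algebra $(L,\eta,\varphi)$, choose representatives $\omega_i$ of the cosets $i=G\omega_i\in G\backslash\pi$, put $N(\alpha)=\{i:\omega_i\alpha\omega_i^{-1}\in G\}$ and $\tilde L_\alpha=\bigoplus_{i\in N(\alpha)}L_{\omega_i\alpha\omega_i^{-1}}$ for $\alpha\in\pi$; multiplication and form are those of $L$ on summands with equal index $i$ and zero on summands with different indices; $\tilde\varphi_\beta$ maps the $i$-th summand of $\tilde L_\alpha$ to the $\beta(i)$-th summand of $\tilde L_{\beta\alpha\beta^{-1}}$ via $\varphi_{\beta_i}$, where $\beta(i)=i\beta^{-1}$ and $\beta_i=\omega_{\beta(i)}\beta\omega_i^{-1}\in G$. This crossed $\pi$-algebra $\tilde L$ is the transfer of $L$; it is independent of the $\omega_i$ up to isomorphism. $L^{\pi,G,\theta}$ denotes the transfer of $L^\theta$, $\theta\in H^2(G;K^* )$; here $\tilde L_1=\bigoplus_{i\in G\backslash\pi}L_1$ with $L_1=K$, and $i_0(\theta)\in\mathrm{bas}(L^{\pi,G,\theta})$ is the unit of the copy of $L_1$ corresponding to the coset $G\in G\backslash\pi$. $\alpha_*:H^2(G;K^*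 )\to H^2(\alpha G\alpha^{-1};K^* )$ is the isomorphism induced by conjugation by $\alpha$. *)

theory Defs
  imports "HOL-Algebra.Algebra"
begin

section \<open>Crossed algebras\<close>

text \<open>
  A graded algebra with a form and an action. The homogeneous component of degree \<open>\<alpha>\<close> is
  \<open>grade L \<alpha>\<close>, the form is \<open>eta L\<close> and the automorphism attached to \<open>\<beta>\<close> is \<open>phi L \<beta>\<close>.
  Values of \<open>grade\<close>, \<open>eta\<close>, \<open>phi\<close> at arguments outside the carriers are irrelevant.
\<close>

record ('g, 'k, 'a) crossed_alg = "('k, 'a) module" +
  grade :: "'g \<Rightarrow> 'a set"
  eta :: "'a \<Rightarrow> 'a \<Rightarrow> 'k"
  phi :: "'g \<Rightarrow> 'a \<Rightarrow> 'a"

text \<open>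
  Vectors \<open>x\<^sub>0, \<dots>, x\<^sub>n\<^sub>-\<^sub>1\<close> of \<open>V\<close> and functionals \<open>f\<^sub>0, \<dots>, f\<^sub>n\<^sub>-\<^sub>1\<close> on \<open>V\<close> with
  \<open>v = f\<^sub>0(v)x\<^sub>0 + \<dots> + f\<^sub>n\<^sub>-\<^sub>1(v)x\<^sub>n\<^sub>-\<^sub>1\<close>: these are the components of linear maps
  \<open>K\<^sup>n \<rightarrow> V\<close> and \<open>V \<rightarrow> K\<^sup>n\<close> that compose to the identity of \<open>V\<close>. Such data exhibit \<open>V\<close> as a
  direct summand of \<open>K\<^sup>n\<close>, i.e. as a projective module of finite type (over a field: as a
  finite-dimensional space), and the trace of an endomorphism \<open>T\<close> is
  \<open>f\<^sub>0(T x\<^sub>0) + \<dots> + f\<^sub>n\<^sub>-\<^sub>1(T x\<^sub>n\<^sub>-\<^sub>1)\<close>, independently of the data.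
\<close>

definition dual_basis ::
  "('k, 'n) ring_scheme \<Rightarrow> ('k, 'a, 'l) module_scheme \<Rightarrow> 'a set
    \<Rightarrow> nat \<Rightarrow> (nat \<Rightarrow> 'a) \<Rightarrow> (nat \<Rightarrow> 'a \<Rightarrow> 'k) \<Rightarrow> bool" where
  "dual_basis K L V n x f \<longleftrightarrow>
     (\<forall>i<n. x i \<in> V \<and> f i \<in> V \<rightarrow> carrier K \<and>
        (\<forall>u\<in>V. \<forall>v\<in>V. f i (u \<oplus>\<^bsub>L\<^esub> v) = f i u \<oplus>\<^bsub>K\<^esub> f i v) \<and>
        (\<forall>c\<in>carrier K. \<forall>v\<in>V. f i (c \<odot>\<^bsub>L\<^esub> v) = c \<otimes>\<^bsub>K\<^esub> f i v)) \<and>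
     (\<forall>v\<in>V. v = (\<Oplus>\<^bsub>L\<^esub>i\<in>{..<n}. f i v \<odot>\<^bsub>L\<^esub> x i))"

definition projective_finite_type ::
  "('k, 'n) ring_scheme \<Rightarrow> ('k, 'a, 'l) module_scheme \<Rightarrow> 'a set \<Rightarrow> bool" where
  "projective_finite_type K L V \<longleftrightarrow> (\<exists>n x f. dual_basis K L V n x f)"

definition trace ::
  "('k, 'n) ring_scheme \<Rightarrow> ('k, 'a, 'l) module_scheme \<Rightarrow> 'a set \<Rightarrow> ('a \<Rightarrow> 'a) \<Rightarrow> 'k" where
  "trace K L V T =
     (THE t. \<exists>n x f. dual_basis K L V n x f \<and> t = (\<Oplus>\<^bsub>K\<^esub>i\<in>{..<n}. f i (T (x i))))"

locale pi_algebra = \<pi>: group \<pi> + K: field K + L: ring L + M: module K L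
  for \<pi> :: "('g, 'm) monoid_scheme"
    and K :: "('k, 'n) ring_scheme"
    and L :: "('g, 'k, 'a) crossed_alg" +
  assumes smult_mult_left:
      "\<lbrakk>k \<in> carrier K; x \<in> carrier L; y \<in> carrier L\<rbrakk>
        \<Longrightarrow> (k \<odot>\<^bsub>L\<^esub> x) \<otimes>\<^bsub>L\<^esub> y = k \<odot>\<^bsub>L\<^esub> (x \<otimes>\<^bsub>L\<^esub> y)"
    and smult_mult_right:
      "\<lbrakk>k \<in> carrier K; x \<in> carrier L; y \<in> carrier L\<rbrakk>
        \<Longrightarrow> x \<otimes>\<^bsub>L\<^esub> (k \<odot>\<^bsub>L\<^esub> y) = k \<odot>\<^bsub>L\<^esub> (x \<otimes>\<^bsub>L\<^esub> y)"
    and grade_submodule: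
      "\<alpha> \<in> carrier \<pi> \<Longrightarrow> submodule (grade L \<alpha>) K L"
    and grade_projective:
      "\<alpha> \<in> carrier \<pi> \<Longrightarrow> projective_finite_type K L (grade L \<alpha>)"
    and grade_direct_sum:
      "x \<in> carrier L \<Longrightarrow>
        \<exists>!f. f \<in> (\<Pi>\<^sub>E \<alpha>\<in>carrier \<pi>. grade L \<alpha>) \<and>
             finite {\<alpha>\<in>carrier \<pi>. f \<alpha> \<noteq> \<zero>\<^bsub>L\<^esub>} \<and>
             x = (\<Oplus>\<^bsub>L\<^esub>\<alpha>\<in>{\<alpha>\<in>carrier \<pi>. f \<alpha> \<noteq> \<zero>\<^bsub>L\<^esub>}. f \<alpha>)"
    and grade_mult:
      "\<lbrakk>\<alpha> \<in> carrier \<pi>; \<beta> \<in> carrier \<pi>; a \<in> grade L \<alpha>; b \<in> grade L \<beta>\<rbrakk>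
        \<Longrightarrow> a \<otimes>\<^bsub>L\<^esub> b \<in> grade L (\<alpha> \<otimes>\<^bsub>\<pi>\<^esub> \<beta>)"
    and grade_one: "\<one>\<^bsub>L\<^esub> \<in> grade L \<one>\<^bsub>\<pi>\<^esub>"

locale frobenius_pi_algebra = pi_algebra +
  assumes eta_closed:
      "\<lbrakk>x \<in> carrier L; y \<in> carrier L\<rbrakk> \<Longrightarrow> eta L x y \<in> carrier K"
    and eta_sym:
      "\<lbrakk>x \<in> carrier L; y \<in> carrier L\<rbrakk> \<Longrightarrow> eta L x y = eta L y x"
    and eta_add:
      "\<lbrakk>x \<in> carrier L; y \<in> carrier L; z \<in> carrier L\<rbrakk>
        \<Longrightarrow> eta L (x \<oplus>\<^bsub>L\<^esub> y) z = eta L x z \<oplus>\<^bsub>K\<^esub> eta L y z"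
    and eta_smult:
      "\<lbrakk>k \<in> carrier K; x \<in> carrier L; y \<in> carrier L\<rbrakk>
        \<Longrightarrow> eta L (k \<odot>\<^bsub>L\<^esub> x) y = k \<otimes>\<^bsub>K\<^esub> eta L x y"
    and eta_orthogonal:
      "\<lbrakk>\<alpha> \<in> carrier \<pi>; \<beta> \<in> carrier \<pi>; \<alpha> \<otimes>\<^bsub>\<pi>\<^esub> \<beta> \<noteq> \<one>\<^bsub>\<pi>\<^esub>; a \<in> grade L \<alpha>; b \<in> grade L \<beta>\<rbrakk>
        \<Longrightarrow> eta L a b = \<zero>\<^bsub>K\<^esub>"
    and eta_nondegenerate:
      "\<lbrakk>\<alpha> \<in> carrier \<pi>; a \<in> grade L \<alpha>; \<And>b. b \<in> grade L (inv\<^bsub>\<pi>\<^esub> \<alpha>) \<Longrightarrow> eta L a b = \<zero>\<^bsub>K\<^esub>\<rbrakk>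
        \<Longrightarrow> a = \<zero>\<^bsub>L\<^esub>"
    and eta_assoc:
      "\<lbrakk>a \<in> carrier L; b \<in> carrier L; c \<in> carrier L\<rbrakk>
        \<Longrightarrow> eta L (a \<otimes>\<^bsub>L\<^esub> b) c = eta L a (b \<otimes>\<^bsub>L\<^esub> c)"

locale crossed_pi_algebra = frobenius_pi_algebra +
  assumes phi_ring_iso:
      "\<beta> \<in> carrier \<pi> \<Longrightarrow> phi L \<beta> \<in> ring_iso L L"
    and phi_smult:
      "\<lbrakk>\<beta> \<in> carrier \<pi>; k \<in> carrier K; x \<in> carrier L\<rbrakk>
        \<Longrightarrow> phi L \<beta> (k \<odot>\<^bsub>L\<^esub> x) = k \<odot>\<^bsub>L\<^esub> phi L \<beta> x"
    and phi_hom: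
      "\<lbrakk>\<alpha> \<in> carrier \<pi>; \<beta> \<in> carrier \<pi>; x \<in> carrier L\<rbrakk>
        \<Longrightarrow> phi L (\<alpha> \<otimes>\<^bsub>\<pi>\<^esub> \<beta>) x = phi L \<alpha> (phi L \<beta> x)"
    and phi_eta:
      "\<lbrakk>\<beta> \<in> carrier \<pi>; x \<in> carrier L; y \<in> carrier L\<rbrakk>
        \<Longrightarrow> eta L (phi L \<beta> x) (phi L \<beta> y) = eta L x y"
    and phi_grade:
      "\<lbrakk>\<alpha> \<in> carrier \<pi>; \<beta> \<in> carrier \<pi>; a \<in> grade L \<alpha>\<rbrakk>
        \<Longrightarrow> phi L \<beta> a \<in> grade L (\<beta> \<otimes>\<^bsub>\<pi>\<^esub> \<alpha> \<otimes>\<^bsub>\<pi>\<^esub> inv\<^bsub>\<pi>\<^esub> \<beta>)"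
    and phi_id:
      "\<lbrakk>\<beta> \<in> carrier \<pi>; b \<in> grade L \<beta>\<rbrakk> \<Longrightarrow> phi L \<beta> b = b"
    and phi_crossed:
      "\<lbrakk>\<beta> \<in> carrier \<pi>; a \<in> carrier L; b \<in> grade L \<beta>\<rbrakk>
        \<Longrightarrow> phi L \<beta> a \<otimes>\<^bsub>L\<^esub> b = b \<otimes>\<^bsub>L\<^esub> a"
    and trace_condition:
      "\<lbrakk>\<alpha> \<in> carrier \<pi>; \<beta> \<in> carrier \<pi>;
        c \<in> grade L (\<alpha> \<otimes>\<^bsub>\<pi>\<^esub> \<beta> \<otimes>\<^bsub>\<pi>\<^esub> inv\<^bsub>\<pi>\<^esub> \<alpha> \<otimes>\<^bsub>\<pi>\<^esub> inv\<^bsub>\<pi>\<^esub> \<beta>)\<rbrakk>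
        \<Longrightarrow> trace K L (grade L \<alpha>) (\<lambda>a. c \<otimes>\<^bsub>L\<^esub> phi L \<beta> a) =
            trace K L (grade L \<beta>) (\<lambda>b. phi L (inv\<^bsub>\<pi>\<^esub> \<alpha>) (c \<otimes>\<^bsub>L\<^esub> b))"


section \<open>Semisimplicity\<close>

text \<open>
  \<open>I\<close> is the set of units of the summands in a decomposition of \<open>L\<^sub>1\<close> into a direct sum of
  finitely many copies of \<open>K\<close>. Uniqueness of the coefficients forces the members of \<open>I\<close> to be
  nonzero, so each \<open>K i\<close> is a copy of the algebra \<open>K\<close>.
\<close>

definition splitting ::
  "('g, 'm) monoid_scheme \<Rightarrow> ('k, 'n) ring_scheme \<Rightarrow> ('g, 'k, 'a) crossed_alg \<Rightarrow> 'a set \<Rightarrow> bool" where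
  "splitting \<pi> K L I \<longleftrightarrow>
     finite I \<and> I \<subseteq> grade L \<one>\<^bsub>\<pi>\<^esub> \<and>
     (\<forall>i\<in>I. \<forall>j\<in>I. i \<otimes>\<^bsub>L\<^esub> j = (if i = j then i else \<zero>\<^bsub>L\<^esub>)) \<and>
     (\<forall>a\<in>grade L \<one>\<^bsub>\<pi>\<^esub>. \<exists>!c. c \<in> I \<rightarrow>\<^sub>E carrier K \<and> a = (\<Oplus>\<^bsub>L\<^esub>i\<in>I. c i \<odot>\<^bsub>L\<^esub> i))"

definition bas ::
  "('g, 'm) monoid_scheme \<Rightarrow> ('k, 'n) ring_scheme \<Rightarrow> ('g, 'k, 'a) crossed_alg \<Rightarrow> 'a set" where
  "bas \<pi> K L = {i. \<exists>I. splitting \<pi> K L I \<and> i \<in> I}"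

definition semisimple_crossed ::
  "('g, 'm) monoid_scheme \<Rightarrow> ('k, 'n) ring_scheme \<Rightarrow> ('g, 'k, 'a) crossed_alg \<Rightarrow> bool" where
  "semisimple_crossed \<pi> K L \<longleftrightarrow> crossed_pi_algebra \<pi> K L \<and> (\<exists>I. splitting \<pi> K L I)"

definition simple_crossed ::
  "('g, 'm) monoid_scheme \<Rightarrow> ('k, 'n) ring_scheme \<Rightarrow> ('g, 'k, 'a) crossed_alg \<Rightarrow> bool" where
  "simple_crossed \<pi> K L \<longleftrightarrow>
     semisimple_crossed \<pi> K L \<and>
     (\<forall>i\<in>bas \<pi> K L. \<forall>j\<in>bas \<pi> K L. \<exists>\<alpha>\<in>carrier \<pi>. phi L \<alpha> i = j)"

definition normalized_simple_crossed ::
  "('g, 'm) monoid_scheme \<Rightarrow> ('k, 'n) ring_scheme \<Rightarrow> ('g, 'k, 'a) crossed_alg \<Rightarrow> bool" where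
  "normalized_simple_crossed \<pi> K L \<longleftrightarrow>
     simple_crossed \<pi> K L \<and> (\<forall>i\<in>bas \<pi> K L. eta L i i = \<one>\<^bsub>K\<^esub>)"


section \<open>Isomorphism classes of pairs\<close>

type_synonym ('g, 'k, 'a) crossed_pair = "('g, 'k, 'a) crossed_alg \<times> 'a"

definition crossed_iso ::
  "('g, 'm) monoid_scheme \<Rightarrow> ('k, 'n) ring_scheme
    \<Rightarrow> ('g, 'k, 'a) crossed_alg \<Rightarrow> ('g, 'k, 'b) crossed_alg \<Rightarrow> ('a \<Rightarrow> 'b) \<Rightarrow> bool" where
  "crossed_iso \<pi> K L L' h \<longleftrightarrow>
     h \<in> ring_iso L L' \<and>
     (\<forall>c\<in>carrier K. \<forall>x\<in>carrier L. h (c \<odot>\<^bsub>L\<^esub> x) = c \<odot>\<^bsub>L'\<^esub> h x) \<and>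
     (\<forall>\<alpha>\<in>carrier \<pi>. h ` grade L \<alpha> \<subseteq> grade L' \<alpha>) \<and>
     (\<forall>x\<in>carrier L. \<forall>y\<in>carrier L. eta L' (h x) (h y) = eta L x y) \<and>
     (\<forall>\<alpha>\<in>carrier \<pi>. \<forall>x\<in>carrier L. h (phi L \<alpha> x) = phi L' \<alpha> (h x))"

definition pair_iso ::
  "('g, 'm) monoid_scheme \<Rightarrow> ('k, 'n) ring_scheme
    \<Rightarrow> ('g, 'k, 'a) crossed_pair \<Rightarrow> ('g, 'k, 'b) crossed_pair \<Rightarrow> bool" where
  "pair_iso \<pi> K p q \<longleftrightarrow> (\<exists>h. crossed_iso \<pi> K (fst p) (fst q) h \<and> h (snd p) = snd q)"

definition simple_pairs ::
  "('g, 'm) monoid_scheme \<Rightarrow> ('k, 'n) ring_scheme \<Rightarrow> ('g, 'k, 'a) crossed_pair set" where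
  "simple_pairs \<pi> K = {(L, i). normalized_simple_crossed \<pi> K L \<and> i \<in> bas \<pi> K L}"

definition pair_iso_rel ::
  "('g, 'm) monoid_scheme \<Rightarrow> ('k, 'n) ring_scheme
    \<Rightarrow> (('g, 'k, 'a) crossed_pair \<times> ('g, 'k, 'a) crossed_pair) set" where
  "pair_iso_rel \<pi> K =
     {(p, q). p \<in> simple_pairs \<pi> K \<and> q \<in> simple_pairs \<pi> K \<and> pair_iso \<pi> K p q}"

text \<open>
  HOL has no set of all isomorphism classes, so these are the classes of pairs whose underlying
  set lies in the type \<open>'a\<close>. The type \<open>('g, 'k) std\<close> is large enough to contain a copy of every
  pair: the elements of \<open>L\<^sup>\<pi>\<^sup>,\<^sup>G\<^sup>,\<^sup>\<theta>\<close> are coded in it, as functions of a coset and a group element.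
\<close>

type_synonym ('g, 'k) std = "'g set \<Rightarrow> 'g \<Rightarrow> 'k"

definition D_set ::
  "('g, 'm) monoid_scheme \<Rightarrow> ('k, 'n) ring_scheme \<Rightarrow> ('g, 'k, 'a) crossed_pair set set" where
  "D_set \<pi> K = simple_pairs \<pi> K // pair_iso_rel \<pi> K"

definition D_action ::
  "('g, 'm) monoid_scheme \<Rightarrow> ('k, 'n) ring_scheme \<Rightarrow> 'g
    \<Rightarrow> ('g, 'k, 'a) crossed_pair set \<Rightarrow> ('g, 'k, 'a) crossed_pair set" where
  "D_action \<pi> K \<alpha> = (\<lambda>d\<in>D_set \<pi> K. (\<lambda>(L, i). (L, phi L \<alpha> i)) ` d)"


section \<open>Second cohomology\<close>

text \<open>
  The group \<open>H\<^sup>2(G; K\<^sup>*)\<close> with trivial action, as cocycles modulo coboundaries; all cocycles are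
  allowed here, normalized or not.
\<close>

definition Z2 :: "('g, 'm) monoid_scheme \<Rightarrow> ('k, 'n) ring_scheme \<Rightarrow> ('g \<times> 'g \<Rightarrow> 'k) monoid" where
  "Z2 G K =
     \<lparr>carrier = {\<theta> \<in> carrier G \<times> carrier G \<rightarrow>\<^sub>E Units K.
        \<forall>\<alpha>\<in>carrier G. \<forall>\<beta>\<in>carrier G. \<forall>\<gamma>\<in>carrier G.
          \<theta> (\<alpha>, \<beta>) \<otimes>\<^bsub>K\<^esub> \<theta> (\<alpha> \<otimes>\<^bsub>G\<^esub> \<beta>, \<gamma>) = \<theta> (\<alpha>, \<beta> \<otimes>\<^bsub>G\<^esub> \<gamma>) \<otimes>\<^bsub>K\<^esub> \<theta> (\<beta>, \<gamma>)},
      monoid.mult = (\<lambda>\<theta> \<theta>'. \<lambda>p\<in>carrier G \<times> carrier G. \<theta> p \<otimes>\<^bsub>K\<^esub> \<theta>' p),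
      monoid.one = (\<lambda>p\<in>carrier G \<times> carrier G. \<one>\<^bsub>K\<^esub>)\<rparr>"

definition B2 :: "('g, 'm) monoid_scheme \<Rightarrow> ('k, 'n) ring_scheme \<Rightarrow> ('g \<times> 'g \<Rightarrow> 'k) set" where
  "B2 G K =
     {\<lambda>(\<alpha>, \<beta>)\<in>carrier G \<times> carrier G. \<mu> \<alpha> \<otimes>\<^bsub>K\<^esub> \<mu> \<beta> \<otimes>\<^bsub>K\<^esub> inv\<^bsub>K\<^esub> \<mu> (\<alpha> \<otimes>\<^bsub>G\<^esub> \<beta>) | \<mu>.
        \<mu> \<in> carrier G \<rightarrow> Units K}"

definition H2 :: "('g, 'm) monoid_scheme \<Rightarrow> ('k, 'n) ring_scheme \<Rightarrow> ('g \<times> 'g \<Rightarrow> 'k) set monoid" where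
  "H2 G K = Z2 G K Mod B2 G K"

definition conj_subgroup :: "('g, 'm) monoid_scheme \<Rightarrow> 'g \<Rightarrow> 'g set \<Rightarrow> 'g set" where
  "conj_subgroup \<pi> \<alpha> G = (\<lambda>g. \<alpha> \<otimes>\<^bsub>\<pi>\<^esub> g \<otimes>\<^bsub>\<pi>\<^esub> inv\<^bsub>\<pi>\<^esub> \<alpha>) ` G"

definition conj_cocycle ::
  "('g, 'm) monoid_scheme \<Rightarrow> 'g \<Rightarrow> 'g set \<Rightarrow> ('g \<times> 'g \<Rightarrow> 'k) \<Rightarrow> ('g \<times> 'g \<Rightarrow> 'k)" where
  "conj_cocycle \<pi> \<alpha> G \<theta> =
     (\<lambda>(x, y)\<in>conj_subgroup \<pi> \<alpha> G \<times> conj_subgroup \<pi> \<alpha> G.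
        \<theta> (inv\<^bsub>\<pi>\<^esub> \<alpha> \<otimes>\<^bsub>\<pi>\<^esub> x \<otimes>\<^bsub>\<pi>\<^esub> \<alpha>, inv\<^bsub>\<pi>\<^esub> \<alpha> \<otimes>\<^bsub>\<pi>\<^esub> y \<otimes>\<^bsub>\<pi>\<^esub> \<alpha>))"

definition C_set ::
  "('g, 'm) monoid_scheme \<Rightarrow> ('k, 'n) ring_scheme \<Rightarrow> ('g set \<times> ('g \<times> 'g \<Rightarrow> 'k) set) set" where
  "C_set \<pi> K =
     {(G, \<Theta>). subgroup G \<pi> \<and> finite (rcosets\<^bsub>\<pi>\<^esub> G) \<and> \<Theta> \<in> carrier (H2 (\<pi>\<lparr>carrier := G\<rparr>) K)}"

text \<open>A cohomology class is a set of cocycles, and \<open>\<alpha>\<^sub>*\<close> is taken elementwise.\<close>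

definition C_action ::
  "('g, 'm) monoid_scheme \<Rightarrow> ('k, 'n) ring_scheme \<Rightarrow> 'g
    \<Rightarrow> 'g set \<times> ('g \<times> 'g \<Rightarrow> 'k) set \<Rightarrow> 'g set \<times> ('g \<times> 'g \<Rightarrow> 'k) set" where
  "C_action \<pi> K \<alpha> =
     (\<lambda>(G, \<Theta>)\<in>C_set \<pi> K. (conj_subgroup \<pi> \<alpha> G, conj_cocycle \<pi> \<alpha> G ` \<Theta>))"


section \<open>The algebra of a cocycle\<close>

text \<open>
  \<open>\<Sum>\<^sub>\<alpha> f(\<alpha>) l\<^sub>\<alpha>\<close> is represented by its finitely supported coefficient function \<open>f\<close>. The product,
  form and action are the (bi)linear extensions of their values on the \<open>l\<^sub>\<alpha>\<close>; in particular
  \<open>\<phi>\<^sub>\<beta>(f)\<close> is the unique solution \<open>y\<close> of \<open>y l\<^sub>\<beta> = l\<^sub>\<beta> f\<close>.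
\<close>

definition twisted_carrier :: "('g, 'm) monoid_scheme \<Rightarrow> ('k, 'n) ring_scheme \<Rightarrow> ('g \<Rightarrow> 'k) set" where
  "twisted_carrier G K =
     {f \<in> carrier G \<rightarrow>\<^sub>E carrier K. finite {\<alpha>\<in>carrier G. f \<alpha> \<noteq> \<zero>\<^bsub>K\<^esub>}}"

definition twisted_mult ::
  "('g, 'm) monoid_scheme \<Rightarrow> ('k, 'n) ring_scheme \<Rightarrow> ('g \<times> 'g \<Rightarrow> 'k)
    \<Rightarrow> ('g \<Rightarrow> 'k) \<Rightarrow> ('g \<Rightarrow> 'k) \<Rightarrow> ('g \<Rightarrow> 'k)" where
  "twisted_mult G K \<theta> f g =
     (\<lambda>\<gamma>\<in>carrier G. \<Oplus>\<^bsub>K\<^esub>\<alpha>\<in>{\<alpha>\<in>carrier G. f \<alpha> \<noteq> \<zero>\<^bsub>K\<^esub>}.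
        f \<alpha> \<otimes>\<^bsub>K\<^esub> g (inv\<^bsub>G\<^esub> \<alpha> \<otimes>\<^bsub>G\<^esub> \<gamma>) \<otimes>\<^bsub>K\<^esub> \<theta> (\<alpha>, inv\<^bsub>G\<^esub> \<alpha> \<otimes>\<^bsub>G\<^esub> \<gamma>))"

text \<open>\<open>twisted_monom G K \<alpha> c\<close> is \<open>c l\<^sub>\<alpha>\<close>.\<close>

definition twisted_monom ::
  "('g, 'm) monoid_scheme \<Rightarrow> ('k, 'n) ring_scheme \<Rightarrow> 'g \<Rightarrow> 'k \<Rightarrow> ('g \<Rightarrow> 'k)" where
  "twisted_monom G K \<alpha> c = (\<lambda>\<gamma>\<in>carrier G. if \<gamma> = \<alpha> then c else \<zero>\<^bsub>K\<^esub>)"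

definition twisted_alg ::
  "('g, 'm) monoid_scheme \<Rightarrow> ('k, 'n) ring_scheme \<Rightarrow> ('g \<times> 'g \<Rightarrow> 'k)
    \<Rightarrow> ('g, 'k, 'g \<Rightarrow> 'k) crossed_alg" where
  "twisted_alg G K \<theta> =
     \<lparr>carrier = twisted_carrier G K,
      monoid.mult = twisted_mult G K \<theta>,
      monoid.one = twisted_monom G K \<one>\<^bsub>G\<^esub> \<one>\<^bsub>K\<^esub>,
      ring.zero = (\<lambda>\<gamma>\<in>carrier G. \<zero>\<^bsub>K\<^esub>),
      ring.add = (\<lambda>f g. \<lambda>\<gamma>\<in>carrier G. f \<gamma> \<oplus>\<^bsub>K\<^esub> g \<gamma>),
      module.smult = (\<lambda>c f. \<lambda>\<gamma>\<in>carrier G. c \<otimes>\<^bsub>K\<^esub> f \<gamma>),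
      grade = (\<lambda>\<alpha>. twisted_monom G K \<alpha> ` carrier K),
      eta = (\<lambda>f g. \<Oplus>\<^bsub>K\<^esub>\<alpha>\<in>{\<alpha>\<in>carrier G. f \<alpha> \<noteq> \<zero>\<^bsub>K\<^esub>}.
               f \<alpha> \<otimes>\<^bsub>K\<^esub> g (inv\<^bsub>G\<^esub> \<alpha>) \<otimes>\<^bsub>K\<^esub> \<theta> (\<alpha>, inv\<^bsub>G\<^esub> \<alpha>)),
      phi = (\<lambda>\<beta> f. THE y. y \<in> twisted_carrier G K \<and>
               twisted_mult G K \<theta> y (twisted_monom G K \<beta> \<one>\<^bsub>K\<^esub>) =
               twisted_mult G K \<theta> (twisted_monom G K \<beta> \<one>\<^bsub>K\<^esub>) f)\<rparr>"


section \<open>Transfer\<close>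

text \<open>
  For a coset \<open>i\<close> of the finite-index subgroup \<open>G\<close>, \<open>\<alpha> \<mapsto> \<omega>\<^sub>i \<alpha> \<omega>\<^sub>i\<^sup>-\<^sup>1\<close> is a bijection from
  \<open>\<omega>\<^sub>i\<^sup>-\<^sup>1 G \<omega>\<^sub>i = {\<alpha>. i \<in> N(\<alpha>)}\<close> onto \<open>G\<close>. Summing the \<open>i\<close>-th summands over all \<open>\<alpha>\<close> thus gives one
  copy of \<open>L\<close>, and the direct sum of all components is the product of copies of \<open>L\<close> indexed by
  the cosets; \<open>f i\<close> is the entry of \<open>f\<close> in the \<open>i\<close>-th copy.

  The entry of \<open>\<phi>\<^sub>\<beta>(f)\<close> at a coset \<open>j = \<beta>(i) = i \<beta>\<^sup>-\<^sup>1\<close> comes from the entry of \<open>f\<close> at \<open>i = j \<beta>\<close>.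
\<close>

definition transfer ::
  "('g, 'm) monoid_scheme \<Rightarrow> ('k, 'n) ring_scheme \<Rightarrow> 'g set \<Rightarrow> ('g set \<Rightarrow> 'g)
    \<Rightarrow> ('g, 'k, 'a) crossed_alg \<Rightarrow> ('g, 'k, 'g set \<Rightarrow> 'a) crossed_alg" where
  "transfer \<pi> K G \<omega> L =
     \<lparr>carrier = rcosets\<^bsub>\<pi>\<^esub> G \<rightarrow>\<^sub>E carrier L,
      monoid.mult = (\<lambda>f g. \<lambda>i\<in>rcosets\<^bsub>\<pi>\<^esub> G. f i \<otimes>\<^bsub>L\<^esub> g i),
      monoid.one = (\<lambda>i\<in>rcosets\<^bsub>\<pi>\<^esub> G. \<one>\<^bsub>L\<^esub>),
      ring.zero = (\<lambda>i\<in>rcosets\<^bsub>\<pi>\<^esub> G. \<zero>\<^bsub>L\<^esub>),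
      ring.add = (\<lambda>f g. \<lambda>i\<in>rcosets\<^bsub>\<pi>\<^esub> G. f i \<oplus>\<^bsub>L\<^esub> g i),
      module.smult = (\<lambda>c f. \<lambda>i\<in>rcosets\<^bsub>\<pi>\<^esub> G. c \<odot>\<^bsub>L\<^esub> f i),
      grade = (\<lambda>\<alpha>. \<Pi>\<^sub>E i\<in>rcosets\<^bsub>\<pi>\<^esub> G.
                 if \<omega> i \<otimes>\<^bsub>\<pi>\<^esub> \<alpha> \<otimes>\<^bsub>\<pi>\<^esub> inv\<^bsub>\<pi>\<^esub> \<omega> i \<in> G
                 then grade L (\<omega> i \<otimes>\<^bsub>\<pi>\<^esub> \<alpha> \<otimes>\<^bsub>\<pi>\<^esub> inv\<^bsub>\<pi>\<^esub> \<omega> i) else {\<zero>\<^bsub>L\<^esub>}),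
      eta = (\<lambda>f g. \<Oplus>\<^bsub>K\<^esub>i\<in>rcosets\<^bsub>\<pi>\<^esub> G. eta L (f i) (g i)),
      phi = (\<lambda>\<beta> f. \<lambda>j\<in>rcosets\<^bsub>\<pi>\<^esub> G.
               phi L (\<omega> j \<otimes>\<^bsub>\<pi>\<^esub> \<beta> \<otimes>\<^bsub>\<pi>\<^esub> inv\<^bsub>\<pi>\<^esub> \<omega> (j #>\<^bsub>\<pi>\<^esub> \<beta>)) (f (j #>\<^bsub>\<pi>\<^esub> \<beta>)))\<rparr>"

definition transfer_idem ::
  "('g, 'm) monoid_scheme \<Rightarrow> 'g set \<Rightarrow> ('g, 'k, 'a) crossed_alg \<Rightarrow> ('g set \<Rightarrow> 'a)" where
  "transfer_idem \<pi> G L = (\<lambda>i\<in>rcosets\<^bsub>\<pi>\<^esub> G. if i = G then \<one>\<^bsub>L\<^esub> else \<zero>\<^bsub>L\<^esub>)"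

text \<open>
  The pair \<open>(L\<^sup>\<pi>\<^sup>,\<^sup>G\<^sup>,\<^sup>\<theta>, i\<^sub>0(\<theta>))\<close> built from a normalized cocycle \<open>\<theta>\<close> and coset representatives \<open>\<omega>\<close>.
\<close>

definition transfer_pair ::
  "('g, 'm) monoid_scheme \<Rightarrow> ('k, 'n) ring_scheme \<Rightarrow> 'g set \<Rightarrow> ('g \<times> 'g \<Rightarrow> 'k) \<Rightarrow> ('g set \<Rightarrow> 'g)
    \<Rightarrow> ('g, 'k, ('g, 'k) std) crossed_pair" where
  "transfer_pair \<pi> K G \<theta> \<omega> =
     (let L = twisted_alg (\<pi>\<lparr>carrier := G\<rparr>) K \<theta>
      in (transfer \<pi> K G \<omega> L, transfer_idem \<pi> G L))"

definition transfer_choices ::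
  "('g, 'm) monoid_scheme \<Rightarrow> ('k, 'n) ring_scheme \<Rightarrow> 'g set \<Rightarrow> ('g \<times> 'g \<Rightarrow> 'k) set
    \<Rightarrow> (('g \<times> 'g \<Rightarrow> 'k) \<times> ('g set \<Rightarrow> 'g)) set" where
  "transfer_choices \<pi> K G \<Theta> =
     {\<theta> \<in> \<Theta>. \<theta> (\<one>\<^bsub>\<pi>\<^esub>, \<one>\<^bsub>\<pi>\<^esub>) = \<one>\<^bsub>K\<^esub>} \<times> {\<omega>. \<forall>i\<in>rcosets\<^bsub>\<pi>\<^esub> G. \<omega> i \<in> i}"

text \<open>
  The isomorphism class of the pair attached to \<open>(G, \<Theta>)\<close>. As usual for a map defined through
  representatives, the union is taken over all choices; that all choices give the same class is
  not built into the definition.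
\<close>

definition C_to_D ::
  "('g, 'm) monoid_scheme \<Rightarrow> ('k, 'n) ring_scheme
    \<Rightarrow> 'g set \<times> ('g \<times> 'g \<Rightarrow> 'k) set
    \<Rightarrow> ('g, 'k, ('g, 'k) std) crossed_pair set" where
  "C_to_D \<pi> K = (\<lambda>(G, \<Theta>). \<Union>(\<theta>, \<omega>)\<in>transfer_choices \<pi> K G \<Theta>.
                    pair_iso_rel \<pi> K `` {transfer_pair \<pi> K G \<theta> \<omega>})"

definition char_zero :: "('k, 'n) ring_scheme \<Rightarrow> bool" where
  "char_zero K \<longleftrightarrow> (\<forall>n::nat. n \<noteq> 0 \<longrightarrow> [n] \<cdot>\<^bsub>K\<^esub> \<one>\<^bsub>K\<^esub> \<noteq> \<zero>\<^bsub>K\<^esub>)"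

end

theory Submission
  imports Defs
begin

text \<open>
  A pair \<open>(L, i\<^sub>0)\<close> is recovered from its corner \<open>i\<^sub>0L\<close>. Call \<open>G\<close> the stabilizer of \<open>i\<^sub>0\<close> under the
  action \<open>\<phi>\<close> of \<open>\<pi>\<close>; its index is the number of basic idempotents, because \<open>\<pi>\<close> permutes them
  transitively. The corner is graded by \<open>G\<close>: if \<open>\<phi>\<^sub>\<alpha>(i\<^sub>0) \<noteq> i\<^sub>0\<close>, then \<open>i\<^sub>0L\<^sub>\<alpha>\<close> vanishes, since left
  multiplication by \<open>i\<^sub>0\<close> agrees there with left multiplication by \<open>\<phi>\<^sub>\<alpha>(i\<^sub>0)\<close> (\<open>corner_zero\<close>). For
  \<open>\<alpha> \<in> G\<close> the component \<open>i\<^sub>0L\<^sub>\<alpha>\<close> is a line. It is at most a line because the form is non-degenerate: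
  a nonzero \<open>a \<in> i\<^sub>0L\<^sub>\<alpha>\<close> has an inverse \<open>b \<in> i\<^sub>0L\<^sub>\<alpha>\<^sup>-\<^sup>1\<close>, and \<open>x = a(bx)\<close> with \<open>bx \<in> i\<^sub>0L\<^sub>1 = Ki\<^sub>0\<close> for every
  \<open>x \<in> i\<^sub>0L\<^sub>\<alpha>\<close> (\<open>corner_inverse\<close>, \<open>corner_line\<close>). It is not zero because the trace condition equates
  the trace of multiplication by \<open>i\<^sub>0\<close> on \<open>L\<^sub>\<alpha>\<close> with the trace of \<open>a \<mapsto> i\<^sub>0\<phi>\<^sub>\<alpha>(a)\<close> on \<open>L\<^sub>1\<close>, which is \<open>1\<close>
  (\<open>corner_nonzero\<close>). Nonzero vectors \<open>l\<^sub>\<alpha> \<in> i\<^sub>0L\<^sub>\<alpha>\<close> multiply by the rule \<open>l\<^sub>\<alpha>l\<^sub>\<beta> = \<theta>\<^sub>\<alpha>\<^sub>,\<^sub>\<beta>l\<^sub>\<alpha>\<^sub>\<beta>\<close> for a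
  cocycle \<open>\<theta>\<close>, and rescaling them changes \<open>\<theta>\<close> by a coboundary. This attaches to the pair an
  invariant \<open>(G, \<theta>)\<close> in \<open>C(\<pi>)\<close> (\<open>pair_invariant\<close>), the inverse of the map to be shown bijective. The
  invariant depends on the isomorphism class only, and it is equivariant because \<open>\<phi>\<^sub>\<alpha>\<close> carries the
  corner of \<open>i\<^sub>0\<close> to that of \<open>\<phi>\<^sub>\<alpha>(i\<^sub>0)\<close>.

  Two facts remain. The first is that \<open>L\<^sup>\<pi>\<^sup>,\<^sup>G\<^sup>,\<^sup>\<theta>\<close> is a normalized simple crossed algebra with invariant
  \<open>(G, \<theta>)\<close>. In \<open>L\<^sup>\<theta>\<close> the action is conjugation by the invertible vectors \<open>l\<^sub>\<beta>\<close>, so its axioms are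
  formal, and all axioms but the trace condition pass to the transfer coset by coset. The trace
  condition follows from the structure of corners (\<open>trace_condition_by_corners\<close>): both of its sides
  are sums over the basic idempotents fixed by \<open>\<alpha>\<close> and \<open>\<beta>\<close>, and corresponding summands are equal by a
  computation with two basis vectors. The second is that the invariant is complete. The coordinates
  in a frame form a homomorphism \<open>c\<close> from \<open>L\<close> onto \<open>L\<^sup>\<theta>\<close> that is injective on \<open>i\<^sub>0L\<close>, and
  \<open>x \<mapsto> (c(\<phi>\<^sub>\<omega>(x)))\<close>, where \<open>\<omega>\<close> runs through the coset representatives, is an isomorphism from
  \<open>(L, i\<^sub>0)\<close> onto the transfer of \<open>L\<^sup>\<theta>\<close> (\<open>to_transfer_iso\<close>). Hence two pairs are isomorphic if and only
  if their invariants agree (\<open>pair_iso_iff_invariant\<close>). In particular the choices made in a transfer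
  do not matter, \<open>(G, \<theta>) \<mapsto> (L\<^sup>\<pi>\<^sup>,\<^sup>G\<^sup>,\<^sup>\<theta>, i\<^sub>0(\<theta>))\<close> is the inverse of the invariant, and the statements about
  actions and orbits are formal consequences.
\<close>

section \<open>Dual families and traces\<close>

text \<open>
  The functionals of a dual basis are additive only on the submodule that they belong to, hence the
  restriction to a closed subset \<open>V\<close>.
\<close>

lemma finsum_additive:
  assumes A: "abelian_group A" and B: "abelian_group B"
    and V: "V \<subseteq> carrier A" "\<zero>\<^bsub>A\<^esub> \<in> V" "\<And>u v. u \<in> V \<Longrightarrow> v \<in> V \<Longrightarrow> u \<oplus>\<^bsub>A\<^esub> v \<in> V"
    and h: "\<And>v. v \<in> V \<Longrightarrow> h v \<in> carrier B"
      "\<And>u v. u \<in> V \<Longrightarrow> v \<in> V \<Longrightarrow> h (u \<oplus>\<^bsub>A\<^esub> v) = h u \<oplus>\<^bsub>B\<^esub> h v"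
    and f: "\<And>i. i \<in> S \<Longrightarrow> f i \<in> V"
  shows "finsum A f S \<in> V" and "h (finsum A f S) = (\<Oplus>\<^bsub>B\<^esub>i\<in>S. h (f i))"
proof -
  interpret A: abelian_group A by fact
  interpret B: abelian_group B by fact
  have "h \<zero>\<^bsub>A\<^esub> \<oplus>\<^bsub>B\<^esub> h \<zero>\<^bsub>A\<^esub> = h \<zero>\<^bsub>A\<^esub>"
    using h(2)[OF V(2) V(2)] by simp
  then have h0: "h \<zero>\<^bsub>A\<^esub> = \<zero>\<^bsub>B\<^esub>"
    using h(1)[OF V(2)] B.add.r_cancel_one by blast
  have "finsum A f S \<in> V \<and> h (finsum A f S) = (\<Oplus>\<^bsub>B\<^esub>i\<in>S. h (f i))"
    using f
  proof (induction S rule: infinite_finite_induct)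
    case (infinite S)
    then show ?case using V(2) h0 by simp
  next
    case empty
    then show ?case using V(2) h0 by simp
  next
    case (insert a S)
    have fS: "f \<in> S \<rightarrow> carrier A" "f a \<in> carrier A"
      using insert.prems V(1) by auto
    have hS: "(\<lambda>i. h (f i)) \<in> S \<rightarrow> carrier B" "h (f a) \<in> carrier B"
      using insert.prems h(1) by auto
    have "f a \<in> V" using insert.prems by auto
    then show ?case
      using insert fS hS V(3) h(2) by (simp add: A.finsum_insert B.finsum_insert)
  qed
  then show "finsum A f S \<in> V" "h (finsum A f S) = (\<Oplus>\<^bsub>B\<^esub>i\<in>S. h (f i))" by auto
qed

lemma (in abelian_group) finsum_swap:
  assumes "\<And>i j. i \<in> A \<Longrightarrow> j \<in> B \<Longrightarrow> f i j \<in> carrier G" and "finite A" and "finite B"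
  shows "(\<Oplus>i\<in>A. \<Oplus>j\<in>B. f i j) = (\<Oplus>j\<in>B. \<Oplus>i\<in>A. f i j)"
  using \<open>finite A\<close> assms(1)
proof (induction A)
  case empty
  then show ?case by simp
next
  case (insert a A)
  have "(\<Oplus>i\<in>insert a A. \<Oplus>j\<in>B. f i j) = (\<Oplus>j\<in>B. f a j) \<oplus> (\<Oplus>i\<in>A. \<Oplus>j\<in>B. f i j)"
    using insert by (subst finsum_insert) (auto intro!: finsum_closed)
  also have "\<dots> = (\<Oplus>j\<in>B. f a j) \<oplus> (\<Oplus>j\<in>B. \<Oplus>i\<in>A. f i j)"
    using insert by simp
  also have "\<dots> = (\<Oplus>j\<in>B. f a j \<oplus> (\<Oplus>i\<in>A. f i j))"
    using insert by (subst finsum_addf) (auto intro!: finsum_closed)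
  also have "\<dots> = (\<Oplus>j\<in>B. \<Oplus>i\<in>insert a A. f i j)"
    using insert by (intro finsum_cong') (auto intro!: finsum_closed simp: finsum_insert Pi_def)
  finally show ?case .
qed

text \<open>
  Dual bases with an arbitrary finite index set: the natural index sets of the bases that occur
  below are sets of idempotents and of cosets, and no enumeration of them is of interest.
\<close>

definition dual_family ::
  "('k, 'n) ring_scheme \<Rightarrow> ('k, 'a, 'l) module_scheme \<Rightarrow> 'a set
    \<Rightarrow> 'i set \<Rightarrow> ('i \<Rightarrow> 'a) \<Rightarrow> ('i \<Rightarrow> 'a \<Rightarrow> 'k) \<Rightarrow> bool" where
  "dual_family K L V I x f \<longleftrightarrow>
     (\<forall>i\<in>I. x i \<in> V \<and> f i \<in> V \<rightarrow> carrier K \<and>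
        (\<forall>u\<in>V. \<forall>v\<in>V. f i (u \<oplus>\<^bsub>L\<^esub> v) = f i u \<oplus>\<^bsub>K\<^esub> f i v) \<and>
        (\<forall>c\<in>carrier K. \<forall>v\<in>V. f i (c \<odot>\<^bsub>L\<^esub> v) = c \<otimes>\<^bsub>K\<^esub> f i v)) \<and>
     (\<forall>v\<in>V. v = (\<Oplus>\<^bsub>L\<^esub>i\<in>I. f i v \<odot>\<^bsub>L\<^esub> x i))"

lemma dual_basis_iff: "dual_basis K L V n x f \<longleftrightarrow> dual_family K L V {..<n} x f"
  unfolding dual_basis_def dual_family_def Ball_def by (simp only: lessThan_iff)

context module
begin

text \<open>
  Both sums equal the sum over \<open>i\<close> and \<open>j\<close> of \<open>f\<^sub>i(T y\<^sub>j) g\<^sub>j(x\<^sub>i)\<close>.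
\<close>

lemma dual_family_trace_unique:
  assumes V: "submodule V R M" and I: "finite I" and J: "finite J"
    and x: "dual_family R M V I x f" and y: "dual_family R M V J y g"
    and T: "\<And>v. v \<in> V \<Longrightarrow> T v \<in> V"
      "\<And>u v. u \<in> V \<Longrightarrow> v \<in> V \<Longrightarrow> T (u \<oplus>\<^bsub>M\<^esub> v) = T u \<oplus>\<^bsub>M\<^esub> T v"
      "\<And>c v. c \<in> carrier R \<Longrightarrow> v \<in> V \<Longrightarrow> T (c \<odot>\<^bsub>M\<^esub> v) = c \<odot>\<^bsub>M\<^esub> T v"
  shows "(\<Oplus>i\<in>I. f i (T (x i))) = (\<Oplus>j\<in>J. g j (T (y j)))"
proof -
  note sub = submoduleE[OF V]
  have V0: "\<zero>\<^bsub>M\<^esub> \<in> V"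
    using sub(2,3,5) sub(1) by (metis M.r_neg ex_in_conv subsetD)
  have xI: "x i \<in> V" "\<And>v. v \<in> V \<Longrightarrow> f i v \<in> carrier R"
    "\<And>u v. u \<in> V \<Longrightarrow> v \<in> V \<Longrightarrow> f i (u \<oplus>\<^bsub>M\<^esub> v) = f i u \<oplus> f i v"
    "\<And>c v. c \<in> carrier R \<Longrightarrow> v \<in> V \<Longrightarrow> f i (c \<odot>\<^bsub>M\<^esub> v) = c \<otimes> f i v" if "i \<in> I" for i
    using x that unfolding dual_family_def by auto
  have yJ: "y j \<in> V" "\<And>v. v \<in> V \<Longrightarrow> g j v \<in> carrier R"
    "\<And>u v. u \<in> V \<Longrightarrow> v \<in> V \<Longrightarrow> g j (u \<oplus>\<^bsub>M\<^esub> v) = g j u \<oplus> g j v"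
    "\<And>c v. c \<in> carrier R \<Longrightarrow> v \<in> V \<Longrightarrow> g j (c \<odot>\<^bsub>M\<^esub> v) = c \<otimes> g j v" if "j \<in> J" for j
    using y that unfolding dual_family_def by auto
  have fexp: "f i (T (x i)) = (\<Oplus>j\<in>J. f i (T (y j)) \<otimes> g j (x i))" if i: "i \<in> I" for i
  proof -
    have "f i (T (\<Oplus>\<^bsub>M\<^esub>j\<in>J. g j (x i) \<odot>\<^bsub>M\<^esub> y j)) = (\<Oplus>j\<in>J. f i (T (g j (x i) \<odot>\<^bsub>M\<^esub> y j)))"
      by (rule finsum_additive(2)[where h = "\<lambda>v. f i (T v)" and V = V])
        (use i sub V0 xI yJ T in \<open>auto simp: M.abelian_group_axioms R.is_abelian_group subset_iff\<close>)
    also have "\<dots> = (\<Oplus>j\<in>J. f i (T (y j)) \<otimes> g j (x i))"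
      using i xI yJ T by (intro R.finsum_cong') (auto simp: R.m_comm)
    finally show ?thesis
      using y xI(1)[OF i] unfolding dual_family_def by auto
  qed
  have gexp: "g j (T (y j)) = (\<Oplus>i\<in>I. f i (T (y j)) \<otimes> g j (x i))" if j: "j \<in> J" for j
  proof -
    have Ty: "T (y j) \<in> V" using yJ(1)[OF j] T(1) by auto
    have "g j (\<Oplus>\<^bsub>M\<^esub>i\<in>I. f i (T (y j)) \<odot>\<^bsub>M\<^esub> x i) = (\<Oplus>i\<in>I. g j (f i (T (y j)) \<odot>\<^bsub>M\<^esub> x i))"
      by (rule finsum_additive(2)[where h = "g j" and V = V])
        (use j sub V0 xI yJ T in \<open>auto simp: M.abelian_group_axioms R.is_abelian_group subset_iff\<close>)
    also have "\<dots> = (\<Oplus>i\<in>I. f i (T (y j)) \<otimes> g j (x i))"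
      using j xI yJ T by (intro R.finsum_cong') auto
    finally show ?thesis
      using x Ty unfolding dual_family_def by metis
  qed
  have "(\<Oplus>i\<in>I. f i (T (x i))) = (\<Oplus>i\<in>I. \<Oplus>j\<in>J. f i (T (y j)) \<otimes> g j (x i))"
    using fexp xI yJ T by (intro R.finsum_cong') (auto intro!: R.finsum_closed)
  also have "\<dots> = (\<Oplus>j\<in>J. \<Oplus>i\<in>I. f i (T (y j)) \<otimes> g j (x i))"
    using I J xI yJ T by (intro R.finsum_swap) auto
  also have "\<dots> = (\<Oplus>j\<in>J. g j (T (y j)))"
    using gexp xI yJ T by (intro R.finsum_cong') auto
  finally show ?thesis .
qed

lemma dual_family_enumerate:
  assumes I: "finite I" and V: "V \<subseteq> carrier M" and x: "dual_family R M V I x f"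
  obtains e where "bij_betw e {..<card I} I"
    "dual_basis R M V (card I) (\<lambda>n. x (e n)) (\<lambda>n. f (e n))"
proof -
  obtain e where e: "bij_betw e {..<card I} I"
    using ex_bij_betw_nat_finite[OF I] by (auto simp: atLeast0LessThan)
  have eI: "e ` {..<card I} = I" "inj_on e {..<card I}"
    using e by (auto simp: bij_betw_def)
  have *: "v = (\<Oplus>\<^bsub>M\<^esub>n\<in>{..<card I}. f (e n) v \<odot>\<^bsub>M\<^esub> x (e n))" if v: "v \<in> V" for v
  proof -
    have "(\<lambda>i. f i v \<odot>\<^bsub>M\<^esub> x i) \<in> e ` {..<card I} \<rightarrow> carrier M"
      using x v V eI unfolding dual_family_def by (auto simp: Pi_def subset_iff)
    from M.finsum_reindex[OF this eI(2)] show ?thesis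
      using x v eI unfolding dual_family_def by auto
  qed
  have "dual_basis R M V (card I) (\<lambda>n. x (e n)) (\<lambda>n. f (e n))"
    unfolding dual_basis_iff dual_family_def
  proof (intro conjI ballI)
    fix n assume "n \<in> {..<card I}"
    then have n: "e n \<in> I" using eI(1) by blast
    note xn = x[unfolded dual_family_def, THEN conjunct1, rule_format, OF n]
    show "x (e n) \<in> V" "f (e n) \<in> V \<rightarrow> carrier R" using xn by auto
    show "f (e n) (u \<oplus>\<^bsub>M\<^esub> v) = f (e n) u \<oplus> f (e n) v" if "u \<in> V" "v \<in> V" for u v
      using xn that by auto
    show "f (e n) (c \<odot>\<^bsub>M\<^esub> v) = c \<otimes> f (e n) v" if "c \<in> carrier R" "v \<in> V" for c v
      using xn that by auto
  qed (rule *)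
  then show ?thesis using e that by blast
qed

lemma projective_finite_typeI:
  assumes "finite I" and "V \<subseteq> carrier M" and "dual_family R M V I x f"
  shows "projective_finite_type R M V"
  using dual_family_enumerate[OF assms] unfolding projective_finite_type_def by metis

lemma trace_eq_dual_family:
  assumes V: "submodule V R M" and I: "finite I" and x: "dual_family R M V I x f"
    and T: "\<And>v. v \<in> V \<Longrightarrow> T v \<in> V"
      "\<And>u v. u \<in> V \<Longrightarrow> v \<in> V \<Longrightarrow> T (u \<oplus>\<^bsub>M\<^esub> v) = T u \<oplus>\<^bsub>M\<^esub> T v"
      "\<And>c v. c \<in> carrier R \<Longrightarrow> v \<in> V \<Longrightarrow> T (c \<odot>\<^bsub>M\<^esub> v) = c \<odot>\<^bsub>M\<^esub> T v"
  shows "trace R M V T = (\<Oplus>i\<in>I. f i (T (x i)))"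
proof -
  obtain e where e: "dual_basis R M V (card I) (\<lambda>n. x (e n)) (\<lambda>n. f (e n))"
    using dual_family_enumerate[OF I submoduleE(1)[OF V] x] .
  have uniq: "(\<Oplus>n\<in>{..<N}. g n (T (y n))) = (\<Oplus>i\<in>I. f i (T (x i)))"
    if "dual_basis R M V N y g" for N y g
    using dual_family_trace_unique[OF V _ I _ x T] that unfolding dual_basis_iff by auto
  show ?thesis
    unfolding trace_def
  proof (rule the_equality)
    show "\<exists>n y g. dual_basis R M V n y g \<and> (\<Oplus>i\<in>I. f i (T (x i))) = (\<Oplus>i\<in>{..<n}. g i (T (y i)))"
      using e uniq[OF e] by metis
  qed (use uniq in auto)
qed

end

section \<open>Homogeneous elements\<close>

text \<open>
  A family of additive projections, each the identity on its own summand and zero on the others,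
  is the usual way to exhibit a direct sum.
\<close>

lemma direct_sum_by_projections:
  assumes L: "abelian_group L"
    and sub: "\<And>\<alpha>. \<alpha> \<in> A \<Longrightarrow> V \<alpha> \<subseteq> carrier L"
    and pr_in: "\<And>\<alpha> x. \<alpha> \<in> A \<Longrightarrow> x \<in> carrier L \<Longrightarrow> pr \<alpha> x \<in> V \<alpha>"
    and pr_add: "\<And>\<alpha> x y. \<alpha> \<in> A \<Longrightarrow> x \<in> carrier L \<Longrightarrow> y \<in> carrier L \<Longrightarrow>
      pr \<alpha> (x \<oplus>\<^bsub>L\<^esub> y) = pr \<alpha> x \<oplus>\<^bsub>L\<^esub> pr \<alpha> y"
    and pr_same: "\<And>\<alpha> x. \<alpha> \<in> A \<Longrightarrow> x \<in> V \<alpha> \<Longrightarrow> pr \<alpha> x = x"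
    and pr_other: "\<And>\<alpha> \<beta> x. \<alpha> \<in> A \<Longrightarrow> \<beta> \<in> A \<Longrightarrow> \<alpha> \<noteq> \<beta> \<Longrightarrow> x \<in> V \<alpha> \<Longrightarrow> pr \<beta> x = \<zero>\<^bsub>L\<^esub>"
    and fin: "finite {\<alpha>\<in>A. pr \<alpha> x \<noteq> \<zero>\<^bsub>L\<^esub>}"
    and sum: "x = (\<Oplus>\<^bsub>L\<^esub>\<alpha>\<in>{\<alpha>\<in>A. pr \<alpha> x \<noteq> \<zero>\<^bsub>L\<^esub>}. pr \<alpha> x)"
    and x: "x \<in> carrier L"
  shows "\<exists>!f. f \<in> (\<Pi>\<^sub>E \<alpha>\<in>A. V \<alpha>) \<and> finite {\<alpha>\<in>A. f \<alpha> \<noteq> \<zero>\<^bsub>L\<^esub>} \<and>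
             x = (\<Oplus>\<^bsub>L\<^esub>\<alpha>\<in>{\<alpha>\<in>A. f \<alpha> \<noteq> \<zero>\<^bsub>L\<^esub>}. f \<alpha>)"
proof (rule ex1I[where a = "\<lambda>\<alpha>\<in>A. pr \<alpha> x"])
  interpret L: abelian_group L by fact
  have S: "{\<alpha>\<in>A. (\<lambda>\<alpha>\<in>A. pr \<alpha> x) \<alpha> \<noteq> \<zero>\<^bsub>L\<^esub>} = {\<alpha>\<in>A. pr \<alpha> x \<noteq> \<zero>\<^bsub>L\<^esub>}"
    by auto
  have "(\<Oplus>\<^bsub>L\<^esub>\<alpha>\<in>{\<alpha>\<in>A. pr \<alpha> x \<noteq> \<zero>\<^bsub>L\<^esub>}. (\<lambda>\<alpha>\<in>A. pr \<alpha> x) \<alpha>) = (\<Oplus>\<^bsub>L\<^esub>\<alpha>\<in>{\<alpha>\<in>A. pr \<alpha> x \<noteq> \<zero>\<^bsub>L\<^esub>}. pr \<alpha> x)"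
    using pr_in sub x by (intro L.finsum_cong') (auto simp: Pi_def subset_iff)
  then show "(\<lambda>\<alpha>\<in>A. pr \<alpha> x) \<in> (\<Pi>\<^sub>E \<alpha>\<in>A. V \<alpha>) \<and> finite {\<alpha>\<in>A. (\<lambda>\<alpha>\<in>A. pr \<alpha> x) \<alpha> \<noteq> \<zero>\<^bsub>L\<^esub>} \<and>
      x = (\<Oplus>\<^bsub>L\<^esub>\<alpha>\<in>{\<alpha>\<in>A. (\<lambda>\<alpha>\<in>A. pr \<alpha> x) \<alpha> \<noteq> \<zero>\<^bsub>L\<^esub>}. (\<lambda>\<alpha>\<in>A. pr \<alpha> x) \<alpha>)"
    unfolding S using pr_in x fin sum by (auto simp: PiE_def)
next
  interpret L: abelian_group L by fact
  fix f
  let ?S = "{\<alpha>\<in>A. f \<alpha> \<noteq> \<zero>\<^bsub>L\<^esub>}"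
  assume "f \<in> (\<Pi>\<^sub>E \<alpha>\<in>A. V \<alpha>) \<and> finite ?S \<and> x = (\<Oplus>\<^bsub>L\<^esub>\<alpha>\<in>?S. f \<alpha>)"
  then have f: "f \<in> (\<Pi>\<^sub>E \<alpha>\<in>A. V \<alpha>)" "finite ?S" "x = (\<Oplus>\<^bsub>L\<^esub>\<alpha>\<in>?S. f \<alpha>)" by auto
  have fc: "f \<alpha> \<in> V \<alpha>" "f \<alpha> \<in> carrier L" if "\<alpha> \<in> A" for \<alpha>
    using f(1) sub[OF that] that by (auto simp: PiE_def Pi_def)
  have "f \<beta> = pr \<beta> x" if \<beta>: "\<beta> \<in> A" for \<beta>
  proof -
    have "pr \<beta> x = pr \<beta> (\<Oplus>\<^bsub>L\<^esub>\<alpha>\<in>?S. f \<alpha>)"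
      by (subst f(3)) rule
    also have "\<dots> = (\<Oplus>\<^bsub>L\<^esub>\<alpha>\<in>?S. pr \<beta> (f \<alpha>))"
      by (rule finsum_additive(2)[where V = "carrier L" and h = "pr \<beta>"])
        (use \<beta> pr_in[OF \<beta>] pr_add sub[OF \<beta>] fc L in auto)
    also have "\<dots> = (\<Oplus>\<^bsub>L\<^esub>\<alpha>\<in>?S. if \<alpha> = \<beta> then f \<alpha> else \<zero>\<^bsub>L\<^esub>)"
      using fc \<beta> pr_same pr_other by (intro L.finsum_cong') (auto simp: Pi_def)
    also have "\<dots> = f \<beta>"
    proof (cases "\<beta> \<in> ?S")
      case True
      then show ?thesis
        using L.add.finprod_singleton_swap[of \<beta> ?S f] f(2) fc by (auto simp: Pi_def)
    next
      case False
      then have "(\<Oplus>\<^bsub>L\<^esub>\<alpha>\<in>?S. if \<alpha> = \<beta> then f \<alpha> else \<zero>\<^bsub>L\<^esub>) = \<zero>\<^bsub>L\<^esub>"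
        by (intro L.add.finprod_one_eqI) auto
      then show ?thesis using False \<beta> by auto
    qed
    finally show ?thesis by simp
  qed
  then show "f = (\<lambda>\<alpha>\<in>A. pr \<alpha> x)"
    using f(1) by (intro extensionalityI[of f A]) (auto simp: PiE_def)
qed

context pi_algebra
begin

lemma grade_closed:
  assumes "\<alpha> \<in> carrier \<pi>"
  shows grade_in_carrier: "a \<in> grade L \<alpha> \<Longrightarrow> a \<in> carrier L"
    and grade_zero: "\<zero>\<^bsub>L\<^esub> \<in> grade L \<alpha>"
    and grade_add: "a \<in> grade L \<alpha> \<Longrightarrow> b \<in> grade L \<alpha> \<Longrightarrow> a \<oplus>\<^bsub>L\<^esub> b \<in> grade L \<alpha>"
    and grade_smult: "c \<in> carrier K \<Longrightarrow> a \<in> grade L \<alpha> \<Longrightarrow> c \<odot>\<^bsub>L\<^esub> a \<in> grade L \<alpha>"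
proof -
  note sub = M.submoduleE[OF grade_submodule[OF assms]]
  show "a \<in> grade L \<alpha> \<Longrightarrow> a \<in> carrier L" using sub(1) by auto
  show "\<zero>\<^bsub>L\<^esub> \<in> grade L \<alpha>"
    using sub(2,3,5) sub(1) by (metis L.r_neg ex_in_conv subsetD)
  show "a \<in> grade L \<alpha> \<Longrightarrow> b \<in> grade L \<alpha> \<Longrightarrow> a \<oplus>\<^bsub>L\<^esub> b \<in> grade L \<alpha>" using sub(5) .
  show "c \<in> carrier K \<Longrightarrow> a \<in> grade L \<alpha> \<Longrightarrow> c \<odot>\<^bsub>L\<^esub> a \<in> grade L \<alpha>" using sub(4) .
qed

lemma homogeneous_decomposition:
  assumes "x \<in> carrier L"
  obtains f S where "finite S" "S \<subseteq> carrier \<pi>" "\<And>\<alpha>. \<alpha> \<in> carrier \<pi> \<Longrightarrow> f \<alpha> \<in> grade L \<alpha>"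
    "\<And>\<alpha>. \<alpha> \<in> carrier \<pi> - S \<Longrightarrow> f \<alpha> = \<zero>\<^bsub>L\<^esub>" "x = (\<Oplus>\<^bsub>L\<^esub>\<alpha>\<in>S. f \<alpha>)"
proof -
  obtain f where f: "f \<in> (\<Pi>\<^sub>E \<alpha>\<in>carrier \<pi>. grade L \<alpha>)"
      "finite {\<alpha>\<in>carrier \<pi>. f \<alpha> \<noteq> \<zero>\<^bsub>L\<^esub>}"
      "x = (\<Oplus>\<^bsub>L\<^esub>\<alpha>\<in>{\<alpha>\<in>carrier \<pi>. f \<alpha> \<noteq> \<zero>\<^bsub>L\<^esub>}. f \<alpha>)"
    using grade_direct_sum[OF assms] by auto
  show ?thesis
    using f by (intro that[of "{\<alpha>\<in>carrier \<pi>. f \<alpha> \<noteq> \<zero>\<^bsub>L\<^esub>}" f]) auto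
qed

text \<open>
  Statements that are additive in \<open>x\<close> need to be checked for homogeneous \<open>x\<close> only.
\<close>

lemma homogeneous_induct [consumes 1, case_names zero add homogeneous]:
  assumes x: "x \<in> carrier L"
    and zero: "P \<zero>\<^bsub>L\<^esub>"
    and add: "\<And>x y. x \<in> carrier L \<Longrightarrow> y \<in> carrier L \<Longrightarrow> P x \<Longrightarrow> P y \<Longrightarrow> P (x \<oplus>\<^bsub>L\<^esub> y)"
    and hom: "\<And>\<alpha> a. \<alpha> \<in> carrier \<pi> \<Longrightarrow> a \<in> grade L \<alpha> \<Longrightarrow> P a"
  shows "P x"
proof -
  obtain f S where f: "finite S" "S \<subseteq> carrier \<pi>" "\<And>\<alpha>. \<alpha> \<in> carrier \<pi> \<Longrightarrow> f \<alpha> \<in> grade L \<alpha>"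
    "x = (\<Oplus>\<^bsub>L\<^esub>\<alpha>\<in>S. f \<alpha>)"
    using homogeneous_decomposition[OF x] by metis
  have "P (\<Oplus>\<^bsub>L\<^esub>\<alpha>\<in>S. f \<alpha>)"
    using f(1,2)
  proof (induction S)
    case empty
    then show ?case using zero by simp
  next
    case (insert a S)
    have fc: "f \<alpha> \<in> carrier L" if "\<alpha> \<in> insert a S" for \<alpha>
      using that insert.prems f(3) grade_in_carrier by blast
    have "P (f a \<oplus>\<^bsub>L\<^esub> (\<Oplus>\<^bsub>L\<^esub>\<alpha>\<in>S. f \<alpha>))"
      using insert fc f(3) hom[of a "f a"] by (intro add) (auto intro!: L.finsum_closed)
    then show ?case
      using insert fc by (subst L.finsum_insert) auto
  qed
  then show ?thesis using f(4) by simp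
qed

definition component where
  "component \<alpha> x = (THE f. f \<in> (\<Pi>\<^sub>E \<alpha>\<in>carrier \<pi>. grade L \<alpha>) \<and>
             finite {\<alpha>\<in>carrier \<pi>. f \<alpha> \<noteq> \<zero>\<^bsub>L\<^esub>} \<and>
             x = (\<Oplus>\<^bsub>L\<^esub>\<alpha>\<in>{\<alpha>\<in>carrier \<pi>. f \<alpha> \<noteq> \<zero>\<^bsub>L\<^esub>}. f \<alpha>)) \<alpha>"

lemma component_props:
  assumes x: "x \<in> carrier L"
  shows component_grade: "\<alpha> \<in> carrier \<pi> \<Longrightarrow> component \<alpha> x \<in> grade L \<alpha>"
    and component_finite: "finite {\<alpha>\<in>carrier \<pi>. component \<alpha> x \<noteq> \<zero>\<^bsub>L\<^esub>}"
    and component_sum: "x = (\<Oplus>\<^bsub>L\<^esub>\<alpha>\<in>{\<alpha>\<in>carrier \<pi>. component \<alpha> x \<noteq> \<zero>\<^bsub>L\<^esub>}. component \<alpha> x)"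
  using theI'[OF grade_direct_sum[OF x]] unfolding component_def by auto

text \<open>
  A decomposition may be summed over any finite set that contains its support. This makes
  components additive: two decompositions can be summed over a common set.
\<close>

lemma component_unique:
  assumes S: "finite S" "S \<subseteq> carrier \<pi>" and g: "\<And>\<alpha>. \<alpha> \<in> carrier \<pi> \<Longrightarrow> g \<alpha> \<in> grade L \<alpha>"
    and 0: "\<And>\<alpha>. \<alpha> \<in> carrier \<pi> - S \<Longrightarrow> g \<alpha> = \<zero>\<^bsub>L\<^esub>" and x: "x = (\<Oplus>\<^bsub>L\<^esub>\<alpha>\<in>S. g \<alpha>)"
    and \<alpha>: "\<alpha> \<in> carrier \<pi>"
  shows "component \<alpha> x = g \<alpha>"
proof -
  let ?r = "restrict g (carrier \<pi>)"
  have gc: "g \<beta> \<in> carrier L" if "\<beta> \<in> carrier \<pi>" for \<beta> using g[OF that] grade_in_carrier[OF that] by blast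
  have xc: "x \<in> carrier L" unfolding x using gc S by (intro L.finsum_closed) auto
  have T: "{\<beta>\<in>carrier \<pi>. ?r \<beta> \<noteq> \<zero>\<^bsub>L\<^esub>} = {\<beta>\<in>S. g \<beta> \<noteq> \<zero>\<^bsub>L\<^esub>}" using 0 S by auto
  have "(\<Oplus>\<^bsub>L\<^esub>\<beta>\<in>{\<beta>\<in>S. g \<beta> \<noteq> \<zero>\<^bsub>L\<^esub>}. ?r \<beta>) = (\<Oplus>\<^bsub>L\<^esub>\<beta>\<in>S. g \<beta>)"
    using S gc by (intro L.add.finprod_mono_neutral_cong_left) auto
  then have r: "?r \<in> (\<Pi>\<^sub>E \<alpha>\<in>carrier \<pi>. grade L \<alpha>) \<and> finite {\<beta>\<in>carrier \<pi>. ?r \<beta> \<noteq> \<zero>\<^bsub>L\<^esub>} \<and>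
      x = (\<Oplus>\<^bsub>L\<^esub>\<beta>\<in>{\<beta>\<in>carrier \<pi>. ?r \<beta> \<noteq> \<zero>\<^bsub>L\<^esub>}. ?r \<beta>)"
    unfolding T using S(1) g x by auto
  have "component \<alpha> x = ?r \<alpha>"
    unfolding component_def
    by (rule arg_cong[where f = "\<lambda>f. f \<alpha>"], rule the1_equality, rule grade_direct_sum[OF xc], rule r)
  then show ?thesis using \<alpha> by simp
qed

lemma component_add:
  assumes x: "x \<in> carrier L" and y: "y \<in> carrier L" and \<alpha>: "\<alpha> \<in> carrier \<pi>"
  shows "component \<alpha> (x \<oplus>\<^bsub>L\<^esub> y) = component \<alpha> x \<oplus>\<^bsub>L\<^esub> component \<alpha> y"
proof (rule component_unique[OF _ _ _ _ _ \<alpha>])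
  let ?A = "\<lambda>x. {\<alpha>\<in>carrier \<pi>. component \<alpha> x \<noteq> \<zero>\<^bsub>L\<^esub>}"
  let ?S = "?A x \<union> ?A y"
  show S: "finite ?S" "?S \<subseteq> carrier \<pi>" using component_finite x y by auto
  have c: "component \<beta> z \<in> carrier L" if "\<beta> \<in> carrier \<pi>" "z \<in> carrier L" for \<beta> z
    using component_grade[OF that(2,1)] grade_in_carrier[OF that(1)] by blast
  have e: "z = (\<Oplus>\<^bsub>L\<^esub>\<beta>\<in>?S. component \<beta> z)" if z: "z = x \<or> z = y" for z
  proof -
    have "(\<Oplus>\<^bsub>L\<^esub>\<beta>\<in>?A z. component \<beta> z) = (\<Oplus>\<^bsub>L\<^esub>\<beta>\<in>?S. component \<beta> z)"
      using S z c x y by (intro L.add.finprod_mono_neutral_cong_left) auto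
    then show ?thesis using component_sum[of z] x y z by auto
  qed
  have "(\<Oplus>\<^bsub>L\<^esub>\<beta>\<in>?S. component \<beta> x \<oplus>\<^bsub>L\<^esub> component \<beta> y) =
      (\<Oplus>\<^bsub>L\<^esub>\<beta>\<in>?S. component \<beta> x) \<oplus>\<^bsub>L\<^esub> (\<Oplus>\<^bsub>L\<^esub>\<beta>\<in>?S. component \<beta> y)"
    using c x y by (intro L.finsum_addf) auto
  then show "x \<oplus>\<^bsub>L\<^esub> y = (\<Oplus>\<^bsub>L\<^esub>\<beta>\<in>?S. component \<beta> x \<oplus>\<^bsub>L\<^esub> component \<beta> y)"
    using e[of x] e[of y] by simp
  show "component \<beta> x \<oplus>\<^bsub>L\<^esub> component \<beta> y \<in> grade L \<beta>" if "\<beta> \<in> carrier \<pi>" for \<beta>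
    using component_grade x y that grade_add by blast
  show "component \<beta> x \<oplus>\<^bsub>L\<^esub> component \<beta> y = \<zero>\<^bsub>L\<^esub>" if "\<beta> \<in> carrier \<pi> - ?S" for \<beta>
    using that by auto
qed

lemma component_homogeneous:
  assumes \<alpha>: "\<alpha> \<in> carrier \<pi>" and \<beta>: "\<beta> \<in> carrier \<pi>" and x: "x \<in> grade L \<alpha>"
  shows "component \<beta> x = (if \<beta> = \<alpha> then x else \<zero>\<^bsub>L\<^esub>)"
  by (rule component_unique[of "{\<alpha>}"])
    (use assms grade_in_carrier[OF \<alpha> x] grade_zero in auto)

end

context frobenius_pi_algebra
begin

lemma eta_smult_right:
  "\<lbrakk>k \<in> carrier K; x \<in> carrier L; y \<in> carrier L\<rbrakk> \<Longrightarrow> eta L x (k \<odot>\<^bsub>L\<^esub> y) = k \<otimes>\<^bsub>K\<^esub> eta L x y"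
  using eta_smult[of k y x] eta_sym[of x] by simp

lemma eta_zero_left: "x \<in> carrier L \<Longrightarrow> eta L \<zero>\<^bsub>L\<^esub> x = \<zero>\<^bsub>K\<^esub>"
  using eta_smult[of "\<zero>\<^bsub>K\<^esub>" "\<zero>\<^bsub>L\<^esub>" x] eta_closed[of "\<zero>\<^bsub>L\<^esub>" x] by simp

lemma eta_zero_right: "x \<in> carrier L \<Longrightarrow> eta L x \<zero>\<^bsub>L\<^esub> = \<zero>\<^bsub>K\<^esub>"
  using eta_zero_left[of x] eta_sym[of x "\<zero>\<^bsub>L\<^esub>"] by simp

lemma eta_finsum_left:
  assumes "\<And>i. i \<in> S \<Longrightarrow> f i \<in> carrier L" and "y \<in> carrier L"
  shows "eta L (\<Oplus>\<^bsub>L\<^esub>i\<in>S. f i) y = (\<Oplus>\<^bsub>K\<^esub>i\<in>S. eta L (f i) y)"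
  by (rule finsum_additive(2)[where V = "carrier L" and h = "\<lambda>x. eta L x y"])
    (use assms eta_closed eta_add in \<open>auto simp: L.abelian_group_axioms K.abelian_group_axioms\<close>)

text \<open>
  Pairing with elements of degree \<open>\<alpha>\<^sup>-\<^sup>1\<close> sees only the part of degree \<open>\<alpha>\<close>.
\<close>

lemma eta_nondegenerate_total:
  assumes x: "x \<in> carrier L"
    and 0: "\<And>\<alpha> b. \<alpha> \<in> carrier \<pi> \<Longrightarrow> b \<in> grade L \<alpha> \<Longrightarrow> eta L x b = \<zero>\<^bsub>K\<^esub>"
  shows "x = \<zero>\<^bsub>L\<^esub>"
proof -
  obtain f S where f: "finite S" "S \<subseteq> carrier \<pi>" "\<And>\<alpha>. \<alpha> \<in> carrier \<pi> \<Longrightarrow> f \<alpha> \<in> grade L \<alpha>"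
    "x = (\<Oplus>\<^bsub>L\<^esub>\<alpha>\<in>S. f \<alpha>)"
    using homogeneous_decomposition[OF x] by metis
  have "f \<beta> = \<zero>\<^bsub>L\<^esub>" if \<beta>: "\<beta> \<in> S" for \<beta>
  proof (rule eta_nondegenerate[of \<beta>])
    show \<beta>': "\<beta> \<in> carrier \<pi>" and "f \<beta> \<in> grade L \<beta>" using \<beta> f by auto
    fix b assume b: "b \<in> grade L (inv\<^bsub>\<pi>\<^esub> \<beta>)"
    have bc: "b \<in> carrier L" using b \<beta>' grade_in_carrier by blast
    have fc: "f \<alpha> \<in> carrier L" if "\<alpha> \<in> S" for \<alpha>
      using that f grade_in_carrier by blast
    have ort: "eta L (f \<alpha>) b = \<zero>\<^bsub>K\<^esub>" if "\<alpha> \<in> S" "\<alpha> \<noteq> \<beta>" for \<alpha>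
    proof (rule eta_orthogonal[OF _ _ _ _ b])
      show "\<alpha> \<otimes>\<^bsub>\<pi>\<^esub> inv\<^bsub>\<pi>\<^esub> \<beta> \<noteq> \<one>\<^bsub>\<pi>\<^esub>"
        using that \<beta>' f(2) by (metis \<pi>.inv_closed \<pi>.inv_equality \<pi>.inv_inv subsetD)
    qed (use that \<beta>' f in auto)
    have "eta L x b = (\<Oplus>\<^bsub>K\<^esub>\<alpha>\<in>S. eta L (f \<alpha>) b)"
      using f(4) fc bc eta_finsum_left[of S f b] by simp
    also have "\<dots> = (\<Oplus>\<^bsub>K\<^esub>\<alpha>\<in>S. if \<beta> = \<alpha> then eta L (f \<alpha>) b else \<zero>\<^bsub>K\<^esub>)"
      using ort fc bc eta_closed by (intro K.finsum_cong') auto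
    also have "\<dots> = eta L (f \<beta>) b"
      using f(1) \<beta> fc bc eta_closed by (intro K.finsum_singleton) auto
    finally show "eta L (f \<beta>) b = \<zero>\<^bsub>K\<^esub>"
      using 0[OF _ b] \<beta>' by simp
  qed
  then have "(\<Oplus>\<^bsub>L\<^esub>\<alpha>\<in>S. f \<alpha>) = \<zero>\<^bsub>L\<^esub>"
    by (intro L.add.finprod_one_eqI) auto
  then show ?thesis using f(4) by simp
qed

end

section \<open>Basic idempotents\<close>

text \<open>
  The trace condition is split off. All other axioms pass from an algebra to its transfer entry by
  entry, whereas in the presence of basic idempotents the trace condition amounts to the
  non-vanishing of certain corners, which is much easier to verify than an equality of traces.
\<close>

locale precrossed_pi_algebra = frobenius_pi_algebra +
  assumes phi_ring_iso:
      "\<beta> \<in> carrier \<pi> \<Longrightarrow> phi L \<beta> \<in> ring_iso L L"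
    and phi_smult:
      "\<lbrakk>\<beta> \<in> carrier \<pi>; k \<in> carrier K; x \<in> carrier L\<rbrakk>
        \<Longrightarrow> phi L \<beta> (k \<odot>\<^bsub>L\<^esub> x) = k \<odot>\<^bsub>L\<^esub> phi L \<beta> x"
    and phi_hom:
      "\<lbrakk>\<alpha> \<in> carrier \<pi>; \<beta> \<in> carrier \<pi>; x \<in> carrier L\<rbrakk>
        \<Longrightarrow> phi L (\<alpha> \<otimes>\<^bsub>\<pi>\<^esub> \<beta>) x = phi L \<alpha> (phi L \<beta> x)"
    and phi_eta:
      "\<lbrakk>\<beta> \<in> carrier \<pi>; x \<in> carrier L; y \<in> carrier L\<rbrakk>
        \<Longrightarrow> eta L (phi L \<beta> x) (phi L \<beta> y) = eta L x y"
    and phi_grade: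
      "\<lbrakk>\<alpha> \<in> carrier \<pi>; \<beta> \<in> carrier \<pi>; a \<in> grade L \<alpha>\<rbrakk>
        \<Longrightarrow> phi L \<beta> a \<in> grade L (\<beta> \<otimes>\<^bsub>\<pi>\<^esub> \<alpha> \<otimes>\<^bsub>\<pi>\<^esub> inv\<^bsub>\<pi>\<^esub> \<beta>)"
    and phi_id:
      "\<lbrakk>\<beta> \<in> carrier \<pi>; b \<in> grade L \<beta>\<rbrakk> \<Longrightarrow> phi L \<beta> b = b"
    and phi_crossed:
      "\<lbrakk>\<beta> \<in> carrier \<pi>; a \<in> carrier L; b \<in> grade L \<beta>\<rbrakk>
        \<Longrightarrow> phi L \<beta> a \<otimes>\<^bsub>L\<^esub> b = b \<otimes>\<^bsub>L\<^esub> a"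

lemma (in crossed_pi_algebra) precrossed: "precrossed_pi_algebra \<pi> K L"
proof (intro precrossed_pi_algebra.intro precrossed_pi_algebra_axioms.intro)
qed (fact frobenius_pi_algebra_axioms phi_ring_iso phi_smult phi_hom phi_eta phi_grade phi_id
    phi_crossed)+

lemma (in precrossed_pi_algebra) crossedI:
  assumes "\<And>\<alpha> \<beta> c. \<lbrakk>\<alpha> \<in> carrier \<pi>; \<beta> \<in> carrier \<pi>;
        c \<in> grade L (\<alpha> \<otimes>\<^bsub>\<pi>\<^esub> \<beta> \<otimes>\<^bsub>\<pi>\<^esub> inv\<^bsub>\<pi>\<^esub> \<alpha> \<otimes>\<^bsub>\<pi>\<^esub> inv\<^bsub>\<pi>\<^esub> \<beta>)\<rbrakk>
        \<Longrightarrow> trace K L (grade L \<alpha>) (\<lambda>a. c \<otimes>\<^bsub>L\<^esub> phi L \<beta> a) =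
            trace K L (grade L \<beta>) (\<lambda>b. phi L (inv\<^bsub>\<pi>\<^esub> \<alpha>) (c \<otimes>\<^bsub>L\<^esub> b))"
  shows "crossed_pi_algebra \<pi> K L"
proof (intro crossed_pi_algebra.intro crossed_pi_algebra_axioms.intro)
qed (fact frobenius_pi_algebra_axioms phi_ring_iso phi_smult phi_hom phi_eta phi_grade phi_id
    phi_crossed assms)+

context precrossed_pi_algebra
begin

lemma phi_ring_hom:
  assumes "\<beta> \<in> carrier \<pi>"
  shows phi_closed: "x \<in> carrier L \<Longrightarrow> phi L \<beta> x \<in> carrier L"
    and phi_mult: "x \<in> carrier L \<Longrightarrow> y \<in> carrier L \<Longrightarrow>
      phi L \<beta> (x \<otimes>\<^bsub>L\<^esub> y) = phi L \<beta> x \<otimes>\<^bsub>L\<^esub> phi L \<beta> y"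
    and phi_add: "x \<in> carrier L \<Longrightarrow> y \<in> carrier L \<Longrightarrow>
      phi L \<beta> (x \<oplus>\<^bsub>L\<^esub> y) = phi L \<beta> x \<oplus>\<^bsub>L\<^esub> phi L \<beta> y"
    and phi_one: "phi L \<beta> \<one>\<^bsub>L\<^esub> = \<one>\<^bsub>L\<^esub>"
    and phi_zero: "phi L \<beta> \<zero>\<^bsub>L\<^esub> = \<zero>\<^bsub>L\<^esub>"
    and phi_inj: "inj_on (phi L \<beta>) (carrier L)"
proof -
  note iso = phi_ring_iso[OF assms]
  show "x \<in> carrier L \<Longrightarrow> phi L \<beta> x \<in> carrier L"
    and "x \<in> carrier L \<Longrightarrow> y \<in> carrier L \<Longrightarrow>
      phi L \<beta> (x \<otimes>\<^bsub>L\<^esub> y) = phi L \<beta> x \<otimes>\<^bsub>L\<^esub> phi L \<beta> y"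
    and "x \<in> carrier L \<Longrightarrow> y \<in> carrier L \<Longrightarrow>
      phi L \<beta> (x \<oplus>\<^bsub>L\<^esub> y) = phi L \<beta> x \<oplus>\<^bsub>L\<^esub> phi L \<beta> y"
    and "phi L \<beta> \<one>\<^bsub>L\<^esub> = \<one>\<^bsub>L\<^esub>"
    using ring_iso_memE[OF iso] by auto
  show "phi L \<beta> \<zero>\<^bsub>L\<^esub> = \<zero>\<^bsub>L\<^esub>"
    using iso by (intro ring_hom_zero) (auto simp: ring_iso_def L.ring_axioms)
  show "inj_on (phi L \<beta>) (carrier L)"
    using ring_iso_memE(5)[OF iso] by (auto simp: bij_betw_def)
qed

lemma phi_unit: "x \<in> carrier L \<Longrightarrow> phi L \<one>\<^bsub>\<pi>\<^esub> x = x"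
  using phi_hom[of "\<one>\<^bsub>\<pi>\<^esub>" "\<one>\<^bsub>\<pi>\<^esub>" x] phi_inj[of "\<one>\<^bsub>\<pi>\<^esub>"] phi_closed[of "\<one>\<^bsub>\<pi>\<^esub>"]
  by (auto simp: inj_on_def)

lemma phi_inverse:
  assumes "\<beta> \<in> carrier \<pi>" "x \<in> carrier L"
  shows "phi L (inv\<^bsub>\<pi>\<^esub> \<beta>) (phi L \<beta> x) = x" "phi L \<beta> (phi L (inv\<^bsub>\<pi>\<^esub> \<beta>) x) = x"
  using assms phi_hom[of "inv\<^bsub>\<pi>\<^esub> \<beta>" \<beta> x] phi_hom[of \<beta> "inv\<^bsub>\<pi>\<^esub> \<beta>" x] phi_unit by auto

lemma phi_finsum:
  assumes "\<beta> \<in> carrier \<pi>" "\<And>i. i \<in> S \<Longrightarrow> f i \<in> carrier L"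
  shows "phi L \<beta> (\<Oplus>\<^bsub>L\<^esub>i\<in>S. f i) = (\<Oplus>\<^bsub>L\<^esub>i\<in>S. phi L \<beta> (f i))"
  by (rule finsum_additive(2)[where V = "carrier L"])
    (use assms phi_closed phi_add in \<open>auto simp: L.abelian_group_axioms\<close>)

lemma phi_degree_one:
  assumes "\<beta> \<in> carrier \<pi>" "a \<in> grade L \<one>\<^bsub>\<pi>\<^esub>"
  shows "phi L \<beta> a \<in> grade L \<one>\<^bsub>\<pi>\<^esub>"
  using phi_grade[of "\<one>\<^bsub>\<pi>\<^esub>" \<beta> a] assms by simp

text \<open>Elements of degree one are central, because \<open>\<phi>\<^sub>1\<close> is the identity.\<close>

lemma degree_one_central:
  assumes "a \<in> grade L \<one>\<^bsub>\<pi>\<^esub>" "x \<in> carrier L"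
  shows "a \<otimes>\<^bsub>L\<^esub> x = x \<otimes>\<^bsub>L\<^esub> a"
  using phi_crossed[of "\<one>\<^bsub>\<pi>\<^esub>" x a] phi_unit[of x] assms by simp

end

context pi_algebra
begin

lemma smult_cancel:
  assumes "c \<in> carrier K" "d \<in> carrier K" "x \<in> carrier L" "x \<noteq> \<zero>\<^bsub>L\<^esub>" "c \<odot>\<^bsub>L\<^esub> x = d \<odot>\<^bsub>L\<^esub> x"
  shows "c = d"
proof (rule ccontr)
  assume "c \<noteq> d"
  let ?e = "c \<ominus>\<^bsub>K\<^esub> d"
  have e: "?e \<in> carrier K" "?e \<noteq> \<zero>\<^bsub>K\<^esub>"
    using \<open>c \<noteq> d\<close> assms by (auto simp: K.r_right_minus_eq)
  have "?e \<odot>\<^bsub>L\<^esub> x = \<zero>\<^bsub>L\<^esub>"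
    using assms by (simp add: a_minus_def M.smult_l_distr M.smult_l_minus L.r_neg)
  then have "(inv\<^bsub>K\<^esub> ?e \<otimes>\<^bsub>K\<^esub> ?e) \<odot>\<^bsub>L\<^esub> x = \<zero>\<^bsub>L\<^esub>"
    using e assms(3) K.field_Units by (subst M.smult_assoc1) auto
  moreover have "inv\<^bsub>K\<^esub> ?e \<otimes>\<^bsub>K\<^esub> ?e = \<one>\<^bsub>K\<^esub>"
    using e K.field_Units K.Units_l_inv by auto
  ultimately show False using assms by simp
qed

lemma smult_eq_zero:
  assumes "c \<in> carrier K" "x \<in> carrier L" "x \<noteq> \<zero>\<^bsub>L\<^esub>" "c \<odot>\<^bsub>L\<^esub> x = \<zero>\<^bsub>L\<^esub>"
  shows "c = \<zero>\<^bsub>K\<^esub>"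
  using smult_cancel[of c "\<zero>\<^bsub>K\<^esub>" x] assms by simp

lemma grade_one_carrier: "a \<in> grade L \<one>\<^bsub>\<pi>\<^esub> \<Longrightarrow> a \<in> carrier L"
  using grade_in_carrier by blast

lemma orthogonal_extract:
  assumes I: "finite I" "I \<subseteq> carrier L"
    and orth: "\<And>i j. i \<in> I \<Longrightarrow> j \<in> I \<Longrightarrow> i \<otimes>\<^bsub>L\<^esub> j = (if i = j then i else \<zero>\<^bsub>L\<^esub>)"
    and c: "\<And>i. i \<in> I \<Longrightarrow> c i \<in> carrier K" and k: "k \<in> I"
  shows "k \<otimes>\<^bsub>L\<^esub> (\<Oplus>\<^bsub>L\<^esub>i\<in>I. c i \<odot>\<^bsub>L\<^esub> i) = c k \<odot>\<^bsub>L\<^esub> k"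
proof -
  have "k \<otimes>\<^bsub>L\<^esub> (\<Oplus>\<^bsub>L\<^esub>i\<in>I. c i \<odot>\<^bsub>L\<^esub> i) = (\<Oplus>\<^bsub>L\<^esub>i\<in>I. k \<otimes>\<^bsub>L\<^esub> (c i \<odot>\<^bsub>L\<^esub> i))"
    using I c k by (intro L.finsum_rdistr) auto
  also have "\<dots> = (\<Oplus>\<^bsub>L\<^esub>i\<in>I. if k = i then c i \<odot>\<^bsub>L\<^esub> i else \<zero>\<^bsub>L\<^esub>)"
  proof (rule L.finsum_cong')
    fix i assume i: "i \<in> I"
    have "k \<otimes>\<^bsub>L\<^esub> (c i \<odot>\<^bsub>L\<^esub> i) = c i \<odot>\<^bsub>L\<^esub> (k \<otimes>\<^bsub>L\<^esub> i)"
      using I(2) c i k by (auto intro: smult_mult_right)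
    then show "k \<otimes>\<^bsub>L\<^esub> (c i \<odot>\<^bsub>L\<^esub> i) = (if k = i then c i \<odot>\<^bsub>L\<^esub> i else \<zero>\<^bsub>L\<^esub>)"
      using orth[OF k i] c[OF i] by auto
  qed (use I c in auto)
  also have "\<dots> = c k \<odot>\<^bsub>L\<^esub> k"
    using I c k by (intro L.add.finprod_singleton) auto
  finally show ?thesis .
qed

lemma splittingI:
  assumes I: "finite I" "I \<subseteq> grade L \<one>\<^bsub>\<pi>\<^esub>"
    and orth: "\<And>i j. i \<in> I \<Longrightarrow> j \<in> I \<Longrightarrow> i \<otimes>\<^bsub>L\<^esub> j = (if i = j then i else \<zero>\<^bsub>L\<^esub>)"
    and nz: "\<zero>\<^bsub>L\<^esub> \<notin> I"
    and span: "\<And>a. a \<in> grade L \<one>\<^bsub>\<pi>\<^esub> \<Longrightarrow> \<exists>c. c \<in> I \<rightarrow> carrier K \<and> a = (\<Oplus>\<^bsub>L\<^esub>i\<in>I. c i \<odot>\<^bsub>L\<^esub> i)"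
  shows "splitting \<pi> K L I"
  unfolding splitting_def
proof (intro conjI ballI)
  have Ic: "I \<subseteq> carrier L" using I(2) grade_one_carrier by auto
  fix a assume "a \<in> grade L \<one>\<^bsub>\<pi>\<^esub>"
  then obtain c where c: "c \<in> I \<rightarrow> carrier K" "a = (\<Oplus>\<^bsub>L\<^esub>i\<in>I. c i \<odot>\<^bsub>L\<^esub> i)" using span by blast
  show "\<exists>!c. c \<in> I \<rightarrow>\<^sub>E carrier K \<and> a = (\<Oplus>\<^bsub>L\<^esub>i\<in>I. c i \<odot>\<^bsub>L\<^esub> i)"
  proof (rule ex1I[where a = "restrict c I"])
    have "(\<Oplus>\<^bsub>L\<^esub>i\<in>I. restrict c I i \<odot>\<^bsub>L\<^esub> i) = (\<Oplus>\<^bsub>L\<^esub>i\<in>I. c i \<odot>\<^bsub>L\<^esub> i)"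
      using c Ic by (intro L.finsum_cong') (auto simp: Pi_def)
    then show "restrict c I \<in> I \<rightarrow>\<^sub>E carrier K \<and> a = (\<Oplus>\<^bsub>L\<^esub>i\<in>I. restrict c I i \<odot>\<^bsub>L\<^esub> i)"
      using c by auto
  next
    fix d assume d: "d \<in> I \<rightarrow>\<^sub>E carrier K \<and> a = (\<Oplus>\<^bsub>L\<^esub>i\<in>I. d i \<odot>\<^bsub>L\<^esub> i)"
    show "d = restrict c I"
    proof (rule extensionalityI[where A = I])
      fix k assume k: "k \<in> I"
      have "c k \<odot>\<^bsub>L\<^esub> k = k \<otimes>\<^bsub>L\<^esub> a"
        unfolding c(2) by (rule orthogonal_extract[OF I(1) Ic orth, symmetric]) (use c k in auto)
      also have "\<dots> = d k \<odot>\<^bsub>L\<^esub> k"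
        unfolding conjunct2[OF d] by (rule orthogonal_extract[OF I(1) Ic orth]) (use d k in auto)
      finally have "c k = d k"
        using smult_cancel[of "c k" "d k" k] c d k Ic nz by (auto simp: PiE_def Pi_def)
      then show "d k = restrict c I k" using k by simp
    qed (use d in \<open>auto simp: PiE_def\<close>)
  qed
qed (use I orth in auto)

lemma splitting_facts:
  assumes "splitting \<pi> K L I"
  shows splitting_finite: "finite I"
    and splitting_degree: "i \<in> I \<Longrightarrow> i \<in> grade L \<one>\<^bsub>\<pi>\<^esub>"
    and splitting_carrier: "i \<in> I \<Longrightarrow> i \<in> carrier L"
    and splitting_orth: "i \<in> I \<Longrightarrow> j \<in> I \<Longrightarrow> i \<otimes>\<^bsub>L\<^esub> j = (if i = j then i else \<zero>\<^bsub>L\<^esub>)"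
    and splitting_span: "a \<in> grade L \<one>\<^bsub>\<pi>\<^esub> \<Longrightarrow>
      \<exists>c. c \<in> I \<rightarrow>\<^sub>E carrier K \<and> a = (\<Oplus>\<^bsub>L\<^esub>i\<in>I. c i \<odot>\<^bsub>L\<^esub> i)"
proof -
  show "finite I" "i \<in> I \<Longrightarrow> i \<in> grade L \<one>\<^bsub>\<pi>\<^esub>" 
    "i \<in> I \<Longrightarrow> j \<in> I \<Longrightarrow> i \<otimes>\<^bsub>L\<^esub> j = (if i = j then i else \<zero>\<^bsub>L\<^esub>)"
    "a \<in> grade L \<one>\<^bsub>\<pi>\<^esub> \<Longrightarrow> \<exists>c. c \<in> I \<rightarrow>\<^sub>E carrier K \<and> a = (\<Oplus>\<^bsub>L\<^esub>i\<in>I. c i \<odot>\<^bsub>L\<^esub> i)"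
    using assms unfolding splitting_def by blast+
  then show "i \<in> I \<Longrightarrow> i \<in> carrier L" using grade_one_carrier by blast
qed

lemma splitting_nonzero:
  assumes s: "splitting \<pi> K L I"
  shows "\<zero>\<^bsub>L\<^esub> \<notin> I"
proof
  assume z: "\<zero>\<^bsub>L\<^esub> \<in> I"
  have 0: "\<zero>\<^bsub>L\<^esub> \<in> grade L \<one>\<^bsub>\<pi>\<^esub>" using grade_zero by blast
  then have ex: "\<exists>!c. c \<in> I \<rightarrow>\<^sub>E carrier K \<and> \<zero>\<^bsub>L\<^esub> = (\<Oplus>\<^bsub>L\<^esub>i\<in>I. c i \<odot>\<^bsub>L\<^esub> i)"
    using s unfolding splitting_def by blast
  \<comment> \<open>A zero member of the family could be given the coefficient one in the expansion of zero.\<close>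
  define c where "c = (\<lambda>i\<in>I. \<zero>\<^bsub>K\<^esub>)"
  define d where "d = (\<lambda>i\<in>I. if i = \<zero>\<^bsub>L\<^esub> then \<one>\<^bsub>K\<^esub> else \<zero>\<^bsub>K\<^esub>)"
  have "(\<Oplus>\<^bsub>L\<^esub>i\<in>I. c i \<odot>\<^bsub>L\<^esub> i) = \<zero>\<^bsub>L\<^esub>" "(\<Oplus>\<^bsub>L\<^esub>i\<in>I. d i \<odot>\<^bsub>L\<^esub> i) = \<zero>\<^bsub>L\<^esub>"
    using splitting_carrier[OF s] by (auto intro!: L.add.finprod_one_eqI simp: c_def d_def)
  moreover have "c \<in> I \<rightarrow>\<^sub>E carrier K" "d \<in> I \<rightarrow>\<^sub>E carrier K"
    by (auto simp: c_def d_def)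
  ultimately have "d = c"
    by (intro Uniq_D[OF ex[unfolded ex1_iff_ex_Uniq, THEN conjunct2]]) simp_all
  then have "d \<zero>\<^bsub>L\<^esub> = c \<zero>\<^bsub>L\<^esub>" by simp
  then have "\<one>\<^bsub>K\<^esub> = \<zero>\<^bsub>K\<^esub>" using z by (simp add: c_def d_def)
  then show False by simp
qed

lemma splitting_line:
  assumes s: "splitting \<pi> K L I" and i: "i \<in> I" and a: "a \<in> grade L \<one>\<^bsub>\<pi>\<^esub>"
  obtains c where "c \<in> carrier K" "i \<otimes>\<^bsub>L\<^esub> a = c \<odot>\<^bsub>L\<^esub> i"
proof -
  obtain c where c: "c \<in> I \<rightarrow>\<^sub>E carrier K" "a = (\<Oplus>\<^bsub>L\<^esub>i\<in>I. c i \<odot>\<^bsub>L\<^esub> i)"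
    using splitting_span[OF s a] by blast
  have "i \<otimes>\<^bsub>L\<^esub> a = c i \<odot>\<^bsub>L\<^esub> i"
    unfolding c(2) by (rule orthogonal_extract[OF splitting_finite[OF s]])
      (use c s splitting_carrier splitting_orth i in auto)
  then show ?thesis using c i that by auto
qed

lemma splitting_sum:
  assumes s: "splitting \<pi> K L I"
  shows "(\<Oplus>\<^bsub>L\<^esub>i\<in>I. i) = \<one>\<^bsub>L\<^esub>"
proof -
  obtain c where c: "c \<in> I \<rightarrow>\<^sub>E carrier K" "\<one>\<^bsub>L\<^esub> = (\<Oplus>\<^bsub>L\<^esub>i\<in>I. c i \<odot>\<^bsub>L\<^esub> i)"
    using splitting_span[OF s grade_one] by blast
  have "c i \<odot>\<^bsub>L\<^esub> i = i" if i: "i \<in> I" for i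
  proof -
    have "i \<otimes>\<^bsub>L\<^esub> \<one>\<^bsub>L\<^esub> = c i \<odot>\<^bsub>L\<^esub> i"
      unfolding c(2) by (rule orthogonal_extract[OF splitting_finite[OF s]])
        (use c s splitting_carrier splitting_orth i in auto)
    then show ?thesis using splitting_carrier[OF s i] by simp
  qed
  then have "(\<Oplus>\<^bsub>L\<^esub>i\<in>I. i) = (\<Oplus>\<^bsub>L\<^esub>i\<in>I. c i \<odot>\<^bsub>L\<^esub> i)"
    using splitting_carrier[OF s] by (intro L.finsum_cong') auto
  then show ?thesis using c(2) by simp
qed

text \<open>
  If \<open>j \<in> J\<close> then \<open>ij \<noteq> 0\<close> for some \<open>i \<in> I\<close>; the product lies on both lines \<open>Ki\<close> and \<open>Kj\<close>, so the
  idempotents \<open>i\<close> and \<open>j\<close> are proportional, hence equal.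
\<close>

lemma splitting_subset:
  assumes I: "splitting \<pi> K L I" and J: "splitting \<pi> K L J"
    and comm: "\<And>i j. i \<in> I \<Longrightarrow> j \<in> J \<Longrightarrow> i \<otimes>\<^bsub>L\<^esub> j = j \<otimes>\<^bsub>L\<^esub> i"
  shows "J \<subseteq> I"
proof
  fix j assume j: "j \<in> J"
  note jc = splitting_carrier[OF J j]
  have j0: "j \<noteq> \<zero>\<^bsub>L\<^esub>" using j splitting_nonzero[OF J] by auto
  have "\<exists>i\<in>I. i \<otimes>\<^bsub>L\<^esub> j \<noteq> \<zero>\<^bsub>L\<^esub>"
  proof (rule ccontr)
    assume "\<not> (\<exists>i\<in>I. i \<otimes>\<^bsub>L\<^esub> j \<noteq> \<zero>\<^bsub>L\<^esub>)"
    then have "(\<Oplus>\<^bsub>L\<^esub>i\<in>I. i \<otimes>\<^bsub>L\<^esub> j) = \<zero>\<^bsub>L\<^esub>"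
      by (intro L.add.finprod_one_eqI) auto
    then have "(\<Oplus>\<^bsub>L\<^esub>i\<in>I. i) \<otimes>\<^bsub>L\<^esub> j = \<zero>\<^bsub>L\<^esub>"
      using L.finsum_ldistr[OF splitting_finite[OF I] jc, of "\<lambda>i. i"] splitting_carrier[OF I] by auto
    then show False using splitting_sum[OF I] j0 jc by simp
  qed
  then obtain i where i: "i \<in> I" "i \<otimes>\<^bsub>L\<^esub> j \<noteq> \<zero>\<^bsub>L\<^esub>" by auto
  note ic = splitting_carrier[OF I i(1)]
  obtain c where c: "c \<in> carrier K" "i \<otimes>\<^bsub>L\<^esub> j = c \<odot>\<^bsub>L\<^esub> i"
    using splitting_line[OF I i(1) splitting_degree[OF J j]] .
  obtain d where d: "d \<in> carrier K" "j \<otimes>\<^bsub>L\<^esub> i = d \<odot>\<^bsub>L\<^esub> j"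
    using splitting_line[OF J j splitting_degree[OF I i(1)]] .
  have ii: "i \<otimes>\<^bsub>L\<^esub> i = i" and jj: "j \<otimes>\<^bsub>L\<^esub> j = j"
    using splitting_orth[OF I i(1) i(1)] splitting_orth[OF J j j] by auto
  note ij = comm[OF i(1) j]
  have "i \<otimes>\<^bsub>L\<^esub> (i \<otimes>\<^bsub>L\<^esub> j) = i \<otimes>\<^bsub>L\<^esub> j" "j \<otimes>\<^bsub>L\<^esub> (j \<otimes>\<^bsub>L\<^esub> i) = j \<otimes>\<^bsub>L\<^esub> i"
    using ii jj ic jc by (simp_all add: L.m_assoc[symmetric])
  have "(i \<otimes>\<^bsub>L\<^esub> j) \<otimes>\<^bsub>L\<^esub> j = i \<otimes>\<^bsub>L\<^esub> j" using jj ic jc by (simp add: L.m_assoc)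
  then have "c \<odot>\<^bsub>L\<^esub> (c \<odot>\<^bsub>L\<^esub> i) = c \<odot>\<^bsub>L\<^esub> i"
    using c ic jc by (metis smult_mult_left)
  then have "(c \<otimes>\<^bsub>K\<^esub> c) \<odot>\<^bsub>L\<^esub> i = c \<odot>\<^bsub>L\<^esub> i" using c ic by (simp add: M.smult_assoc1)
  then have "c \<otimes>\<^bsub>K\<^esub> c = c \<otimes>\<^bsub>K\<^esub> \<one>\<^bsub>K\<^esub>"
    using smult_cancel[of "c \<otimes>\<^bsub>K\<^esub> c" c i] c ic splitting_nonzero[OF I] i(1) by auto
  moreover have "c \<noteq> \<zero>\<^bsub>K\<^esub>" using i(2) c ic by auto
  ultimately have c1: "c = \<one>\<^bsub>K\<^esub>" using c K.m_lcancel[of c c "\<one>\<^bsub>K\<^esub>"] by auto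
  have "(j \<otimes>\<^bsub>L\<^esub> i) \<otimes>\<^bsub>L\<^esub> i = j \<otimes>\<^bsub>L\<^esub> i" using ii ic jc by (simp add: L.m_assoc)
  then have "d \<odot>\<^bsub>L\<^esub> (d \<odot>\<^bsub>L\<^esub> j) = d \<odot>\<^bsub>L\<^esub> j"
    using d ic jc by (metis smult_mult_left)
  then have "(d \<otimes>\<^bsub>K\<^esub> d) \<odot>\<^bsub>L\<^esub> j = d \<odot>\<^bsub>L\<^esub> j" using d jc by (simp add: M.smult_assoc1)
  then have "d \<otimes>\<^bsub>K\<^esub> d = d \<otimes>\<^bsub>K\<^esub> \<one>\<^bsub>K\<^esub>"
    using smult_cancel[of "d \<otimes>\<^bsub>K\<^esub> d" d j] d jc j0 by auto
  moreover have "d \<noteq> \<zero>\<^bsub>K\<^esub>" using i(2) ij d jc by auto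
  ultimately have d1: "d = \<one>\<^bsub>K\<^esub>" using d K.m_lcancel[of d d "\<one>\<^bsub>K\<^esub>"] by auto
  have "j = i" using c(2) d(2) c1 d1 ij ic jc by simp
  then show "j \<in> I" using i by simp
qed

end

context precrossed_pi_algebra
begin

lemma splitting_unique:
  assumes I: "splitting \<pi> K L I" and J: "splitting \<pi> K L J"
  shows "I = J"
  using splitting_subset[OF I J] splitting_subset[OF J I]
    degree_one_central splitting_degree[OF I] splitting_carrier[OF J]
    splitting_degree[OF J] splitting_carrier[OF I] by blast

lemma bas_eq:
  assumes "splitting \<pi> K L I"
  shows "bas \<pi> K L = I"
  using assms splitting_unique[OF assms] unfolding bas_def by blast

text \<open>
  An automorphism maps a splitting to a splitting, and there is only one.
\<close>

lemma splitting_phi: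
  assumes s: "splitting \<pi> K L I" and \<beta>: "\<beta> \<in> carrier \<pi>"
  shows "phi L \<beta> ` I = I"
proof -
  have inj: "inj_on (phi L \<beta>) I"
    using phi_inj[OF \<beta>] splitting_carrier[OF s] by (meson inj_on_subset subsetI)
  have "splitting \<pi> K L (phi L \<beta> ` I)"
  proof (rule splittingI)
    show "finite (phi L \<beta> ` I)" using splitting_finite[OF s] by simp
    show "phi L \<beta> ` I \<subseteq> grade L \<one>\<^bsub>\<pi>\<^esub>"
      using phi_degree_one[OF \<beta>] splitting_degree[OF s] by auto
    show "\<zero>\<^bsub>L\<^esub> \<notin> phi L \<beta> ` I"
      using phi_inj[OF \<beta>] phi_zero[OF \<beta>] splitting_carrier[OF s] splitting_nonzero[OF s]
      by (metis (no_types, lifting) L.zero_closed imageE inj_onD)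
  next
    fix k l assume "k \<in> phi L \<beta> ` I" "l \<in> phi L \<beta> ` I"
    then obtain i j where ij: "i \<in> I" "j \<in> I" "k = phi L \<beta> i" "l = phi L \<beta> j" by auto
    have "k \<otimes>\<^bsub>L\<^esub> l = phi L \<beta> (i \<otimes>\<^bsub>L\<^esub> j)"
      using ij splitting_carrier[OF s] phi_mult[OF \<beta>] by simp
    then show "k \<otimes>\<^bsub>L\<^esub> l = (if k = l then k else \<zero>\<^bsub>L\<^esub>)"
      using ij splitting_orth[OF s ij(1,2)] phi_zero[OF \<beta>] inj by (auto simp: inj_on_def)
  next
    fix a assume a: "a \<in> grade L \<one>\<^bsub>\<pi>\<^esub>"
    then have ac: "a \<in> carrier L" using grade_one_carrier by simp
    obtain c where c: "c \<in> I \<rightarrow>\<^sub>E carrier K" "phi L (inv\<^bsub>\<pi>\<^esub> \<beta>) a = (\<Oplus>\<^bsub>L\<^esub>i\<in>I. c i \<odot>\<^bsub>L\<^esub> i)"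
      using splitting_span[OF s phi_degree_one[of "inv\<^bsub>\<pi>\<^esub> \<beta>" a]] a \<beta> by auto
    have cI: "c i \<in> carrier K" if "i \<in> I" for i using c(1) that by auto
    define d where "d = c \<circ> inv_into I (phi L \<beta>)"
    have d: "d (phi L \<beta> i) = c i" if "i \<in> I" for i
      using that inj by (simp add: d_def)
    have "a = phi L \<beta> (\<Oplus>\<^bsub>L\<^esub>i\<in>I. c i \<odot>\<^bsub>L\<^esub> i)"
      using phi_inverse(2)[OF \<beta> ac] c(2) by simp
    also have "\<dots> = (\<Oplus>\<^bsub>L\<^esub>i\<in>I. d (phi L \<beta> i) \<odot>\<^bsub>L\<^esub> phi L \<beta> i)"
      using c cI splitting_carrier[OF s] \<beta> d
      by (subst phi_finsum) (auto intro!: L.finsum_cong' simp: phi_smult phi_closed)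
    also have "\<dots> = (\<Oplus>\<^bsub>L\<^esub>k\<in>phi L \<beta> ` I. d k \<odot>\<^bsub>L\<^esub> k)"
      using inj cI splitting_carrier[OF s] \<beta> d
      by (subst L.finsum_reindex) (auto simp: phi_closed)
    finally show "\<exists>d. d \<in> phi L \<beta> ` I \<rightarrow> carrier K \<and> a = (\<Oplus>\<^bsub>L\<^esub>k\<in>phi L \<beta> ` I. d k \<odot>\<^bsub>L\<^esub> k)"
      using d cI by (intro exI[of _ d]) auto
  qed
  then show ?thesis using splitting_unique s by metis
qed

end

section \<open>Corners at basic idempotents and the trace condition\<close>

locale normalized_splitting = precrossed_pi_algebra +
  fixes I
  assumes splitting: "splitting \<pi> K L I"
    and norm: "i \<in> I \<Longrightarrow> eta L i i = \<one>\<^bsub>K\<^esub>"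
begin

lemmas idem_finite = splitting_finite[OF splitting]
  and idem_degree = splitting_degree[OF splitting]
  and idem_carrier = splitting_carrier[OF splitting]
  and idem_orth = splitting_orth[OF splitting]
  and idem_sum = splitting_sum[OF splitting]

lemma idem_idem: "i \<in> I \<Longrightarrow> i \<otimes>\<^bsub>L\<^esub> i = i"
  using idem_orth[of i i] by simp

lemma idem_central: "i \<in> I \<Longrightarrow> x \<in> carrier L \<Longrightarrow> i \<otimes>\<^bsub>L\<^esub> x = x \<otimes>\<^bsub>L\<^esub> i"
  using degree_one_central idem_degree by blast

lemma idem_phi: "i \<in> I \<Longrightarrow> \<beta> \<in> carrier \<pi> \<Longrightarrow> phi L \<beta> i \<in> I"
  using splitting_phi[OF splitting] by blast

lemma idem_eta_move:
  assumes "i \<in> I" "x \<in> carrier L" "y \<in> carrier L"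
  shows "eta L (i \<otimes>\<^bsub>L\<^esub> x) y = eta L x (i \<otimes>\<^bsub>L\<^esub> y)"
  using assms idem_central[of i x] eta_assoc[of x i y] idem_carrier by simp

lemma idem_mult_left:
  assumes "i \<in> I" "x \<in> carrier L"
  shows "i \<otimes>\<^bsub>L\<^esub> (i \<otimes>\<^bsub>L\<^esub> x) = i \<otimes>\<^bsub>L\<^esub> x"
  using assms idem_idem idem_carrier by (simp add: L.m_assoc[symmetric])

lemma idem_grade:
  assumes "i \<in> I" "\<alpha> \<in> carrier \<pi>" "a \<in> grade L \<alpha>"
  shows "i \<otimes>\<^bsub>L\<^esub> a \<in> grade L \<alpha>"
  using grade_mult[of "\<one>\<^bsub>\<pi>\<^esub>" \<alpha> i a] assms idem_degree by simp

text \<open>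
  The product lies on the line \<open>Ki\<close>, and \<open>\<eta>(i, i) = 1\<close> allows its coefficient to be read off.
\<close>

lemma corner_one:
  assumes i: "i \<in> I" and x: "x \<in> grade L \<one>\<^bsub>\<pi>\<^esub>"
  shows "i \<otimes>\<^bsub>L\<^esub> x = eta L x i \<odot>\<^bsub>L\<^esub> i"
proof -
  obtain c where c: "c \<in> carrier K" "i \<otimes>\<^bsub>L\<^esub> x = c \<odot>\<^bsub>L\<^esub> i"
    using splitting_line[OF splitting i x] .
  have "eta L x i = eta L (i \<otimes>\<^bsub>L\<^esub> x) i"
    using i x grade_one_carrier idem_eta_move[of i x i] idem_idem idem_carrier by simp
  also have "\<dots> = c"
    using c i idem_carrier norm by (simp add: eta_smult)
  finally show ?thesis using c by simp
qed

lemma corner_product: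
  assumes i: "i \<in> I" and \<alpha>: "\<alpha> \<in> carrier \<pi>"
    and a: "a \<in> grade L \<alpha>" "i \<otimes>\<^bsub>L\<^esub> a = a" and b: "b \<in> grade L (inv\<^bsub>\<pi>\<^esub> \<alpha>)"
  shows "a \<otimes>\<^bsub>L\<^esub> b = eta L a b \<odot>\<^bsub>L\<^esub> i"
proof -
  have ac: "a \<in> carrier L" and bc: "b \<in> carrier L"
    using grade_in_carrier a b \<alpha> by (blast, meson \<pi>.inv_closed grade_in_carrier)
  note ic = idem_carrier[OF i]
  have ab: "a \<otimes>\<^bsub>L\<^esub> b \<in> grade L \<one>\<^bsub>\<pi>\<^esub>"
    using grade_mult[OF \<alpha> _ a(1) b] \<alpha> by simp
  have "a \<otimes>\<^bsub>L\<^esub> b = i \<otimes>\<^bsub>L\<^esub> (a \<otimes>\<^bsub>L\<^esub> b)"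
    using a(2) ac bc ic by (simp add: L.m_assoc[symmetric])
  also have "\<dots> = eta L (a \<otimes>\<^bsub>L\<^esub> b) i \<odot>\<^bsub>L\<^esub> i"
    using corner_one[OF i ab] .
  also have "eta L (a \<otimes>\<^bsub>L\<^esub> b) i = eta L a (i \<otimes>\<^bsub>L\<^esub> b)"
    using ac bc ic i by (simp add: eta_assoc idem_central)
  also have "\<dots> = eta L a b"
    using idem_eta_move[OF i ac bc] a(2) by simp
  finally show ?thesis .
qed

text \<open>
  Non-degeneracy of the form makes every nonzero homogeneous element of the corner \<open>iL\<close>
  invertible in \<open>iL\<close>.
\<close>

lemma corner_inverse:
  assumes i: "i \<in> I" and \<alpha>: "\<alpha> \<in> carrier \<pi>"
    and a: "a \<in> grade L \<alpha>" "i \<otimes>\<^bsub>L\<^esub> a = a" "a \<noteq> \<zero>\<^bsub>L\<^esub>"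
  obtains b where "b \<in> grade L (inv\<^bsub>\<pi>\<^esub> \<alpha>)" "i \<otimes>\<^bsub>L\<^esub> b = b" "a \<otimes>\<^bsub>L\<^esub> b = i" "b \<otimes>\<^bsub>L\<^esub> a = i"
proof -
  note ic = idem_carrier[OF i]
  have \<alpha>': "inv\<^bsub>\<pi>\<^esub> \<alpha> \<in> carrier \<pi>" using \<alpha> by simp
  have ac: "a \<in> carrier L" using grade_in_carrier a \<alpha> by blast
  obtain b where b: "b \<in> grade L (inv\<^bsub>\<pi>\<^esub> \<alpha>)" "eta L a b \<noteq> \<zero>\<^bsub>K\<^esub>"
    using eta_nondegenerate[OF \<alpha> a(1)] a(3) by blast
  have bc: "b \<in> carrier L" using grade_in_carrier b \<alpha>' by blast
  define e where "e = eta L a b"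
  have e: "e \<in> carrier K" "e \<noteq> \<zero>\<^bsub>K\<^esub>" using b eta_closed ac bc by (auto simp: e_def)
  then have e': "inv\<^bsub>K\<^esub> e \<in> carrier K" "inv\<^bsub>K\<^esub> e \<otimes>\<^bsub>K\<^esub> e = \<one>\<^bsub>K\<^esub>"
    using K.field_Units by auto
  define b' where "b' = inv\<^bsub>K\<^esub> e \<odot>\<^bsub>L\<^esub> (i \<otimes>\<^bsub>L\<^esub> b)"
  have b'g: "b' \<in> grade L (inv\<^bsub>\<pi>\<^esub> \<alpha>)"
    unfolding b'_def using grade_smult[OF \<alpha>'] idem_grade[OF i \<alpha>' b(1)] e' by simp
  have b'i: "i \<otimes>\<^bsub>L\<^esub> b' = b'"
    unfolding b'_def using e' ic bc i by (simp add: smult_mult_right idem_mult_left)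
  have b'c: "b' \<in> carrier L" using b'g grade_in_carrier \<alpha>' by blast
  have "eta L a b' = inv\<^bsub>K\<^esub> e \<otimes>\<^bsub>K\<^esub> eta L a (i \<otimes>\<^bsub>L\<^esub> b)"
    unfolding b'_def using e' ac ic bc by (simp add: eta_smult_right)
  also have "eta L a (i \<otimes>\<^bsub>L\<^esub> b) = e"
    using idem_eta_move[OF i ac bc] a(2) by (simp add: e_def)
  finally have ab': "eta L a b' = \<one>\<^bsub>K\<^esub>" using e' by simp
  have "a \<otimes>\<^bsub>L\<^esub> b' = i"
    using corner_product[OF i \<alpha> a(1,2) b'g] ab' ic by simp
  moreover have "b' \<otimes>\<^bsub>L\<^esub> a = i"
    using corner_product[OF i \<alpha>' b'g b'i] ab' ic a(1) \<alpha> eta_sym[OF ac b'c] by simp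
  ultimately show ?thesis using that b'g b'i by blast
qed

text \<open>Associativity gives \<open>ix = a(bx)\<close>, and \<open>bx = i(bx)\<close> has degree one, hence lies on the line \<open>Ki\<close>.\<close>

lemma corner_line:
  assumes i: "i \<in> I" and \<alpha>: "\<alpha> \<in> carrier \<pi>"
    and a: "a \<in> grade L \<alpha>" "i \<otimes>\<^bsub>L\<^esub> a = a"
    and b: "b \<in> grade L (inv\<^bsub>\<pi>\<^esub> \<alpha>)" "i \<otimes>\<^bsub>L\<^esub> b = b" "a \<otimes>\<^bsub>L\<^esub> b = i"
    and x: "x \<in> grade L \<alpha>"
  shows "i \<otimes>\<^bsub>L\<^esub> x = eta L x b \<odot>\<^bsub>L\<^esub> a"
proof -
  note ic = idem_carrier[OF i]
  have \<alpha>': "inv\<^bsub>\<pi>\<^esub> \<alpha> \<in> carrier \<pi>" using \<alpha> by simp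
  have c: "a \<in> carrier L" "x \<in> carrier L" "b \<in> carrier L"
    using grade_in_carrier[OF \<alpha>] grade_in_carrier[OF \<alpha>'] a x b by auto
  have "i \<otimes>\<^bsub>L\<^esub> x = a \<otimes>\<^bsub>L\<^esub> (b \<otimes>\<^bsub>L\<^esub> x)"
    using b(3) c by (simp add: L.m_assoc[symmetric])
  also have "b \<otimes>\<^bsub>L\<^esub> x = eta L x b \<odot>\<^bsub>L\<^esub> i"
    using corner_product[OF i \<alpha>' b(1,2), of x] x \<alpha> eta_sym c by simp
  also have "a \<otimes>\<^bsub>L\<^esub> (eta L x b \<odot>\<^bsub>L\<^esub> i) = eta L x b \<odot>\<^bsub>L\<^esub> a"
    using c ic eta_closed a(2) idem_central[OF i, of a] by (simp add: smult_mult_right)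
  finally show ?thesis .
qed

text \<open>
  Since \<open>\<phi>\<^sub>\<alpha>(i)x = xi = ix\<close>, the element \<open>ix\<close> is fixed by multiplication with both of the
  orthogonal idempotents \<open>i\<close> and \<open>\<phi>\<^sub>\<alpha>(i)\<close>.
\<close>

lemma corner_zero:
  assumes i: "i \<in> I" and \<alpha>: "\<alpha> \<in> carrier \<pi>" "phi L \<alpha> i \<noteq> i" and x: "x \<in> grade L \<alpha>"
  shows "i \<otimes>\<^bsub>L\<^esub> x = \<zero>\<^bsub>L\<^esub>"
proof -
  note ic = idem_carrier[OF i] and pc = idem_carrier[OF idem_phi[OF i \<alpha>(1)]]
  have xc: "x \<in> carrier L" using grade_in_carrier x \<alpha> by blast
  have "i \<otimes>\<^bsub>L\<^esub> x = phi L \<alpha> i \<otimes>\<^bsub>L\<^esub> x"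
    using phi_crossed[OF \<alpha>(1) ic x] idem_central[OF i xc] by simp
  then have "i \<otimes>\<^bsub>L\<^esub> x = i \<otimes>\<^bsub>L\<^esub> (phi L \<alpha> i \<otimes>\<^bsub>L\<^esub> x)"
    using idem_mult_left[OF i xc] by simp
  also have "\<dots> = (i \<otimes>\<^bsub>L\<^esub> phi L \<alpha> i) \<otimes>\<^bsub>L\<^esub> x"
    using ic pc xc by (simp add: L.m_assoc)
  also have "\<dots> = \<zero>\<^bsub>L\<^esub>"
    using idem_orth[OF i idem_phi[OF i \<alpha>(1)]] \<alpha>(2) xc by auto
  finally show ?thesis .
qed

text \<open>
  The operator \<open>a \<mapsto> i\<phi>\<^sub>\<alpha>(a)\<close> of \<open>L\<^sub>1\<close> has trace \<open>1\<close> if \<open>\<phi>\<^sub>\<alpha>(i) = i\<close>, so the trace condition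
  with first argument the neutral element says that multiplication by \<open>i\<close> on \<open>L\<^sub>\<alpha>\<close> has trace
  \<open>1\<close>, which rules out that it vanishes.
\<close>

lemma corner_nonzero:
  assumes crossed: "crossed_pi_algebra \<pi> K L"
    and i: "i \<in> I" and \<alpha>: "\<alpha> \<in> carrier \<pi>" and fixed: "phi L \<alpha> i = i"
  obtains a where "a \<in> grade L \<alpha>" "i \<otimes>\<^bsub>L\<^esub> a = a" "a \<noteq> \<zero>\<^bsub>L\<^esub>"
proof -
  interpret crossed_pi_algebra \<pi> K L by fact
  note ic = idem_carrier[OF i]
  have gc: "x \<in> carrier L" if "x \<in> grade L \<alpha>" for x using that grade_in_carrier \<alpha> by blast
  have "trace K L (grade L \<one>\<^bsub>\<pi>\<^esub>) (\<lambda>a. i \<otimes>\<^bsub>L\<^esub> phi L \<alpha> a) =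
      (\<Oplus>\<^bsub>K\<^esub>j\<in>I. eta L (i \<otimes>\<^bsub>L\<^esub> phi L \<alpha> j) j)"
  proof (rule M.trace_eq_dual_family[where x = "\<lambda>j. j" and f = "\<lambda>j x. eta L x j"])
    show "submodule (grade L \<one>\<^bsub>\<pi>\<^esub>) K L" using grade_submodule by simp
    show "dual_family K L (grade L \<one>\<^bsub>\<pi>\<^esub>) I (\<lambda>j. j) (\<lambda>j x. eta L x j)"
      unfolding dual_family_def
    proof (intro conjI ballI)
      fix v assume v: "v \<in> grade L \<one>\<^bsub>\<pi>\<^esub>"
      have "v = (\<Oplus>\<^bsub>L\<^esub>j\<in>I. j) \<otimes>\<^bsub>L\<^esub> v" using idem_sum v grade_one_carrier by simp
      also have "\<dots> = (\<Oplus>\<^bsub>L\<^esub>j\<in>I. j \<otimes>\<^bsub>L\<^esub> v)"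
        using idem_finite v grade_one_carrier idem_carrier by (intro L.finsum_ldistr) auto
      also have "\<dots> = (\<Oplus>\<^bsub>L\<^esub>j\<in>I. eta L v j \<odot>\<^bsub>L\<^esub> j)"
        using v grade_one_carrier idem_carrier eta_closed corner_one by (intro L.finsum_cong') auto
      finally show "v = (\<Oplus>\<^bsub>L\<^esub>j\<in>I. eta L v j \<odot>\<^bsub>L\<^esub> j)" .
    qed (use idem_degree idem_carrier grade_one_carrier eta_closed eta_add eta_smult in auto)
    show "i \<otimes>\<^bsub>L\<^esub> phi L \<alpha> v \<in> grade L \<one>\<^bsub>\<pi>\<^esub>" if "v \<in> grade L \<one>\<^bsub>\<pi>\<^esub>" for v
      using idem_grade[OF i _ phi_degree_one[OF \<alpha> that]] by simp
  qed (use ic \<alpha> phi_closed phi_add phi_smult grade_one_carrier idem_finite in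
      \<open>auto simp: L.r_distr smult_mult_right\<close>)
  also have "\<dots> = (\<Oplus>\<^bsub>K\<^esub>j\<in>I. if i = j then \<one>\<^bsub>K\<^esub> else \<zero>\<^bsub>K\<^esub>)"
  proof (rule K.finsum_cong')
    fix j assume j: "j \<in> I"
    note jc = idem_carrier[OF j]
    have "i \<otimes>\<^bsub>L\<^esub> phi L \<alpha> j = phi L \<alpha> (i \<otimes>\<^bsub>L\<^esub> j)"
      using phi_mult[OF \<alpha> ic jc] fixed by simp
    then show "eta L (i \<otimes>\<^bsub>L\<^esub> phi L \<alpha> j) j = (if i = j then \<one>\<^bsub>K\<^esub> else \<zero>\<^bsub>K\<^esub>)"
      using idem_orth[OF i j] fixed norm[OF i] phi_zero[OF \<alpha>] eta_zero_left[OF jc] by auto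
  qed auto
  also have "\<dots> = \<one>\<^bsub>K\<^esub>"
    using K.add.finprod_singleton[OF i idem_finite, of "\<lambda>_. \<one>\<^bsub>K\<^esub>"] by auto
  finally have "trace K L (grade L \<alpha>) (\<lambda>b. phi L (inv\<^bsub>\<pi>\<^esub> \<one>\<^bsub>\<pi>\<^esub>) (i \<otimes>\<^bsub>L\<^esub> b)) = \<one>\<^bsub>K\<^esub>"
    using trace_condition[of "\<one>\<^bsub>\<pi>\<^esub>" \<alpha> i] idem_degree[OF i] \<alpha> by simp
  moreover have "trace K L (grade L \<alpha>) (\<lambda>b. phi L (inv\<^bsub>\<pi>\<^esub> \<one>\<^bsub>\<pi>\<^esub>) (i \<otimes>\<^bsub>L\<^esub> b)) = \<zero>\<^bsub>K\<^esub>"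
    if z: "\<And>b. b \<in> grade L \<alpha> \<Longrightarrow> i \<otimes>\<^bsub>L\<^esub> b = \<zero>\<^bsub>L\<^esub>"
  proof -
    obtain n x f where d: "dual_family K L (grade L \<alpha>) {..<n::nat} x f"
      using grade_projective[OF \<alpha>] unfolding projective_finite_type_def dual_basis_iff by blast
    have z': "phi L (inv\<^bsub>\<pi>\<^esub> \<one>\<^bsub>\<pi>\<^esub>) (i \<otimes>\<^bsub>L\<^esub> b) = \<zero>\<^bsub>L\<^esub>" if "b \<in> grade L \<alpha>" for b
      using z[OF that] phi_zero by simp
    have "trace K L (grade L \<alpha>) (\<lambda>b. phi L (inv\<^bsub>\<pi>\<^esub> \<one>\<^bsub>\<pi>\<^esub>) (i \<otimes>\<^bsub>L\<^esub> b)) =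
        (\<Oplus>\<^bsub>K\<^esub>k\<in>{..<n}. f k (phi L (inv\<^bsub>\<pi>\<^esub> \<one>\<^bsub>\<pi>\<^esub>) (i \<otimes>\<^bsub>L\<^esub> x k)))"
      by (rule M.trace_eq_dual_family[OF grade_submodule[OF \<alpha>] _ d])
        (use z' grade_zero[OF \<alpha>] grade_add[OF \<alpha>] grade_smult[OF \<alpha>] in auto)
    also have "\<dots> = \<zero>\<^bsub>K\<^esub>"
    proof (rule K.add.finprod_one_eqI)
      fix k assume k: "k \<in> {..<n}"
      have xk: "x k \<in> grade L \<alpha>" and fk: "f k (\<zero>\<^bsub>K\<^esub> \<odot>\<^bsub>L\<^esub> x k) = \<zero>\<^bsub>K\<^esub> \<otimes>\<^bsub>K\<^esub> f k (x k)"
        "f k (x k) \<in> carrier K"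
        using d k unfolding dual_family_def by auto
      show "f k (phi L (inv\<^bsub>\<pi>\<^esub> \<one>\<^bsub>\<pi>\<^esub>) (i \<otimes>\<^bsub>L\<^esub> x k)) = \<zero>\<^bsub>K\<^esub>"
        using fk z'[OF xk] gc[OF xk] by simp
    qed
    finally show ?thesis .
  qed
  ultimately obtain b where b: "b \<in> grade L \<alpha>" "i \<otimes>\<^bsub>L\<^esub> b \<noteq> \<zero>\<^bsub>L\<^esub>"
    using K.one_not_zero by metis
  then show ?thesis
    using that[of "i \<otimes>\<^bsub>L\<^esub> b"] idem_grade[OF i \<alpha>] idem_mult_left[OF i] gc by simp
qed

text \<open>
  Conversely, let \<open>l\<^sub>\<alpha>\<close> span \<open>iL\<^sub>\<alpha>\<close> for every \<open>\<alpha>\<close> that fixes \<open>i\<close>. Both traces in the trace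
  condition are sums over the idempotents \<open>i\<close> fixed by \<open>\<alpha>\<close> and \<open>\<beta>\<close>, and the summands are the
  scalars \<open>p\<close> and \<open>q\<close> with \<open>c\<phi>\<^sub>\<beta>(l\<^sub>\<alpha>) = p l\<^sub>\<alpha>\<close> and \<open>\<phi>\<^sub>\<alpha>\<^sup>-\<^sup>1(c l\<^sub>\<beta>) = q l\<^sub>\<beta>\<close>. They agree because
  \<open>p l\<^sub>\<alpha>l\<^sub>\<beta> = c\<phi>\<^sub>\<beta>(l\<^sub>\<alpha>)l\<^sub>\<beta> = c l\<^sub>\<beta>l\<^sub>\<alpha> = q \<phi>\<^sub>\<alpha>(l\<^sub>\<beta>)l\<^sub>\<alpha> = q l\<^sub>\<alpha>l\<^sub>\<beta>\<close>.
\<close>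

lemma trace_condition_by_corners:
  assumes ex: "\<And>i \<alpha>. i \<in> I \<Longrightarrow> \<alpha> \<in> carrier \<pi> \<Longrightarrow> phi L \<alpha> i = i \<Longrightarrow>
      \<exists>a\<in>grade L \<alpha>. i \<otimes>\<^bsub>L\<^esub> a = a \<and> a \<noteq> \<zero>\<^bsub>L\<^esub>"
  shows "crossed_pi_algebra \<pi> K L"
proof (rule crossedI)
  define F where "F = (\<lambda>\<alpha>. {i\<in>I. phi L \<alpha> i = i})"
  have "\<forall>p. \<exists>q. fst p \<in> I \<and> snd p \<in> carrier \<pi> \<and> phi L (snd p) (fst p) = fst p \<longrightarrow>
      fst q \<in> grade L (snd p) \<and> fst p \<otimes>\<^bsub>L\<^esub> fst q = fst q \<and> fst q \<noteq> \<zero>\<^bsub>L\<^esub> \<and>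
      snd q \<in> grade L (inv\<^bsub>\<pi>\<^esub> (snd p)) \<and> fst p \<otimes>\<^bsub>L\<^esub> snd q = snd q \<and>
      fst q \<otimes>\<^bsub>L\<^esub> snd q = fst p \<and> snd q \<otimes>\<^bsub>L\<^esub> fst q = fst p"
  proof
    fix p
    show "\<exists>q. fst p \<in> I \<and> snd p \<in> carrier \<pi> \<and> phi L (snd p) (fst p) = fst p \<longrightarrow>
      fst q \<in> grade L (snd p) \<and> fst p \<otimes>\<^bsub>L\<^esub> fst q = fst q \<and> fst q \<noteq> \<zero>\<^bsub>L\<^esub> \<and>
      snd q \<in> grade L (inv\<^bsub>\<pi>\<^esub> (snd p)) \<and> fst p \<otimes>\<^bsub>L\<^esub> snd q = snd q \<and>
      fst q \<otimes>\<^bsub>L\<^esub> snd q = fst p \<and> snd q \<otimes>\<^bsub>L\<^esub> fst q = fst p"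
      using ex[of "fst p" "snd p"] corner_inverse[of "fst p" "snd p"]
      by (metis fst_conv snd_conv)
  qed
  then obtain r where r: "\<And>i \<alpha>. i \<in> I \<Longrightarrow> \<alpha> \<in> carrier \<pi> \<Longrightarrow> phi L \<alpha> i = i \<Longrightarrow>
      fst (r (i, \<alpha>)) \<in> grade L \<alpha> \<and> i \<otimes>\<^bsub>L\<^esub> fst (r (i, \<alpha>)) = fst (r (i, \<alpha>)) \<and> fst (r (i, \<alpha>)) \<noteq> \<zero>\<^bsub>L\<^esub> \<and>
      snd (r (i, \<alpha>)) \<in> grade L (inv\<^bsub>\<pi>\<^esub> \<alpha>) \<and> i \<otimes>\<^bsub>L\<^esub> snd (r (i, \<alpha>)) = snd (r (i, \<alpha>)) \<and>
      fst (r (i, \<alpha>)) \<otimes>\<^bsub>L\<^esub> snd (r (i, \<alpha>)) = i \<and> snd (r (i, \<alpha>)) \<otimes>\<^bsub>L\<^esub> fst (r (i, \<alpha>)) = i"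
    by (metis fst_conv snd_conv)
  define l where "l = (\<lambda>\<alpha> i. fst (r (i, \<alpha>)))"
  define m where "m = (\<lambda>\<alpha> i. snd (r (i, \<alpha>)))"
  have l: "l \<alpha> i \<in> grade L \<alpha>" "i \<otimes>\<^bsub>L\<^esub> l \<alpha> i = l \<alpha> i" "l \<alpha> i \<noteq> \<zero>\<^bsub>L\<^esub>" "l \<alpha> i \<in> carrier L"
    and m: "m \<alpha> i \<in> grade L (inv\<^bsub>\<pi>\<^esub> \<alpha>)" "i \<otimes>\<^bsub>L\<^esub> m \<alpha> i = m \<alpha> i" "m \<alpha> i \<in> carrier L"
    and lm: "l \<alpha> i \<otimes>\<^bsub>L\<^esub> m \<alpha> i = i" "m \<alpha> i \<otimes>\<^bsub>L\<^esub> l \<alpha> i = i"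
    if "i \<in> F \<alpha>" "\<alpha> \<in> carrier \<pi>" for i \<alpha>
    using r[of i \<alpha>] that grade_in_carrier[of \<alpha>] grade_in_carrier[of "inv\<^bsub>\<pi>\<^esub> \<alpha>"]
    by (auto simp: F_def l_def m_def)
  have FI: "i \<in> I" "phi L \<alpha> i = i" if "i \<in> F \<alpha>" for i \<alpha> using that by (auto simp: F_def)
  have Ffin: "finite (F \<alpha>)" for \<alpha> using idem_finite by (auto simp: F_def)
  have dual: "dual_family K L (grade L \<alpha>) (F \<alpha>) (l \<alpha>) (\<lambda>i x. eta L x (m \<alpha> i))"
    if \<alpha>: "\<alpha> \<in> carrier \<pi>" for \<alpha>
    unfolding dual_family_def
  proof (intro conjI ballI)
    note gc = grade_in_carrier[OF \<alpha>]
    fix v assume v: "v \<in> grade L \<alpha>"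
    have "v = (\<Oplus>\<^bsub>L\<^esub>j\<in>I. j) \<otimes>\<^bsub>L\<^esub> v" using idem_sum v gc by simp
    also have "\<dots> = (\<Oplus>\<^bsub>L\<^esub>j\<in>I. j \<otimes>\<^bsub>L\<^esub> v)"
      using idem_finite v gc idem_carrier by (intro L.finsum_ldistr) auto
    also have "\<dots> = (\<Oplus>\<^bsub>L\<^esub>j\<in>F \<alpha>. eta L v (m \<alpha> j) \<odot>\<^bsub>L\<^esub> l \<alpha> j)"
    proof (rule L.add.finprod_mono_neutral_cong_right)
      show "F \<alpha> \<subseteq> I" by (auto simp: F_def)
      show "j \<otimes>\<^bsub>L\<^esub> v = \<zero>\<^bsub>L\<^esub>" if "j \<in> I - F \<alpha>" for j
        using that corner_zero[OF _ \<alpha> _ v] by (auto simp: F_def)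
      show "j \<otimes>\<^bsub>L\<^esub> v = eta L v (m \<alpha> j) \<odot>\<^bsub>L\<^esub> l \<alpha> j" if "j \<in> F \<alpha>" for j
        using corner_line[OF FI(1)[OF that] \<alpha> l(1,2)[OF that \<alpha>] m(1,2)[OF that \<alpha>] lm(1)[OF that \<alpha>] v] .
    qed (use idem_finite v gc idem_carrier in auto)
    finally show "v = (\<Oplus>\<^bsub>L\<^esub>j\<in>F \<alpha>. eta L v (m \<alpha> j) \<odot>\<^bsub>L\<^esub> l \<alpha> j)" .
  qed (use \<alpha> l m grade_in_carrier[OF \<alpha>] eta_closed eta_add eta_smult in auto)
  fix \<alpha> \<beta> c
  assume \<alpha>: "\<alpha> \<in> carrier \<pi>" and \<beta>: "\<beta> \<in> carrier \<pi>"
    and c: "c \<in> grade L (\<alpha> \<otimes>\<^bsub>\<pi>\<^esub> \<beta> \<otimes>\<^bsub>\<pi>\<^esub> inv\<^bsub>\<pi>\<^esub> \<alpha> \<otimes>\<^bsub>\<pi>\<^esub> inv\<^bsub>\<pi>\<^esub> \<beta>)"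
  let ?\<gamma> = "\<alpha> \<otimes>\<^bsub>\<pi>\<^esub> \<beta> \<otimes>\<^bsub>\<pi>\<^esub> inv\<^bsub>\<pi>\<^esub> \<alpha> \<otimes>\<^bsub>\<pi>\<^esub> inv\<^bsub>\<pi>\<^esub> \<beta>"
  have \<alpha>': "inv\<^bsub>\<pi>\<^esub> \<alpha> \<in> carrier \<pi>" and \<beta>': "inv\<^bsub>\<pi>\<^esub> \<beta> \<in> carrier \<pi>" and \<gamma>: "?\<gamma> \<in> carrier \<pi>"
    using \<alpha> \<beta> by auto
  have cc: "c \<in> carrier L" using c grade_in_carrier \<gamma> by blast
  note ga = grade_in_carrier[OF \<alpha>] and gb = grade_in_carrier[OF \<beta>]
  define T where "T = (\<lambda>a. c \<otimes>\<^bsub>L\<^esub> phi L \<beta> a)"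
  define S where "S = (\<lambda>b. phi L (inv\<^bsub>\<pi>\<^esub> \<alpha>) (c \<otimes>\<^bsub>L\<^esub> b))"
  have Tg: "T a \<in> grade L \<alpha>" if "a \<in> grade L \<alpha>" for a
    using grade_mult[OF \<gamma> _ c phi_grade[OF \<alpha> \<beta> that]] \<alpha> \<beta>
    by (simp add: T_def \<pi>.m_assoc) (simp add: \<pi>.m_assoc[symmetric])
  have Sg: "S b \<in> grade L \<beta>" if "b \<in> grade L \<beta>" for b
    using phi_grade[OF _ \<alpha>' grade_mult[OF \<gamma> \<beta> c that]] \<alpha> \<beta>
    by (simp add: S_def \<pi>.m_assoc) (simp add: \<pi>.m_assoc[symmetric])
  have "trace K L (grade L \<alpha>) T = (\<Oplus>\<^bsub>K\<^esub>i\<in>F \<alpha>. eta L (T (l \<alpha> i)) (m \<alpha> i))"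
    by (rule M.trace_eq_dual_family[OF grade_submodule[OF \<alpha>] Ffin dual[OF \<alpha>]])
      (use Tg in \<open>auto simp: T_def ga cc \<alpha> \<beta> phi_closed phi_add phi_smult L.r_distr smult_mult_right\<close>)
  also have "\<dots> = (\<Oplus>\<^bsub>K\<^esub>i\<in>F \<alpha> \<inter> F \<beta>. eta L (T (l \<alpha> i)) (m \<alpha> i))"
  proof (rule K.add.finprod_mono_neutral_cong_right)
    show "eta L (T (l \<alpha> i)) (m \<alpha> i) = \<zero>\<^bsub>K\<^esub>" if "i \<in> F \<alpha> - F \<alpha> \<inter> F \<beta>" for i
    proof -
      have i: "i \<in> F \<alpha>" "i \<in> I" "phi L \<beta> i \<noteq> i" using that by (auto simp: F_def)
      note cs = l(4)[OF i(1) \<alpha>] m(3)[OF i(1) \<alpha>] idem_carrier[OF i(2)]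
        idem_carrier[OF idem_phi[OF i(2) \<beta>]]
      let ?j = "phi L \<beta> i" and ?x = "phi L \<beta> (l \<alpha> i)"
      have xc: "?x \<in> carrier L" using cs phi_closed[OF \<beta>] by simp
      have x: "?x = ?j \<otimes>\<^bsub>L\<^esub> ?x"
        using phi_mult[OF \<beta> cs(3) cs(1)] l(2)[OF i(1) \<alpha>] by simp
      have "i \<otimes>\<^bsub>L\<^esub> T (l \<alpha> i) = c \<otimes>\<^bsub>L\<^esub> (i \<otimes>\<^bsub>L\<^esub> ?x)"
        unfolding T_def using cs cc xc idem_central[OF i(2) cc]
        by (simp add: L.m_assoc[symmetric])
      also have "i \<otimes>\<^bsub>L\<^esub> ?x = (i \<otimes>\<^bsub>L\<^esub> ?j) \<otimes>\<^bsub>L\<^esub> ?x"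
        using x cs xc by (simp add: L.m_assoc)
      also have "\<dots> = \<zero>\<^bsub>L\<^esub>"
        using idem_orth[OF i(2) idem_phi[OF i(2) \<beta>]] i(3) xc by auto
      finally have "i \<otimes>\<^bsub>L\<^esub> T (l \<alpha> i) = \<zero>\<^bsub>L\<^esub>" using cc by simp
      moreover have "eta L (T (l \<alpha> i)) (m \<alpha> i) = eta L (i \<otimes>\<^bsub>L\<^esub> T (l \<alpha> i)) (m \<alpha> i)"
        using idem_eta_move[OF i(2), of "T (l \<alpha> i)" "m \<alpha> i"] m(2)[OF i(1) \<alpha>] cs
          ga[OF Tg[OF l(1)[OF i(1) \<alpha>]]] by simp
      ultimately show ?thesis using eta_zero_left cs by simp
    qed
  qed (use Ffin eta_closed ga Tg l m \<alpha> in auto)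
  also have "\<dots> = (\<Oplus>\<^bsub>K\<^esub>i\<in>F \<alpha> \<inter> F \<beta>. eta L (S (l \<beta> i)) (m \<beta> i))"
  proof (rule K.finsum_cong')
    fix i assume "i \<in> F \<alpha> \<inter> F \<beta>"
    then have ia: "i \<in> F \<alpha>" and ib: "i \<in> F \<beta>" by auto
    note i = FI(1)[OF ia]
    note cs = idem_carrier[OF i] l(4)[OF ia \<alpha>] l(4)[OF ib \<beta>]
    define p where "p = eta L (T (l \<alpha> i)) (m \<alpha> i)"
    define q where "q = eta L (S (l \<beta> i)) (m \<beta> i)"
    have pq: "p \<in> carrier K" "q \<in> carrier K"
      using ga[OF Tg[OF l(1)[OF ia \<alpha>]]] gb[OF Sg[OF l(1)[OF ib \<beta>]]] m(3)[OF ia \<alpha>] m(3)[OF ib \<beta>]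
      by (auto simp: p_def q_def eta_closed)
    have xc: "phi L \<beta> (l \<alpha> i) \<in> carrier L" using cs \<beta> phi_closed by simp
    have xi: "i \<otimes>\<^bsub>L\<^esub> phi L \<beta> (l \<alpha> i) = phi L \<beta> (l \<alpha> i)"
      using phi_mult[OF \<beta> cs(1,2)] l(2)[OF ia \<alpha>] FI(2)[OF ib] by simp
    have "i \<otimes>\<^bsub>L\<^esub> T (l \<alpha> i) = c \<otimes>\<^bsub>L\<^esub> (i \<otimes>\<^bsub>L\<^esub> phi L \<beta> (l \<alpha> i))"
      unfolding T_def using cs cc xc idem_central[OF i cc] by (simp add: L.m_assoc[symmetric])
    then have Tl: "c \<otimes>\<^bsub>L\<^esub> phi L \<beta> (l \<alpha> i) = p \<odot>\<^bsub>L\<^esub> l \<alpha> i"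
      using corner_line[OF i \<alpha> l(1,2)[OF ia \<alpha>] m(1,2)[OF ia \<alpha>] lm(1)[OF ia \<alpha>] Tg[OF l(1)[OF ia \<alpha>]]]
      unfolding xi p_def by (simp add: T_def)
    have ai: "phi L (inv\<^bsub>\<pi>\<^esub> \<alpha>) i = i"
      using phi_inverse(1)[OF \<alpha> cs(1)] FI(2)[OF ia] by simp
    have "i \<otimes>\<^bsub>L\<^esub> S (l \<beta> i) = phi L (inv\<^bsub>\<pi>\<^esub> \<alpha>) (i \<otimes>\<^bsub>L\<^esub> (c \<otimes>\<^bsub>L\<^esub> l \<beta> i))"
      using phi_mult[OF \<alpha>' cs(1), of "c \<otimes>\<^bsub>L\<^esub> l \<beta> i"] cs cc ai by (simp add: S_def)
    also have "i \<otimes>\<^bsub>L\<^esub> (c \<otimes>\<^bsub>L\<^esub> l \<beta> i) = c \<otimes>\<^bsub>L\<^esub> (i \<otimes>\<^bsub>L\<^esub> l \<beta> i)"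
      using cs cc idem_central[OF i cc] by (simp add: L.m_assoc[symmetric])
    finally have "S (l \<beta> i) = q \<odot>\<^bsub>L\<^esub> l \<beta> i"
      using corner_line[OF i \<beta> l(1,2)[OF ib \<beta>] m(1,2)[OF ib \<beta>] lm(1)[OF ib \<beta>] Sg[OF l(1)[OF ib \<beta>]]]
        l(2)[OF ib \<beta>] by (simp add: S_def q_def)
    then have "phi L \<alpha> (S (l \<beta> i)) = q \<odot>\<^bsub>L\<^esub> phi L \<alpha> (l \<beta> i)"
      using pq cs \<alpha> by (simp add: phi_smult)
    then have Sl: "c \<otimes>\<^bsub>L\<^esub> l \<beta> i = q \<odot>\<^bsub>L\<^esub> phi L \<alpha> (l \<beta> i)"
      using phi_inverse(2)[OF \<alpha>, of "c \<otimes>\<^bsub>L\<^esub> l \<beta> i"] cs cc by (simp add: S_def)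
    have "p \<odot>\<^bsub>L\<^esub> (l \<alpha> i \<otimes>\<^bsub>L\<^esub> l \<beta> i) = c \<otimes>\<^bsub>L\<^esub> phi L \<beta> (l \<alpha> i) \<otimes>\<^bsub>L\<^esub> l \<beta> i"
      using Tl pq cs by (simp add: smult_mult_left)
    also have "\<dots> = c \<otimes>\<^bsub>L\<^esub> (l \<beta> i \<otimes>\<^bsub>L\<^esub> l \<alpha> i)"
      using phi_crossed[OF \<beta> cs(2) l(1)[OF ib \<beta>]] cs cc xc by (simp add: L.m_assoc)
    also have "\<dots> = (q \<odot>\<^bsub>L\<^esub> phi L \<alpha> (l \<beta> i)) \<otimes>\<^bsub>L\<^esub> l \<alpha> i"
      using Sl cs cc by (simp add: L.m_assoc[symmetric])
    also have "\<dots> = q \<odot>\<^bsub>L\<^esub> (l \<alpha> i \<otimes>\<^bsub>L\<^esub> l \<beta> i)"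
      using phi_crossed[OF \<alpha> cs(3) l(1)[OF ia \<alpha>]] cs pq \<alpha> phi_closed by (simp add: smult_mult_left)
    finally have eq: "p \<odot>\<^bsub>L\<^esub> (l \<alpha> i \<otimes>\<^bsub>L\<^esub> l \<beta> i) = q \<odot>\<^bsub>L\<^esub> (l \<alpha> i \<otimes>\<^bsub>L\<^esub> l \<beta> i)" .
    have "m \<alpha> i \<otimes>\<^bsub>L\<^esub> (l \<alpha> i \<otimes>\<^bsub>L\<^esub> l \<beta> i) = l \<beta> i"
      using lm(2)[OF ia \<alpha>] l(2)[OF ib \<beta>] cs m(3)[OF ia \<alpha>] by (simp add: L.m_assoc[symmetric])
    then have "l \<alpha> i \<otimes>\<^bsub>L\<^esub> l \<beta> i \<noteq> \<zero>\<^bsub>L\<^esub>"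
      using l(3)[OF ib \<beta>] m(3)[OF ia \<alpha>] by auto
    then have "p = q" using smult_cancel[OF pq _ _ eq] cs by simp
    then show "eta L (T (l \<alpha> i)) (m \<alpha> i) = eta L (S (l \<beta> i)) (m \<beta> i)"
      by (simp add: p_def q_def)
  qed (use eta_closed gb Sg l m \<beta> in auto)
  also have "\<dots> = (\<Oplus>\<^bsub>K\<^esub>i\<in>F \<beta>. eta L (S (l \<beta> i)) (m \<beta> i))"
  proof (rule K.add.finprod_mono_neutral_cong_left)
    show "eta L (S (l \<beta> i)) (m \<beta> i) = \<zero>\<^bsub>K\<^esub>" if "i \<in> F \<beta> - F \<alpha> \<inter> F \<beta>" for i
    proof -
      have i: "i \<in> F \<beta>" "i \<in> I" "phi L \<alpha> i \<noteq> i" using that by (auto simp: F_def)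
      note cs = l(4)[OF i(1) \<beta>] m(3)[OF i(1) \<beta>] idem_carrier[OF i(2)]
        idem_carrier[OF idem_phi[OF i(2) \<alpha>']]
      let ?j = "phi L (inv\<^bsub>\<pi>\<^esub> \<alpha>) i"
      have ji: "?j \<noteq> i" using i(3) phi_inverse(2)[OF \<alpha> cs(3)] by auto
      have "c \<otimes>\<^bsub>L\<^esub> l \<beta> i = i \<otimes>\<^bsub>L\<^esub> (c \<otimes>\<^bsub>L\<^esub> l \<beta> i)"
        using cs cc idem_central[OF i(2) cc] l(2)[OF i(1) \<beta>]
        by (metis L.m_assoc)
      then have S: "S (l \<beta> i) = ?j \<otimes>\<^bsub>L\<^esub> S (l \<beta> i)"
        using phi_mult[OF \<alpha>' cs(3), of "c \<otimes>\<^bsub>L\<^esub> l \<beta> i"] cs cc by (simp add: S_def)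
      note Sc = gb[OF Sg[OF l(1)[OF i(1) \<beta>]]]
      have "i \<otimes>\<^bsub>L\<^esub> S (l \<beta> i) = (i \<otimes>\<^bsub>L\<^esub> ?j) \<otimes>\<^bsub>L\<^esub> S (l \<beta> i)"
        using S cs Sc by (simp add: L.m_assoc)
      also have "\<dots> = \<zero>\<^bsub>L\<^esub>"
        using idem_orth[OF i(2) idem_phi[OF i(2) \<alpha>']] ji Sc by auto
      finally have "i \<otimes>\<^bsub>L\<^esub> S (l \<beta> i) = \<zero>\<^bsub>L\<^esub>" .
      moreover have "eta L (S (l \<beta> i)) (m \<beta> i) = eta L (i \<otimes>\<^bsub>L\<^esub> S (l \<beta> i)) (m \<beta> i)"
        using idem_eta_move[OF i(2) Sc cs(2)] m(2)[OF i(1) \<beta>] by simp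
      ultimately show ?thesis using eta_zero_left cs by simp
    qed
  qed (use Ffin eta_closed gb Sg l m \<beta> in auto)
  also have "\<dots> = trace K L (grade L \<beta>) S"
    by (rule M.trace_eq_dual_family[OF grade_submodule[OF \<beta>] Ffin dual[OF \<beta>], symmetric])
      (use Sg in \<open>auto simp: S_def gb cc \<alpha>' \<beta> phi_closed phi_add phi_smult L.r_distr smult_mult_right\<close>)
  finally show "trace K L (grade L \<alpha>) (\<lambda>a. c \<otimes>\<^bsub>L\<^esub> phi L \<beta> a) =
      trace K L (grade L \<beta>) (\<lambda>b. phi L (inv\<^bsub>\<pi>\<^esub> \<alpha>) (c \<otimes>\<^bsub>L\<^esub> b))"
    unfolding T_def S_def .
qed

end

section \<open>Cohomologous cocycles\<close>

text \<open>
  The relation \<open>\<theta>'(\<alpha>, \<beta>) = \<mu>(\<alpha>)\<mu>(\<beta>)\<mu>(\<alpha>\<beta>)\<^sup>-\<^sup>1\<theta>(\<alpha>, \<beta>)\<close>, cleared of inverses.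
\<close>

definition cohomologous ::
  "('g, 'm) monoid_scheme \<Rightarrow> ('k, 'n) ring_scheme \<Rightarrow> ('g \<times> 'g \<Rightarrow> 'k) \<Rightarrow> ('g \<times> 'g \<Rightarrow> 'k) \<Rightarrow> bool" where
  "cohomologous G K \<theta> \<theta>' \<longleftrightarrow> (\<exists>\<mu>\<in>carrier G \<rightarrow> Units K. \<forall>\<alpha>\<in>carrier G. \<forall>\<beta>\<in>carrier G.
     \<theta>' (\<alpha>, \<beta>) \<otimes>\<^bsub>K\<^esub> \<mu> (\<alpha> \<otimes>\<^bsub>G\<^esub> \<beta>) = \<mu> \<alpha> \<otimes>\<^bsub>K\<^esub> \<mu> \<beta> \<otimes>\<^bsub>K\<^esub> \<theta> (\<alpha>, \<beta>))"

definition cohomology_class ::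
  "('g, 'm) monoid_scheme \<Rightarrow> ('k, 'n) ring_scheme \<Rightarrow> ('g \<times> 'g \<Rightarrow> 'k) \<Rightarrow> ('g \<times> 'g \<Rightarrow> 'k) set" where
  "cohomology_class G K \<theta> =
     {\<theta>' \<in> carrier G \<times> carrier G \<rightarrow>\<^sub>E Units K. cohomologous G K \<theta> \<theta>'}"

locale cocycle_group = G: group G + K: field K
  for G :: "('g, 'm) monoid_scheme" and K :: "('k, 'n) ring_scheme"
begin

lemma cohomologous_sym:
  assumes \<theta>: "\<theta> \<in> carrier G \<times> carrier G \<rightarrow> Units K" and \<theta>': "\<theta>' \<in> carrier G \<times> carrier G \<rightarrow> Units K"
    and "cohomologous G K \<theta> \<theta>'"
  shows "cohomologous G K \<theta>' \<theta>"
proof -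
  obtain \<mu> where \<mu>: "\<mu> \<in> carrier G \<rightarrow> Units K" and eq: "\<And>\<alpha> \<beta>. \<alpha> \<in> carrier G \<Longrightarrow> \<beta> \<in> carrier G \<Longrightarrow>
      \<theta>' (\<alpha>, \<beta>) \<otimes>\<^bsub>K\<^esub> \<mu> (\<alpha> \<otimes>\<^bsub>G\<^esub> \<beta>) = \<mu> \<alpha> \<otimes>\<^bsub>K\<^esub> \<mu> \<beta> \<otimes>\<^bsub>K\<^esub> \<theta> (\<alpha>, \<beta>)"
    using assms(3) unfolding cohomologous_def by blast
  have "\<theta> (\<alpha>, \<beta>) \<otimes>\<^bsub>K\<^esub> inv\<^bsub>K\<^esub> \<mu> (\<alpha> \<otimes>\<^bsub>G\<^esub> \<beta>) = inv\<^bsub>K\<^esub> \<mu> \<alpha> \<otimes>\<^bsub>K\<^esub> inv\<^bsub>K\<^esub> \<mu> \<beta> \<otimes>\<^bsub>K\<^esub> \<theta>' (\<alpha>, \<beta>)"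
    if \<alpha>: "\<alpha> \<in> carrier G" and \<beta>: "\<beta> \<in> carrier G" for \<alpha> \<beta>
  proof -
    let ?a = "\<mu> \<alpha>" and ?b = "\<mu> \<beta>" and ?c = "\<mu> (\<alpha> \<otimes>\<^bsub>G\<^esub> \<beta>)"
    have u: "?a \<in> Units K" "?b \<in> Units K" "?c \<in> Units K" using \<mu> \<alpha> \<beta> by auto
    have t: "\<theta> (\<alpha>, \<beta>) \<in> carrier K" "\<theta>' (\<alpha>, \<beta>) \<in> carrier K"
      using funcset_mem[OF \<theta>, of "(\<alpha>, \<beta>)"] funcset_mem[OF \<theta>', of "(\<alpha>, \<beta>)"] \<alpha> \<beta> K.Units_closed by auto
    note cl = u[THEN K.Units_closed] u[THEN K.Units_inv_closed] t
    have "\<theta> (\<alpha>, \<beta>) \<otimes>\<^bsub>K\<^esub> inv\<^bsub>K\<^esub> ?c =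
        (inv\<^bsub>K\<^esub> ?a \<otimes>\<^bsub>K\<^esub> ?a) \<otimes>\<^bsub>K\<^esub> (inv\<^bsub>K\<^esub> ?b \<otimes>\<^bsub>K\<^esub> ?b) \<otimes>\<^bsub>K\<^esub> \<theta> (\<alpha>, \<beta>) \<otimes>\<^bsub>K\<^esub> inv\<^bsub>K\<^esub> ?c"
      using cl u[THEN K.Units_l_inv] by simp
    also have "\<dots> = inv\<^bsub>K\<^esub> ?a \<otimes>\<^bsub>K\<^esub> inv\<^bsub>K\<^esub> ?b \<otimes>\<^bsub>K\<^esub> (?a \<otimes>\<^bsub>K\<^esub> ?b \<otimes>\<^bsub>K\<^esub> \<theta> (\<alpha>, \<beta>)) \<otimes>\<^bsub>K\<^esub> inv\<^bsub>K\<^esub> ?c"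
      using cl by (simp add: K.m_ac)
    also have "?a \<otimes>\<^bsub>K\<^esub> ?b \<otimes>\<^bsub>K\<^esub> \<theta> (\<alpha>, \<beta>) = \<theta>' (\<alpha>, \<beta>) \<otimes>\<^bsub>K\<^esub> ?c"
      using eq[OF \<alpha> \<beta>] by simp
    also have "inv\<^bsub>K\<^esub> ?a \<otimes>\<^bsub>K\<^esub> inv\<^bsub>K\<^esub> ?b \<otimes>\<^bsub>K\<^esub> (\<theta>' (\<alpha>, \<beta>) \<otimes>\<^bsub>K\<^esub> ?c) \<otimes>\<^bsub>K\<^esub> inv\<^bsub>K\<^esub> ?c =
        inv\<^bsub>K\<^esub> ?a \<otimes>\<^bsub>K\<^esub> inv\<^bsub>K\<^esub> ?b \<otimes>\<^bsub>K\<^esub> \<theta>' (\<alpha>, \<beta>) \<otimes>\<^bsub>K\<^esub> (?c \<otimes>\<^bsub>K\<^esub> inv\<^bsub>K\<^esub> ?c)"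
      using cl by (simp add: K.m_assoc)
    finally show ?thesis using cl u(3)[THEN K.Units_r_inv] by simp
  qed
  then show ?thesis
    unfolding cohomologous_def using \<mu> by (intro bexI[of _ "\<lambda>\<alpha>. inv\<^bsub>K\<^esub> \<mu> \<alpha>"]) auto
qed

lemma cohomologous_trans:
  assumes \<theta>: "\<theta> \<in> carrier G \<times> carrier G \<rightarrow> Units K" "\<theta>' \<in> carrier G \<times> carrier G \<rightarrow> Units K"
      "\<theta>'' \<in> carrier G \<times> carrier G \<rightarrow> Units K"
    and "cohomologous G K \<theta> \<theta>'" "cohomologous G K \<theta>' \<theta>''"
  shows "cohomologous G K \<theta> \<theta>''"
proof -
  obtain \<mu> where \<mu>: "\<mu> \<in> carrier G \<rightarrow> Units K" and eq: "\<And>\<alpha> \<beta>. \<alpha> \<in> carrier G \<Longrightarrow> \<beta> \<in> carrier G \<Longrightarrow>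
      \<theta>' (\<alpha>, \<beta>) \<otimes>\<^bsub>K\<^esub> \<mu> (\<alpha> \<otimes>\<^bsub>G\<^esub> \<beta>) = \<mu> \<alpha> \<otimes>\<^bsub>K\<^esub> \<mu> \<beta> \<otimes>\<^bsub>K\<^esub> \<theta> (\<alpha>, \<beta>)"
    using assms(4) unfolding cohomologous_def by blast
  obtain \<nu> where \<nu>: "\<nu> \<in> carrier G \<rightarrow> Units K" and eq': "\<And>\<alpha> \<beta>. \<alpha> \<in> carrier G \<Longrightarrow> \<beta> \<in> carrier G \<Longrightarrow>
      \<theta>'' (\<alpha>, \<beta>) \<otimes>\<^bsub>K\<^esub> \<nu> (\<alpha> \<otimes>\<^bsub>G\<^esub> \<beta>) = \<nu> \<alpha> \<otimes>\<^bsub>K\<^esub> \<nu> \<beta> \<otimes>\<^bsub>K\<^esub> \<theta>' (\<alpha>, \<beta>)"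
    using assms(5) unfolding cohomologous_def by blast
  have "\<theta>'' (\<alpha>, \<beta>) \<otimes>\<^bsub>K\<^esub> (\<nu> (\<alpha> \<otimes>\<^bsub>G\<^esub> \<beta>) \<otimes>\<^bsub>K\<^esub> \<mu> (\<alpha> \<otimes>\<^bsub>G\<^esub> \<beta>)) =
      (\<nu> \<alpha> \<otimes>\<^bsub>K\<^esub> \<mu> \<alpha>) \<otimes>\<^bsub>K\<^esub> (\<nu> \<beta> \<otimes>\<^bsub>K\<^esub> \<mu> \<beta>) \<otimes>\<^bsub>K\<^esub> \<theta> (\<alpha>, \<beta>)"
    if \<alpha>: "\<alpha> \<in> carrier G" and \<beta>: "\<beta> \<in> carrier G" for \<alpha> \<beta>
  proof -
    have cl: "\<mu> \<alpha> \<in> carrier K" "\<mu> \<beta> \<in> carrier K" "\<mu> (\<alpha> \<otimes>\<^bsub>G\<^esub> \<beta>) \<in> carrier K"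
       "\<nu> \<alpha> \<in> carrier K" "\<nu> \<beta> \<in> carrier K" "\<nu> (\<alpha> \<otimes>\<^bsub>G\<^esub> \<beta>) \<in> carrier K"
      using \<mu> \<nu> \<alpha> \<beta> K.Units_closed by (auto simp: Pi_def)
    have t: "\<theta> (\<alpha>, \<beta>) \<in> carrier K" "\<theta>' (\<alpha>, \<beta>) \<in> carrier K" "\<theta>'' (\<alpha>, \<beta>) \<in> carrier K"
      using \<theta>[THEN funcset_mem, of "(\<alpha>, \<beta>)"] \<alpha> \<beta> K.Units_closed by auto
    have "\<theta>'' (\<alpha>, \<beta>) \<otimes>\<^bsub>K\<^esub> (\<nu> (\<alpha> \<otimes>\<^bsub>G\<^esub> \<beta>) \<otimes>\<^bsub>K\<^esub> \<mu> (\<alpha> \<otimes>\<^bsub>G\<^esub> \<beta>)) =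
        (\<theta>'' (\<alpha>, \<beta>) \<otimes>\<^bsub>K\<^esub> \<nu> (\<alpha> \<otimes>\<^bsub>G\<^esub> \<beta>)) \<otimes>\<^bsub>K\<^esub> \<mu> (\<alpha> \<otimes>\<^bsub>G\<^esub> \<beta>)"
      using cl t by (simp add: K.m_assoc)
    also have "\<dots> = \<nu> \<alpha> \<otimes>\<^bsub>K\<^esub> \<nu> \<beta> \<otimes>\<^bsub>K\<^esub> (\<theta>' (\<alpha>, \<beta>) \<otimes>\<^bsub>K\<^esub> \<mu> (\<alpha> \<otimes>\<^bsub>G\<^esub> \<beta>))"
      unfolding eq'[OF \<alpha> \<beta>] using cl t by (simp add: K.m_assoc)
    also have "\<dots> = (\<nu> \<alpha> \<otimes>\<^bsub>K\<^esub> \<mu> \<alpha>) \<otimes>\<^bsub>K\<^esub> (\<nu> \<beta> \<otimes>\<^bsub>K\<^esub> \<mu> \<beta>) \<otimes>\<^bsub>K\<^esub> \<theta> (\<alpha>, \<beta>)"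
      unfolding eq[OF \<alpha> \<beta>] using cl t by (simp add: K.m_ac)
    finally show ?thesis .
  qed
  then show ?thesis
    unfolding cohomologous_def using \<mu> \<nu> by (intro bexI[of _ "\<lambda>\<alpha>. \<nu> \<alpha> \<otimes>\<^bsub>K\<^esub> \<mu> \<alpha>"]) auto
qed

lemma cohomology_class_eq:
  assumes "\<theta> \<in> carrier G \<times> carrier G \<rightarrow> Units K" "\<theta>' \<in> cohomology_class G K \<theta>"
  shows "cohomology_class G K \<theta>' = cohomology_class G K \<theta>"
proof -
  have \<theta>': "\<theta>' \<in> carrier G \<times> carrier G \<rightarrow> Units K" "cohomologous G K \<theta> \<theta>'" "cohomologous G K \<theta>' \<theta>"
    using assms cohomologous_sym by (auto simp: cohomology_class_def PiE_def)
  have "cohomologous G K \<theta>' \<chi> \<longleftrightarrow> cohomologous G K \<theta> \<chi>"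
    if "\<chi> \<in> carrier G \<times> carrier G \<rightarrow> Units K" for \<chi>
    using cohomologous_trans[OF assms(1) \<theta>'(1) that \<theta>'(2)]
      cohomologous_trans[OF \<theta>'(1) assms(1) that \<theta>'(3)] by blast
  then show ?thesis
    unfolding cohomology_class_def PiE_def by blast
qed

lemma coset_eq_cohomology_class:
  assumes \<theta>: "\<theta> \<in> carrier (Z2 G K)"
  shows "B2 G K #>\<^bsub>Z2 G K\<^esub> \<theta> = cohomology_class G K \<theta>"
proof (intro equalityI subsetI)
  let ?P = "carrier G \<times> carrier G"
  have \<theta>E: "\<theta> \<in> ?P \<rightarrow>\<^sub>E Units K" using \<theta> by (simp add: Z2_def)
  have t: "\<theta> (\<alpha>, \<beta>) \<in> Units K" if "\<alpha> \<in> carrier G" "\<beta> \<in> carrier G" for \<alpha> \<beta>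
    using \<theta>E that by (auto simp: PiE_def Pi_def)
  {
    fix \<theta>' assume "\<theta>' \<in> B2 G K #>\<^bsub>Z2 G K\<^esub> \<theta>"
    then obtain \<mu> where \<mu>: "\<mu> \<in> carrier G \<rightarrow> Units K" and \<theta>': "\<theta>' = (\<lambda>p\<in>?P.
        (\<lambda>(\<alpha>, \<beta>)\<in>?P. \<mu> \<alpha> \<otimes>\<^bsub>K\<^esub> \<mu> \<beta> \<otimes>\<^bsub>K\<^esub> inv\<^bsub>K\<^esub> \<mu> (\<alpha> \<otimes>\<^bsub>G\<^esub> \<beta>)) p \<otimes>\<^bsub>K\<^esub> \<theta> p)"
      by (auto simp: r_coset_def B2_def Z2_def)
    have \<mu>u: "\<mu> \<alpha> \<in> Units K" if "\<alpha> \<in> carrier G" for \<alpha> using \<mu> that by auto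
    have "\<theta>' \<in> ?P \<rightarrow>\<^sub>E Units K"
      unfolding \<theta>' using \<mu>u t by (auto intro!: K.Units_m_closed)
    moreover have "\<theta>' (\<alpha>, \<beta>) \<otimes>\<^bsub>K\<^esub> \<mu> (\<alpha> \<otimes>\<^bsub>G\<^esub> \<beta>) = \<mu> \<alpha> \<otimes>\<^bsub>K\<^esub> \<mu> \<beta> \<otimes>\<^bsub>K\<^esub> \<theta> (\<alpha>, \<beta>)"
      if \<alpha>: "\<alpha> \<in> carrier G" and \<beta>: "\<beta> \<in> carrier G" for \<alpha> \<beta>
    proof -
      have u: "\<mu> (\<alpha> \<otimes>\<^bsub>G\<^esub> \<beta>) \<in> Units K" using \<mu>u \<alpha> \<beta> by auto
      have cl: "\<mu> \<alpha> \<in> carrier K" "\<mu> \<beta> \<in> carrier K" "\<mu> (\<alpha> \<otimes>\<^bsub>G\<^esub> \<beta>) \<in> carrier K" 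
        "inv\<^bsub>K\<^esub> \<mu> (\<alpha> \<otimes>\<^bsub>G\<^esub> \<beta>) \<in> carrier K" "\<theta> (\<alpha>, \<beta>) \<in> carrier K"
        using K.Units_closed[OF u] \<mu>u t \<alpha> \<beta> u by auto
      have "\<theta>' (\<alpha>, \<beta>) \<otimes>\<^bsub>K\<^esub> \<mu> (\<alpha> \<otimes>\<^bsub>G\<^esub> \<beta>) =
          \<mu> \<alpha> \<otimes>\<^bsub>K\<^esub> \<mu> \<beta> \<otimes>\<^bsub>K\<^esub> \<theta> (\<alpha>, \<beta>) \<otimes>\<^bsub>K\<^esub> (inv\<^bsub>K\<^esub> \<mu> (\<alpha> \<otimes>\<^bsub>G\<^esub> \<beta>) \<otimes>\<^bsub>K\<^esub> \<mu> (\<alpha> \<otimes>\<^bsub>G\<^esub> \<beta>))"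
        unfolding \<theta>' using \<alpha> \<beta> cl by (simp add: K.m_ac)
      then show ?thesis using u cl by simp
    qed
    ultimately show "\<theta>' \<in> cohomology_class G K \<theta>"
      unfolding cohomology_class_def cohomologous_def using \<mu> by blast
  }
  {
    fix \<theta>' assume "\<theta>' \<in> cohomology_class G K \<theta>"
    then obtain \<mu> where \<theta>': "\<theta>' \<in> ?P \<rightarrow>\<^sub>E Units K" and \<mu>: "\<mu> \<in> carrier G \<rightarrow> Units K"
      and eq: "\<And>\<alpha> \<beta>. \<alpha> \<in> carrier G \<Longrightarrow> \<beta> \<in> carrier G \<Longrightarrow>
        \<theta>' (\<alpha>, \<beta>) \<otimes>\<^bsub>K\<^esub> \<mu> (\<alpha> \<otimes>\<^bsub>G\<^esub> \<beta>) = \<mu> \<alpha> \<otimes>\<^bsub>K\<^esub> \<mu> \<beta> \<otimes>\<^bsub>K\<^esub> \<theta> (\<alpha>, \<beta>)"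
      unfolding cohomology_class_def cohomologous_def by blast
    have \<mu>u: "\<mu> \<alpha> \<in> Units K" if "\<alpha> \<in> carrier G" for \<alpha> using \<mu> that by auto
    define b where "b = (\<lambda>(\<alpha>, \<beta>)\<in>?P. \<mu> \<alpha> \<otimes>\<^bsub>K\<^esub> \<mu> \<beta> \<otimes>\<^bsub>K\<^esub> inv\<^bsub>K\<^esub> \<mu> (\<alpha> \<otimes>\<^bsub>G\<^esub> \<beta>))"
    have "\<theta>' = (\<lambda>p\<in>?P. b p \<otimes>\<^bsub>K\<^esub> \<theta> p)"
    proof (rule extensionalityI[where A = ?P])
      fix p assume p: "p \<in> ?P"
      then obtain \<alpha> \<beta> where ab: "p = (\<alpha>, \<beta>)" "\<alpha> \<in> carrier G" "\<beta> \<in> carrier G" by auto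
      have u: "\<mu> (\<alpha> \<otimes>\<^bsub>G\<^esub> \<beta>) \<in> Units K" using \<mu>u ab by auto
      have t': "\<theta>' (\<alpha>, \<beta>) \<in> carrier K"
        using \<theta>' ab K.Units_closed by (auto simp: PiE_def Pi_def)
      have cl: "\<mu> \<alpha> \<in> carrier K" "\<mu> \<beta> \<in> carrier K" "\<mu> (\<alpha> \<otimes>\<^bsub>G\<^esub> \<beta>) \<in> carrier K" 
        "inv\<^bsub>K\<^esub> \<mu> (\<alpha> \<otimes>\<^bsub>G\<^esub> \<beta>) \<in> carrier K" "\<theta> (\<alpha>, \<beta>) \<in> carrier K"
        using K.Units_closed[OF u] \<mu>u t ab u by auto
      have "b p \<otimes>\<^bsub>K\<^esub> \<theta> p = (\<mu> \<alpha> \<otimes>\<^bsub>K\<^esub> \<mu> \<beta> \<otimes>\<^bsub>K\<^esub> \<theta> (\<alpha>, \<beta>)) \<otimes>\<^bsub>K\<^esub> inv\<^bsub>K\<^esub> \<mu> (\<alpha> \<otimes>\<^bsub>G\<^esub> \<beta>)"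
        using ab cl by (simp add: b_def K.m_ac)
      also have "\<dots> = \<theta>' (\<alpha>, \<beta>) \<otimes>\<^bsub>K\<^esub> (\<mu> (\<alpha> \<otimes>\<^bsub>G\<^esub> \<beta>) \<otimes>\<^bsub>K\<^esub> inv\<^bsub>K\<^esub> \<mu> (\<alpha> \<otimes>\<^bsub>G\<^esub> \<beta>))"
        unfolding eq[OF ab(2,3), symmetric] using cl t' by (simp add: K.m_assoc)
      finally show "\<theta>' p = (\<lambda>p\<in>?P. b p \<otimes>\<^bsub>K\<^esub> \<theta> p) p"
        using u t' p ab(1) by simp
    qed (use \<theta>' in \<open>auto simp: PiE_def\<close>)
    moreover have "b \<in> B2 G K" using \<mu> by (auto simp: B2_def b_def)
    ultimately show "\<theta>' \<in> B2 G K #>\<^bsub>Z2 G K\<^esub> \<theta>"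
      unfolding r_coset_def by (auto simp: Z2_def intro!: bexI[of _ b])
  }
qed

lemma H2_iff:
  "\<Theta> \<in> carrier (H2 G K) \<longleftrightarrow> (\<exists>\<theta>\<in>carrier (Z2 G K). \<Theta> = cohomology_class G K \<theta>)"
  unfolding H2_def FactGroup_def RCOSETS_def using coset_eq_cohomology_class by auto

lemma cohomology_class_cocycle:
  assumes \<theta>: "\<theta> \<in> carrier (Z2 G K)" and \<theta>': "\<theta>' \<in> cohomology_class G K \<theta>"
  shows "\<theta>' \<in> carrier (Z2 G K)"
proof -
  obtain \<mu> where \<theta>'E: "\<theta>' \<in> carrier G \<times> carrier G \<rightarrow>\<^sub>E Units K" and \<mu>: "\<mu> \<in> carrier G \<rightarrow> Units K"
    and eq: "\<And>\<alpha> \<beta>. \<alpha> \<in> carrier G \<Longrightarrow> \<beta> \<in> carrier G \<Longrightarrow>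
        \<theta>' (\<alpha>, \<beta>) \<otimes>\<^bsub>K\<^esub> \<mu> (\<alpha> \<otimes>\<^bsub>G\<^esub> \<beta>) = \<mu> \<alpha> \<otimes>\<^bsub>K\<^esub> \<mu> \<beta> \<otimes>\<^bsub>K\<^esub> \<theta> (\<alpha>, \<beta>)"
    using \<theta>' unfolding cohomology_class_def cohomologous_def by blast
  have \<mu>u: "\<mu> \<alpha> \<in> Units K" "\<mu> \<alpha> \<in> carrier K" if "\<alpha> \<in> carrier G" for \<alpha> using \<mu> that by auto
  have t: "\<theta> (\<alpha>, \<beta>) \<in> carrier K" "\<theta>' (\<alpha>, \<beta>) \<in> carrier K" if "\<alpha> \<in> carrier G" "\<beta> \<in> carrier G" for \<alpha> \<beta>
    using \<theta> \<theta>'E that K.Units_closed by (auto simp: PiE_def Pi_def Z2_def)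
  have "\<theta>' (\<alpha>, \<beta>) \<otimes>\<^bsub>K\<^esub> \<theta>' (\<alpha> \<otimes>\<^bsub>G\<^esub> \<beta>, \<gamma>) = \<theta>' (\<alpha>, \<beta> \<otimes>\<^bsub>G\<^esub> \<gamma>) \<otimes>\<^bsub>K\<^esub> \<theta>' (\<beta>, \<gamma>)"
    if a: "\<alpha> \<in> carrier G" and b: "\<beta> \<in> carrier G" and c: "\<gamma> \<in> carrier G" for \<alpha> \<beta> \<gamma>
  proof -
    let ?abc = "\<alpha> \<otimes>\<^bsub>G\<^esub> \<beta> \<otimes>\<^bsub>G\<^esub> \<gamma>"
    have ab: "\<alpha> \<otimes>\<^bsub>G\<^esub> \<beta> \<in> carrier G" and bc: "\<beta> \<otimes>\<^bsub>G\<^esub> \<gamma> \<in> carrier G" and abc: "?abc \<in> carrier G"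
      using a b c by auto
    have as: "\<alpha> \<otimes>\<^bsub>G\<^esub> (\<beta> \<otimes>\<^bsub>G\<^esub> \<gamma>) = ?abc" using a b c by (simp add: G.m_assoc)
    note cl = \<mu>u(2)[OF a] \<mu>u(2)[OF b] \<mu>u(2)[OF c] \<mu>u(2)[OF ab] \<mu>u(2)[OF bc] \<mu>u(2)[OF abc]
      t[OF a b] t[OF ab c] t[OF a bc] t[OF b c]
    have z: "\<theta> (\<alpha>, \<beta>) \<otimes>\<^bsub>K\<^esub> \<theta> (\<alpha> \<otimes>\<^bsub>G\<^esub> \<beta>, \<gamma>) = \<theta> (\<alpha>, \<beta> \<otimes>\<^bsub>G\<^esub> \<gamma>) \<otimes>\<^bsub>K\<^esub> \<theta> (\<beta>, \<gamma>)"
      using \<theta> a b c by (simp add: Z2_def)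
    have "(\<theta>' (\<alpha>, \<beta>) \<otimes>\<^bsub>K\<^esub> \<theta>' (\<alpha> \<otimes>\<^bsub>G\<^esub> \<beta>, \<gamma>)) \<otimes>\<^bsub>K\<^esub> \<mu> ?abc =
        \<theta>' (\<alpha>, \<beta>) \<otimes>\<^bsub>K\<^esub> (\<theta>' (\<alpha> \<otimes>\<^bsub>G\<^esub> \<beta>, \<gamma>) \<otimes>\<^bsub>K\<^esub> \<mu> ?abc)"
      using cl by (simp add: K.m_assoc)
    also have "\<dots> = (\<theta>' (\<alpha>, \<beta>) \<otimes>\<^bsub>K\<^esub> \<mu> (\<alpha> \<otimes>\<^bsub>G\<^esub> \<beta>)) \<otimes>\<^bsub>K\<^esub> \<mu> \<gamma> \<otimes>\<^bsub>K\<^esub> \<theta> (\<alpha> \<otimes>\<^bsub>G\<^esub> \<beta>, \<gamma>)"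
      unfolding eq[OF ab c] using cl by (simp add: K.m_assoc)
    also have "\<dots> = \<mu> \<alpha> \<otimes>\<^bsub>K\<^esub> \<mu> \<beta> \<otimes>\<^bsub>K\<^esub> \<mu> \<gamma> \<otimes>\<^bsub>K\<^esub> (\<theta> (\<alpha>, \<beta>) \<otimes>\<^bsub>K\<^esub> \<theta> (\<alpha> \<otimes>\<^bsub>G\<^esub> \<beta>, \<gamma>))"
      unfolding eq[OF a b] using cl by (simp add: K.m_ac)
    also have "\<dots> = \<mu> \<alpha> \<otimes>\<^bsub>K\<^esub> (\<mu> \<beta> \<otimes>\<^bsub>K\<^esub> \<mu> \<gamma> \<otimes>\<^bsub>K\<^esub> \<theta> (\<beta>, \<gamma>)) \<otimes>\<^bsub>K\<^esub> \<theta> (\<alpha>, \<beta> \<otimes>\<^bsub>G\<^esub> \<gamma>)"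
      unfolding z using cl by (simp add: K.m_ac)
    also have "\<dots> = (\<mu> \<alpha> \<otimes>\<^bsub>K\<^esub> \<mu> (\<beta> \<otimes>\<^bsub>G\<^esub> \<gamma>) \<otimes>\<^bsub>K\<^esub> \<theta> (\<alpha>, \<beta> \<otimes>\<^bsub>G\<^esub> \<gamma>)) \<otimes>\<^bsub>K\<^esub> \<theta>' (\<beta>, \<gamma>)"
      unfolding eq[OF b c, symmetric] using cl by (simp add: K.m_ac)
    also have "\<dots> = (\<theta>' (\<alpha>, \<beta> \<otimes>\<^bsub>G\<^esub> \<gamma>) \<otimes>\<^bsub>K\<^esub> \<theta>' (\<beta>, \<gamma>)) \<otimes>\<^bsub>K\<^esub> \<mu> ?abc"
      unfolding eq[OF a bc, symmetric] as using cl by (simp add: K.m_ac)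
    finally show ?thesis
      using \<mu>u(1)[OF abc] cl K.m_rcancel[of "\<mu> ?abc"] K.field_Units by auto
  qed
  then show ?thesis using \<theta>'E by (simp add: Z2_def)
qed

lemma H2_class:
  assumes "\<Theta> \<in> carrier (H2 G K)" "\<theta> \<in> \<Theta>"
  shows "\<theta> \<in> carrier (Z2 G K)" and "\<Theta> = cohomology_class G K \<theta>"
proof -
  obtain \<theta>0 where 0: "\<theta>0 \<in> carrier (Z2 G K)" "\<Theta> = cohomology_class G K \<theta>0"
    using assms(1) H2_iff by blast
  show "\<theta> \<in> carrier (Z2 G K)" using cohomology_class_cocycle 0 assms(2) by blast
  have "\<theta>0 \<in> carrier G \<times> carrier G \<rightarrow> Units K" using 0 by (auto simp: Z2_def PiE_def)
  then show "\<Theta> = cohomology_class G K \<theta>" using cohomology_class_eq 0 assms(2) by metis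
qed

text \<open>Rescaling by the constant \<open>\<theta>(1,1)\<^sup>-\<^sup>1\<close> normalizes a cocycle.\<close>

lemma H2_normalized:
  assumes "\<Theta> \<in> carrier (H2 G K)"
  obtains \<theta> where "\<theta> \<in> \<Theta>" "\<theta> (\<one>\<^bsub>G\<^esub>, \<one>\<^bsub>G\<^esub>) = \<one>\<^bsub>K\<^esub>"
proof -
  obtain \<theta> where \<theta>: "\<theta> \<in> carrier (Z2 G K)" "\<Theta> = cohomology_class G K \<theta>"
    using assms H2_iff by blast
  have t: "\<theta> (\<alpha>, \<beta>) \<in> Units K" if "\<alpha> \<in> carrier G" "\<beta> \<in> carrier G" for \<alpha> \<beta>
    using \<theta>(1) that by (auto simp: PiE_def Pi_def Z2_def)
  define u where "u = inv\<^bsub>K\<^esub> \<theta> (\<one>\<^bsub>G\<^esub>, \<one>\<^bsub>G\<^esub>)"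
  have u: "u \<in> Units K" "u \<in> carrier K" using t[of "\<one>\<^bsub>G\<^esub>" "\<one>\<^bsub>G\<^esub>"] by (auto simp: u_def)
  define \<theta>' where "\<theta>' = (\<lambda>p\<in>carrier G \<times> carrier G. u \<otimes>\<^bsub>K\<^esub> \<theta> p)"
  have "\<theta>' (\<alpha>, \<beta>) \<otimes>\<^bsub>K\<^esub> u = u \<otimes>\<^bsub>K\<^esub> u \<otimes>\<^bsub>K\<^esub> \<theta> (\<alpha>, \<beta>)" if "\<alpha> \<in> carrier G" "\<beta> \<in> carrier G" for \<alpha> \<beta>
    using t[OF that] that u K.Units_closed by (auto simp: \<theta>'_def K.m_ac)
  then have "cohomologous G K \<theta> \<theta>'"
    unfolding cohomologous_def using u by (intro bexI[of _ "\<lambda>_. u"]) auto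
  moreover have "\<theta>' \<in> carrier G \<times> carrier G \<rightarrow>\<^sub>E Units K" using u t by (auto simp: \<theta>'_def)
  moreover have "\<theta>' (\<one>\<^bsub>G\<^esub>, \<one>\<^bsub>G\<^esub>) = \<one>\<^bsub>K\<^esub>" using t[of "\<one>\<^bsub>G\<^esub>" "\<one>\<^bsub>G\<^esub>"] by (simp add: \<theta>'_def u_def)
  ultimately show ?thesis using that \<theta>(2) by (auto simp: cohomology_class_def)
qed

end

section \<open>The invariant of a pointed simple algebra\<close>

definition idem_stabilizer ::
  "('g, 'm) monoid_scheme \<Rightarrow> ('g, 'k, 'a) crossed_alg \<Rightarrow> 'a \<Rightarrow> 'g set" where
  "idem_stabilizer \<pi> L i = {\<alpha>\<in>carrier \<pi>. phi L \<alpha> i = i}"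

text \<open>
  For \<open>\<alpha>\<close> in the stabilizer of \<open>i\<close> the component \<open>iL\<^sub>\<alpha>\<close> is a line. A frame is a choice of basis
  vectors of these lines, and its cocycle consists of the structure constants of the algebra \<open>iL\<close>.
\<close>

definition corner_frame ::
  "('g, 'm) monoid_scheme \<Rightarrow> ('g, 'k, 'a) crossed_alg \<Rightarrow> 'a \<Rightarrow> ('g \<Rightarrow> 'a) \<Rightarrow> bool" where
  "corner_frame \<pi> L i l \<longleftrightarrow>
     (\<forall>\<alpha>\<in>idem_stabilizer \<pi> L i. l \<alpha> \<in> grade L \<alpha> \<and> i \<otimes>\<^bsub>L\<^esub> l \<alpha> = l \<alpha> \<and> l \<alpha> \<noteq> \<zero>\<^bsub>L\<^esub>)"

definition frame_cocycle ::
  "('g, 'm) monoid_scheme \<Rightarrow> ('g, 'k, 'a) crossed_alg \<Rightarrow> 'a \<Rightarrow> ('g \<Rightarrow> 'a) \<Rightarrow> ('g \<times> 'g \<Rightarrow> 'k) \<Rightarrow> bool" where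
  "frame_cocycle \<pi> L i l \<theta> \<longleftrightarrow>
     (\<forall>\<alpha>\<in>idem_stabilizer \<pi> L i. \<forall>\<beta>\<in>idem_stabilizer \<pi> L i.
        l \<alpha> \<otimes>\<^bsub>L\<^esub> l \<beta> = \<theta> (\<alpha>, \<beta>) \<odot>\<^bsub>L\<^esub> l (\<alpha> \<otimes>\<^bsub>\<pi>\<^esub> \<beta>))"

text \<open>
  All cocycles of all frames of the corner are collected, so that no choice is involved and
  invariance under isomorphisms is immediate.
\<close>

definition corner_cocycles ::
  "('g, 'm) monoid_scheme \<Rightarrow> ('k, 'n) ring_scheme \<Rightarrow> ('g, 'k, 'a) crossed_alg \<Rightarrow> 'a
    \<Rightarrow> ('g \<times> 'g \<Rightarrow> 'k) set" where
  "corner_cocycles \<pi> K L i =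
     {\<theta> \<in> idem_stabilizer \<pi> L i \<times> idem_stabilizer \<pi> L i \<rightarrow>\<^sub>E Units K.
        \<exists>l. corner_frame \<pi> L i l \<and> frame_cocycle \<pi> L i l \<theta>}"

text \<open>
  On isomorphism classes this is the inverse of \<open>(G, \<theta>) \<mapsto> (L\<^sup>\<pi>\<^sup>,\<^sup>G\<^sup>,\<^sup>\<theta>, i\<^sub>0(\<theta>))\<close>.
\<close>

definition pair_invariant ::
  "('g, 'm) monoid_scheme \<Rightarrow> ('k, 'n) ring_scheme \<Rightarrow> ('g, 'k, 'a) crossed_pair
    \<Rightarrow> 'g set \<times> ('g \<times> 'g \<Rightarrow> 'k) set" where
  "pair_invariant \<pi> K = (\<lambda>(L, i). (idem_stabilizer \<pi> L i, corner_cocycles \<pi> K L i))"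

locale pointed_simple = normalized_splitting +
  fixes i0
  assumes crossed: "crossed_pi_algebra \<pi> K L"
    and point: "i0 \<in> I"
    and transitive: "j \<in> I \<Longrightarrow> \<exists>\<alpha>\<in>carrier \<pi>. phi L \<alpha> i0 = j"
begin

abbreviation G where "G \<equiv> idem_stabilizer \<pi> L i0"

lemmas point_carrier = idem_carrier[OF point]

lemma stab_iff: "\<alpha> \<in> G \<longleftrightarrow> \<alpha> \<in> carrier \<pi> \<and> phi L \<alpha> i0 = i0"
  by (simp add: idem_stabilizer_def)

lemma stab_carrier: "\<alpha> \<in> G \<Longrightarrow> \<alpha> \<in> carrier \<pi>"
  by (simp add: stab_iff)

lemma stab_subgroup: "subgroup G \<pi>"
proof (rule \<pi>.subgroupI)
  show "G \<subseteq> carrier \<pi>" by (auto simp: stab_iff)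
  have "\<one>\<^bsub>\<pi>\<^esub> \<in> G" using phi_unit[OF point_carrier] by (simp add: stab_iff)
  then show "G \<noteq> {}" by blast
  show "inv\<^bsub>\<pi>\<^esub> \<alpha> \<in> G" if "\<alpha> \<in> G" for \<alpha>
    using that phi_inverse(1)[of \<alpha> i0] point_carrier by (simp add: stab_iff)
  show "\<alpha> \<otimes>\<^bsub>\<pi>\<^esub> \<beta> \<in> G" if "\<alpha> \<in> G" "\<beta> \<in> G" for \<alpha> \<beta>
    using that phi_hom[of \<alpha> \<beta> i0] point_carrier by (simp add: stab_iff)
qed

lemma phi_eq_iff_stab:
  assumes "\<alpha> \<in> carrier \<pi>" "\<beta> \<in> carrier \<pi>"
  shows "phi L (inv\<^bsub>\<pi>\<^esub> \<alpha>) i0 = phi L (inv\<^bsub>\<pi>\<^esub> \<beta>) i0 \<longleftrightarrow> \<beta> \<otimes>\<^bsub>\<pi>\<^esub> inv\<^bsub>\<pi>\<^esub> \<alpha> \<in> G"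
proof -
  have "\<beta> \<otimes>\<^bsub>\<pi>\<^esub> inv\<^bsub>\<pi>\<^esub> \<alpha> \<in> G \<longleftrightarrow> phi L \<beta> (phi L (inv\<^bsub>\<pi>\<^esub> \<alpha>) i0) = i0"
    using assms phi_hom[of \<beta> "inv\<^bsub>\<pi>\<^esub> \<alpha>" i0] point_carrier by (simp add: stab_iff)
  also have "\<dots> \<longleftrightarrow> phi L (inv\<^bsub>\<pi>\<^esub> \<alpha>) i0 = phi L (inv\<^bsub>\<pi>\<^esub> \<beta>) i0"
  proof -
    have y: "phi L (inv\<^bsub>\<pi>\<^esub> \<alpha>) i0 \<in> carrier L" using assms(1) point_carrier phi_closed by simp
    show ?thesis
      using phi_inverse(1)[OF assms(2) y] phi_inverse(2)[OF assms(2) point_carrier] by auto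
  qed
  finally show ?thesis by simp
qed

text \<open>
  The right coset of \<open>\<alpha>\<close> is determined by \<open>\<phi>\<^sub>\<alpha>\<^sup>-\<^sup>1(i\<^sub>0)\<close>, which is one of the finitely many basic
  idempotents.
\<close>

lemma stab_finite_index: "finite (rcosets\<^bsub>\<pi>\<^esub> G)"
proof -
  have "G #>\<^bsub>\<pi>\<^esub> \<alpha> = {\<beta>\<in>carrier \<pi>. phi L (inv\<^bsub>\<pi>\<^esub> \<alpha>) i0 = phi L (inv\<^bsub>\<pi>\<^esub> \<beta>) i0}"
    if \<alpha>: "\<alpha> \<in> carrier \<pi>" for \<alpha>
  proof -
    have "\<beta> \<in> G #>\<^bsub>\<pi>\<^esub> \<alpha> \<longleftrightarrow> \<beta> \<otimes>\<^bsub>\<pi>\<^esub> inv\<^bsub>\<pi>\<^esub> \<alpha> \<in> G" if "\<beta> \<in> carrier \<pi>" for \<beta>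
      using \<alpha> that subgroup.rcos_module[OF stab_subgroup \<pi>.is_group] by blast
    then show ?thesis
      using \<pi>.r_coset_subset_G[OF subgroup.subset[OF stab_subgroup] \<alpha>] phi_eq_iff_stab[OF \<alpha>]
      by auto
  qed
  then have "rcosets\<^bsub>\<pi>\<^esub> G \<subseteq> (\<lambda>j. {\<beta>\<in>carrier \<pi>. j = phi L (inv\<^bsub>\<pi>\<^esub> \<beta>) i0}) ` I"
    using idem_phi[OF point] by (auto simp: RCOSETS_def)
  then show ?thesis using idem_finite finite_surj by blast
qed

abbreviation H where "H \<equiv> \<pi>\<lparr>carrier := G\<rparr>"

sublocale H: cocycle_group H K
  using subgroup.subgroup_is_group[OF stab_subgroup \<pi>.is_group] K.field_axioms
  by (simp add: cocycle_group_def)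

lemma frame_exists: "\<exists>l. corner_frame \<pi> L i0 l"
proof -
  have "\<forall>\<alpha>\<in>G. \<exists>a. a \<in> grade L \<alpha> \<and> i0 \<otimes>\<^bsub>L\<^esub> a = a \<and> a \<noteq> \<zero>\<^bsub>L\<^esub>"
    using corner_nonzero[OF crossed point] by (metis stab_iff)
  then show ?thesis unfolding corner_frame_def by metis
qed

lemma frameD:
  assumes "corner_frame \<pi> L i0 l" "\<alpha> \<in> G"
  shows "l \<alpha> \<in> grade L \<alpha>" "i0 \<otimes>\<^bsub>L\<^esub> l \<alpha> = l \<alpha>" "l \<alpha> \<noteq> \<zero>\<^bsub>L\<^esub>" "l \<alpha> \<in> carrier L"
  using assms grade_in_carrier[OF stab_carrier[OF assms(2)]] unfolding corner_frame_def by auto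

lemma frame_span:
  assumes l: "corner_frame \<pi> L i0 l" and \<alpha>: "\<alpha> \<in> G" and x: "x \<in> grade L \<alpha>" "i0 \<otimes>\<^bsub>L\<^esub> x = x"
  shows "\<exists>c\<in>carrier K. x = c \<odot>\<^bsub>L\<^esub> l \<alpha>"
proof -
  note \<alpha>c = stab_carrier[OF \<alpha>]
  obtain b where b: "b \<in> grade L (inv\<^bsub>\<pi>\<^esub> \<alpha>)" "i0 \<otimes>\<^bsub>L\<^esub> b = b" "l \<alpha> \<otimes>\<^bsub>L\<^esub> b = i0"
    using corner_inverse[OF point \<alpha>c frameD(1-3)[OF l \<alpha>]] by blast
  have "b \<in> carrier L" using b(1) grade_in_carrier \<alpha>c by (meson \<pi>.inv_closed)
  then show ?thesis
    using corner_line[OF point \<alpha>c frameD(1,2)[OF l \<alpha>] b x(1)] x grade_in_carrier[OF \<alpha>c] eta_closed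
    by (intro bexI[of _ "eta L x b"]) auto
qed

lemma frame_rescale:
  assumes l: "corner_frame \<pi> L i0 l" and l': "corner_frame \<pi> L i0 l'"
  obtains \<mu> where "\<mu> \<in> G \<rightarrow> Units K" "\<And>\<alpha>. \<alpha> \<in> G \<Longrightarrow> l' \<alpha> = \<mu> \<alpha> \<odot>\<^bsub>L\<^esub> l \<alpha>"
proof -
  have "\<forall>\<alpha>\<in>G. \<exists>c. c \<in> carrier K \<and> l' \<alpha> = c \<odot>\<^bsub>L\<^esub> l \<alpha>"
    using frame_span[OF l _ frameD(1,2)[OF l']] by blast
  then obtain \<mu> where \<mu>: "\<And>\<alpha>. \<alpha> \<in> G \<Longrightarrow> \<mu> \<alpha> \<in> carrier K \<and> l' \<alpha> = \<mu> \<alpha> \<odot>\<^bsub>L\<^esub> l \<alpha>" by metis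
  have "\<mu> \<alpha> \<noteq> \<zero>\<^bsub>K\<^esub>" if "\<alpha> \<in> G" for \<alpha>
    using \<mu>[OF that] frameD(3)[OF l' that] frameD(4)[OF l that] by auto
  then show ?thesis
    using \<mu> K.field_Units by (intro that[of \<mu>]) auto
qed

lemma frame_product_nonzero:
  assumes l: "corner_frame \<pi> L i0 l" and \<alpha>: "\<alpha> \<in> G" and \<beta>: "\<beta> \<in> G"
  shows "l \<alpha> \<otimes>\<^bsub>L\<^esub> l \<beta> \<noteq> \<zero>\<^bsub>L\<^esub>"
proof
  assume 0: "l \<alpha> \<otimes>\<^bsub>L\<^esub> l \<beta> = \<zero>\<^bsub>L\<^esub>"
  obtain b where b: "b \<in> grade L (inv\<^bsub>\<pi>\<^esub> \<alpha>)" "b \<otimes>\<^bsub>L\<^esub> l \<alpha> = i0"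
    using corner_inverse[OF point stab_carrier[OF \<alpha>] frameD(1-3)[OF l \<alpha>]] by blast
  have bc: "b \<in> carrier L" using b(1) grade_in_carrier stab_carrier[OF \<alpha>] by (meson \<pi>.inv_closed)
  have "l \<beta> = b \<otimes>\<^bsub>L\<^esub> (l \<alpha> \<otimes>\<^bsub>L\<^esub> l \<beta>)"
    using b(2) bc frameD[OF l \<alpha>] frameD[OF l \<beta>] by (simp add: L.m_assoc[symmetric])
  then show False using 0 bc frameD(3)[OF l \<beta>] by simp
qed

text \<open>
  The cocycle identity is associativity of \<open>l\<^sub>\<alpha>l\<^sub>\<beta>l\<^sub>\<gamma>\<close>.
\<close>

lemma frame_cocycle_exists:
  assumes l: "corner_frame \<pi> L i0 l"
  shows "\<exists>\<theta>\<in>carrier (Z2 H K). frame_cocycle \<pi> L i0 l \<theta>"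
proof -
  note m = subgroup.m_closed[OF stab_subgroup]
  have "\<exists>c. c \<in> Units K \<and> l \<alpha> \<otimes>\<^bsub>L\<^esub> l \<beta> = c \<odot>\<^bsub>L\<^esub> l (\<alpha> \<otimes>\<^bsub>\<pi>\<^esub> \<beta>)" if \<alpha>: "\<alpha> \<in> G" and \<beta>: "\<beta> \<in> G" for \<alpha> \<beta>
  proof -
    note la = frameD[OF l \<alpha>] and lb = frameD[OF l \<beta>] and lab = frameD[OF l m[OF \<alpha> \<beta>]]
    have "l \<alpha> \<otimes>\<^bsub>L\<^esub> l \<beta> \<in> grade L (\<alpha> \<otimes>\<^bsub>\<pi>\<^esub> \<beta>)"
      using grade_mult[OF stab_carrier[OF \<alpha>] stab_carrier[OF \<beta>] la(1) lb(1)] .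
    moreover have "i0 \<otimes>\<^bsub>L\<^esub> (l \<alpha> \<otimes>\<^bsub>L\<^esub> l \<beta>) = l \<alpha> \<otimes>\<^bsub>L\<^esub> l \<beta>"
      using la lb point_carrier by (simp add: L.m_assoc[symmetric])
    ultimately obtain c where c: "c \<in> carrier K" "l \<alpha> \<otimes>\<^bsub>L\<^esub> l \<beta> = c \<odot>\<^bsub>L\<^esub> l (\<alpha> \<otimes>\<^bsub>\<pi>\<^esub> \<beta>)"
      using frame_span[OF l m[OF \<alpha> \<beta>]] by blast
    have "c \<noteq> \<zero>\<^bsub>K\<^esub>"
      using c(2) frame_product_nonzero[OF l \<alpha> \<beta>] lab(4) by auto
    then have "c \<in> Units K" using c(1) K.field_Units by simp
    then show ?thesis using c(2) by blast
  qed
  then obtain t where t: "\<And>\<alpha> \<beta>. \<alpha> \<in> G \<Longrightarrow> \<beta> \<in> G \<Longrightarrow>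
      t \<alpha> \<beta> \<in> Units K \<and> l \<alpha> \<otimes>\<^bsub>L\<^esub> l \<beta> = t \<alpha> \<beta> \<odot>\<^bsub>L\<^esub> l (\<alpha> \<otimes>\<^bsub>\<pi>\<^esub> \<beta>)"
    by metis
  define \<theta> where "\<theta> = (\<lambda>(\<alpha>, \<beta>)\<in>G \<times> G. t \<alpha> \<beta>)"
  have \<theta>: "\<theta> (\<alpha>, \<beta>) \<in> carrier K" "\<theta> (\<alpha>, \<beta>) \<in> Units K"
    "l \<alpha> \<otimes>\<^bsub>L\<^esub> l \<beta> = \<theta> (\<alpha>, \<beta>) \<odot>\<^bsub>L\<^esub> l (\<alpha> \<otimes>\<^bsub>\<pi>\<^esub> \<beta>)" if "\<alpha> \<in> G" "\<beta> \<in> G" for \<alpha> \<beta>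
    using t[OF that] that by (auto simp: \<theta>_def)
  have "\<theta> (\<alpha>, \<beta>) \<otimes>\<^bsub>K\<^esub> \<theta> (\<alpha> \<otimes>\<^bsub>\<pi>\<^esub> \<beta>, \<gamma>) = \<theta> (\<alpha>, \<beta> \<otimes>\<^bsub>\<pi>\<^esub> \<gamma>) \<otimes>\<^bsub>K\<^esub> \<theta> (\<beta>, \<gamma>)"
    if a: "\<alpha> \<in> G" and b: "\<beta> \<in> G" and c: "\<gamma> \<in> G" for \<alpha> \<beta> \<gamma>
  proof -
    let ?abc = "\<alpha> \<otimes>\<^bsub>\<pi>\<^esub> \<beta> \<otimes>\<^bsub>\<pi>\<^esub> \<gamma>"
    note ab = m[OF a b] and bc = m[OF b c] and abc = m[OF m[OF a b] c]
    have as: "\<alpha> \<otimes>\<^bsub>\<pi>\<^esub> (\<beta> \<otimes>\<^bsub>\<pi>\<^esub> \<gamma>) = ?abc" using a b c stab_carrier by (simp add: \<pi>.m_assoc)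
    note cs = frameD(4)[OF l a] frameD(4)[OF l b] frameD(4)[OF l c] frameD(4)[OF l ab]
      frameD(4)[OF l bc] frameD(4)[OF l abc] \<theta>(1)[OF a b] \<theta>(1)[OF ab c] \<theta>(1)[OF a bc] \<theta>(1)[OF b c]
    have "(\<theta> (\<alpha>, \<beta>) \<otimes>\<^bsub>K\<^esub> \<theta> (\<alpha> \<otimes>\<^bsub>\<pi>\<^esub> \<beta>, \<gamma>)) \<odot>\<^bsub>L\<^esub> l ?abc = (l \<alpha> \<otimes>\<^bsub>L\<^esub> l \<beta>) \<otimes>\<^bsub>L\<^esub> l \<gamma>"
      using cs by (simp add: M.smult_assoc1 \<theta>(3)[OF a b] smult_mult_left \<theta>(3)[OF ab c])
    also have "\<dots> = l \<alpha> \<otimes>\<^bsub>L\<^esub> (l \<beta> \<otimes>\<^bsub>L\<^esub> l \<gamma>)" using cs by (simp add: L.m_assoc)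
    also have "\<dots> = \<theta> (\<beta>, \<gamma>) \<odot>\<^bsub>L\<^esub> (\<theta> (\<alpha>, \<beta> \<otimes>\<^bsub>\<pi>\<^esub> \<gamma>) \<odot>\<^bsub>L\<^esub> l ?abc)"
      using cs by (simp add: \<theta>(3)[OF b c] smult_mult_right \<theta>(3)[OF a bc] as)
    also have "\<dots> = (\<theta> (\<alpha>, \<beta> \<otimes>\<^bsub>\<pi>\<^esub> \<gamma>) \<otimes>\<^bsub>K\<^esub> \<theta> (\<beta>, \<gamma>)) \<odot>\<^bsub>L\<^esub> l ?abc"
      using cs by (simp add: M.smult_assoc1[symmetric] K.m_comm)
    finally show ?thesis
      using smult_cancel[OF _ _ cs(6) frameD(3)[OF l abc]] cs by simp
  qed
  then have "\<theta> \<in> carrier (Z2 H K)"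
    using \<theta>(2) by (auto simp: Z2_def \<theta>_def)
  then show ?thesis using \<theta>(3) unfolding frame_cocycle_def by blast
qed

text \<open>Rescaling a frame by \<open>\<mu>\<close> multiplies its cocycle by the coboundary of \<open>\<mu>\<close>.\<close>

lemma corner_cocycles_eq_class:
  assumes l: "corner_frame \<pi> L i0 l" and \<theta>: "\<theta> \<in> G \<times> G \<rightarrow> Units K" "frame_cocycle \<pi> L i0 l \<theta>"
  shows "corner_cocycles \<pi> K L i0 = cohomology_class H K \<theta>"
proof (intro equalityI subsetI)
  note m = subgroup.m_closed[OF stab_subgroup]
  have t: "\<theta> (\<alpha>, \<beta>) \<in> carrier K" "l \<alpha> \<otimes>\<^bsub>L\<^esub> l \<beta> = \<theta> (\<alpha>, \<beta>) \<odot>\<^bsub>L\<^esub> l (\<alpha> \<otimes>\<^bsub>\<pi>\<^esub> \<beta>)"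
    if "\<alpha> \<in> G" "\<beta> \<in> G" for \<alpha> \<beta>
    using \<theta> that by (auto simp: frame_cocycle_def Pi_def K.Units_closed)
  {
    fix \<theta>' assume "\<theta>' \<in> corner_cocycles \<pi> K L i0"
    then obtain l' where \<theta>': "\<theta>' \<in> G \<times> G \<rightarrow>\<^sub>E Units K" and l': "corner_frame \<pi> L i0 l'"
      and fc: "frame_cocycle \<pi> L i0 l' \<theta>'"
      by (auto simp: corner_cocycles_def)
    obtain \<mu> where \<mu>: "\<mu> \<in> G \<rightarrow> Units K" "\<And>\<alpha>. \<alpha> \<in> G \<Longrightarrow> l' \<alpha> = \<mu> \<alpha> \<odot>\<^bsub>L\<^esub> l \<alpha>"
      using frame_rescale[OF l l'] by blast
    have "\<theta>' (\<alpha>, \<beta>) \<otimes>\<^bsub>K\<^esub> \<mu> (\<alpha> \<otimes>\<^bsub>\<pi>\<^esub> \<beta>) = \<mu> \<alpha> \<otimes>\<^bsub>K\<^esub> \<mu> \<beta> \<otimes>\<^bsub>K\<^esub> \<theta> (\<alpha>, \<beta>)" if a: "\<alpha> \<in> G" and b: "\<beta> \<in> G" for \<alpha> \<beta>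
    proof -
      note ab = m[OF a b]
      note cs = frameD(4)[OF l a] frameD(4)[OF l b] frameD(4)[OF l ab] t(1)[OF a b]
        funcset_mem[OF \<mu>(1) a, THEN K.Units_closed] funcset_mem[OF \<mu>(1) b, THEN K.Units_closed]
        funcset_mem[OF \<mu>(1) ab, THEN K.Units_closed]
      have t': "\<theta>' (\<alpha>, \<beta>) \<in> carrier K" using \<theta>' a b by (auto simp: PiE_def Pi_def K.Units_closed)
      have "(\<theta>' (\<alpha>, \<beta>) \<otimes>\<^bsub>K\<^esub> \<mu> (\<alpha> \<otimes>\<^bsub>\<pi>\<^esub> \<beta>)) \<odot>\<^bsub>L\<^esub> l (\<alpha> \<otimes>\<^bsub>\<pi>\<^esub> \<beta>) = l' \<alpha> \<otimes>\<^bsub>L\<^esub> l' \<beta>"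
        using fc a b cs t' \<mu>(2)[OF ab] by (simp add: frame_cocycle_def M.smult_assoc1)
      also have "\<dots> = \<mu> \<alpha> \<odot>\<^bsub>L\<^esub> (\<mu> \<beta> \<odot>\<^bsub>L\<^esub> (l \<alpha> \<otimes>\<^bsub>L\<^esub> l \<beta>))"
        unfolding \<mu>(2)[OF a] \<mu>(2)[OF b]
        using cs by (subst smult_mult_left) (simp_all add: smult_mult_right)
      also have "\<dots> = (\<mu> \<alpha> \<otimes>\<^bsub>K\<^esub> \<mu> \<beta> \<otimes>\<^bsub>K\<^esub> \<theta> (\<alpha>, \<beta>)) \<odot>\<^bsub>L\<^esub> l (\<alpha> \<otimes>\<^bsub>\<pi>\<^esub> \<beta>)"
        using cs by (simp add: t(2)[OF a b] M.smult_assoc1)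
      finally show ?thesis
        using smult_cancel[OF _ _ cs(3) frameD(3)[OF l ab]] cs t' by simp
    qed
    then show "\<theta>' \<in> cohomology_class H K \<theta>"
      unfolding cohomology_class_def cohomologous_def using \<theta>' \<mu>(1) by auto
  }
  {
    fix \<theta>' assume "\<theta>' \<in> cohomology_class H K \<theta>"
    then obtain \<mu> where \<theta>': "\<theta>' \<in> G \<times> G \<rightarrow>\<^sub>E Units K" and \<mu>: "\<mu> \<in> G \<rightarrow> Units K"
      and eq: "\<And>\<alpha> \<beta>. \<alpha> \<in> G \<Longrightarrow> \<beta> \<in> G \<Longrightarrow>
        \<theta>' (\<alpha>, \<beta>) \<otimes>\<^bsub>K\<^esub> \<mu> (\<alpha> \<otimes>\<^bsub>\<pi>\<^esub> \<beta>) = \<mu> \<alpha> \<otimes>\<^bsub>K\<^esub> \<mu> \<beta> \<otimes>\<^bsub>K\<^esub> \<theta> (\<alpha>, \<beta>)"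
      unfolding cohomology_class_def cohomologous_def by auto
    have \<mu>c: "\<mu> \<alpha> \<in> carrier K" "\<mu> \<alpha> \<noteq> \<zero>\<^bsub>K\<^esub>" if "\<alpha> \<in> G" for \<alpha>
      using \<mu> that K.field_Units by auto
    define l' where "l' = (\<lambda>\<alpha>. \<mu> \<alpha> \<odot>\<^bsub>L\<^esub> l \<alpha>)"
    have "l' \<alpha> \<in> grade L \<alpha> \<and> i0 \<otimes>\<^bsub>L\<^esub> l' \<alpha> = l' \<alpha> \<and> l' \<alpha> \<noteq> \<zero>\<^bsub>L\<^esub>" if a: "\<alpha> \<in> G" for \<alpha>
      using frameD[OF l a] \<mu>c[OF a] grade_smult[OF stab_carrier[OF a]] smult_eq_zero[of "\<mu> \<alpha>" "l \<alpha>"]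
        point_carrier by (auto simp: l'_def smult_mult_right)
    then have "corner_frame \<pi> L i0 l'" by (simp add: corner_frame_def)
    moreover have "l' \<alpha> \<otimes>\<^bsub>L\<^esub> l' \<beta> = \<theta>' (\<alpha>, \<beta>) \<odot>\<^bsub>L\<^esub> l' (\<alpha> \<otimes>\<^bsub>\<pi>\<^esub> \<beta>)" if a: "\<alpha> \<in> G" and b: "\<beta> \<in> G" for \<alpha> \<beta>
    proof -
      note ab = m[OF a b]
      note cs = frameD(4)[OF l a] frameD(4)[OF l b] frameD(4)[OF l ab] t(1)[OF a b]
        \<mu>c(1)[OF a] \<mu>c(1)[OF b] \<mu>c(1)[OF ab]
      have t': "\<theta>' (\<alpha>, \<beta>) \<in> carrier K" using \<theta>' a b by (auto simp: PiE_def Pi_def K.Units_closed)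
      have "l' \<alpha> \<otimes>\<^bsub>L\<^esub> l' \<beta> = (\<mu> \<alpha> \<otimes>\<^bsub>K\<^esub> \<mu> \<beta> \<otimes>\<^bsub>K\<^esub> \<theta> (\<alpha>, \<beta>)) \<odot>\<^bsub>L\<^esub> l (\<alpha> \<otimes>\<^bsub>\<pi>\<^esub> \<beta>)"
        using cs unfolding l'_def
        by (subst smult_mult_left) (simp_all add: smult_mult_right t(2)[OF a b] M.smult_assoc1)
      also have "\<dots> = \<theta>' (\<alpha>, \<beta>) \<odot>\<^bsub>L\<^esub> l' (\<alpha> \<otimes>\<^bsub>\<pi>\<^esub> \<beta>)"
        unfolding eq[OF a b, symmetric] l'_def using cs t' by (simp add: M.smult_assoc1)
      finally show ?thesis .
    qed
    ultimately show "\<theta>' \<in> corner_cocycles \<pi> K L i0"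
      unfolding corner_cocycles_def frame_cocycle_def using \<theta>' by blast
  }
qed

lemma corner_cocycles_class: "corner_cocycles \<pi> K L i0 \<in> carrier (H2 H K)"
proof -
  obtain l where l: "corner_frame \<pi> L i0 l" using frame_exists by blast
  obtain \<theta> where "\<theta> \<in> carrier (Z2 H K)" "frame_cocycle \<pi> L i0 l \<theta>"
    using frame_cocycle_exists[OF l] by blast
  then show ?thesis
    using corner_cocycles_eq_class[OF l, of \<theta>] H.H2_iff by (auto simp: Z2_def PiE_def)
qed

lemma pair_invariant_in_C: "pair_invariant \<pi> K (L, i0) \<in> C_set \<pi> K"
  using stab_subgroup stab_finite_index corner_cocycles_class
  by (simp add: pair_invariant_def C_set_def)

lemma pointed_simple_phi:
  assumes \<alpha>: "\<alpha> \<in> carrier \<pi>"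
  shows "pointed_simple \<pi> K L I (phi L \<alpha> i0)"
proof (intro pointed_simple.intro pointed_simple_axioms.intro)
  show "phi L \<alpha> i0 \<in> I" using idem_phi[OF point \<alpha>] .
  fix j assume "j \<in> I"
  then obtain \<beta> where \<beta>: "\<beta> \<in> carrier \<pi>" "phi L \<beta> i0 = j" using transitive by blast
  have "phi L (\<beta> \<otimes>\<^bsub>\<pi>\<^esub> inv\<^bsub>\<pi>\<^esub> \<alpha>) (phi L \<alpha> i0) = phi L \<beta> (phi L (inv\<^bsub>\<pi>\<^esub> \<alpha>) (phi L \<alpha> i0))"
    using \<alpha> \<beta> point_carrier phi_closed by (intro phi_hom) auto
  then show "\<exists>\<gamma>\<in>carrier \<pi>. phi L \<gamma> (phi L \<alpha> i0) = j"
    using \<alpha> \<beta> phi_inverse(1)[OF \<alpha> point_carrier] by (intro bexI[of _ "\<beta> \<otimes>\<^bsub>\<pi>\<^esub> inv\<^bsub>\<pi>\<^esub> \<alpha>"]) auto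
qed (rule normalized_splitting_axioms crossed)+

lemma stab_conj:
  assumes \<alpha>: "\<alpha> \<in> carrier \<pi>"
  shows "idem_stabilizer \<pi> L (phi L \<alpha> i0) = conj_subgroup \<pi> \<alpha> G"
    and "\<gamma> \<in> idem_stabilizer \<pi> L (phi L \<alpha> i0) \<Longrightarrow> inv\<^bsub>\<pi>\<^esub> \<alpha> \<otimes>\<^bsub>\<pi>\<^esub> \<gamma> \<otimes>\<^bsub>\<pi>\<^esub> \<alpha> \<in> G"
proof -
  have 1: "inv\<^bsub>\<pi>\<^esub> \<alpha> \<otimes>\<^bsub>\<pi>\<^esub> \<gamma> \<otimes>\<^bsub>\<pi>\<^esub> \<alpha> \<in> G" if "\<gamma> \<in> idem_stabilizer \<pi> L (phi L \<alpha> i0)" for \<gamma>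
  proof -
    have \<gamma>: "\<gamma> \<in> carrier \<pi>" "phi L \<gamma> (phi L \<alpha> i0) = phi L \<alpha> i0"
      using that by (auto simp: idem_stabilizer_def)
    have "phi L (inv\<^bsub>\<pi>\<^esub> \<alpha> \<otimes>\<^bsub>\<pi>\<^esub> \<gamma> \<otimes>\<^bsub>\<pi>\<^esub> \<alpha>) i0 = phi L (inv\<^bsub>\<pi>\<^esub> \<alpha>) (phi L \<gamma> (phi L \<alpha> i0))"
      using \<alpha> \<gamma>(1) point_carrier phi_closed by (simp add: phi_hom)
    then show ?thesis
      using \<alpha> \<gamma> phi_inverse(1)[OF \<alpha> point_carrier] by (simp add: stab_iff)
  qed
  show "\<gamma> \<in> idem_stabilizer \<pi> L (phi L \<alpha> i0) \<Longrightarrow> inv\<^bsub>\<pi>\<^esub> \<alpha> \<otimes>\<^bsub>\<pi>\<^esub> \<gamma> \<otimes>\<^bsub>\<pi>\<^esub> \<alpha> \<in> G" by (rule 1)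
  show "idem_stabilizer \<pi> L (phi L \<alpha> i0) = conj_subgroup \<pi> \<alpha> G"
  proof (intro equalityI subsetI)
    fix \<gamma> assume g: "\<gamma> \<in> idem_stabilizer \<pi> L (phi L \<alpha> i0)"
    then have "\<gamma> \<in> carrier \<pi>" by (simp add: idem_stabilizer_def)
    then have "\<gamma> = \<alpha> \<otimes>\<^bsub>\<pi>\<^esub> (inv\<^bsub>\<pi>\<^esub> \<alpha> \<otimes>\<^bsub>\<pi>\<^esub> \<gamma> \<otimes>\<^bsub>\<pi>\<^esub> \<alpha>) \<otimes>\<^bsub>\<pi>\<^esub> inv\<^bsub>\<pi>\<^esub> \<alpha>"
      using \<alpha> by (simp add: \<pi>.m_assoc) (simp add: \<pi>.m_assoc[symmetric])
    then show "\<gamma> \<in> conj_subgroup \<pi> \<alpha> G"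
      unfolding conj_subgroup_def using 1[OF g] by blast
  next
    fix \<gamma> assume "\<gamma> \<in> conj_subgroup \<pi> \<alpha> G"
    then obtain g where g: "g \<in> G" "\<gamma> = \<alpha> \<otimes>\<^bsub>\<pi>\<^esub> g \<otimes>\<^bsub>\<pi>\<^esub> inv\<^bsub>\<pi>\<^esub> \<alpha>"
      unfolding conj_subgroup_def by blast
    then show "\<gamma> \<in> idem_stabilizer \<pi> L (phi L \<alpha> i0)"
      using \<alpha> point_carrier phi_closed phi_inverse(1)[OF \<alpha> point_carrier]
      by (auto simp: idem_stabilizer_def phi_hom)
  qed
qed

text \<open>
  The automorphism \<open>\<phi>\<^sub>\<alpha>\<close> carries a frame at \<open>i\<^sub>0\<close> to a frame at \<open>\<phi>\<^sub>\<alpha>(i\<^sub>0)\<close> and conjugates all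
  degrees by \<open>\<alpha>\<close>.
\<close>

lemma corner_cocycles_conj_subset:
  assumes \<alpha>: "\<alpha> \<in> carrier \<pi>"
  shows "conj_cocycle \<pi> \<alpha> G ` corner_cocycles \<pi> K L i0 \<subseteq> corner_cocycles \<pi> K L (phi L \<alpha> i0)"
proof
  let ?S = "idem_stabilizer \<pi> L (phi L \<alpha> i0)"
  let ?c = "\<lambda>\<gamma>. inv\<^bsub>\<pi>\<^esub> \<alpha> \<otimes>\<^bsub>\<pi>\<^esub> \<gamma> \<otimes>\<^bsub>\<pi>\<^esub> \<alpha>"
  note S = stab_conj[OF \<alpha>]
  fix \<theta>' assume "\<theta>' \<in> conj_cocycle \<pi> \<alpha> G ` corner_cocycles \<pi> K L i0"
  then obtain \<theta> l where \<theta>': "\<theta>' = conj_cocycle \<pi> \<alpha> G \<theta>" and \<theta>: "\<theta> \<in> G \<times> G \<rightarrow>\<^sub>E Units K"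
    and l: "corner_frame \<pi> L i0 l" and fc: "frame_cocycle \<pi> L i0 l \<theta>"
    by (auto simp: corner_cocycles_def)
  have val: "\<theta>' (\<gamma>, \<delta>) = \<theta> (?c \<gamma>, ?c \<delta>)" if "\<gamma> \<in> ?S" "\<delta> \<in> ?S" for \<gamma> \<delta>
    using that by (simp add: \<theta>' conj_cocycle_def S(1)[symmetric])
  have "\<theta>' \<in> ?S \<times> ?S \<rightarrow>\<^sub>E Units K"
  proof (rule PiE_I)
    fix p assume "p \<in> ?S \<times> ?S"
    then obtain \<gamma> \<delta> where p: "p = (\<gamma>, \<delta>)" "\<gamma> \<in> ?S" "\<delta> \<in> ?S" by auto
    then show "\<theta>' p \<in> Units K"
      using val[OF p(2,3)] S(2)[OF p(2)] S(2)[OF p(3)] \<theta> by (auto simp: PiE_def Pi_def)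
  qed (simp add: \<theta>' conj_cocycle_def S(1))
  moreover define l' where "l' = (\<lambda>\<gamma>. phi L \<alpha> (l (?c \<gamma>)))"
  have "corner_frame \<pi> L (phi L \<alpha> i0) l'"
    unfolding corner_frame_def
  proof
    fix \<gamma> assume g: "\<gamma> \<in> ?S"
    then have gc: "\<gamma> \<in> carrier \<pi>" by (simp add: idem_stabilizer_def)
    note lg = frameD[OF l S(2)[OF g]]
    have "\<alpha> \<otimes>\<^bsub>\<pi>\<^esub> ?c \<gamma> \<otimes>\<^bsub>\<pi>\<^esub> inv\<^bsub>\<pi>\<^esub> \<alpha> = \<gamma>"
      using \<alpha> gc by (simp add: \<pi>.m_assoc) (simp add: \<pi>.m_assoc[symmetric])
    then have "l' \<gamma> \<in> grade L \<gamma>"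
      using phi_grade[OF stab_carrier[OF S(2)[OF g]] \<alpha> lg(1)] by (simp add: l'_def)
    moreover have "phi L \<alpha> i0 \<otimes>\<^bsub>L\<^esub> l' \<gamma> = l' \<gamma>"
      using phi_mult[OF \<alpha> point_carrier lg(4)] lg(2) by (simp add: l'_def)
    moreover have "l' \<gamma> \<noteq> \<zero>\<^bsub>L\<^esub>"
      using phi_inj[OF \<alpha>] phi_zero[OF \<alpha>] lg(3,4) unfolding l'_def inj_on_def
      by (metis L.zero_closed)
    ultimately show "l' \<gamma> \<in> grade L \<gamma> \<and> phi L \<alpha> i0 \<otimes>\<^bsub>L\<^esub> l' \<gamma> = l' \<gamma> \<and> l' \<gamma> \<noteq> \<zero>\<^bsub>L\<^esub>" by blast
  qed
  moreover have "frame_cocycle \<pi> L (phi L \<alpha> i0) l' \<theta>'"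
    unfolding frame_cocycle_def
  proof (intro ballI)
    fix \<gamma> \<delta> assume g: "\<gamma> \<in> ?S" and d: "\<delta> \<in> ?S"
    have gc: "\<gamma> \<in> carrier \<pi>" "\<delta> \<in> carrier \<pi>" using g d by (auto simp: idem_stabilizer_def)
    note lg = frameD[OF l S(2)[OF g]] and ld = frameD[OF l S(2)[OF d]]
    have cm: "?c \<gamma> \<otimes>\<^bsub>\<pi>\<^esub> ?c \<delta> = ?c (\<gamma> \<otimes>\<^bsub>\<pi>\<^esub> \<delta>)"
      using \<alpha> gc by (simp add: \<pi>.m_assoc) (simp add: \<pi>.m_assoc[symmetric])
    have t: "\<theta> (?c \<gamma>, ?c \<delta>) \<in> carrier K"
      using \<theta> S(2)[OF g] S(2)[OF d] by (auto simp: PiE_def Pi_def K.Units_closed)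
    have "l' \<gamma> \<otimes>\<^bsub>L\<^esub> l' \<delta> = phi L \<alpha> (l (?c \<gamma>) \<otimes>\<^bsub>L\<^esub> l (?c \<delta>))"
      using phi_mult[OF \<alpha> lg(4) ld(4)] by (simp add: l'_def)
    also have "l (?c \<gamma>) \<otimes>\<^bsub>L\<^esub> l (?c \<delta>) = \<theta> (?c \<gamma>, ?c \<delta>) \<odot>\<^bsub>L\<^esub> l (?c (\<gamma> \<otimes>\<^bsub>\<pi>\<^esub> \<delta>))"
      using fc S(2)[OF g] S(2)[OF d] cm unfolding frame_cocycle_def by metis
    also have "phi L \<alpha> \<dots> = \<theta>' (\<gamma>, \<delta>) \<odot>\<^bsub>L\<^esub> l' (\<gamma> \<otimes>\<^bsub>\<pi>\<^esub> \<delta>)"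
      using val[OF g d] t phi_smult[OF \<alpha> t]
        frameD(4)[OF l subgroup.m_closed[OF stab_subgroup S(2)[OF g] S(2)[OF d]]]
      by (simp add: l'_def cm)
    finally show "l' \<gamma> \<otimes>\<^bsub>L\<^esub> l' \<delta> = \<theta>' (\<gamma>, \<delta>) \<odot>\<^bsub>L\<^esub> l' (\<gamma> \<otimes>\<^bsub>\<pi>\<^esub> \<delta>)" .
  qed
  ultimately show "\<theta>' \<in> corner_cocycles \<pi> K L (phi L \<alpha> i0)"
    unfolding corner_cocycles_def by blast
qed

end

text \<open>
  The inclusion above for \<open>\<alpha>\<^sup>-\<^sup>1\<close>, started at \<open>\<phi>\<^sub>\<alpha>(i\<^sub>0)\<close>, gives the reverse inclusion for \<open>\<alpha>\<close>.
\<close>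

lemma (in pointed_simple) pair_invariant_phi:
  assumes \<alpha>: "\<alpha> \<in> carrier \<pi>"
  shows "pair_invariant \<pi> K (L, phi L \<alpha> i0) =
    (conj_subgroup \<pi> \<alpha> G, conj_cocycle \<pi> \<alpha> G ` corner_cocycles \<pi> K L i0)"
proof -
  interpret A: pointed_simple \<pi> K L I "phi L \<alpha> i0" using pointed_simple_phi[OF \<alpha>] .
  have \<alpha>': "inv\<^bsub>\<pi>\<^esub> \<alpha> \<in> carrier \<pi>" using \<alpha> by simp
  have ret: "phi L (inv\<^bsub>\<pi>\<^esub> \<alpha>) (phi L \<alpha> i0) = i0" using phi_inverse(1)[OF \<alpha> point_carrier] .
  let ?S = "idem_stabilizer \<pi> L (phi L \<alpha> i0)"
  have S: "conj_subgroup \<pi> \<alpha> G = ?S" "conj_subgroup \<pi> (inv\<^bsub>\<pi>\<^esub> \<alpha>) ?S = G"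
    using stab_conj(1)[OF \<alpha>] A.stab_conj(1)[OF \<alpha>'] ret by auto
  have "corner_cocycles \<pi> K L (phi L \<alpha> i0) \<subseteq> conj_cocycle \<pi> \<alpha> G ` corner_cocycles \<pi> K L i0"
  proof
    fix \<theta> assume \<theta>: "\<theta> \<in> corner_cocycles \<pi> K L (phi L \<alpha> i0)"
    then have \<theta>E: "\<theta> \<in> extensional (?S \<times> ?S)" by (auto simp: corner_cocycles_def PiE_def)
    have "\<theta> = conj_cocycle \<pi> \<alpha> G (conj_cocycle \<pi> (inv\<^bsub>\<pi>\<^esub> \<alpha>) ?S \<theta>)"
    proof (rule extensionalityI[OF \<theta>E])
      fix p assume "p \<in> ?S \<times> ?S"
      then obtain \<gamma> \<delta> where p: "p = (\<gamma>, \<delta>)" "\<gamma> \<in> ?S" "\<delta> \<in> ?S" by auto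
      have "\<alpha> \<otimes>\<^bsub>\<pi>\<^esub> (inv\<^bsub>\<pi>\<^esub> \<alpha> \<otimes>\<^bsub>\<pi>\<^esub> x \<otimes>\<^bsub>\<pi>\<^esub> \<alpha>) \<otimes>\<^bsub>\<pi>\<^esub> inv\<^bsub>\<pi>\<^esub> \<alpha> = x" if "x \<in> ?S" for x
        using \<alpha> A.stab_carrier[OF that]
        by (simp add: \<pi>.m_assoc) (simp add: \<pi>.m_assoc[symmetric])
      then show "\<theta> p = conj_cocycle \<pi> \<alpha> G (conj_cocycle \<pi> (inv\<^bsub>\<pi>\<^esub> \<alpha>) ?S \<theta>) p"
        using p \<alpha> stab_conj(2)[OF \<alpha>] by (simp add: conj_cocycle_def S)
    qed (simp add: conj_cocycle_def S)
    moreover have "conj_cocycle \<pi> (inv\<^bsub>\<pi>\<^esub> \<alpha>) ?S \<theta> \<in> corner_cocycles \<pi> K L i0"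
      using A.corner_cocycles_conj_subset[OF \<alpha>'] \<theta> unfolding ret by blast
    ultimately show "\<theta> \<in> conj_cocycle \<pi> \<alpha> G ` corner_cocycles \<pi> K L i0" by blast
  qed
  then show ?thesis
    using corner_cocycles_conj_subset[OF \<alpha>] stab_conj(1)[OF \<alpha>]
    by (simp add: pair_invariant_def subset_antisym)
qed

lemma simple_pairs_iff:
  "(L, i) \<in> simple_pairs \<pi> K \<longleftrightarrow> pointed_simple \<pi> K L (bas \<pi> K L) i"
proof
  assume s: "(L, i) \<in> simple_pairs \<pi> K"
  then have n: "normalized_simple_crossed \<pi> K L" and i: "i \<in> bas \<pi> K L"
    by (auto simp: simple_pairs_def)
  then obtain I where c: "crossed_pi_algebra \<pi> K L" and I: "splitting \<pi> K L I"
    by (auto simp: normalized_simple_crossed_def simple_crossed_def semisimple_crossed_def)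
  interpret precrossed_pi_algebra \<pi> K L using crossed_pi_algebra.precrossed[OF c] .
  have "normalized_splitting \<pi> K L (bas \<pi> K L)"
    using n I bas_eq[OF I] precrossed_pi_algebra_axioms
    by (auto simp: normalized_splitting_def normalized_splitting_axioms_def normalized_simple_crossed_def)
  then show "pointed_simple \<pi> K L (bas \<pi> K L) i"
    using n c i
    by (auto simp: pointed_simple_def pointed_simple_axioms_def normalized_simple_crossed_def
        simple_crossed_def)
next
  assume "pointed_simple \<pi> K L (bas \<pi> K L) i"
  then interpret pointed_simple \<pi> K L "bas \<pi> K L" i .
  have "\<exists>\<gamma>\<in>carrier \<pi>. phi L \<gamma> j = k" if "j \<in> bas \<pi> K L" "k \<in> bas \<pi> K L" for j k
  proof -
    obtain \<alpha> where \<alpha>: "\<alpha> \<in> carrier \<pi>" "phi L \<alpha> i = j" using transitive \<open>j \<in> bas \<pi> K L\<close> by blast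
    show ?thesis
      using pointed_simple.transitive[OF pointed_simple_phi[OF \<alpha>(1)] that(2)] \<alpha>(2) by simp
  qed
  then show "(L, i) \<in> simple_pairs \<pi> K"
    using crossed splitting norm point
    by (auto simp: simple_pairs_def normalized_simple_crossed_def simple_crossed_def
        semisimple_crossed_def)
qed

text \<open>
  An isomorphism carries a frame to a frame with the same cocycle. As both sets of cocycles are
  cohomology classes, one common element suffices for their equality.
\<close>

lemma pair_iso_invariant:
  assumes p: "p \<in> simple_pairs \<pi> K" and q: "q \<in> simple_pairs \<pi> K" and iso: "pair_iso \<pi> K p q"
  shows "pair_invariant \<pi> K p = pair_invariant \<pi> K q"
proof -
  obtain L i where pL: "p = (L, i)" by (cases p)
  obtain L' i' where qL: "q = (L', i')" by (cases q)
  interpret A: pointed_simple \<pi> K L "bas \<pi> K L" i using p unfolding pL simple_pairs_iff .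
  interpret B: pointed_simple \<pi> K L' "bas \<pi> K L'" i' using q unfolding qL simple_pairs_iff .
  obtain h where h: "crossed_iso \<pi> K L L' h" and hi: "h i = i'"
    using iso by (auto simp: pair_iso_def pL qL)
  have hr: "h \<in> ring_iso L L'" using h by (simp add: crossed_iso_def)
  note hm = ring_iso_memE[OF hr]
  have inj: "inj_on h (carrier L)" using hm(5) by (simp add: bij_betw_def)
  have h0: "h \<zero>\<^bsub>L\<^esub> = \<zero>\<^bsub>L'\<^esub>"
    using hr A.L.ring_axioms B.L.ring_axioms by (intro ring_hom_zero) (auto simp: ring_iso_def)
  have hphi: "h (phi L \<alpha> x) = phi L' \<alpha> (h x)" if "\<alpha> \<in> carrier \<pi>" "x \<in> carrier L" for \<alpha> x
    using h that by (simp add: crossed_iso_def)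
  have S: "A.G = B.G"
  proof -
    have "phi L \<alpha> i = i \<longleftrightarrow> phi L' \<alpha> i' = i'" if "\<alpha> \<in> carrier \<pi>" for \<alpha>
      using hphi[OF that A.point_carrier] hi
        inj_on_eq_iff[OF inj A.phi_closed[OF that A.point_carrier] A.point_carrier] by simp
    then show ?thesis by (auto simp: idem_stabilizer_def)
  qed
  obtain l where l: "corner_frame \<pi> L i l" using A.frame_exists by blast
  obtain \<theta> where "\<theta> \<in> carrier (Z2 A.H K)" and fc: "frame_cocycle \<pi> L i l \<theta>"
    using A.frame_cocycle_exists[OF l] by blast
  then have \<theta>: "\<theta> \<in> A.G \<times> A.G \<rightarrow> Units K" by (auto simp: Z2_def PiE_def)
  have "corner_frame \<pi> L' i' (h \<circ> l)"
    unfolding corner_frame_def S[symmetric]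
  proof
    fix \<alpha> assume \<alpha>: "\<alpha> \<in> A.G"
    note la = A.frameD[OF l \<alpha>]
    have "h (l \<alpha>) \<in> grade L' \<alpha>" using h la(1) A.stab_carrier[OF \<alpha>] unfolding crossed_iso_def by blast
    moreover have "i' \<otimes>\<^bsub>L'\<^esub> h (l \<alpha>) = h (l \<alpha>)"
      using hm(2)[OF A.point_carrier la(4)] la(2) hi by simp
    moreover have "h (l \<alpha>) \<noteq> \<zero>\<^bsub>L'\<^esub>"
      using inj h0 la(3,4) by (metis A.L.zero_closed inj_onD)
    ultimately show "(h \<circ> l) \<alpha> \<in> grade L' \<alpha> \<and> i' \<otimes>\<^bsub>L'\<^esub> (h \<circ> l) \<alpha> = (h \<circ> l) \<alpha> \<and> (h \<circ> l) \<alpha> \<noteq> \<zero>\<^bsub>L'\<^esub>"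
      by simp
  qed
  moreover have "frame_cocycle \<pi> L' i' (h \<circ> l) \<theta>"
    unfolding frame_cocycle_def S[symmetric]
  proof (intro ballI)
    fix \<alpha> \<beta> assume \<alpha>: "\<alpha> \<in> A.G" and \<beta>: "\<beta> \<in> A.G"
    note ab = subgroup.m_closed[OF A.stab_subgroup \<alpha> \<beta>]
    have t: "\<theta> (\<alpha>, \<beta>) \<in> carrier K" using \<theta> \<alpha> \<beta> by (auto simp: Pi_def A.K.Units_closed)
    have "(h \<circ> l) \<alpha> \<otimes>\<^bsub>L'\<^esub> (h \<circ> l) \<beta> = h (l \<alpha> \<otimes>\<^bsub>L\<^esub> l \<beta>)"
      using hm(2)[OF A.frameD(4)[OF l \<alpha>] A.frameD(4)[OF l \<beta>]] by simp
    also have "l \<alpha> \<otimes>\<^bsub>L\<^esub> l \<beta> = \<theta> (\<alpha>, \<beta>) \<odot>\<^bsub>L\<^esub> l (\<alpha> \<otimes>\<^bsub>\<pi>\<^esub> \<beta>)"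
      using fc \<alpha> \<beta> by (simp add: frame_cocycle_def)
    also have "h \<dots> = \<theta> (\<alpha>, \<beta>) \<odot>\<^bsub>L'\<^esub> (h \<circ> l) (\<alpha> \<otimes>\<^bsub>\<pi>\<^esub> \<beta>)"
      using h t A.frameD(4)[OF l ab] by (simp add: crossed_iso_def)
    finally show "(h \<circ> l) \<alpha> \<otimes>\<^bsub>L'\<^esub> (h \<circ> l) \<beta> = \<theta> (\<alpha>, \<beta>) \<odot>\<^bsub>L'\<^esub> (h \<circ> l) (\<alpha> \<otimes>\<^bsub>\<pi>\<^esub> \<beta>)" .
  qed
  ultimately have "corner_cocycles \<pi> K L' i' = cohomology_class B.H K \<theta>"
    using B.corner_cocycles_eq_class[of "h \<circ> l" \<theta>] \<theta> S by simp
  then show ?thesis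
    using A.corner_cocycles_eq_class[OF l \<theta> fc] S by (simp add: pair_invariant_def pL qL)
qed

section \<open>The algebra of a normalized cocycle\<close>

locale twisted = cocycle_group +
  fixes \<theta>
  assumes cocycle: "\<theta> \<in> carrier (Z2 G K)"
    and normalized: "\<theta> (\<one>\<^bsub>G\<^esub>, \<one>\<^bsub>G\<^esub>) = \<one>\<^bsub>K\<^esub>"
begin

abbreviation T where "T \<equiv> twisted_alg G K \<theta>"
abbreviation mon where "mon \<equiv> twisted_monom G K"
abbreviation supp where "supp f \<equiv> {\<alpha>\<in>carrier G. f \<alpha> \<noteq> \<zero>\<^bsub>K\<^esub>}"

lemma T_simps [simp]:
  "carrier T = twisted_carrier G K"
  "x \<otimes>\<^bsub>T\<^esub> y = twisted_mult G K \<theta> x y"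
  "\<one>\<^bsub>T\<^esub> = mon \<one>\<^bsub>G\<^esub> \<one>\<^bsub>K\<^esub>"
  "\<zero>\<^bsub>T\<^esub> = (\<lambda>\<gamma>\<in>carrier G. \<zero>\<^bsub>K\<^esub>)"
  "x \<oplus>\<^bsub>T\<^esub> y = (\<lambda>\<gamma>\<in>carrier G. x \<gamma> \<oplus>\<^bsub>K\<^esub> y \<gamma>)"
  "c \<odot>\<^bsub>T\<^esub> x = (\<lambda>\<gamma>\<in>carrier G. c \<otimes>\<^bsub>K\<^esub> x \<gamma>)"
  "grade T \<alpha> = mon \<alpha> ` carrier K"
  by (simp_all add: twisted_alg_def)

subsection \<open>The underlying module\<close>

lemma carrierD:
  assumes "f \<in> twisted_carrier G K"
  shows "\<gamma> \<in> carrier G \<Longrightarrow> f \<gamma> \<in> carrier K" "finite (supp f)" "f \<in> extensional (carrier G)"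
  using assms by (auto simp: twisted_carrier_def PiE_def)

lemma carrier_eqI:
  assumes "f \<in> twisted_carrier G K" "g \<in> twisted_carrier G K"
    and "\<And>\<gamma>. \<gamma> \<in> carrier G \<Longrightarrow> f \<gamma> = g \<gamma>"
  shows "f = g"
  using extensionalityI[OF carrierD(3)[OF assms(1)] carrierD(3)[OF assms(2)]] assms(3) .

lemma carrierI:
  assumes "\<And>\<gamma>. \<gamma> \<in> carrier G \<Longrightarrow> f \<gamma> \<in> carrier K" "finite S"
    and "\<And>\<gamma>. \<gamma> \<in> carrier G \<Longrightarrow> \<gamma> \<notin> S \<Longrightarrow> f \<gamma> = \<zero>\<^bsub>K\<^esub>"
  shows "(\<lambda>\<gamma>\<in>carrier G. f \<gamma>) \<in> twisted_carrier G K"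
proof -
  have "{\<alpha>\<in>carrier G. (\<lambda>\<gamma>\<in>carrier G. f \<gamma>) \<alpha> \<noteq> \<zero>\<^bsub>K\<^esub>} \<subseteq> S" using assms(3) by auto
  then have "finite {\<alpha>\<in>carrier G. (\<lambda>\<gamma>\<in>carrier G. f \<gamma>) \<alpha> \<noteq> \<zero>\<^bsub>K\<^esub>}"
    using assms(2) finite_subset by blast
  moreover have "(\<lambda>\<gamma>\<in>carrier G. f \<gamma>) \<in> carrier G \<rightarrow>\<^sub>E carrier K" using assms(1) by auto
  ultimately show ?thesis unfolding twisted_carrier_def by blast
qed

lemma zero_closed: "(\<lambda>\<gamma>\<in>carrier G. \<zero>\<^bsub>K\<^esub>) \<in> twisted_carrier G K"
  by (rule carrierI[of _ "{}"]) auto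

lemma add_closed:
  assumes "f \<in> twisted_carrier G K" "g \<in> twisted_carrier G K"
  shows "(\<lambda>\<gamma>\<in>carrier G. f \<gamma> \<oplus>\<^bsub>K\<^esub> g \<gamma>) \<in> twisted_carrier G K"
  using assms[THEN carrierD(1)] assms[THEN carrierD(2)]
  by (intro carrierI[of _ "supp f \<union> supp g"]) auto

lemma smult_closed:
  assumes "c \<in> carrier K" "f \<in> twisted_carrier G K"
  shows "(\<lambda>\<gamma>\<in>carrier G. c \<otimes>\<^bsub>K\<^esub> f \<gamma>) \<in> twisted_carrier G K"
  using assms carrierD[OF assms(2)] by (intro carrierI[of _ "supp f"]) auto

lemma mon_closed: "c \<in> carrier K \<Longrightarrow> mon \<alpha> c \<in> twisted_carrier G K"
  unfolding twisted_monom_def by (rule carrierI[of _ "{\<alpha>}"]) auto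

lemma mon_apply: "\<gamma> \<in> carrier G \<Longrightarrow> mon \<alpha> c \<gamma> = (if \<gamma> = \<alpha> then c else \<zero>\<^bsub>K\<^esub>)"
  by (simp add: twisted_monom_def)

lemma abelian_group_T: "abelian_group T"
proof (rule abelian_groupI)
  show "x \<oplus>\<^bsub>T\<^esub> y \<in> carrier T" if "x \<in> carrier T" "y \<in> carrier T" for x y
    using that add_closed by simp
  show "\<zero>\<^bsub>T\<^esub> \<in> carrier T" using zero_closed by simp
  show "x \<oplus>\<^bsub>T\<^esub> y \<oplus>\<^bsub>T\<^esub> z = x \<oplus>\<^bsub>T\<^esub> (y \<oplus>\<^bsub>T\<^esub> z)"
    if "x \<in> carrier T" "y \<in> carrier T" "z \<in> carrier T" for x y z
    using that[simplified, THEN carrierD(1)] by (auto simp: K.a_assoc intro!: restrict_ext)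
  show "x \<oplus>\<^bsub>T\<^esub> y = y \<oplus>\<^bsub>T\<^esub> x" if "x \<in> carrier T" "y \<in> carrier T" for x y
    using that[simplified, THEN carrierD(1)] by (auto simp: K.a_comm intro!: restrict_ext)
  show "\<zero>\<^bsub>T\<^esub> \<oplus>\<^bsub>T\<^esub> x = x" if "x \<in> carrier T" for x
    using that add_closed[OF zero_closed, of x] carrierD(1)[of x]
    by (intro carrier_eqI) auto
  show "\<exists>y\<in>carrier T. y \<oplus>\<^bsub>T\<^esub> x = \<zero>\<^bsub>T\<^esub>" if "x \<in> carrier T" for x
  proof
    show "(\<lambda>\<gamma>\<in>carrier G. \<ominus>\<^bsub>K\<^esub> x \<gamma>) \<in> carrier T"
      using that carrierD[of x] by (auto intro!: carrierI[of _ "supp x"])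
    show "(\<lambda>\<gamma>\<in>carrier G. \<ominus>\<^bsub>K\<^esub> x \<gamma>) \<oplus>\<^bsub>T\<^esub> x = \<zero>\<^bsub>T\<^esub>"
      using that carrierD[of x] by (auto simp: K.l_neg intro!: restrict_ext)
  qed
qed

lemma module_T: "module K T"
proof (rule moduleI[OF K.is_cring abelian_group_T])
  show "c \<odot>\<^bsub>T\<^esub> x \<in> carrier T" if "c \<in> carrier K" "x \<in> carrier T" for c x
    using that smult_closed by simp
  show "(c \<oplus>\<^bsub>K\<^esub> d) \<odot>\<^bsub>T\<^esub> x = c \<odot>\<^bsub>T\<^esub> x \<oplus>\<^bsub>T\<^esub> d \<odot>\<^bsub>T\<^esub> x"
    if "c \<in> carrier K" "d \<in> carrier K" "x \<in> carrier T" for c d x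
    using that carrierD(1)[of x] by (auto simp: K.l_distr intro!: restrict_ext)
  show "c \<odot>\<^bsub>T\<^esub> (x \<oplus>\<^bsub>T\<^esub> y) = c \<odot>\<^bsub>T\<^esub> x \<oplus>\<^bsub>T\<^esub> c \<odot>\<^bsub>T\<^esub> y"
    if "c \<in> carrier K" "x \<in> carrier T" "y \<in> carrier T" for c x y
    using that carrierD(1)[of x] carrierD(1)[of y] by (auto simp: K.r_distr intro!: restrict_ext)
  show "(c \<otimes>\<^bsub>K\<^esub> d) \<odot>\<^bsub>T\<^esub> x = c \<odot>\<^bsub>T\<^esub> (d \<odot>\<^bsub>T\<^esub> x)"
    if "c \<in> carrier K" "d \<in> carrier K" "x \<in> carrier T" for c d x
    using that carrierD(1)[of x] by (auto simp: K.m_assoc intro!: restrict_ext)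
  show "\<one>\<^bsub>K\<^esub> \<odot>\<^bsub>T\<^esub> x = x" if "x \<in> carrier T" for x
    using that smult_closed[of "\<one>\<^bsub>K\<^esub>" x] carrierD(1)[of x] by (intro carrier_eqI) auto
qed

text \<open>
  The multilinear identities for the product need to be checked on basis vectors only, where they
  reduce to the cocycle identity.
\<close>

lemma monomial_induct [consumes 1, case_names zero add monomial]:
  assumes "f \<in> twisted_carrier G K"
    and zero: "P \<zero>\<^bsub>T\<^esub>"
    and add: "\<And>f g. f \<in> twisted_carrier G K \<Longrightarrow> g \<in> twisted_carrier G K \<Longrightarrow> P f \<Longrightarrow> P g \<Longrightarrow> P (f \<oplus>\<^bsub>T\<^esub> g)"
    and monomial: "\<And>\<alpha> c. \<alpha> \<in> carrier G \<Longrightarrow> c \<in> carrier K \<Longrightarrow> P (mon \<alpha> c)"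
  shows "P f"
proof -
  have "P f" if "finite S" "f \<in> twisted_carrier G K" "supp f \<subseteq> S" for S f
    using that
  proof (induction S arbitrary: f rule: finite_induct)
    case empty
    then have "f = \<zero>\<^bsub>T\<^esub>" using zero_closed by (intro carrier_eqI) auto
    with zero show ?case by (simp only:)
  next
    case (insert a S)
    show ?case
    proof (cases "a \<in> carrier G")
      case False
      then have "supp f \<subseteq> S" using insert.prems(2) by auto
      then show ?thesis using insert.IH insert.prems(1) by simp
    next
      case True
      define g where "g = (\<lambda>\<gamma>\<in>carrier G. if \<gamma> = a then \<zero>\<^bsub>K\<^esub> else f \<gamma>)"
      have g: "g \<in> twisted_carrier G K" unfolding g_def
        using carrierD[OF insert.prems(1)] by (intro carrierI[of _ "supp f"]) auto
      have "f = g \<oplus>\<^bsub>T\<^esub> mon a (f a)"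
        using insert.prems(1) add_closed[OF g mon_closed[of "f a"]]
          carrierD(1)[OF insert.prems(1)] True
        by (intro carrier_eqI) (auto simp: g_def mon_apply)
      moreover have "P g"
        using insert.prems(2) by (intro insert.IH g) (auto simp: g_def)
      ultimately show ?thesis
        using add[OF g mon_closed] monomial[OF True] carrierD(1)[OF insert.prems(1) True] by metis
    qed
  qed
  then show ?thesis using assms(1) carrierD(2) by blast
qed

subsection \<open>The product\<close>

lemma \<theta>_units: "\<alpha> \<in> carrier G \<Longrightarrow> \<beta> \<in> carrier G \<Longrightarrow> \<theta> (\<alpha>, \<beta>) \<in> Units K"
  using cocycle by (auto simp: Z2_def PiE_def Pi_def)

lemma \<theta>_closed: "\<alpha> \<in> carrier G \<Longrightarrow> \<beta> \<in> carrier G \<Longrightarrow> \<theta> (\<alpha>, \<beta>) \<in> carrier K"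
  using \<theta>_units K.Units_closed by blast

lemma \<theta>_cocycle:
  "\<alpha> \<in> carrier G \<Longrightarrow> \<beta> \<in> carrier G \<Longrightarrow> \<gamma> \<in> carrier G \<Longrightarrow>
    \<theta> (\<alpha>, \<beta>) \<otimes>\<^bsub>K\<^esub> \<theta> (\<alpha> \<otimes>\<^bsub>G\<^esub> \<beta>, \<gamma>) = \<theta> (\<alpha>, \<beta> \<otimes>\<^bsub>G\<^esub> \<gamma>) \<otimes>\<^bsub>K\<^esub> \<theta> (\<beta>, \<gamma>)"
  using cocycle by (auto simp: Z2_def)

lemma \<theta>_nonzero: "\<alpha> \<in> carrier G \<Longrightarrow> \<beta> \<in> carrier G \<Longrightarrow> \<theta> (\<alpha>, \<beta>) \<noteq> \<zero>\<^bsub>K\<^esub>"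
  using \<theta>_units K.field_Units by auto

lemma \<theta>_one_left: "\<alpha> \<in> carrier G \<Longrightarrow> \<theta> (\<one>\<^bsub>G\<^esub>, \<alpha>) = \<one>\<^bsub>K\<^esub>"
  using \<theta>_cocycle[of "\<one>\<^bsub>G\<^esub>" "\<one>\<^bsub>G\<^esub>" \<alpha>] normalized \<theta>_closed[of "\<one>\<^bsub>G\<^esub>" \<alpha>] \<theta>_nonzero[of "\<one>\<^bsub>G\<^esub>" \<alpha>]
    K.m_lcancel[of "\<theta> (\<one>\<^bsub>G\<^esub>, \<alpha>)" "\<theta> (\<one>\<^bsub>G\<^esub>, \<alpha>)" "\<one>\<^bsub>K\<^esub>"] by auto

lemma \<theta>_one_right: "\<alpha> \<in> carrier G \<Longrightarrow> \<theta> (\<alpha>, \<one>\<^bsub>G\<^esub>) = \<one>\<^bsub>K\<^esub>"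
  using \<theta>_cocycle[of \<alpha> "\<one>\<^bsub>G\<^esub>" "\<one>\<^bsub>G\<^esub>"] normalized \<theta>_closed[of \<alpha> "\<one>\<^bsub>G\<^esub>"] \<theta>_nonzero[of \<alpha> "\<one>\<^bsub>G\<^esub>"]
    K.m_lcancel[of "\<theta> (\<alpha>, \<one>\<^bsub>G\<^esub>)" "\<theta> (\<alpha>, \<one>\<^bsub>G\<^esub>)" "\<one>\<^bsub>K\<^esub>"] by auto

text \<open>
  The cocycle identity for \<open>(\<alpha>, \<alpha>\<^sup>-\<^sup>1, \<alpha>)\<close>; it is what makes the form symmetric.
\<close>

lemma \<theta>_inverse:
  assumes "\<alpha> \<in> carrier G"
  shows "\<theta> (inv\<^bsub>G\<^esub> \<alpha>, \<alpha>) = \<theta> (\<alpha>, inv\<^bsub>G\<^esub> \<alpha>)"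
  using \<theta>_cocycle[of \<alpha> "inv\<^bsub>G\<^esub> \<alpha>" \<alpha>] assms \<theta>_closed[of \<alpha> "inv\<^bsub>G\<^esub> \<alpha>"] \<theta>_closed[of "inv\<^bsub>G\<^esub> \<alpha>" \<alpha>]
  by (simp add: \<theta>_one_left \<theta>_one_right)

text \<open>
  Extending the sum from the support of \<open>f\<close> to a larger finite set gives a formula that is
  visibly additive in \<open>f\<close>.
\<close>

lemma mult_apply:
  assumes f: "f \<in> twisted_carrier G K" and g: "g \<in> twisted_carrier G K" and \<gamma>: "\<gamma> \<in> carrier G"
    and S: "finite S" "S \<subseteq> carrier G" "supp f \<subseteq> S"
  shows "twisted_mult G K \<theta> f g \<gamma> =
    (\<Oplus>\<^bsub>K\<^esub>\<alpha>\<in>S. f \<alpha> \<otimes>\<^bsub>K\<^esub> g (inv\<^bsub>G\<^esub> \<alpha> \<otimes>\<^bsub>G\<^esub> \<gamma>) \<otimes>\<^bsub>K\<^esub> \<theta> (\<alpha>, inv\<^bsub>G\<^esub> \<alpha> \<otimes>\<^bsub>G\<^esub> \<gamma>))"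
proof -
  have "(\<Oplus>\<^bsub>K\<^esub>\<alpha>\<in>supp f. f \<alpha> \<otimes>\<^bsub>K\<^esub> g (inv\<^bsub>G\<^esub> \<alpha> \<otimes>\<^bsub>G\<^esub> \<gamma>) \<otimes>\<^bsub>K\<^esub> \<theta> (\<alpha>, inv\<^bsub>G\<^esub> \<alpha> \<otimes>\<^bsub>G\<^esub> \<gamma>)) =
      (\<Oplus>\<^bsub>K\<^esub>\<alpha>\<in>S. f \<alpha> \<otimes>\<^bsub>K\<^esub> g (inv\<^bsub>G\<^esub> \<alpha> \<otimes>\<^bsub>G\<^esub> \<gamma>) \<otimes>\<^bsub>K\<^esub> \<theta> (\<alpha>, inv\<^bsub>G\<^esub> \<alpha> \<otimes>\<^bsub>G\<^esub> \<gamma>))"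
  proof (rule K.add.finprod_mono_neutral_cong_left)
    show "f \<alpha> \<otimes>\<^bsub>K\<^esub> g (inv\<^bsub>G\<^esub> \<alpha> \<otimes>\<^bsub>G\<^esub> \<gamma>) \<otimes>\<^bsub>K\<^esub> \<theta> (\<alpha>, inv\<^bsub>G\<^esub> \<alpha> \<otimes>\<^bsub>G\<^esub> \<gamma>) = \<zero>\<^bsub>K\<^esub>" if "\<alpha> \<in> S - supp f" for \<alpha>
    proof -
      have a: "\<alpha> \<in> carrier G" "f \<alpha> = \<zero>\<^bsub>K\<^esub>" using that S(2) by auto
      show ?thesis
        using a \<gamma> carrierD(1)[OF g, of "inv\<^bsub>G\<^esub> \<alpha> \<otimes>\<^bsub>G\<^esub> \<gamma>"] \<theta>_closed[of \<alpha> "inv\<^bsub>G\<^esub> \<alpha> \<otimes>\<^bsub>G\<^esub> \<gamma>"] by simp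
    qed
  qed (use S \<gamma> carrierD(1)[OF f] carrierD(1)[OF g] \<theta>_closed in \<open>auto intro!: K.m_closed\<close>)
  then show ?thesis using \<gamma> by (simp add: twisted_mult_def)
qed

lemma mon_mult_apply:
  assumes "\<alpha> \<in> carrier G" "c \<in> carrier K" "g \<in> twisted_carrier G K" "\<gamma> \<in> carrier G"
  shows "twisted_mult G K \<theta> (mon \<alpha> c) g \<gamma> =
    c \<otimes>\<^bsub>K\<^esub> g (inv\<^bsub>G\<^esub> \<alpha> \<otimes>\<^bsub>G\<^esub> \<gamma>) \<otimes>\<^bsub>K\<^esub> \<theta> (\<alpha>, inv\<^bsub>G\<^esub> \<alpha> \<otimes>\<^bsub>G\<^esub> \<gamma>)"
proof -
  have "twisted_mult G K \<theta> (mon \<alpha> c) g \<gamma> =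
    (\<Oplus>\<^bsub>K\<^esub>\<delta>\<in>{\<alpha>}. mon \<alpha> c \<delta> \<otimes>\<^bsub>K\<^esub> g (inv\<^bsub>G\<^esub> \<delta> \<otimes>\<^bsub>G\<^esub> \<gamma>) \<otimes>\<^bsub>K\<^esub> \<theta> (\<delta>, inv\<^bsub>G\<^esub> \<delta> \<otimes>\<^bsub>G\<^esub> \<gamma>))"
    using assms mon_closed by (intro mult_apply) (auto simp: mon_apply split: if_splits)
  then show ?thesis
    using assms carrierD(1)[OF assms(3)] \<theta>_closed by (simp add: mon_apply)
qed

lemma mult_closed:
  assumes f: "f \<in> twisted_carrier G K" and g: "g \<in> twisted_carrier G K"
  shows "twisted_mult G K \<theta> f g \<in> twisted_carrier G K"
  unfolding twisted_mult_def
proof (rule carrierI[where S = "(\<lambda>(\<alpha>, \<beta>). \<alpha> \<otimes>\<^bsub>G\<^esub> \<beta>) ` (supp f \<times> supp g)"])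
  show "(\<Oplus>\<^bsub>K\<^esub>\<alpha>\<in>supp f. f \<alpha> \<otimes>\<^bsub>K\<^esub> g (inv\<^bsub>G\<^esub> \<alpha> \<otimes>\<^bsub>G\<^esub> \<gamma>) \<otimes>\<^bsub>K\<^esub> \<theta> (\<alpha>, inv\<^bsub>G\<^esub> \<alpha> \<otimes>\<^bsub>G\<^esub> \<gamma>)) \<in> carrier K"
    if "\<gamma> \<in> carrier G" for \<gamma>
    using that carrierD(1)[OF f] carrierD(1)[OF g] \<theta>_closed
    by (intro K.finsum_closed) (auto intro!: K.m_closed)
  show "finite ((\<lambda>(\<alpha>, \<beta>). \<alpha> \<otimes>\<^bsub>G\<^esub> \<beta>) ` (supp f \<times> supp g))"
    using carrierD(2)[OF f] carrierD(2)[OF g] by blast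
  fix \<gamma> assume \<gamma>: "\<gamma> \<in> carrier G" "\<gamma> \<notin> (\<lambda>(\<alpha>, \<beta>). \<alpha> \<otimes>\<^bsub>G\<^esub> \<beta>) ` (supp f \<times> supp g)"
  show "(\<Oplus>\<^bsub>K\<^esub>\<alpha>\<in>supp f. f \<alpha> \<otimes>\<^bsub>K\<^esub> g (inv\<^bsub>G\<^esub> \<alpha> \<otimes>\<^bsub>G\<^esub> \<gamma>) \<otimes>\<^bsub>K\<^esub> \<theta> (\<alpha>, inv\<^bsub>G\<^esub> \<alpha> \<otimes>\<^bsub>G\<^esub> \<gamma>)) = \<zero>\<^bsub>K\<^esub>"
  proof (rule K.add.finprod_one_eqI)
    fix \<alpha> assume a: "\<alpha> \<in> supp f"
    let ?\<beta> = "inv\<^bsub>G\<^esub> \<alpha> \<otimes>\<^bsub>G\<^esub> \<gamma>"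
    have \<beta>: "?\<beta> \<in> carrier G" using a \<gamma> by simp
    have "\<gamma> = \<alpha> \<otimes>\<^bsub>G\<^esub> ?\<beta>" using a \<gamma> by (simp add: G.m_assoc[symmetric])
    then have "?\<beta> \<notin> supp g" using \<gamma>(2) a by (metis (no_types, lifting) SigmaI case_prod_conv image_eqI)
    then have "g ?\<beta> = \<zero>\<^bsub>K\<^esub>" using \<beta> by simp
    then show "f \<alpha> \<otimes>\<^bsub>K\<^esub> g ?\<beta> \<otimes>\<^bsub>K\<^esub> \<theta> (\<alpha>, ?\<beta>) = \<zero>\<^bsub>K\<^esub>"
      using a \<beta> carrierD(1)[OF f] \<theta>_closed by simp
  qed
qed

lemma mon_mult_mon:
  assumes "\<alpha> \<in> carrier G" "\<beta> \<in> carrier G" "c \<in> carrier K" "d \<in> carrier K"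
  shows "twisted_mult G K \<theta> (mon \<alpha> c) (mon \<beta> d) = mon (\<alpha> \<otimes>\<^bsub>G\<^esub> \<beta>) (c \<otimes>\<^bsub>K\<^esub> d \<otimes>\<^bsub>K\<^esub> \<theta> (\<alpha>, \<beta>))"
proof (rule carrier_eqI)
  fix \<gamma> assume \<gamma>: "\<gamma> \<in> carrier G"
  have "inv\<^bsub>G\<^esub> \<alpha> \<otimes>\<^bsub>G\<^esub> \<gamma> = \<beta> \<longleftrightarrow> \<gamma> = \<alpha> \<otimes>\<^bsub>G\<^esub> \<beta>"
    using assms \<gamma> G.inv_solve_left'[of \<beta> \<alpha> \<gamma>] by auto
  then show "twisted_mult G K \<theta> (mon \<alpha> c) (mon \<beta> d) \<gamma> = mon (\<alpha> \<otimes>\<^bsub>G\<^esub> \<beta>) (c \<otimes>\<^bsub>K\<^esub> d \<otimes>\<^bsub>K\<^esub> \<theta> (\<alpha>, \<beta>)) \<gamma>"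
    using assms \<gamma> mon_closed \<theta>_closed by (auto simp: mon_mult_apply mon_apply)
qed (use assms mon_closed mult_closed \<theta>_closed in auto)

lemma mult_add_left:
  assumes "f \<in> twisted_carrier G K" "f' \<in> twisted_carrier G K" "g \<in> twisted_carrier G K"
  shows "(f \<oplus>\<^bsub>T\<^esub> f') \<otimes>\<^bsub>T\<^esub> g = f \<otimes>\<^bsub>T\<^esub> g \<oplus>\<^bsub>T\<^esub> f' \<otimes>\<^bsub>T\<^esub> g"
proof (rule carrier_eqI)
  let ?S = "supp f \<union> supp f'"
  have S: "finite ?S" "?S \<subseteq> carrier G" using assms carrierD(2) by auto
  note c = assms[THEN carrierD(1)]
  have sub: "supp f \<subseteq> ?S" "supp f' \<subseteq> ?S" "supp (f \<oplus>\<^bsub>T\<^esub> f') \<subseteq> ?S" by auto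
  fix \<gamma> assume \<gamma>: "\<gamma> \<in> carrier G"
  let ?g = "\<lambda>\<alpha>. g (inv\<^bsub>G\<^esub> \<alpha> \<otimes>\<^bsub>G\<^esub> \<gamma>)" and ?t = "\<lambda>\<alpha>. \<theta> (\<alpha>, inv\<^bsub>G\<^esub> \<alpha> \<otimes>\<^bsub>G\<^esub> \<gamma>)"
  have gt: "?g \<alpha> \<in> carrier K" "?t \<alpha> \<in> carrier K" if "\<alpha> \<in> carrier G" for \<alpha>
    using that \<gamma> c(3) \<theta>_closed by auto
  have "((f \<oplus>\<^bsub>T\<^esub> f') \<otimes>\<^bsub>T\<^esub> g) \<gamma> = (\<Oplus>\<^bsub>K\<^esub>\<alpha>\<in>?S. (f \<oplus>\<^bsub>T\<^esub> f') \<alpha> \<otimes>\<^bsub>K\<^esub> ?g \<alpha> \<otimes>\<^bsub>K\<^esub> ?t \<alpha>)"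
    using mult_apply[OF add_closed[OF assms(1,2)] assms(3) \<gamma> S] sub(3) by simp
  also have "\<dots> = (\<Oplus>\<^bsub>K\<^esub>\<alpha>\<in>?S. f \<alpha> \<otimes>\<^bsub>K\<^esub> ?g \<alpha> \<otimes>\<^bsub>K\<^esub> ?t \<alpha> \<oplus>\<^bsub>K\<^esub> f' \<alpha> \<otimes>\<^bsub>K\<^esub> ?g \<alpha> \<otimes>\<^bsub>K\<^esub> ?t \<alpha>)"
    using c gt by (intro K.finsum_cong') (auto simp: K.l_distr)
  also have "\<dots> = (f \<otimes>\<^bsub>T\<^esub> g \<oplus>\<^bsub>T\<^esub> f' \<otimes>\<^bsub>T\<^esub> g) \<gamma>"
    using mult_apply[OF assms(1,3) \<gamma> S sub(1)] mult_apply[OF assms(2,3) \<gamma> S sub(2)] c gt \<gamma>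
    by (subst K.finsum_addf) auto
  finally show "((f \<oplus>\<^bsub>T\<^esub> f') \<otimes>\<^bsub>T\<^esub> g) \<gamma> = (f \<otimes>\<^bsub>T\<^esub> g \<oplus>\<^bsub>T\<^esub> f' \<otimes>\<^bsub>T\<^esub> g) \<gamma>" .
qed (use assms mult_closed add_closed in auto)

lemma mult_add_right:
  assumes "f \<in> twisted_carrier G K" "g \<in> twisted_carrier G K" "g' \<in> twisted_carrier G K"
  shows "f \<otimes>\<^bsub>T\<^esub> (g \<oplus>\<^bsub>T\<^esub> g') = f \<otimes>\<^bsub>T\<^esub> g \<oplus>\<^bsub>T\<^esub> f \<otimes>\<^bsub>T\<^esub> g'"
proof (rule carrier_eqI)
  note c = assms[THEN carrierD(1)] and S = carrierD(2)[OF assms(1)]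
  fix \<gamma> assume \<gamma>: "\<gamma> \<in> carrier G"
  let ?i = "\<lambda>\<alpha>. inv\<^bsub>G\<^esub> \<alpha> \<otimes>\<^bsub>G\<^esub> \<gamma>"
  have gt: "g (?i \<alpha>) \<in> carrier K" "g' (?i \<alpha>) \<in> carrier K" "\<theta> (\<alpha>, ?i \<alpha>) \<in> carrier K"
    if "\<alpha> \<in> carrier G" for \<alpha>
    using that \<gamma> c \<theta>_closed by auto
  have "(f \<otimes>\<^bsub>T\<^esub> (g \<oplus>\<^bsub>T\<^esub> g')) \<gamma> =
      (\<Oplus>\<^bsub>K\<^esub>\<alpha>\<in>supp f. f \<alpha> \<otimes>\<^bsub>K\<^esub> (g \<oplus>\<^bsub>T\<^esub> g') (?i \<alpha>) \<otimes>\<^bsub>K\<^esub> \<theta> (\<alpha>, ?i \<alpha>))"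
    using \<gamma> by (simp add: twisted_mult_def)
  also have "\<dots> = (\<Oplus>\<^bsub>K\<^esub>\<alpha>\<in>supp f. f \<alpha> \<otimes>\<^bsub>K\<^esub> g (?i \<alpha>) \<otimes>\<^bsub>K\<^esub> \<theta> (\<alpha>, ?i \<alpha>) \<oplus>\<^bsub>K\<^esub>
      f \<alpha> \<otimes>\<^bsub>K\<^esub> g' (?i \<alpha>) \<otimes>\<^bsub>K\<^esub> \<theta> (\<alpha>, ?i \<alpha>))"
    using c gt \<gamma> by (intro K.finsum_cong') (auto simp: K.l_distr K.r_distr)
  also have "\<dots> = (f \<otimes>\<^bsub>T\<^esub> g \<oplus>\<^bsub>T\<^esub> f \<otimes>\<^bsub>T\<^esub> g') \<gamma>"
    using c gt \<gamma> by (subst K.finsum_addf) (auto simp: twisted_mult_def)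
  finally show "(f \<otimes>\<^bsub>T\<^esub> (g \<oplus>\<^bsub>T\<^esub> g')) \<gamma> = (f \<otimes>\<^bsub>T\<^esub> g \<oplus>\<^bsub>T\<^esub> f \<otimes>\<^bsub>T\<^esub> g') \<gamma>" .
qed (use assms mult_closed add_closed in auto)

lemma mult_smult:
  assumes "c \<in> carrier K" "f \<in> twisted_carrier G K" "g \<in> twisted_carrier G K"
  shows "(c \<odot>\<^bsub>T\<^esub> f) \<otimes>\<^bsub>T\<^esub> g = c \<odot>\<^bsub>T\<^esub> (f \<otimes>\<^bsub>T\<^esub> g)" and "f \<otimes>\<^bsub>T\<^esub> (c \<odot>\<^bsub>T\<^esub> g) = c \<odot>\<^bsub>T\<^esub> (f \<otimes>\<^bsub>T\<^esub> g)"
proof -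
  note d = assms(2,3)[THEN carrierD(1)] and S = carrierD(2)[OF assms(2)]
  have *: "((c \<odot>\<^bsub>T\<^esub> f) \<otimes>\<^bsub>T\<^esub> g) \<gamma> = (c \<odot>\<^bsub>T\<^esub> (f \<otimes>\<^bsub>T\<^esub> g)) \<gamma> \<and>
      (f \<otimes>\<^bsub>T\<^esub> (c \<odot>\<^bsub>T\<^esub> g)) \<gamma> = (c \<odot>\<^bsub>T\<^esub> (f \<otimes>\<^bsub>T\<^esub> g)) \<gamma>" if \<gamma>: "\<gamma> \<in> carrier G" for \<gamma>
  proof -
    let ?i = "\<lambda>\<alpha>. inv\<^bsub>G\<^esub> \<alpha> \<otimes>\<^bsub>G\<^esub> \<gamma>"
    have gt: "f \<alpha> \<in> carrier K" "g (?i \<alpha>) \<in> carrier K" "\<theta> (\<alpha>, ?i \<alpha>) \<in> carrier K" "?i \<alpha> \<in> carrier G"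
      if "\<alpha> \<in> carrier G" for \<alpha>
      using that \<gamma> d \<theta>_closed by auto
    have r: "(c \<odot>\<^bsub>T\<^esub> (f \<otimes>\<^bsub>T\<^esub> g)) \<gamma> =
        (\<Oplus>\<^bsub>K\<^esub>\<alpha>\<in>supp f. c \<otimes>\<^bsub>K\<^esub> (f \<alpha> \<otimes>\<^bsub>K\<^esub> g (?i \<alpha>) \<otimes>\<^bsub>K\<^esub> \<theta> (\<alpha>, ?i \<alpha>)))"
      using \<gamma> gt assms(1) S by (simp add: twisted_mult_def, intro K.finsum_rdistr) auto
    have "((c \<odot>\<^bsub>T\<^esub> f) \<otimes>\<^bsub>T\<^esub> g) \<gamma> =
        (\<Oplus>\<^bsub>K\<^esub>\<alpha>\<in>supp f. (c \<odot>\<^bsub>T\<^esub> f) \<alpha> \<otimes>\<^bsub>K\<^esub> g (?i \<alpha>) \<otimes>\<^bsub>K\<^esub> \<theta> (\<alpha>, ?i \<alpha>))"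
      unfolding T_simps using assms(1)
      by (intro mult_apply smult_closed assms \<gamma> S) auto
    also have "\<dots> = (\<Oplus>\<^bsub>K\<^esub>\<alpha>\<in>supp f. c \<otimes>\<^bsub>K\<^esub> (f \<alpha> \<otimes>\<^bsub>K\<^esub> g (?i \<alpha>) \<otimes>\<^bsub>K\<^esub> \<theta> (\<alpha>, ?i \<alpha>)))"
      using gt assms(1) by (intro K.finsum_cong') (auto simp: K.m_assoc)
    finally have 1: "((c \<odot>\<^bsub>T\<^esub> f) \<otimes>\<^bsub>T\<^esub> g) \<gamma> = (c \<odot>\<^bsub>T\<^esub> (f \<otimes>\<^bsub>T\<^esub> g)) \<gamma>" using r by simp
    have "(f \<otimes>\<^bsub>T\<^esub> (c \<odot>\<^bsub>T\<^esub> g)) \<gamma> =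
        (\<Oplus>\<^bsub>K\<^esub>\<alpha>\<in>supp f. f \<alpha> \<otimes>\<^bsub>K\<^esub> (c \<odot>\<^bsub>T\<^esub> g) (?i \<alpha>) \<otimes>\<^bsub>K\<^esub> \<theta> (\<alpha>, ?i \<alpha>))"
      using \<gamma> by (simp add: twisted_mult_def)
    also have "\<dots> = (\<Oplus>\<^bsub>K\<^esub>\<alpha>\<in>supp f. c \<otimes>\<^bsub>K\<^esub> (f \<alpha> \<otimes>\<^bsub>K\<^esub> g (?i \<alpha>) \<otimes>\<^bsub>K\<^esub> \<theta> (\<alpha>, ?i \<alpha>)))"
      using gt assms(1) by (intro K.finsum_cong') (auto simp: K.m_ac)
    finally show ?thesis using 1 r by simp
  qed
  have cl: "(c \<odot>\<^bsub>T\<^esub> f) \<otimes>\<^bsub>T\<^esub> g \<in> twisted_carrier G K" "f \<otimes>\<^bsub>T\<^esub> (c \<odot>\<^bsub>T\<^esub> g) \<in> twisted_carrier G K"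
    "c \<odot>\<^bsub>T\<^esub> (f \<otimes>\<^bsub>T\<^esub> g) \<in> twisted_carrier G K"
    using assms mult_closed smult_closed by auto
  show "(c \<odot>\<^bsub>T\<^esub> f) \<otimes>\<^bsub>T\<^esub> g = c \<odot>\<^bsub>T\<^esub> (f \<otimes>\<^bsub>T\<^esub> g)" using carrier_eqI[OF cl(1,3)] * by blast
  show "f \<otimes>\<^bsub>T\<^esub> (c \<odot>\<^bsub>T\<^esub> g) = c \<odot>\<^bsub>T\<^esub> (f \<otimes>\<^bsub>T\<^esub> g)" using carrier_eqI[OF cl(2,3)] * by blast
qed

lemma mult_zero:
  assumes "f \<in> twisted_carrier G K"
  shows "\<zero>\<^bsub>T\<^esub> \<otimes>\<^bsub>T\<^esub> f = \<zero>\<^bsub>T\<^esub>" "f \<otimes>\<^bsub>T\<^esub> \<zero>\<^bsub>T\<^esub> = \<zero>\<^bsub>T\<^esub>"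
proof -
  interpret T: module K T by (rule module_T)
  have 0: "\<zero>\<^bsub>K\<^esub> \<odot>\<^bsub>T\<^esub> g = \<zero>\<^bsub>T\<^esub>" if "g \<in> carrier T" for g using T.smult_l_null[OF that] .
  have f: "f \<in> carrier T" and z: "\<zero>\<^bsub>T\<^esub> \<in> carrier T" and m: "\<zero>\<^bsub>T\<^esub> \<otimes>\<^bsub>T\<^esub> f \<in> carrier T" "f \<otimes>\<^bsub>T\<^esub> \<zero>\<^bsub>T\<^esub> \<in> carrier T"
    using assms zero_closed mult_closed by auto
  show "\<zero>\<^bsub>T\<^esub> \<otimes>\<^bsub>T\<^esub> f = \<zero>\<^bsub>T\<^esub>"
    using mult_smult(1)[of "\<zero>\<^bsub>K\<^esub>" "\<zero>\<^bsub>T\<^esub>" f] z assms unfolding 0[OF z] 0[OF m(1)] by simp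
  show "f \<otimes>\<^bsub>T\<^esub> \<zero>\<^bsub>T\<^esub> = \<zero>\<^bsub>T\<^esub>"
    using mult_smult(2)[of "\<zero>\<^bsub>K\<^esub>" f "\<zero>\<^bsub>T\<^esub>"] z assms unfolding 0[OF z] 0[OF m(2)] by simp
qed

declare T_simps [simp del]

lemma carrier_T: "carrier T = twisted_carrier G K"
  and one_T: "\<one>\<^bsub>T\<^esub> = mon \<one>\<^bsub>G\<^esub> \<one>\<^bsub>K\<^esub>"
  and grade_T: "grade T \<alpha> = mon \<alpha> ` carrier K"
  by (simp_all add: T_simps)

lemma T_apply:
  assumes "\<gamma> \<in> carrier G"
  shows T_add_apply: "(x \<oplus>\<^bsub>T\<^esub> y) \<gamma> = x \<gamma> \<oplus>\<^bsub>K\<^esub> y \<gamma>"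
    and T_smult_apply: "(c \<odot>\<^bsub>T\<^esub> x) \<gamma> = c \<otimes>\<^bsub>K\<^esub> x \<gamma>"
    and T_zero_apply: "\<zero>\<^bsub>T\<^esub> \<gamma> = \<zero>\<^bsub>K\<^esub>"
  using assms by (simp_all add: T_simps)

lemma T_mult_closed: "f \<in> carrier T \<Longrightarrow> g \<in> carrier T \<Longrightarrow> f \<otimes>\<^bsub>T\<^esub> g \<in> carrier T"
  using mult_closed by (simp add: T_simps)

lemma mon_carrier: "c \<in> carrier K \<Longrightarrow> mon \<alpha> c \<in> carrier T"
  using mon_closed by (simp add: T_simps)

lemma mon_mult:
  assumes "\<alpha> \<in> carrier G" "\<beta> \<in> carrier G" "c \<in> carrier K" "d \<in> carrier K"
  shows "mon \<alpha> c \<otimes>\<^bsub>T\<^esub> mon \<beta> d = mon (\<alpha> \<otimes>\<^bsub>G\<^esub> \<beta>) (c \<otimes>\<^bsub>K\<^esub> d \<otimes>\<^bsub>K\<^esub> \<theta> (\<alpha>, \<beta>))"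
  using mon_mult_mon[OF assms] by (simp add: T_simps)

lemma mon_smult: "c \<in> carrier K \<Longrightarrow> d \<in> carrier K \<Longrightarrow> c \<odot>\<^bsub>T\<^esub> mon \<alpha> d = mon \<alpha> (c \<otimes>\<^bsub>K\<^esub> d)"
  using smult_closed mon_closed by (intro carrier_eqI) (auto simp: T_simps mon_apply)

lemma mon_zero: "mon \<alpha> \<zero>\<^bsub>K\<^esub> = \<zero>\<^bsub>T\<^esub>"
  by (auto simp: T_simps twisted_monom_def)

lemma mon_eq_zero_iff:
  assumes "\<alpha> \<in> carrier G"
  shows "mon \<alpha> c = \<zero>\<^bsub>T\<^esub> \<longleftrightarrow> c = \<zero>\<^bsub>K\<^esub>"
  using mon_zero assms by (metis T_zero_apply mon_apply)

lemma T_induct [consumes 1, case_names zero add monomial]: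
  assumes "f \<in> carrier T" and "P \<zero>\<^bsub>T\<^esub>"
    and "\<And>f g. f \<in> carrier T \<Longrightarrow> g \<in> carrier T \<Longrightarrow> P f \<Longrightarrow> P g \<Longrightarrow> P (f \<oplus>\<^bsub>T\<^esub> g)"
    and "\<And>\<alpha> c. \<alpha> \<in> carrier G \<Longrightarrow> c \<in> carrier K \<Longrightarrow> P (mon \<alpha> c)"
  shows "P f"
  using monomial_induct[of f P] assms unfolding carrier_T by blast

lemma T_assoc:
  assumes "f \<in> carrier T" "g \<in> carrier T" "h \<in> carrier T"
  shows "f \<otimes>\<^bsub>T\<^esub> g \<otimes>\<^bsub>T\<^esub> h = f \<otimes>\<^bsub>T\<^esub> (g \<otimes>\<^bsub>T\<^esub> h)"
proof -
  interpret T: module K T by (rule module_T)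
  note bil = mult_add_left[folded carrier_T] mult_add_right[folded carrier_T] mult_zero[folded carrier_T]
    T_mult_closed
  have 1: "mon \<alpha> a \<otimes>\<^bsub>T\<^esub> mon \<beta> b \<otimes>\<^bsub>T\<^esub> mon \<gamma> c = mon \<alpha> a \<otimes>\<^bsub>T\<^esub> (mon \<beta> b \<otimes>\<^bsub>T\<^esub> mon \<gamma> c)"
    if g: "\<alpha> \<in> carrier G" "\<beta> \<in> carrier G" "\<gamma> \<in> carrier G" and k: "a \<in> carrier K" "b \<in> carrier K" "c \<in> carrier K"
    for \<alpha> \<beta> \<gamma> a b c
  proof -
    have t: "\<theta> (\<alpha>, \<beta>) \<in> carrier K" "\<theta> (\<beta>, \<gamma>) \<in> carrier K" "\<theta> (\<alpha> \<otimes>\<^bsub>G\<^esub> \<beta>, \<gamma>) \<in> carrier K"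
      "\<theta> (\<alpha>, \<beta> \<otimes>\<^bsub>G\<^esub> \<gamma>) \<in> carrier K"
      using g \<theta>_closed by auto
    have "(a \<otimes>\<^bsub>K\<^esub> b \<otimes>\<^bsub>K\<^esub> \<theta> (\<alpha>, \<beta>)) \<otimes>\<^bsub>K\<^esub> c \<otimes>\<^bsub>K\<^esub> \<theta> (\<alpha> \<otimes>\<^bsub>G\<^esub> \<beta>, \<gamma>) =
        a \<otimes>\<^bsub>K\<^esub> b \<otimes>\<^bsub>K\<^esub> c \<otimes>\<^bsub>K\<^esub> (\<theta> (\<alpha>, \<beta>) \<otimes>\<^bsub>K\<^esub> \<theta> (\<alpha> \<otimes>\<^bsub>G\<^esub> \<beta>, \<gamma>))"
      using k t by (simp add: K.m_ac)
    also have "\<dots> = a \<otimes>\<^bsub>K\<^esub> (b \<otimes>\<^bsub>K\<^esub> c \<otimes>\<^bsub>K\<^esub> \<theta> (\<beta>, \<gamma>)) \<otimes>\<^bsub>K\<^esub> \<theta> (\<alpha>, \<beta> \<otimes>\<^bsub>G\<^esub> \<gamma>)"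
      unfolding \<theta>_cocycle[OF g] using k t by (simp add: K.m_ac)
    finally show ?thesis using g k t by (simp add: mon_mult G.m_assoc)
  qed
  have 2: "mon \<alpha> a \<otimes>\<^bsub>T\<^esub> mon \<beta> b \<otimes>\<^bsub>T\<^esub> h = mon \<alpha> a \<otimes>\<^bsub>T\<^esub> (mon \<beta> b \<otimes>\<^bsub>T\<^esub> h)"
    if g: "\<alpha> \<in> carrier G" "\<beta> \<in> carrier G" and k: "a \<in> carrier K" "b \<in> carrier K" for \<alpha> \<beta> a b
    using assms(3)
  proof (induction rule: T_induct)
    case (monomial \<gamma> c)
    then show ?case using 1 g k by blast
  qed (use bil mon_carrier k in auto)
  have 3: "mon \<alpha> a \<otimes>\<^bsub>T\<^esub> g \<otimes>\<^bsub>T\<^esub> h = mon \<alpha> a \<otimes>\<^bsub>T\<^esub> (g \<otimes>\<^bsub>T\<^esub> h)"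
    if g: "\<alpha> \<in> carrier G" and k: "a \<in> carrier K" for \<alpha> a
    using assms(2)
  proof (induction rule: T_induct)
    case (monomial \<gamma> c)
    then show ?case using 2 g k by blast
  qed (use bil mon_carrier k assms(3) in auto)
  show ?thesis
    using assms(1)
  proof (induction rule: T_induct)
    case (monomial \<gamma> c)
    then show ?case using 3 by blast
  qed (use bil assms(2,3) in auto)
qed

lemma ring_T: "ring T"
proof (rule ringI[OF abelian_group_T])
  interpret T: module K T by (rule module_T)
  note bil = mult_add_left[folded carrier_T] mult_add_right[folded carrier_T] mult_zero[folded carrier_T]
    T_mult_closed
  have o: "\<one>\<^bsub>T\<^esub> \<in> carrier T" using mon_carrier one_T by simp
  have 1: "\<one>\<^bsub>T\<^esub> \<otimes>\<^bsub>T\<^esub> x = x \<and> x \<otimes>\<^bsub>T\<^esub> \<one>\<^bsub>T\<^esub> = x" if "x \<in> carrier T" for x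
    using that
  proof (induction rule: T_induct)
    case (monomial \<alpha> c)
    then show ?case using \<theta>_one_left \<theta>_one_right by (simp add: one_T mon_mult)
  qed (use bil o in auto)
  show "monoid T"
    by (rule monoidI) (use 1 o T_mult_closed T_assoc in auto)
  show "(x \<oplus>\<^bsub>T\<^esub> y) \<otimes>\<^bsub>T\<^esub> z = x \<otimes>\<^bsub>T\<^esub> z \<oplus>\<^bsub>T\<^esub> y \<otimes>\<^bsub>T\<^esub> z"
    "z \<otimes>\<^bsub>T\<^esub> (x \<oplus>\<^bsub>T\<^esub> y) = z \<otimes>\<^bsub>T\<^esub> x \<oplus>\<^bsub>T\<^esub> z \<otimes>\<^bsub>T\<^esub> y"
    if "x \<in> carrier T" "y \<in> carrier T" "z \<in> carrier T" for x y z
    using that bil by auto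
qed

sublocale T: ring T by (rule ring_T)
sublocale TM: module K T by (rule module_T)

subsection \<open>Grading\<close>

lemma T_finsum_apply:
  assumes "\<gamma> \<in> carrier G" "\<And>i. i \<in> S \<Longrightarrow> f i \<in> carrier T"
  shows "(\<Oplus>\<^bsub>T\<^esub>i\<in>S. f i) \<gamma> = (\<Oplus>\<^bsub>K\<^esub>i\<in>S. f i \<gamma>)"
  by (rule finsum_additive(2)[where V = "carrier T" and h = "\<lambda>x. x \<gamma>"])
    (use assms carrierD(1) in \<open>auto simp: T_add_apply carrier_T[symmetric] T.abelian_group_axioms K.abelian_group_axioms\<close>)

lemma pi_algebra_T: "pi_algebra G K T"
proof (intro pi_algebra.intro pi_algebra_axioms.intro)
  show "group G" "field K" "ring T" "module K T"
    by (rule G.is_group K.field_axioms ring_T module_T)+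
  show "(k \<odot>\<^bsub>T\<^esub> x) \<otimes>\<^bsub>T\<^esub> y = k \<odot>\<^bsub>T\<^esub> (x \<otimes>\<^bsub>T\<^esub> y)" "x \<otimes>\<^bsub>T\<^esub> (k \<odot>\<^bsub>T\<^esub> y) = k \<odot>\<^bsub>T\<^esub> (x \<otimes>\<^bsub>T\<^esub> y)"
    if "k \<in> carrier K" "x \<in> carrier T" "y \<in> carrier T" for k x y
    using that mult_smult by (simp_all add: carrier_T)
  have madd: "mon \<alpha> c \<oplus>\<^bsub>T\<^esub> mon \<alpha> d = mon \<alpha> (c \<oplus>\<^bsub>K\<^esub> d)" if "c \<in> carrier K" "d \<in> carrier K" for \<alpha> c d
    using that add_closed mon_closed by (intro carrier_eqI) (auto simp: T_simps mon_apply)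
  show "submodule (grade T \<alpha>) K T" if "\<alpha> \<in> carrier G" for \<alpha>
  proof (rule TM.submoduleI)
    show "\<ominus>\<^bsub>T\<^esub> a \<in> grade T \<alpha>" if a: "a \<in> grade T \<alpha>" for a
    proof -
      obtain c where c: "c \<in> carrier K" "a = mon \<alpha> c" using a by (auto simp: grade_T)
      have "\<ominus>\<^bsub>T\<^esub> a = (\<ominus>\<^bsub>K\<^esub> \<one>\<^bsub>K\<^esub>) \<odot>\<^bsub>T\<^esub> a"
        using c mon_carrier by (simp add: TM.smult_l_minus)
      then show ?thesis using c by (auto simp: mon_smult grade_T)
    qed
    show "\<zero>\<^bsub>T\<^esub> \<in> grade T \<alpha>" unfolding grade_T using mon_zero[of \<alpha>] K.zero_closed by (metis imageI)
  qed (use mon_carrier madd mon_smult in \<open>auto simp: grade_T\<close>)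
  show "projective_finite_type K T (grade T \<alpha>)" if \<alpha>: "\<alpha> \<in> carrier G" for \<alpha>
  proof (rule TM.projective_finite_typeI)
    show "dual_family K T (grade T \<alpha>) {()} (\<lambda>_. mon \<alpha> \<one>\<^bsub>K\<^esub>) (\<lambda>_ f. f \<alpha>)"
      unfolding dual_family_def
    proof (intro conjI ballI)
      fix v assume "v \<in> grade T \<alpha>"
      then obtain c where c: "c \<in> carrier K" "v = mon \<alpha> c" by (auto simp: grade_T)
      then show "v = (\<Oplus>\<^bsub>T\<^esub>i\<in>{()}. v \<alpha> \<odot>\<^bsub>T\<^esub> mon \<alpha> \<one>\<^bsub>K\<^esub>)"
        using \<alpha> mon_carrier by (simp add: mon_apply mon_smult)
    qed (use \<alpha> in \<open>auto simp: grade_T mon_apply T_add_apply T_smult_apply\<close>)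
    show "grade T \<alpha> \<subseteq> carrier T" using mon_carrier by (auto simp: grade_T)
  qed simp
  show "\<exists>!f. f \<in> (\<Pi>\<^sub>E \<alpha>\<in>carrier G. grade T \<alpha>) \<and> finite {\<alpha>\<in>carrier G. f \<alpha> \<noteq> \<zero>\<^bsub>T\<^esub>} \<and>
      x = (\<Oplus>\<^bsub>T\<^esub>\<alpha>\<in>{\<alpha>\<in>carrier G. f \<alpha> \<noteq> \<zero>\<^bsub>T\<^esub>}. f \<alpha>)" if x: "x \<in> carrier T" for x
  proof (rule direct_sum_by_projections[where pr = "\<lambda>\<alpha> f. mon \<alpha> (f \<alpha>)", OF T.abelian_group_axioms _ _ _ _ _ _ _ x])
    have xc: "x \<alpha> \<in> carrier K" if "\<alpha> \<in> carrier G" for \<alpha> using x that carrierD(1) carrier_T by auto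
    have S: "{\<alpha>\<in>carrier G. mon \<alpha> (x \<alpha>) \<noteq> \<zero>\<^bsub>T\<^esub>} = supp x" using mon_eq_zero_iff by auto
    have fin: "finite (supp x)" using x carrierD(2) carrier_T by auto
    show "finite {\<alpha>\<in>carrier G. mon \<alpha> (x \<alpha>) \<noteq> \<zero>\<^bsub>T\<^esub>}" using S fin by simp
    have mc: "mon \<alpha> (x \<alpha>) \<in> carrier T" if "\<alpha> \<in> supp x" for \<alpha> using that xc mon_carrier by auto
    show "x = (\<Oplus>\<^bsub>T\<^esub>\<alpha>\<in>{\<alpha>\<in>carrier G. mon \<alpha> (x \<alpha>) \<noteq> \<zero>\<^bsub>T\<^esub>}. mon \<alpha> (x \<alpha>))"
      unfolding S
    proof (rule carrier_eqI)
      show "x \<in> twisted_carrier G K" using x carrier_T by simp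
      show "(\<Oplus>\<^bsub>T\<^esub>\<alpha>\<in>supp x. mon \<alpha> (x \<alpha>)) \<in> twisted_carrier G K"
        using T.finsum_closed[of "\<lambda>\<alpha>. mon \<alpha> (x \<alpha>)" "supp x"] mc carrier_T by auto
      fix \<gamma> assume \<gamma>: "\<gamma> \<in> carrier G"
      have "(\<Oplus>\<^bsub>T\<^esub>\<alpha>\<in>supp x. mon \<alpha> (x \<alpha>)) \<gamma> = (\<Oplus>\<^bsub>K\<^esub>\<alpha>\<in>supp x. mon \<alpha> (x \<alpha>) \<gamma>)"
        by (rule T_finsum_apply[OF \<gamma> mc])
      also have "\<dots> = (\<Oplus>\<^bsub>K\<^esub>\<alpha>\<in>supp x. if \<gamma> = \<alpha> then x \<alpha> else \<zero>\<^bsub>K\<^esub>)"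
        using \<gamma> xc by (intro K.finsum_cong') (auto simp: mon_apply)
      also have "\<dots> = x \<gamma>"
      proof (cases "\<gamma> \<in> supp x")
        case True
        then show ?thesis using K.add.finprod_singleton[OF True fin, of x] xc by auto
      next
        case False
        then have "(\<Oplus>\<^bsub>K\<^esub>\<alpha>\<in>supp x. if \<gamma> = \<alpha> then x \<alpha> else \<zero>\<^bsub>K\<^esub>) = \<zero>\<^bsub>K\<^esub>"
          by (intro K.add.finprod_one_eqI) auto
        then show ?thesis using False \<gamma> by auto
      qed
      finally show "x \<gamma> = (\<Oplus>\<^bsub>T\<^esub>\<alpha>\<in>supp x. mon \<alpha> (x \<alpha>)) \<gamma>" by simp
    qed
  qed (use mon_carrier carrierD(1) madd mon_zero in
      \<open>auto simp: grade_T carrier_T T_add_apply mon_apply\<close>)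
  show "a \<otimes>\<^bsub>T\<^esub> b \<in> grade T (\<alpha> \<otimes>\<^bsub>G\<^esub> \<beta>)"
    if "\<alpha> \<in> carrier G" "\<beta> \<in> carrier G" "a \<in> grade T \<alpha>" "b \<in> grade T \<beta>" for \<alpha> \<beta> a b
    using that \<theta>_closed by (auto simp: grade_T mon_mult)
  show "\<one>\<^bsub>T\<^esub> \<in> grade T \<one>\<^bsub>G\<^esub>" by (auto simp: grade_T one_T)
qed

sublocale TP: pi_algebra G K T by (rule pi_algebra_T)

subsection \<open>Form and action\<close>

text \<open>
  The form is the coefficient at the neutral element of the product, so its associativity is that
  of the product.
\<close>

lemma eta_T:
  assumes "f \<in> carrier T" "g \<in> carrier T"
  shows "eta T f g = (f \<otimes>\<^bsub>T\<^esub> g) \<one>\<^bsub>G\<^esub>"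
proof -
  have "eta T f g = (\<Oplus>\<^bsub>K\<^esub>\<alpha>\<in>supp f. f \<alpha> \<otimes>\<^bsub>K\<^esub> g (inv\<^bsub>G\<^esub> \<alpha>) \<otimes>\<^bsub>K\<^esub> \<theta> (\<alpha>, inv\<^bsub>G\<^esub> \<alpha>))"
    by (simp add: twisted_alg_def)
  also have "\<dots> = (\<Oplus>\<^bsub>K\<^esub>\<alpha>\<in>supp f. f \<alpha> \<otimes>\<^bsub>K\<^esub> g (inv\<^bsub>G\<^esub> \<alpha> \<otimes>\<^bsub>G\<^esub> \<one>\<^bsub>G\<^esub>) \<otimes>\<^bsub>K\<^esub> \<theta> (\<alpha>, inv\<^bsub>G\<^esub> \<alpha> \<otimes>\<^bsub>G\<^esub> \<one>\<^bsub>G\<^esub>))"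
    using assms carrierD(1) \<theta>_closed by (intro K.finsum_cong') (auto simp: carrier_T intro!: K.m_closed)
  finally show ?thesis by (simp add: T_simps twisted_mult_def)
qed

lemma eta_T_mon:
  assumes "\<alpha> \<in> carrier G" "\<beta> \<in> carrier G" "c \<in> carrier K" "d \<in> carrier K"
  shows "eta T (mon \<alpha> c) (mon \<beta> d) =
    (if \<alpha> \<otimes>\<^bsub>G\<^esub> \<beta> = \<one>\<^bsub>G\<^esub> then c \<otimes>\<^bsub>K\<^esub> d \<otimes>\<^bsub>K\<^esub> \<theta> (\<alpha>, \<beta>) else \<zero>\<^bsub>K\<^esub>)"
  using assms mon_carrier by (auto simp: eta_T mon_mult mon_apply)

lemma T_apply_closed: "f \<in> carrier T \<Longrightarrow> \<gamma> \<in> carrier G \<Longrightarrow> f \<gamma> \<in> carrier K"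
  using carrierD(1) carrier_T by simp

lemma frobenius_T: "frobenius_pi_algebra G K T"
proof (intro frobenius_pi_algebra.intro frobenius_pi_algebra_axioms.intro)
  show "pi_algebra G K T" by (rule pi_algebra_T)
  show "eta T x y \<in> carrier K" if "x \<in> carrier T" "y \<in> carrier T" for x y
    using that T_apply_closed by (simp add: eta_T)
  have add: "eta T (x \<oplus>\<^bsub>T\<^esub> y) z = eta T x z \<oplus>\<^bsub>K\<^esub> eta T y z"
    "eta T z (x \<oplus>\<^bsub>T\<^esub> y) = eta T z x \<oplus>\<^bsub>K\<^esub> eta T z y"
    if "x \<in> carrier T" "y \<in> carrier T" "z \<in> carrier T" for x y z
    using that by (simp_all add: eta_T T.l_distr T.r_distr T_add_apply)
  then show "eta T (x \<oplus>\<^bsub>T\<^esub> y) z = eta T x z \<oplus>\<^bsub>K\<^esub> eta T y z"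
    if "x \<in> carrier T" "y \<in> carrier T" "z \<in> carrier T" for x y z
    using that by simp
  have ms: "eta T (mon \<alpha> c) (mon \<beta> d) = eta T (mon \<beta> d) (mon \<alpha> c)"
    if g: "\<alpha> \<in> carrier G" "\<beta> \<in> carrier G" and k: "c \<in> carrier K" "d \<in> carrier K" for \<alpha> \<beta> c d
  proof (cases "\<alpha> \<otimes>\<^bsub>G\<^esub> \<beta> = \<one>\<^bsub>G\<^esub>")
    case True
    then have b: "\<alpha> = inv\<^bsub>G\<^esub> \<beta>" using g by (metis G.inv_equality)
    then show ?thesis
      using g k \<theta>_inverse[of \<beta>] \<theta>_closed by (simp add: eta_T_mon K.m_ac)
  next
    case False
    then have "\<beta> \<otimes>\<^bsub>G\<^esub> \<alpha> \<noteq> \<one>\<^bsub>G\<^esub>" using g by (metis G.inv_comm)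
    then show ?thesis using False g k by (simp add: eta_T_mon)
  qed
  have sm: "eta T (mon \<alpha> c) y = eta T y (mon \<alpha> c)"
    if "\<alpha> \<in> carrier G" "c \<in> carrier K" "y \<in> carrier T" for \<alpha> c y
    using that(3)
  proof (induction rule: T_induct)
    case (monomial \<beta> d)
    then show ?case using ms that by blast
  qed (use that mon_carrier add in \<open>auto simp: eta_T T_zero_apply\<close>)
  show "eta T x y = eta T y x" if x: "x \<in> carrier T" and y: "y \<in> carrier T" for x y
    using x
  proof (induction rule: T_induct)
    case (monomial \<alpha> c)
    then show ?case using sm y by blast
  qed (use y add in \<open>auto simp: eta_T T_zero_apply\<close>)
  show "eta T (k \<odot>\<^bsub>T\<^esub> x) y = k \<otimes>\<^bsub>K\<^esub> eta T x y"
    if "k \<in> carrier K" "x \<in> carrier T" "y \<in> carrier T" for k x y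
    using that by (simp add: eta_T TP.smult_mult_left T_smult_apply)
  show "eta T a b = \<zero>\<^bsub>K\<^esub>"
    if "\<alpha> \<in> carrier G" "\<beta> \<in> carrier G" "\<alpha> \<otimes>\<^bsub>G\<^esub> \<beta> \<noteq> \<one>\<^bsub>G\<^esub>" "a \<in> grade T \<alpha>" "b \<in> grade T \<beta>" for \<alpha> \<beta> a b
    using that by (auto simp: grade_T eta_T_mon)
  show "a = \<zero>\<^bsub>T\<^esub>" if \<alpha>: "\<alpha> \<in> carrier G" and a: "a \<in> grade T \<alpha>"
    and z: "\<And>b. b \<in> grade T (inv\<^bsub>G\<^esub> \<alpha>) \<Longrightarrow> eta T a b = \<zero>\<^bsub>K\<^esub>" for \<alpha> a
  proof -
    obtain c where c: "c \<in> carrier K" "a = mon \<alpha> c" using a by (auto simp: grade_T)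
    have "eta T a (mon (inv\<^bsub>G\<^esub> \<alpha>) \<one>\<^bsub>K\<^esub>) = \<zero>\<^bsub>K\<^esub>" using z by (auto simp: grade_T)
    then have "c \<otimes>\<^bsub>K\<^esub> \<theta> (\<alpha>, inv\<^bsub>G\<^esub> \<alpha>) = \<zero>\<^bsub>K\<^esub>" using \<alpha> c by (simp add: eta_T_mon)
    then have "c = \<zero>\<^bsub>K\<^esub>" using \<alpha> c \<theta>_closed \<theta>_nonzero K.integral by (metis G.inv_closed)
    then show ?thesis using c mon_zero by simp
  qed
  show "eta T (a \<otimes>\<^bsub>T\<^esub> b) c = eta T a (b \<otimes>\<^bsub>T\<^esub> c)"
    if "a \<in> carrier T" "b \<in> carrier T" "c \<in> carrier T" for a b c
    using that by (simp add: eta_T T.m_assoc)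
qed

sublocale TF: frobenius_pi_algebra G K T by (rule frobenius_T)

lemma mon_unit:
  assumes \<beta>: "\<beta> \<in> carrier G" and c: "c \<in> Units K"
  shows "mon \<beta> c \<in> Units T"
proof -
  let ?t = "inv\<^bsub>K\<^esub> (c \<otimes>\<^bsub>K\<^esub> \<theta> (\<beta>, inv\<^bsub>G\<^esub> \<beta>))"
  have u: "c \<otimes>\<^bsub>K\<^esub> \<theta> (\<beta>, inv\<^bsub>G\<^esub> \<beta>) \<in> Units K" using assms \<theta>_units by simp
  have cl: "c \<in> carrier K" "?t \<in> carrier K" "\<theta> (\<beta>, inv\<^bsub>G\<^esub> \<beta>) \<in> carrier K" using c u \<beta> \<theta>_closed by auto
  have "c \<otimes>\<^bsub>K\<^esub> ?t \<otimes>\<^bsub>K\<^esub> \<theta> (\<beta>, inv\<^bsub>G\<^esub> \<beta>) = (c \<otimes>\<^bsub>K\<^esub> \<theta> (\<beta>, inv\<^bsub>G\<^esub> \<beta>)) \<otimes>\<^bsub>K\<^esub> ?t"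
    using cl by (simp add: K.m_ac)
  then have 1: "c \<otimes>\<^bsub>K\<^esub> ?t \<otimes>\<^bsub>K\<^esub> \<theta> (\<beta>, inv\<^bsub>G\<^esub> \<beta>) = \<one>\<^bsub>K\<^esub>" using u by simp
  then have 2: "?t \<otimes>\<^bsub>K\<^esub> c \<otimes>\<^bsub>K\<^esub> \<theta> (inv\<^bsub>G\<^esub> \<beta>, \<beta>) = \<one>\<^bsub>K\<^esub>"
    using cl \<theta>_inverse[OF \<beta>] by (simp add: K.m_comm)
  have "mon \<beta> c \<otimes>\<^bsub>T\<^esub> mon (inv\<^bsub>G\<^esub> \<beta>) ?t = \<one>\<^bsub>T\<^esub>" "mon (inv\<^bsub>G\<^esub> \<beta>) ?t \<otimes>\<^bsub>T\<^esub> mon \<beta> c = \<one>\<^bsub>T\<^esub>"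
    using \<beta> cl 1 2 by (simp_all add: mon_mult one_T)
  then show ?thesis
    using mon_carrier cl unfolding Units_def by blast
qed

abbreviation u where "u \<beta> \<equiv> mon \<beta> \<one>\<^bsub>K\<^esub>"

lemma u_unit: "\<beta> \<in> carrier G \<Longrightarrow> u \<beta> \<in> Units T"
  using mon_unit by simp

lemma u_closed: "\<beta> \<in> carrier G \<Longrightarrow> u \<beta> \<in> carrier T" "\<beta> \<in> carrier G \<Longrightarrow> inv\<^bsub>T\<^esub> (u \<beta>) \<in> carrier T"
  using u_unit by auto

text \<open>The equation determines \<open>y\<close>, because the basis vector \<open>u \<beta>\<close> is invertible.\<close>

lemma phi_T_unique:
  assumes \<beta>: "\<beta> \<in> carrier G" and f: "f \<in> carrier T" and y: "y \<in> carrier T"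
    and eq: "y \<otimes>\<^bsub>T\<^esub> u \<beta> = u \<beta> \<otimes>\<^bsub>T\<^esub> f"
  shows "phi T \<beta> f = y"
proof -
  have "(THE y. y \<in> carrier T \<and> y \<otimes>\<^bsub>T\<^esub> u \<beta> = u \<beta> \<otimes>\<^bsub>T\<^esub> f) = y"
  proof (rule the_equality)
    fix z assume z: "z \<in> carrier T \<and> z \<otimes>\<^bsub>T\<^esub> u \<beta> = u \<beta> \<otimes>\<^bsub>T\<^esub> f"
    then have "z \<otimes>\<^bsub>T\<^esub> u \<beta> = y \<otimes>\<^bsub>T\<^esub> u \<beta>" using eq by simp
    then have "z \<otimes>\<^bsub>T\<^esub> (u \<beta> \<otimes>\<^bsub>T\<^esub> inv\<^bsub>T\<^esub> (u \<beta>)) = y \<otimes>\<^bsub>T\<^esub> (u \<beta> \<otimes>\<^bsub>T\<^esub> inv\<^bsub>T\<^esub> (u \<beta>))"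
      using z y u_closed[OF \<beta>] by (simp only: T.m_assoc[symmetric])
    then show "z = y" using z y u_unit[OF \<beta>] by simp
  qed (use y eq in auto)
  then show ?thesis by (simp add: twisted_alg_def)
qed

lemma phi_T:
  assumes \<beta>: "\<beta> \<in> carrier G" and f: "f \<in> carrier T"
  shows "phi T \<beta> f = u \<beta> \<otimes>\<^bsub>T\<^esub> f \<otimes>\<^bsub>T\<^esub> inv\<^bsub>T\<^esub> (u \<beta>)"
  using u_closed[OF \<beta>] u_unit[OF \<beta>] f by (intro phi_T_unique[OF \<beta> f]) (auto simp: T.m_assoc)

lemma phi_T_closed: "\<beta> \<in> carrier G \<Longrightarrow> f \<in> carrier T \<Longrightarrow> phi T \<beta> f \<in> carrier T"
  using phi_T u_closed by simp

lemma phi_T_mult_u: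
  assumes \<beta>: "\<beta> \<in> carrier G" and f: "f \<in> carrier T"
  shows "phi T \<beta> f \<otimes>\<^bsub>T\<^esub> u \<beta> = u \<beta> \<otimes>\<^bsub>T\<^esub> f"
  using u_closed[OF \<beta>] u_unit[OF \<beta>] f by (simp add: phi_T[OF \<beta> f] T.m_assoc)

lemma mon_eq_smult_u: "c \<in> carrier K \<Longrightarrow> mon \<alpha> c = c \<odot>\<^bsub>T\<^esub> u \<alpha>"
  by (simp add: mon_smult)

lemma precrossed_T: "precrossed_pi_algebra G K T"
proof (intro precrossed_pi_algebra.intro precrossed_pi_algebra_axioms.intro)
  show "frobenius_pi_algebra G K T" by (rule frobenius_T)
  have hom: "phi T (\<alpha> \<otimes>\<^bsub>G\<^esub> \<beta>) x = phi T \<alpha> (phi T \<beta> x)"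
    if g: "\<alpha> \<in> carrier G" "\<beta> \<in> carrier G" and x: "x \<in> carrier T" for \<alpha> \<beta> x
  proof (rule phi_T_unique)
    let ?t = "\<theta> (\<alpha>, \<beta>)"
    have t: "?t \<in> carrier K" "?t \<in> Units K" using g \<theta>_closed \<theta>_units by auto
    let ?y = "phi T \<alpha> (phi T \<beta> x)"
    note cl = u_closed(1)[OF g(1)] u_closed(1)[OF g(2)] u_closed(1)[OF G.m_closed[OF g]]
      phi_T_closed[OF g(2) x] phi_T_closed[OF g(1) phi_T_closed[OF g(2) x]]
    have uu: "u \<alpha> \<otimes>\<^bsub>T\<^esub> u \<beta> = ?t \<odot>\<^bsub>T\<^esub> u (\<alpha> \<otimes>\<^bsub>G\<^esub> \<beta>)"
      using g t by (simp add: mon_mult mon_smult)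
    have "?t \<odot>\<^bsub>T\<^esub> (?y \<otimes>\<^bsub>T\<^esub> u (\<alpha> \<otimes>\<^bsub>G\<^esub> \<beta>)) = ?y \<otimes>\<^bsub>T\<^esub> u \<alpha> \<otimes>\<^bsub>T\<^esub> u \<beta>"
      using cl t uu by (simp add: TP.smult_mult_right T.m_assoc)
    also have "\<dots> = u \<alpha> \<otimes>\<^bsub>T\<^esub> (phi T \<beta> x \<otimes>\<^bsub>T\<^esub> u \<beta>)"
      using cl phi_T_mult_u[OF g(1) cl(4)] by (simp add: T.m_assoc)
    also have "\<dots> = u \<alpha> \<otimes>\<^bsub>T\<^esub> u \<beta> \<otimes>\<^bsub>T\<^esub> x"
      using cl x phi_T_mult_u[OF g(2) x] by (simp add: T.m_assoc)
    also have "\<dots> = ?t \<odot>\<^bsub>T\<^esub> (u (\<alpha> \<otimes>\<^bsub>G\<^esub> \<beta>) \<otimes>\<^bsub>T\<^esub> x)"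
      using cl x t uu by (simp add: TP.smult_mult_left)
    finally have "inv\<^bsub>K\<^esub> ?t \<odot>\<^bsub>T\<^esub> (?t \<odot>\<^bsub>T\<^esub> (?y \<otimes>\<^bsub>T\<^esub> u (\<alpha> \<otimes>\<^bsub>G\<^esub> \<beta>))) =
        inv\<^bsub>K\<^esub> ?t \<odot>\<^bsub>T\<^esub> (?t \<odot>\<^bsub>T\<^esub> (u (\<alpha> \<otimes>\<^bsub>G\<^esub> \<beta>) \<otimes>\<^bsub>T\<^esub> x))" by simp
    then show "?y \<otimes>\<^bsub>T\<^esub> u (\<alpha> \<otimes>\<^bsub>G\<^esub> \<beta>) = u (\<alpha> \<otimes>\<^bsub>G\<^esub> \<beta>) \<otimes>\<^bsub>T\<^esub> x"
      using t cl x by (simp add: TM.smult_assoc1[symmetric])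
  qed (use g x phi_T_closed in auto)
  then show "phi T (\<alpha> \<otimes>\<^bsub>G\<^esub> \<beta>) x = phi T \<alpha> (phi T \<beta> x)"
    if "\<alpha> \<in> carrier G" "\<beta> \<in> carrier G" "x \<in> carrier T" for \<alpha> \<beta> x using that by simp
  have one: "phi T \<one>\<^bsub>G\<^esub> x = x" if "x \<in> carrier T" for x
    using that one_T by (intro phi_T_unique) (auto simp: one_T[symmetric])
  show "phi T \<beta> \<in> ring_iso T T" if \<beta>: "\<beta> \<in> carrier G" for \<beta>
  proof (rule ring_iso_memI)
    note ub = u_closed[OF \<beta>] u_unit[OF \<beta>]
    show "phi T \<beta> x \<in> carrier T" if "x \<in> carrier T" for x using phi_T_closed[OF \<beta> that] .
    show "phi T \<beta> (x \<otimes>\<^bsub>T\<^esub> y) = phi T \<beta> x \<otimes>\<^bsub>T\<^esub> phi T \<beta> y"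
      if "x \<in> carrier T" "y \<in> carrier T" for x y
    proof (rule phi_T_unique[OF \<beta>])
      note c = phi_T_closed[OF \<beta> that(1)] phi_T_closed[OF \<beta> that(2)] ub(1) that
      have "phi T \<beta> x \<otimes>\<^bsub>T\<^esub> phi T \<beta> y \<otimes>\<^bsub>T\<^esub> u \<beta> = phi T \<beta> x \<otimes>\<^bsub>T\<^esub> (u \<beta> \<otimes>\<^bsub>T\<^esub> y)"
        using phi_T_mult_u[OF \<beta> that(2)] c by (simp add: T.m_assoc)
      also have "\<dots> = (phi T \<beta> x \<otimes>\<^bsub>T\<^esub> u \<beta>) \<otimes>\<^bsub>T\<^esub> y" using c by (simp add: T.m_assoc)
      also have "\<dots> = u \<beta> \<otimes>\<^bsub>T\<^esub> (x \<otimes>\<^bsub>T\<^esub> y)"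
        unfolding phi_T_mult_u[OF \<beta> that(1)] using c by (simp add: T.m_assoc)
      finally show "phi T \<beta> x \<otimes>\<^bsub>T\<^esub> phi T \<beta> y \<otimes>\<^bsub>T\<^esub> u \<beta> = u \<beta> \<otimes>\<^bsub>T\<^esub> (x \<otimes>\<^bsub>T\<^esub> y)" .
    qed (use that phi_T_closed[OF \<beta>] in auto)
    show "phi T \<beta> (x \<oplus>\<^bsub>T\<^esub> y) = phi T \<beta> x \<oplus>\<^bsub>T\<^esub> phi T \<beta> y" if "x \<in> carrier T" "y \<in> carrier T" for x y
      using that ub by (simp add: phi_T \<beta> T.l_distr T.r_distr)
    show "phi T \<beta> \<one>\<^bsub>T\<^esub> = \<one>\<^bsub>T\<^esub>"
      using ub by (intro phi_T_unique[OF \<beta>]) auto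
    show "bij_betw (phi T \<beta>) (carrier T) (carrier T)"
      using \<beta> phi_T_closed one hom[of "inv\<^bsub>G\<^esub> \<beta>" \<beta>] hom[of \<beta> "inv\<^bsub>G\<^esub> \<beta>"]
      by (intro bij_betwI[where g = "phi T (inv\<^bsub>G\<^esub> \<beta>)"]) auto
  qed
  show "phi T \<beta> (k \<odot>\<^bsub>T\<^esub> x) = k \<odot>\<^bsub>T\<^esub> phi T \<beta> x"
    if "\<beta> \<in> carrier G" "k \<in> carrier K" "x \<in> carrier T" for \<beta> k x
    using that u_closed[OF that(1)] by (simp add: phi_T TP.smult_mult_left TP.smult_mult_right)
  show "eta T (phi T \<beta> x) (phi T \<beta> y) = eta T x y"
    if \<beta>: "\<beta> \<in> carrier G" and x: "x \<in> carrier T" and y: "y \<in> carrier T" for \<beta> x y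
  proof -
    let ?u = "u \<beta>" and ?v = "inv\<^bsub>T\<^esub> (u \<beta>)"
    note c = u_closed[OF \<beta>] x y
    have "eta T (phi T \<beta> x) (phi T \<beta> y) = eta T (?u \<otimes>\<^bsub>T\<^esub> (x \<otimes>\<^bsub>T\<^esub> ?v)) (?u \<otimes>\<^bsub>T\<^esub> y \<otimes>\<^bsub>T\<^esub> ?v)"
      using c by (simp add: phi_T \<beta> T.m_assoc)
    also have "\<dots> = eta T ?u (x \<otimes>\<^bsub>T\<^esub> (?v \<otimes>\<^bsub>T\<^esub> ?u) \<otimes>\<^bsub>T\<^esub> y \<otimes>\<^bsub>T\<^esub> ?v)"
      using c by (simp add: TF.eta_assoc T.m_assoc del: T.Units_l_inv)
    also have "\<dots> = eta T (x \<otimes>\<^bsub>T\<^esub> y \<otimes>\<^bsub>T\<^esub> ?v) ?u"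
      using c u_unit[OF \<beta>] by (simp add: TF.eta_sym)
    also have "\<dots> = eta T (x \<otimes>\<^bsub>T\<^esub> y) (?v \<otimes>\<^bsub>T\<^esub> ?u)"
      using c by (simp add: TF.eta_assoc del: T.Units_l_inv)
    also have "\<dots> = eta T x y"
      using c u_unit[OF \<beta>] by (simp add: TF.eta_assoc)
    finally show ?thesis .
  qed
  show "phi T \<beta> a \<in> grade T (\<beta> \<otimes>\<^bsub>G\<^esub> \<alpha> \<otimes>\<^bsub>G\<^esub> inv\<^bsub>G\<^esub> \<beta>)"
    if g: "\<alpha> \<in> carrier G" "\<beta> \<in> carrier G" and a: "a \<in> grade T \<alpha>" for \<alpha> \<beta> a
  proof -
    obtain c where c: "c \<in> carrier K" "a = mon \<alpha> c" using a by (auto simp: grade_T)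
    let ?\<gamma> = "\<beta> \<otimes>\<^bsub>G\<^esub> \<alpha> \<otimes>\<^bsub>G\<^esub> inv\<^bsub>G\<^esub> \<beta>"
    let ?d = "inv\<^bsub>K\<^esub> \<theta> (?\<gamma>, \<beta>) \<otimes>\<^bsub>K\<^esub> (c \<otimes>\<^bsub>K\<^esub> \<theta> (\<beta>, \<alpha>))"
    have t: "\<theta> (?\<gamma>, \<beta>) \<in> Units K" "\<theta> (\<beta>, \<alpha>) \<in> carrier K" using g \<theta>_units \<theta>_closed by auto
    have t': "\<theta> (?\<gamma>, \<beta>) \<in> carrier K" "inv\<^bsub>K\<^esub> \<theta> (?\<gamma>, \<beta>) \<in> carrier K" "?d \<in> carrier K"
      using t c(1) by auto
    have e: "?d \<otimes>\<^bsub>K\<^esub> \<theta> (?\<gamma>, \<beta>) = c \<otimes>\<^bsub>K\<^esub> \<theta> (\<beta>, \<alpha>)"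
    proof -
      have "?d \<otimes>\<^bsub>K\<^esub> \<theta> (?\<gamma>, \<beta>) = \<theta> (?\<gamma>, \<beta>) \<otimes>\<^bsub>K\<^esub> ?d"
        using t' by (intro K.m_comm)
      also have "\<dots> = (\<theta> (?\<gamma>, \<beta>) \<otimes>\<^bsub>K\<^esub> inv\<^bsub>K\<^esub> \<theta> (?\<gamma>, \<beta>)) \<otimes>\<^bsub>K\<^esub> (c \<otimes>\<^bsub>K\<^esub> \<theta> (\<beta>, \<alpha>))"
        using t t' c(1) by (intro K.m_assoc[symmetric]) auto
      also have "\<dots> = c \<otimes>\<^bsub>K\<^esub> \<theta> (\<beta>, \<alpha>)" using t c(1) by simp
      finally show ?thesis .
    qed
    have "?\<gamma> \<otimes>\<^bsub>G\<^esub> \<beta> = \<beta> \<otimes>\<^bsub>G\<^esub> \<alpha>" using g by (simp add: G.m_assoc)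
    then have "mon ?\<gamma> ?d \<otimes>\<^bsub>T\<^esub> u \<beta> = u \<beta> \<otimes>\<^bsub>T\<^esub> a"
      using g c t' e by (simp add: mon_mult)
    then have "phi T \<beta> a = mon ?\<gamma> ?d"
      using g c t' mon_carrier by (intro phi_T_unique) auto
    then show ?thesis using t' by (auto simp: grade_T)
  qed
  have gen: "phi T \<beta> a \<otimes>\<^bsub>T\<^esub> b = b \<otimes>\<^bsub>T\<^esub> a"
    if \<beta>: "\<beta> \<in> carrier G" and a: "a \<in> carrier T" and b: "b \<in> grade T \<beta>" for \<beta> a b
  proof -
    obtain c where c: "c \<in> carrier K" "b = mon \<beta> c" using b by (auto simp: grade_T)
    then have "b = c \<odot>\<^bsub>T\<^esub> u \<beta>" using mon_eq_smult_u by blast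
    then show ?thesis
      using c(1) phi_T_mult_u[OF \<beta> a] phi_T_closed[OF \<beta> a] a u_closed[OF \<beta>]
      by (simp add: TP.smult_mult_left TP.smult_mult_right)
  qed
  then show "phi T \<beta> a \<otimes>\<^bsub>T\<^esub> b = b \<otimes>\<^bsub>T\<^esub> a"
    if "\<beta> \<in> carrier G" "a \<in> carrier T" "b \<in> grade T \<beta>" for \<beta> a b using that by simp
  show "phi T \<beta> b = b" if \<beta>: "\<beta> \<in> carrier G" and b: "b \<in> grade T \<beta>" for \<beta> b
  proof -
    obtain c where c: "c \<in> carrier K" "b = mon \<beta> c" using b by (auto simp: grade_T)
    then have "b = c \<odot>\<^bsub>T\<^esub> u \<beta>" using mon_eq_smult_u by blast
    then show ?thesis
      using c(1) u_closed[OF \<beta>] by (intro phi_T_unique[OF \<beta>]) (auto simp: TP.smult_mult_left TP.smult_mult_right)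
  qed
qed

end

section \<open>Transfer\<close>

locale coset_system = \<pi>: group \<pi> for \<pi> :: "('g, 'm) monoid_scheme" +
  fixes G :: "'g set" and \<omega> :: "'g set \<Rightarrow> 'g"
  assumes G: "subgroup G \<pi>" and finite_cosets: "finite (rcosets\<^bsub>\<pi>\<^esub> G)"
    and representative: "i \<in> rcosets\<^bsub>\<pi>\<^esub> G \<Longrightarrow> \<omega> i \<in> i"
begin

abbreviation R where "R \<equiv> rcosets\<^bsub>\<pi>\<^esub> G"

lemmas G_closed = subgroup.m_closed[OF G] subgroup.one_closed[OF G] subgroup.m_inv_closed[OF G]

lemma G_carrier: "g \<in> G \<Longrightarrow> g \<in> carrier \<pi>"
  using subgroup.mem_carrier[OF G] .

lemma coset_eq_iff:
  assumes "a \<in> carrier \<pi>" "b \<in> carrier \<pi>"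
  shows "G #>\<^bsub>\<pi>\<^esub> a = G #>\<^bsub>\<pi>\<^esub> b \<longleftrightarrow> a \<otimes>\<^bsub>\<pi>\<^esub> inv\<^bsub>\<pi>\<^esub> b \<in> G"
  using \<pi>.repr_independence[OF _ assms(2) G, of a] \<pi>.rcos_self[OF assms(1) G]
    subgroup.rcos_module[OF G \<pi>.is_group assms(2,1)] by auto

lemma rep_closed: "i \<in> R \<Longrightarrow> \<omega> i \<in> carrier \<pi>"
  using representative[of i] \<pi>.rcosets_subset_PowG[OF G] by blast

lemma coset_rep: 
  assumes "i \<in> R"
  shows "G #>\<^bsub>\<pi>\<^esub> \<omega> i = i"
proof -
  obtain a where a: "a \<in> carrier \<pi>" "i = G #>\<^bsub>\<pi>\<^esub> a" using assms by (auto simp: RCOSETS_def)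
  then show ?thesis using \<pi>.repr_independence[of "\<omega> i" G a] representative[OF assms] G by simp
qed

lemma coset_closed: "a \<in> carrier \<pi> \<Longrightarrow> G #>\<^bsub>\<pi>\<^esub> a \<in> R"
  using \<pi>.rcosetsI[OF subgroup.subset[OF G]] .

lemma G_coset: "G \<in> R"
  using coset_closed[of "\<one>\<^bsub>\<pi>\<^esub>"] \<pi>.coset_mult_one[OF subgroup.subset[OF G]] by simp

lemma act_rep:
  assumes "i \<in> R" "\<beta> \<in> carrier \<pi>"
  shows "i #>\<^bsub>\<pi>\<^esub> \<beta> = G #>\<^bsub>\<pi>\<^esub> (\<omega> i \<otimes>\<^bsub>\<pi>\<^esub> \<beta>)"
  using \<pi>.coset_mult_assoc[OF subgroup.subset[OF G] rep_closed[OF assms(1)] assms(2)] coset_rep[OF assms(1)] by simp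

lemma act_closed: "i \<in> R \<Longrightarrow> \<beta> \<in> carrier \<pi> \<Longrightarrow> i #>\<^bsub>\<pi>\<^esub> \<beta> \<in> R"
  using act_rep coset_closed rep_closed by simp

lemma act_act:
  assumes "i \<in> R" "\<alpha> \<in> carrier \<pi>" "\<beta> \<in> carrier \<pi>"
  shows "i #>\<^bsub>\<pi>\<^esub> \<alpha> #>\<^bsub>\<pi>\<^esub> \<beta> = i #>\<^bsub>\<pi>\<^esub> (\<alpha> \<otimes>\<^bsub>\<pi>\<^esub> \<beta>)"
  using \<pi>.coset_mult_assoc[of i \<alpha> \<beta>] \<pi>.rcosets_subset_PowG[OF G] assms by blast

lemma act_one: "i \<in> R \<Longrightarrow> i #>\<^bsub>\<pi>\<^esub> \<one>\<^bsub>\<pi>\<^esub> = i"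
  using act_rep[of i "\<one>\<^bsub>\<pi>\<^esub>"] coset_rep rep_closed by simp

lemma act_inv:
  assumes "i \<in> R" "\<beta> \<in> carrier \<pi>"
  shows "i #>\<^bsub>\<pi>\<^esub> \<beta> #>\<^bsub>\<pi>\<^esub> inv\<^bsub>\<pi>\<^esub> \<beta> = i" "i #>\<^bsub>\<pi>\<^esub> inv\<^bsub>\<pi>\<^esub> \<beta> #>\<^bsub>\<pi>\<^esub> \<beta> = i"
  using act_act[of i \<beta> "inv\<^bsub>\<pi>\<^esub> \<beta>"] act_act[of i "inv\<^bsub>\<pi>\<^esub> \<beta>" \<beta>] act_one assms by auto

lemma act_eq_iff:
  assumes "i \<in> R" "j \<in> R" "\<beta> \<in> carrier \<pi>"
  shows "i #>\<^bsub>\<pi>\<^esub> \<beta> = j \<longleftrightarrow> i = j #>\<^bsub>\<pi>\<^esub> inv\<^bsub>\<pi>\<^esub> \<beta>"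
  using act_inv[OF assms(1,3)] act_inv[OF assms(2,3)] by auto

text \<open>
  \<open>cj i \<alpha>\<close> is the degree in \<open>L\<close> of the \<open>i\<close>-th entry of an element of degree \<open>\<alpha>\<close> of the transfer,
  and \<open>dv i \<beta>\<close> is the element of \<open>G\<close> through which \<open>\<beta>\<close> maps the entry at \<open>i\<beta>\<close> to the entry at \<open>i\<close>.
\<close>

abbreviation cj where "cj i \<alpha> \<equiv> \<omega> i \<otimes>\<^bsub>\<pi>\<^esub> \<alpha> \<otimes>\<^bsub>\<pi>\<^esub> inv\<^bsub>\<pi>\<^esub> \<omega> i"
abbreviation dv where "dv i \<beta> \<equiv> \<omega> i \<otimes>\<^bsub>\<pi>\<^esub> \<beta> \<otimes>\<^bsub>\<pi>\<^esub> inv\<^bsub>\<pi>\<^esub> \<omega> (i #>\<^bsub>\<pi>\<^esub> \<beta>)"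

lemma fixed_iff:
  assumes "i \<in> R" "\<alpha> \<in> carrier \<pi>"
  shows "i #>\<^bsub>\<pi>\<^esub> \<alpha> = i \<longleftrightarrow> cj i \<alpha> \<in> G"
  using coset_eq_iff[of "\<omega> i \<otimes>\<^bsub>\<pi>\<^esub> \<alpha>" "\<omega> i"] act_rep[OF assms] coset_rep rep_closed assms by auto

lemma dv_closed:
  assumes "i \<in> R" "\<beta> \<in> carrier \<pi>"
  shows "dv i \<beta> \<in> G"
proof -
  have "G #>\<^bsub>\<pi>\<^esub> (\<omega> i \<otimes>\<^bsub>\<pi>\<^esub> \<beta>) = G #>\<^bsub>\<pi>\<^esub> \<omega> (i #>\<^bsub>\<pi>\<^esub> \<beta>)"
    using act_rep[OF assms] coset_rep[OF act_closed[OF assms]] by simp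
  then show ?thesis
    using coset_eq_iff[of "\<omega> i \<otimes>\<^bsub>\<pi>\<^esub> \<beta>"] rep_closed act_closed assms by auto
qed

lemma dv_mult:
  assumes "i \<in> R" "\<alpha> \<in> carrier \<pi>" "\<beta> \<in> carrier \<pi>"
  shows "dv i (\<alpha> \<otimes>\<^bsub>\<pi>\<^esub> \<beta>) = dv i \<alpha> \<otimes>\<^bsub>\<pi>\<^esub> dv (i #>\<^bsub>\<pi>\<^esub> \<alpha>) \<beta>"
proof -
  note c = rep_closed[OF assms(1)] rep_closed[OF act_closed[OF assms(1,2)]] assms(2,3)
    rep_closed[OF act_closed[OF act_closed[OF assms(1,2)] assms(3)]]
  show ?thesis
    unfolding act_act[OF assms, symmetric]
    using c by (simp add: \<pi>.m_assoc) (simp add: \<pi>.m_assoc[symmetric])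
qed

lemma dv_conj:
  assumes "i \<in> R" "\<alpha> \<in> carrier \<pi>" "\<beta> \<in> carrier \<pi>"
  shows "dv i \<beta> \<otimes>\<^bsub>\<pi>\<^esub> cj (i #>\<^bsub>\<pi>\<^esub> \<beta>) \<alpha> \<otimes>\<^bsub>\<pi>\<^esub> inv\<^bsub>\<pi>\<^esub> dv i \<beta> = cj i (\<beta> \<otimes>\<^bsub>\<pi>\<^esub> \<alpha> \<otimes>\<^bsub>\<pi>\<^esub> inv\<^bsub>\<pi>\<^esub> \<beta>)"
proof -
  note c = rep_closed[OF assms(1)] rep_closed[OF act_closed[OF assms(1,3)]] assms(2,3)
  show ?thesis
    using c by (simp add: \<pi>.m_assoc \<pi>.inv_mult_group) (simp add: \<pi>.m_assoc[symmetric])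
qed

lemma cj_mult:
  assumes "i \<in> R" "\<alpha> \<in> carrier \<pi>" "\<beta> \<in> carrier \<pi>"
  shows "cj i \<alpha> \<otimes>\<^bsub>\<pi>\<^esub> cj i \<beta> = cj i (\<alpha> \<otimes>\<^bsub>\<pi>\<^esub> \<beta>)"
  using rep_closed[OF assms(1)] assms(2,3) by (simp add: \<pi>.m_assoc) (simp add: \<pi>.m_assoc[symmetric])

lemma cj_closed: "i \<in> R \<Longrightarrow> \<alpha> \<in> carrier \<pi> \<Longrightarrow> cj i \<alpha> \<in> carrier \<pi>"
  using rep_closed by simp

lemma cj_inv:
  assumes "i \<in> R" "\<alpha> \<in> carrier \<pi>"
  shows "cj i (inv\<^bsub>\<pi>\<^esub> \<alpha>) = inv\<^bsub>\<pi>\<^esub> (cj i \<alpha>)"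
  using rep_closed[OF assms(1)] assms(2) by (simp add: \<pi>.inv_mult_group \<pi>.m_assoc)

lemma cj_one: "i \<in> R \<Longrightarrow> cj i \<one>\<^bsub>\<pi>\<^esub> = \<one>\<^bsub>\<pi>\<^esub>"
  using rep_closed by simp

lemma cj_inject:
  assumes "i \<in> R" "\<alpha> \<in> carrier \<pi>" "\<beta> \<in> carrier \<pi>"
  shows "cj i \<alpha> = cj i \<beta> \<longleftrightarrow> \<alpha> = \<beta>"
  using rep_closed[OF assms(1)] assms(2,3) by (auto simp: \<pi>.m_assoc)

definition unconj where "unconj i g = inv\<^bsub>\<pi>\<^esub> \<omega> i \<otimes>\<^bsub>\<pi>\<^esub> g \<otimes>\<^bsub>\<pi>\<^esub> \<omega> i"

lemma unconj_facts:
  assumes "i \<in> R" "g \<in> carrier \<pi>"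
  shows "unconj i g \<in> carrier \<pi>" "cj i (unconj i g) = g" "unconj i (cj i g) = g"
  unfolding unconj_def
  using rep_closed[OF assms(1)] assms(2)
  by (simp, simp add: \<pi>.m_assoc, simp add: \<pi>.m_assoc[symmetric], simp add: \<pi>.m_assoc, simp add: \<pi>.m_assoc[symmetric])

end

locale transfer_data = coset_system \<pi> G \<omega> + base: precrossed_pi_algebra "\<pi>\<lparr>carrier := G\<rparr>" K L
  for \<pi> :: "('g, 'm) monoid_scheme" and G \<omega> and K :: "('k, 'n) ring_scheme"
    and L :: "('g, 'k, 'a) crossed_alg"
begin

lemma inv_G:
  assumes "g \<in> G"
  shows "inv\<^bsub>\<pi>\<lparr>carrier := G\<rparr>\<^esub> g = inv\<^bsub>\<pi>\<^esub> g"
proof -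
  have h: "inv\<^bsub>\<pi>\<lparr>carrier := G\<rparr>\<^esub> g \<in> G" "inv\<^bsub>\<pi>\<lparr>carrier := G\<rparr>\<^esub> g \<otimes>\<^bsub>\<pi>\<^esub> g = \<one>\<^bsub>\<pi>\<^esub>"
    using base.\<pi>.inv_closed[of g] base.\<pi>.l_inv[of g] assms by auto
  then show ?thesis using \<pi>.inv_equality G_carrier assms by metis
qed

abbreviation TL where "TL \<equiv> transfer \<pi> K G \<omega> L"

lemma TL_simps:
  "carrier TL = R \<rightarrow>\<^sub>E carrier L"
  "x \<otimes>\<^bsub>TL\<^esub> y = (\<lambda>i\<in>R. x i \<otimes>\<^bsub>L\<^esub> y i)"
  "\<one>\<^bsub>TL\<^esub> = (\<lambda>i\<in>R. \<one>\<^bsub>L\<^esub>)"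
  "\<zero>\<^bsub>TL\<^esub> = (\<lambda>i\<in>R. \<zero>\<^bsub>L\<^esub>)"
  "x \<oplus>\<^bsub>TL\<^esub> y = (\<lambda>i\<in>R. x i \<oplus>\<^bsub>L\<^esub> y i)"
  "c \<odot>\<^bsub>TL\<^esub> x = (\<lambda>i\<in>R. c \<odot>\<^bsub>L\<^esub> x i)"
  "grade TL \<alpha> = (\<Pi>\<^sub>E i\<in>R. if cj i \<alpha> \<in> G then grade L (cj i \<alpha>) else {\<zero>\<^bsub>L\<^esub>})"
  "eta TL x y = (\<Oplus>\<^bsub>K\<^esub>i\<in>R. eta L (x i) (y i))"
  "phi TL \<beta> x = (\<lambda>i\<in>R. phi L (dv i \<beta>) (x (i #>\<^bsub>\<pi>\<^esub> \<beta>)))"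
  by (simp_all add: transfer_def)

lemma TL_apply:
  assumes "i \<in> R"
  shows "(x \<otimes>\<^bsub>TL\<^esub> y) i = x i \<otimes>\<^bsub>L\<^esub> y i"
  "\<one>\<^bsub>TL\<^esub> i = \<one>\<^bsub>L\<^esub>" "\<zero>\<^bsub>TL\<^esub> i = \<zero>\<^bsub>L\<^esub>" "(x \<oplus>\<^bsub>TL\<^esub> y) i = x i \<oplus>\<^bsub>L\<^esub> y i" "(c \<odot>\<^bsub>TL\<^esub> x) i = c \<odot>\<^bsub>L\<^esub> x i"
  "phi TL \<beta> x i = phi L (dv i \<beta>) (x (i #>\<^bsub>\<pi>\<^esub> \<beta>))"
  using assms by (simp_all add: TL_simps)

lemma TL_entry: "x \<in> carrier TL \<Longrightarrow> i \<in> R \<Longrightarrow> x i \<in> carrier L"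
  by (auto simp: TL_simps PiE_def Pi_def)

lemma TL_ext: "x \<in> carrier TL \<Longrightarrow> y \<in> carrier TL \<Longrightarrow> (\<And>i. i \<in> R \<Longrightarrow> x i = y i) \<Longrightarrow> x = y"
  unfolding TL_simps by (rule PiE_ext)

lemma TL_closed:
  "x \<in> carrier TL \<Longrightarrow> y \<in> carrier TL \<Longrightarrow> x \<otimes>\<^bsub>TL\<^esub> y \<in> carrier TL"
  "\<one>\<^bsub>TL\<^esub> \<in> carrier TL" "\<zero>\<^bsub>TL\<^esub> \<in> carrier TL"
  "x \<in> carrier TL \<Longrightarrow> y \<in> carrier TL \<Longrightarrow> x \<oplus>\<^bsub>TL\<^esub> y \<in> carrier TL"
  "c \<in> carrier K \<Longrightarrow> x \<in> carrier TL \<Longrightarrow> c \<odot>\<^bsub>TL\<^esub> x \<in> carrier TL"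
  by (auto simp: TL_simps PiE_def Pi_def)

lemma TL_grade_iff:
  "x \<in> grade TL \<alpha> \<longleftrightarrow> x \<in> extensional R \<and>
    (\<forall>i\<in>R. x i \<in> (if cj i \<alpha> \<in> G then grade L (cj i \<alpha>) else {\<zero>\<^bsub>L\<^esub>}))"
  by (auto simp: TL_simps PiE_def Pi_def)

lemma TL_gradeD:
  assumes "x \<in> grade TL \<alpha>" "i \<in> R"
  shows "cj i \<alpha> \<in> G \<Longrightarrow> x i \<in> grade L (cj i \<alpha>)" "cj i \<alpha> \<notin> G \<Longrightarrow> x i = \<zero>\<^bsub>L\<^esub>"
  using assms unfolding TL_grade_iff by auto

lemma base_grade_carrier: "g \<in> G \<Longrightarrow> a \<in> grade L g \<Longrightarrow> a \<in> carrier L"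
  using base.grade_in_carrier[of g a] by simp

lemma TL_grade_carrier: "x \<in> grade TL \<alpha> \<Longrightarrow> x \<in> carrier TL"
  unfolding TL_grade_iff TL_simps(1) PiE_def using base_grade_carrier
  by (auto split: if_splits)

lemma abelian_group_TL: "abelian_group TL"
proof (rule abelian_groupI)
  show "\<exists>y\<in>carrier TL. y \<oplus>\<^bsub>TL\<^esub> x = \<zero>\<^bsub>TL\<^esub>" if "x \<in> carrier TL" for x
  proof
    show y: "(\<lambda>i\<in>R. \<ominus>\<^bsub>L\<^esub> x i) \<in> carrier TL" using TL_entry[OF that] by (auto simp: TL_simps)
    show "(\<lambda>i\<in>R. \<ominus>\<^bsub>L\<^esub> x i) \<oplus>\<^bsub>TL\<^esub> x = \<zero>\<^bsub>TL\<^esub>"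
      by (rule TL_ext) (use TL_entry[OF that] TL_closed that y in \<open>simp_all add: TL_apply base.L.l_neg\<close>)
  qed
  show "x \<oplus>\<^bsub>TL\<^esub> y \<oplus>\<^bsub>TL\<^esub> z = x \<oplus>\<^bsub>TL\<^esub> (y \<oplus>\<^bsub>TL\<^esub> z)"
    if "x \<in> carrier TL" "y \<in> carrier TL" "z \<in> carrier TL" for x y z
    by (rule TL_ext) (use that in \<open>simp_all add: TL_closed TL_apply TL_entry base.L.a_assoc\<close>)
  show "x \<oplus>\<^bsub>TL\<^esub> y = y \<oplus>\<^bsub>TL\<^esub> x" if "x \<in> carrier TL" "y \<in> carrier TL" for x y
    by (rule TL_ext) (use that in \<open>simp_all add: TL_closed TL_apply TL_entry base.L.a_comm\<close>)
  show "\<zero>\<^bsub>TL\<^esub> \<oplus>\<^bsub>TL\<^esub> x = x" if "x \<in> carrier TL" for x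
    by (rule TL_ext) (use that in \<open>simp_all add: TL_closed TL_apply TL_entry\<close>)
qed (simp_all add: TL_closed)

lemma ring_TL: "ring TL"
proof (rule ringI[OF abelian_group_TL])
  show "monoid TL"
  proof (rule monoidI)
    show "x \<otimes>\<^bsub>TL\<^esub> y \<otimes>\<^bsub>TL\<^esub> z = x \<otimes>\<^bsub>TL\<^esub> (y \<otimes>\<^bsub>TL\<^esub> z)"
      if "x \<in> carrier TL" "y \<in> carrier TL" "z \<in> carrier TL" for x y z
      by (rule TL_ext) (use that in \<open>simp_all add: TL_closed TL_apply TL_entry base.L.m_assoc\<close>)
    show "\<one>\<^bsub>TL\<^esub> \<otimes>\<^bsub>TL\<^esub> x = x" "x \<otimes>\<^bsub>TL\<^esub> \<one>\<^bsub>TL\<^esub> = x" if "x \<in> carrier TL" for x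
      by (rule TL_ext; use that in \<open>simp add: TL_closed TL_apply TL_entry\<close>)+
  qed (simp_all add: TL_closed)
  show "(x \<oplus>\<^bsub>TL\<^esub> y) \<otimes>\<^bsub>TL\<^esub> z = x \<otimes>\<^bsub>TL\<^esub> z \<oplus>\<^bsub>TL\<^esub> y \<otimes>\<^bsub>TL\<^esub> z"
    if "x \<in> carrier TL" "y \<in> carrier TL" "z \<in> carrier TL" for x y z
    by (rule TL_ext) (use that in \<open>simp_all add: TL_closed TL_apply TL_entry base.L.l_distr\<close>)
  show "z \<otimes>\<^bsub>TL\<^esub> (x \<oplus>\<^bsub>TL\<^esub> y) = z \<otimes>\<^bsub>TL\<^esub> x \<oplus>\<^bsub>TL\<^esub> z \<otimes>\<^bsub>TL\<^esub> y"
    if "x \<in> carrier TL" "y \<in> carrier TL" "z \<in> carrier TL" for x y z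
    by (rule TL_ext) (use that in \<open>simp_all add: TL_closed TL_apply TL_entry base.L.r_distr\<close>)
qed

lemma module_TL: "module K TL"
proof (rule moduleI[OF base.K.is_cring abelian_group_TL])
  show "(c \<oplus>\<^bsub>K\<^esub> d) \<odot>\<^bsub>TL\<^esub> x = c \<odot>\<^bsub>TL\<^esub> x \<oplus>\<^bsub>TL\<^esub> d \<odot>\<^bsub>TL\<^esub> x"
    if "c \<in> carrier K" "d \<in> carrier K" "x \<in> carrier TL" for c d x
    by (rule TL_ext) (use that in \<open>simp_all add: TL_closed TL_apply TL_entry base.M.smult_l_distr\<close>)
  show "c \<odot>\<^bsub>TL\<^esub> (x \<oplus>\<^bsub>TL\<^esub> y) = c \<odot>\<^bsub>TL\<^esub> x \<oplus>\<^bsub>TL\<^esub> c \<odot>\<^bsub>TL\<^esub> y"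
    if "c \<in> carrier K" "x \<in> carrier TL" "y \<in> carrier TL" for c x y
    by (rule TL_ext) (use that in \<open>simp_all add: TL_closed TL_apply TL_entry base.M.smult_r_distr\<close>)
  show "(c \<otimes>\<^bsub>K\<^esub> d) \<odot>\<^bsub>TL\<^esub> x = c \<odot>\<^bsub>TL\<^esub> (d \<odot>\<^bsub>TL\<^esub> x)"
    if "c \<in> carrier K" "d \<in> carrier K" "x \<in> carrier TL" for c d x
    by (rule TL_ext) (use that in \<open>simp_all add: TL_closed TL_apply TL_entry base.M.smult_assoc1\<close>)
  show "\<one>\<^bsub>K\<^esub> \<odot>\<^bsub>TL\<^esub> x = x" if "x \<in> carrier TL" for x
    by (rule TL_ext) (use that in \<open>simp_all add: TL_closed TL_apply TL_entry\<close>)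
qed (simp_all add: TL_closed)

sublocale TL: ring TL by (rule ring_TL)
sublocale TLM: module K TL by (rule module_TL)

lemma TL_finsum_apply:
  assumes "i \<in> R" "\<And>s. s \<in> S \<Longrightarrow> f s \<in> carrier TL"
  shows "(\<Oplus>\<^bsub>TL\<^esub>s\<in>S. f s) i = (\<Oplus>\<^bsub>L\<^esub>s\<in>S. f s i)"
  by (rule finsum_additive(2)[where V = "carrier TL" and h = "\<lambda>x. x i"])
    (use assms TL_entry TL_closed in \<open>auto simp: TL_apply TL.abelian_group_axioms base.L.abelian_group_axioms\<close>)

definition single where "single i a = (\<lambda>j\<in>R. if j = i then a else \<zero>\<^bsub>L\<^esub>)"

lemma single_apply: "j \<in> R \<Longrightarrow> single i a j = (if j = i then a else \<zero>\<^bsub>L\<^esub>)"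
  by (simp add: single_def)

lemma single_closed: "a \<in> carrier L \<Longrightarrow> single i a \<in> carrier TL"
  by (auto simp: single_def TL_simps)

lemma single_grade:
  assumes "i \<in> R" "\<alpha> \<in> carrier \<pi>" "cj i \<alpha> \<in> G" "a \<in> grade L (cj i \<alpha>)"
  shows "single i a \<in> grade TL \<alpha>"
  unfolding TL_grade_iff using assms base.grade_zero by (auto simp: single_def)

lemma TL_grade_submodule:
  assumes \<alpha>: "\<alpha> \<in> carrier \<pi>"
  shows "submodule (grade TL \<alpha>) K TL"
proof (rule TLM.submoduleI)
  show "grade TL \<alpha> \<subseteq> carrier TL" using TL_grade_carrier by blast
  show z: "\<zero>\<^bsub>TL\<^esub> \<in> grade TL \<alpha>" unfolding TL_grade_iff using base.grade_zero by (auto simp: TL_simps)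
  show "x \<oplus>\<^bsub>TL\<^esub> y \<in> grade TL \<alpha>" if "x \<in> grade TL \<alpha>" "y \<in> grade TL \<alpha>" for x y
    unfolding TL_grade_iff using TL_gradeD[OF that(1)] TL_gradeD[OF that(2)] base.grade_add
    by (auto simp: TL_simps)
  show sm: "c \<odot>\<^bsub>TL\<^esub> x \<in> grade TL \<alpha>" if "c \<in> carrier K" "x \<in> grade TL \<alpha>" for c x
    unfolding TL_grade_iff using TL_gradeD[OF that(2)] base.grade_smult that(1)
    by (auto simp: TL_simps)
  show "\<ominus>\<^bsub>TL\<^esub> x \<in> grade TL \<alpha>" if "x \<in> grade TL \<alpha>" for x
    using sm[of "\<ominus>\<^bsub>K\<^esub> \<one>\<^bsub>K\<^esub>" x] that TL_grade_carrier[OF that] by (simp add: TLM.smult_l_minus)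
qed

text \<open>Dual bases of the summands combine to a dual basis of their direct sum.\<close>

lemma TL_grade_projective:
  assumes \<alpha>: "\<alpha> \<in> carrier \<pi>"
  shows "projective_finite_type K TL (grade TL \<alpha>)"
proof -
  let ?N = "{i\<in>R. cj i \<alpha> \<in> G}"
  have "\<forall>i\<in>?N. \<exists>d. dual_family K L (grade L (cj i \<alpha>)) {..<fst d :: nat} (fst (snd d)) (snd (snd d))"
  proof
    fix i assume "i \<in> ?N"
    then obtain n y f where "dual_basis K L (grade L (cj i \<alpha>)) n y f"
      using base.grade_projective[of "cj i \<alpha>"] unfolding projective_finite_type_def by auto
    then show "\<exists>d. dual_family K L (grade L (cj i \<alpha>)) {..<fst d :: nat} (fst (snd d)) (snd (snd d))"
      unfolding dual_basis_iff by (intro exI[of _ "(n, y, f)"]) simp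
  qed
  from bchoice[OF this] obtain d where d: "\<forall>i\<in>?N.
      dual_family K L (grade L (cj i \<alpha>)) {..<fst (d i) :: nat} (fst (snd (d i))) (snd (snd (d i)))"
    by (elim exE)
  define n where "n i = fst (d i)" for i
  define y where "y i = fst (snd (d i))" for i
  define f where "f i = snd (snd (d i))" for i
  have dual: "dual_family K L (grade L (cj i \<alpha>)) {..<n i} (y i) (f i)" if "i \<in> ?N" for i
    using bspec[OF d that] by (simp only: n_def y_def f_def)
  have yk: "y i k \<in> grade L (cj i \<alpha>)" "y i k \<in> carrier L" if "i \<in> ?N" "k < n i" for i k
    using dual[OF that(1)] that base_grade_carrier unfolding dual_family_def by auto
  have fk: "\<And>v. v \<in> grade L (cj i \<alpha>) \<Longrightarrow> f i k v \<in> carrier K"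
    "\<And>u v. u \<in> grade L (cj i \<alpha>) \<Longrightarrow> v \<in> grade L (cj i \<alpha>) \<Longrightarrow> f i k (u \<oplus>\<^bsub>L\<^esub> v) = f i k u \<oplus>\<^bsub>K\<^esub> f i k v"
    "\<And>c v. c \<in> carrier K \<Longrightarrow> v \<in> grade L (cj i \<alpha>) \<Longrightarrow> f i k (c \<odot>\<^bsub>L\<^esub> v) = c \<otimes>\<^bsub>K\<^esub> f i k v"
    if "i \<in> ?N" "k < n i" for i k
    using dual[OF that(1)] that unfolding dual_family_def by auto
  let ?J = "Sigma ?N (\<lambda>i. {..<n i})"
  have J: "finite ?J" using finite_cosets by auto
  have sc: "single i (y i k) \<in> grade TL \<alpha>" "single i (y i k) \<in> carrier TL" if "(i, k) \<in> ?J" for i k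
    using single_grade[OF _ \<alpha>, of i "y i k"] single_closed yk that by auto
  show ?thesis
  proof (rule TLM.projective_finite_typeI[OF J])
    show "grade TL \<alpha> \<subseteq> carrier TL" using TL_grade_carrier by blast
    show "dual_family K TL (grade TL \<alpha>) ?J (\<lambda>(i, k). single i (y i k)) (\<lambda>(i, k) v. f i k (v i))"
      unfolding dual_family_def
    proof (intro conjI ballI)
      fix p assume p: "p \<in> ?J"
      then obtain i k where ik: "p = (i, k)" "i \<in> ?N" "i \<in> R" "cj i \<alpha> \<in> G" "k < n i" by auto
      note vi = TL_gradeD(1)[OF _ ik(3,4)]
      show "(case p of (i, k) \<Rightarrow> single i (y i k)) \<in> grade TL \<alpha>" using sc ik p by auto
      show "(case p of (i, k) \<Rightarrow> \<lambda>v. f i k (v i)) \<in> grade TL \<alpha> \<rightarrow> carrier K"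
        using fk(1)[OF ik(2,5)] vi ik(1) by auto
      show "(case p of (i, k) \<Rightarrow> \<lambda>v. f i k (v i)) (u \<oplus>\<^bsub>TL\<^esub> v) =
          (case p of (i, k) \<Rightarrow> \<lambda>v. f i k (v i)) u \<oplus>\<^bsub>K\<^esub> (case p of (i, k) \<Rightarrow> \<lambda>v. f i k (v i)) v"
        if "u \<in> grade TL \<alpha>" "v \<in> grade TL \<alpha>" for u v
        using fk(2)[OF ik(2,5) vi[OF that(1)] vi[OF that(2)]] ik by (simp add: TL_apply)
      show "(case p of (i, k) \<Rightarrow> \<lambda>v. f i k (v i)) (c \<odot>\<^bsub>TL\<^esub> v) =
          c \<otimes>\<^bsub>K\<^esub> (case p of (i, k) \<Rightarrow> \<lambda>v. f i k (v i)) v"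
        if "c \<in> carrier K" "v \<in> grade TL \<alpha>" for c v
        using fk(3)[OF ik(2,5) that(1) vi[OF that(2)]] ik by (simp add: TL_apply)
    next
      fix v assume v: "v \<in> grade TL \<alpha>"
      let ?t = "\<lambda>(i, k). f i k (v i) \<odot>\<^bsub>TL\<^esub> single i (y i k)"
      have vi: "v i \<in> grade L (cj i \<alpha>)" if "i \<in> ?N" for i using TL_gradeD(1)[OF v] that by auto
      have tc: "?t p \<in> carrier TL" if "p \<in> ?J" for p
        using that sc fk(1) vi TL_closed(5) by (auto split: prod.splits)
      have "v = (\<Oplus>\<^bsub>TL\<^esub>p\<in>?J. ?t p)"
      proof (rule TL_ext)
        show "v \<in> carrier TL" using TL_grade_carrier[OF v] .
        show "(\<Oplus>\<^bsub>TL\<^esub>p\<in>?J. ?t p) \<in> carrier TL" using tc by (intro TL.finsum_closed) blast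
        fix j assume j: "j \<in> R"
        have e: "(\<Oplus>\<^bsub>TL\<^esub>p\<in>?J. ?t p) j = (\<Oplus>\<^bsub>L\<^esub>p\<in>?J. ?t p j)"
          by (rule TL_finsum_apply[OF j tc])
        show "v j = (\<Oplus>\<^bsub>TL\<^esub>p\<in>?J. ?t p) j"
        proof (cases "j \<in> ?N")
          case False
          then have "?t p j = \<zero>\<^bsub>L\<^esub>" if "p \<in> ?J" for p
            using that j fk(1) vi by (auto simp: TL_apply single_apply)
          then have "(\<Oplus>\<^bsub>L\<^esub>p\<in>?J. ?t p j) = \<zero>\<^bsub>L\<^esub>" by (rule base.L.add.finprod_one_eqI)
          then show ?thesis using e TL_gradeD(2)[OF v j] False j by simp
        next
          case True
          have "(\<Oplus>\<^bsub>L\<^esub>p\<in>?J. ?t p j) = (\<Oplus>\<^bsub>L\<^esub>p\<in>Pair j ` {..<n j}. ?t p j)"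
            using True J j fk(1) vi TL_entry[OF tc j]
            by (intro base.L.add.finprod_mono_neutral_cong_right)
              (auto simp: TL_apply single_apply image_iff)
          also have "\<dots> = (\<Oplus>\<^bsub>L\<^esub>k\<in>{..<n j}. ?t (j, k) j)"
            using True j fk(1) vi yk by (intro base.L.finsum_reindex) (auto simp: inj_on_def TL_apply single_apply)
          also have "\<dots> = (\<Oplus>\<^bsub>L\<^esub>k\<in>{..<n j}. f j k (v j) \<odot>\<^bsub>L\<^esub> y j k)"
            using True j fk(1) vi yk by (intro base.L.finsum_cong') (auto simp: TL_apply single_apply)
          also have "\<dots> = v j"
            using dual[OF True] vi[OF True] unfolding dual_family_def by simp
          finally show ?thesis using e by simp
        qed
      qed
      then show "v = (\<Oplus>\<^bsub>TL\<^esub>p\<in>?J. (case p of (i, k) \<Rightarrow> \<lambda>v. f i k (v i)) v \<odot>\<^bsub>TL\<^esub> (case p of (i, k) \<Rightarrow> single i (y i k)))"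
        by (simp add: case_prod_beta')
    qed
  qed
qed

text \<open>
  The projection to degree \<open>\<alpha>\<close> takes the component of degree \<open>\<omega>\<^sub>i\<alpha>\<omega>\<^sub>i\<^sup>-\<^sup>1\<close> of the entry at \<open>i\<close>, if this
  is an element of \<open>G\<close>. The sum over \<open>\<alpha>\<close> of the \<open>i\<close>-th entries becomes the decomposition of the
  \<open>i\<close>-th entry in \<open>L\<close> by the substitution \<open>g = \<omega>\<^sub>i\<alpha>\<omega>\<^sub>i\<^sup>-\<^sup>1\<close>.
\<close>

lemma TL_direct_sum:
  assumes x: "x \<in> carrier TL"
  shows "\<exists>!f. f \<in> (\<Pi>\<^sub>E \<alpha>\<in>carrier \<pi>. grade TL \<alpha>) \<and> finite {\<alpha>\<in>carrier \<pi>. f \<alpha> \<noteq> \<zero>\<^bsub>TL\<^esub>} \<and>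
             x = (\<Oplus>\<^bsub>TL\<^esub>\<alpha>\<in>{\<alpha>\<in>carrier \<pi>. f \<alpha> \<noteq> \<zero>\<^bsub>TL\<^esub>}. f \<alpha>)"
proof (rule direct_sum_by_projections[OF TL.abelian_group_axioms _ _ _ _ _ _ _ x])
  define pr where "pr \<alpha> x = (\<lambda>i\<in>R. if cj i \<alpha> \<in> G then base.component (cj i \<alpha>) (x i) else \<zero>\<^bsub>L\<^esub>)" for \<alpha> x
  have cg: "base.component g a \<in> grade L g" "base.component g a \<in> carrier L" if "g \<in> G" "a \<in> carrier L" for g a
    using base.component_grade[OF that(2), of g] that base_grade_carrier by auto
  show prg: "pr \<alpha> x \<in> grade TL \<alpha>" if "x \<in> carrier TL" for \<alpha> x
    unfolding TL_grade_iff using cg TL_entry[OF that] by (auto simp: pr_def)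
  have prc: "pr \<alpha> x \<in> carrier TL" if "x \<in> carrier TL" for \<alpha> x
    using TL_grade_carrier[OF prg[OF that]] .
  show "grade TL \<alpha> \<subseteq> carrier TL" for \<alpha> using TL_grade_carrier by blast
  show "pr \<alpha> (x \<oplus>\<^bsub>TL\<^esub> y) = pr \<alpha> x \<oplus>\<^bsub>TL\<^esub> pr \<alpha> y" if "x \<in> carrier TL" "y \<in> carrier TL" for \<alpha> x y
    using that prc TL_closed TL_entry base.component_add
    by (intro TL_ext) (auto simp: TL_apply pr_def)
  show "pr \<alpha> x = x" if "x \<in> grade TL \<alpha>" for \<alpha> x
    using prc[OF TL_grade_carrier[OF that]] TL_grade_carrier[OF that] TL_gradeD[OF that] base.component_homogeneous
    by (intro TL_ext) (auto simp: pr_def)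
  show "pr \<beta> x = \<zero>\<^bsub>TL\<^esub>" if "\<alpha> \<in> carrier \<pi>" "\<beta> \<in> carrier \<pi>" "\<alpha> \<noteq> \<beta>" "x \<in> grade TL \<alpha>" for \<alpha> \<beta> x
  proof (rule TL_ext)
    show "pr \<beta> x \<in> carrier TL" using prc TL_grade_carrier that(4) by blast
    fix i assume i: "i \<in> R"
    have ne: "cj i \<beta> \<noteq> cj i \<alpha>" using cj_inject[OF i that(1,2)] that(3) by metis
    show "pr \<beta> x i = \<zero>\<^bsub>TL\<^esub> i"
    proof (cases "cj i \<alpha> \<in> G")
      case True
      then show ?thesis
        using base.component_homogeneous[of "cj i \<alpha>" "cj i \<beta>" "x i"] TL_gradeD(1)[OF that(4) i] i ne
        by (auto simp: pr_def TL_apply)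
    next
      case False
      then have "x i = \<zero>\<^bsub>L\<^esub>" using TL_gradeD(2)[OF that(4) i] by simp
      then show ?thesis
        using base.component_homogeneous[of "cj i \<beta>" "cj i \<beta>" "\<zero>\<^bsub>L\<^esub>"] base.grade_zero i
        by (auto simp: pr_def TL_apply)
    qed
  qed (rule TL_closed)
  let ?s = "\<lambda>i. {g\<in>G. base.component g (x i) \<noteq> \<zero>\<^bsub>L\<^esub>}"
  let ?S = "{\<alpha>\<in>carrier \<pi>. pr \<alpha> x \<noteq> \<zero>\<^bsub>TL\<^esub>}"
  have sfin: "finite (?s i)" if "i \<in> R" for i
    using base.component_finite[OF TL_entry[OF x that]] by simp
  have "?S \<subseteq> (\<Union>i\<in>R. unconj i ` ?s i)"
  proof
    fix \<alpha> assume "\<alpha> \<in> ?S"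
    then have \<alpha>: "\<alpha> \<in> carrier \<pi>" "pr \<alpha> x \<noteq> \<zero>\<^bsub>TL\<^esub>" by auto
    then obtain i where i: "i \<in> R" "pr \<alpha> x i \<noteq> \<zero>\<^bsub>TL\<^esub> i" using TL_ext[OF prc[OF x] TL_closed(3)] by blast
    then have "cj i \<alpha> \<in> ?s i" by (auto simp: pr_def TL_apply split: if_splits)
    then show "\<alpha> \<in> (\<Union>i\<in>R. unconj i ` ?s i)"
      using i(1) unconj_facts(3)[OF i(1) \<alpha>(1)] by (metis (no_types, lifting) UN_I image_eqI)
  qed
  then show S: "finite ?S"
    using sfin finite_cosets by (meson finite_UN_I finite_imageI finite_subset)
  show "x = (\<Oplus>\<^bsub>TL\<^esub>\<alpha>\<in>?S. pr \<alpha> x)"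
  proof (rule TL_ext[OF x])
    show "(\<Oplus>\<^bsub>TL\<^esub>\<alpha>\<in>?S. pr \<alpha> x) \<in> carrier TL" using prc[OF x] by (intro TL.finsum_closed) auto
    fix i assume i: "i \<in> R"
    note xi = TL_entry[OF x i]
    have sub: "unconj i ` ?s i \<subseteq> ?S"
    proof
      fix \<alpha> assume "\<alpha> \<in> unconj i ` ?s i"
      then obtain g where g: "\<alpha> = unconj i g" "g \<in> G" "base.component g (x i) \<noteq> \<zero>\<^bsub>L\<^esub>" by auto
      note u = unconj_facts[OF i G_carrier[OF g(2)]]
      have "pr \<alpha> x i = base.component g (x i)" using g u i by (simp add: pr_def)
      then show "\<alpha> \<in> ?S" using g u i TL_apply(3) by auto
    qed
    have "(\<Oplus>\<^bsub>TL\<^esub>\<alpha>\<in>?S. pr \<alpha> x) i = (\<Oplus>\<^bsub>L\<^esub>\<alpha>\<in>?S. pr \<alpha> x i)"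
      by (rule TL_finsum_apply[OF i prc[OF x]])
    also have "\<dots> = (\<Oplus>\<^bsub>L\<^esub>\<alpha>\<in>unconj i ` ?s i. pr \<alpha> x i)"
    proof (rule base.L.add.finprod_mono_neutral_cong_right[OF S sub])
      show "pr \<alpha> x i = \<zero>\<^bsub>L\<^esub>" if "\<alpha> \<in> ?S - unconj i ` ?s i" for \<alpha>
      proof (rule ccontr)
        assume "pr \<alpha> x i \<noteq> \<zero>\<^bsub>L\<^esub>"
        then have "cj i \<alpha> \<in> ?s i" using i by (auto simp: pr_def split: if_splits)
        then show False using that unconj_facts(3)[OF i, of \<alpha>] by (metis (no_types, lifting) DiffE image_eqI mem_Collect_eq)
      qed
    qed (use TL_entry[OF prc[OF x] i] in auto)
    also have "\<dots> = (\<Oplus>\<^bsub>L\<^esub>g\<in>?s i. pr (unconj i g) x i)"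
    proof (rule base.L.finsum_reindex)
      show "inj_on (unconj i) (?s i)"
        using unconj_facts(2)[OF i] G_carrier by (intro inj_onI) (metis (no_types, lifting) mem_Collect_eq)
    qed (use TL_entry[OF prc[OF x] i] in auto)
    also have "\<dots> = (\<Oplus>\<^bsub>L\<^esub>g\<in>?s i. base.component g (x i))"
      using cg xi i unconj_facts(2)[OF i] G_carrier by (intro base.L.finsum_cong') (auto simp: pr_def)
    also have "\<dots> = x i" using base.component_sum[OF xi] by simp
    finally show "x i = (\<Oplus>\<^bsub>TL\<^esub>\<alpha>\<in>?S. pr \<alpha> x) i" by simp
  qed
qed

lemma pi_algebra_TL: "pi_algebra \<pi> K TL"
proof (intro pi_algebra.intro pi_algebra_axioms.intro)
  show "group \<pi>" "field K" "ring TL" "module K TL"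
    by (rule \<pi>.is_group base.K.field_axioms ring_TL module_TL)+
  show "(k \<odot>\<^bsub>TL\<^esub> x) \<otimes>\<^bsub>TL\<^esub> y = k \<odot>\<^bsub>TL\<^esub> (x \<otimes>\<^bsub>TL\<^esub> y)" "x \<otimes>\<^bsub>TL\<^esub> (k \<odot>\<^bsub>TL\<^esub> y) = k \<odot>\<^bsub>TL\<^esub> (x \<otimes>\<^bsub>TL\<^esub> y)"
    if "k \<in> carrier K" "x \<in> carrier TL" "y \<in> carrier TL" for k x y
    by (rule TL_ext; use that in \<open>simp add: TL_closed TL_apply TL_entry base.smult_mult_left base.smult_mult_right\<close>)+
  show "a \<otimes>\<^bsub>TL\<^esub> b \<in> grade TL (\<alpha> \<otimes>\<^bsub>\<pi>\<^esub> \<beta>)"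
    if g: "\<alpha> \<in> carrier \<pi>" "\<beta> \<in> carrier \<pi>" and a: "a \<in> grade TL \<alpha>" and b: "b \<in> grade TL \<beta>" for \<alpha> \<beta> a b
    unfolding TL_grade_iff
  proof (intro conjI ballI)
    show "a \<otimes>\<^bsub>TL\<^esub> b \<in> extensional R" by (simp add: TL_simps)
    fix i assume i: "i \<in> R"
    note c = TL_entry[OF TL_grade_carrier[OF a] i] TL_entry[OF TL_grade_carrier[OF b] i]
    show "(a \<otimes>\<^bsub>TL\<^esub> b) i \<in> (if cj i (\<alpha> \<otimes>\<^bsub>\<pi>\<^esub> \<beta>) \<in> G then grade L (cj i (\<alpha> \<otimes>\<^bsub>\<pi>\<^esub> \<beta>)) else {\<zero>\<^bsub>L\<^esub>})"
    proof (cases "cj i \<alpha> \<in> G \<and> cj i \<beta> \<in> G")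
      case True
      then have "a i \<otimes>\<^bsub>L\<^esub> b i \<in> grade L (cj i \<alpha> \<otimes>\<^bsub>\<pi>\<^esub> cj i \<beta>)"
        using base.grade_mult[of "cj i \<alpha>" "cj i \<beta>"] TL_gradeD(1)[OF a i] TL_gradeD(1)[OF b i] by simp
      moreover have "cj i (\<alpha> \<otimes>\<^bsub>\<pi>\<^esub> \<beta>) \<in> G"
        using G_closed(1)[of "cj i \<alpha>" "cj i \<beta>"] True unfolding cj_mult[OF i g] by simp
      ultimately show ?thesis using i unfolding cj_mult[OF i g] by (simp add: TL_apply)
    next
      case False
      then have "(a \<otimes>\<^bsub>TL\<^esub> b) i = \<zero>\<^bsub>L\<^esub>"
        using TL_gradeD(2)[OF a i] TL_gradeD(2)[OF b i] i c by (auto simp: TL_apply)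
      then show ?thesis using base.grade_zero by auto
    qed
  qed
  show "\<one>\<^bsub>TL\<^esub> \<in> grade TL \<one>\<^bsub>\<pi>\<^esub>"
    unfolding TL_grade_iff using cj_one G_closed(2) base.grade_one by (auto simp: TL_simps)
qed (use TL_grade_submodule TL_grade_projective TL_direct_sum in auto)

end

context transfer_data
begin

lemma eta_TL_single:
  assumes "x \<in> carrier TL" "i \<in> R" "b \<in> carrier L"
  shows "eta TL x (single i b) = eta L (x i) b"
proof -
  have "eta TL x (single i b) = (\<Oplus>\<^bsub>K\<^esub>j\<in>R. if i = j then eta L (x j) b else \<zero>\<^bsub>K\<^esub>)"
    unfolding TL_simps using assms TL_entry base.eta_closed base.eta_zero_right
    by (intro base.K.finsum_cong') (auto simp: single_apply)
  also have "\<dots> = eta L (x i) b"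
    using assms finite_cosets TL_entry base.eta_closed
    by (intro base.K.add.finprod_singleton[where f = "\<lambda>j. eta L (x j) b"]) auto
  finally show ?thesis .
qed

lemma frobenius_TL: "frobenius_pi_algebra \<pi> K TL"
proof (intro frobenius_pi_algebra.intro frobenius_pi_algebra_axioms.intro)
  show "pi_algebra \<pi> K TL" by (rule pi_algebra_TL)
  note ec = base.eta_closed[OF TL_entry TL_entry]
  show cl: "eta TL x y \<in> carrier K" if "x \<in> carrier TL" "y \<in> carrier TL" for x y
    unfolding TL_simps using ec that by (intro base.K.finsum_closed) auto
  show "eta TL x y = eta TL y x" if "x \<in> carrier TL" "y \<in> carrier TL" for x y
    unfolding TL_simps using ec that base.eta_sym[OF TL_entry TL_entry]
    by (intro base.K.finsum_cong') auto
  show "eta TL (x \<oplus>\<^bsub>TL\<^esub> y) z = eta TL x z \<oplus>\<^bsub>K\<^esub> eta TL y z"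
    if c: "x \<in> carrier TL" "y \<in> carrier TL" "z \<in> carrier TL" for x y z
  proof -
    have "eta TL (x \<oplus>\<^bsub>TL\<^esub> y) z = (\<Oplus>\<^bsub>K\<^esub>i\<in>R. eta L (x i) (z i) \<oplus>\<^bsub>K\<^esub> eta L (y i) (z i))"
      unfolding TL_simps(8) using ec c base.eta_add[OF TL_entry TL_entry TL_entry]
      by (intro base.K.finsum_cong') (auto simp: TL_apply)
    also have "\<dots> = eta TL x z \<oplus>\<^bsub>K\<^esub> eta TL y z"
      unfolding TL_simps(8) using ec c by (intro base.K.finsum_addf) auto
    finally show ?thesis .
  qed
  show "eta TL (k \<odot>\<^bsub>TL\<^esub> x) y = k \<otimes>\<^bsub>K\<^esub> eta TL x y"
    if c: "k \<in> carrier K" "x \<in> carrier TL" "y \<in> carrier TL" for k x y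
  proof -
    have "eta TL (k \<odot>\<^bsub>TL\<^esub> x) y = (\<Oplus>\<^bsub>K\<^esub>i\<in>R. k \<otimes>\<^bsub>K\<^esub> eta L (x i) (y i))"
      unfolding TL_simps(8) using ec c base.eta_smult[OF _ TL_entry TL_entry]
      by (intro base.K.finsum_cong') (auto simp: TL_apply)
    also have "\<dots> = k \<otimes>\<^bsub>K\<^esub> eta TL x y"
      unfolding TL_simps(8) using ec c finite_cosets by (intro base.K.finsum_rdistr[symmetric]) auto
    finally show ?thesis .
  qed
  show "eta TL a b = \<zero>\<^bsub>K\<^esub>"
    if g: "\<alpha> \<in> carrier \<pi>" "\<beta> \<in> carrier \<pi>" "\<alpha> \<otimes>\<^bsub>\<pi>\<^esub> \<beta> \<noteq> \<one>\<^bsub>\<pi>\<^esub>" and a: "a \<in> grade TL \<alpha>" and b: "b \<in> grade TL \<beta>"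
    for \<alpha> \<beta> a b
    unfolding TL_simps(8)
  proof (rule base.K.add.finprod_one_eqI)
    fix i assume i: "i \<in> R"
    note c = TL_entry[OF TL_grade_carrier[OF a] i] TL_entry[OF TL_grade_carrier[OF b] i]
    show "eta L (a i) (b i) = \<zero>\<^bsub>K\<^esub>"
    proof (cases "cj i \<alpha> \<in> G \<and> cj i \<beta> \<in> G")
      case True
      have "cj i \<alpha> \<otimes>\<^bsub>\<pi>\<^esub> cj i \<beta> \<noteq> \<one>\<^bsub>\<pi>\<^esub>"
        using cj_mult[OF i g(1,2)] cj_one[OF i] cj_inject[OF i, of "\<alpha> \<otimes>\<^bsub>\<pi>\<^esub> \<beta>" "\<one>\<^bsub>\<pi>\<^esub>"] g by simp
      then show ?thesis
        using base.eta_orthogonal[of "cj i \<alpha>" "cj i \<beta>"] True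
          TL_gradeD(1)[OF a i] TL_gradeD(1)[OF b i] by simp
    next
      case False
      then show ?thesis
        using TL_gradeD(2)[OF a i] TL_gradeD(2)[OF b i] c base.eta_zero_left base.eta_zero_right by auto
    qed
  qed
  show "a = \<zero>\<^bsub>TL\<^esub>"
    if \<alpha>: "\<alpha> \<in> carrier \<pi>" and a: "a \<in> grade TL \<alpha>"
      and z: "\<And>b. b \<in> grade TL (inv\<^bsub>\<pi>\<^esub> \<alpha>) \<Longrightarrow> eta TL a b = \<zero>\<^bsub>K\<^esub>" for \<alpha> a
  proof (rule TL_ext[OF TL_grade_carrier[OF a] TL_closed(3)])
    fix i assume i: "i \<in> R"
    have "a i = \<zero>\<^bsub>L\<^esub>"
    proof (cases "cj i \<alpha> \<in> G")
      case True
      have i': "cj i (inv\<^bsub>\<pi>\<^esub> \<alpha>) = inv\<^bsub>\<pi>\<lparr>carrier := G\<rparr>\<^esub> (cj i \<alpha>)"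
        using cj_inv[OF i \<alpha>] inv_G[OF True] by simp
      have ig: "inv\<^bsub>\<pi>\<lparr>carrier := G\<rparr>\<^esub> (cj i \<alpha>) \<in> G" using base.\<pi>.inv_closed[of "cj i \<alpha>"] True by simp
      show ?thesis
      proof (rule base.eta_nondegenerate)
        show "cj i \<alpha> \<in> carrier (\<pi>\<lparr>carrier := G\<rparr>)" using True by simp
        show "a i \<in> grade L (cj i \<alpha>)" using TL_gradeD(1)[OF a i True] .
        fix b assume b: "b \<in> grade L (inv\<^bsub>\<pi>\<lparr>carrier := G\<rparr>\<^esub> (cj i \<alpha>))"
        have "single i b \<in> grade TL (inv\<^bsub>\<pi>\<^esub> \<alpha>)"
          using single_grade[OF i, of "inv\<^bsub>\<pi>\<^esub> \<alpha>" b] b ig \<alpha> unfolding i' by simp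
        then show "eta L (a i) b = \<zero>\<^bsub>K\<^esub>"
          using z eta_TL_single[OF TL_grade_carrier[OF a] i base_grade_carrier[OF ig b]] by simp
      qed
    qed (use TL_gradeD(2)[OF a i] in blast)
    then show "a i = \<zero>\<^bsub>TL\<^esub> i" using i by (simp add: TL_apply)
  qed
  show "eta TL (a \<otimes>\<^bsub>TL\<^esub> b) c = eta TL a (b \<otimes>\<^bsub>TL\<^esub> c)"
    if "a \<in> carrier TL" "b \<in> carrier TL" "c \<in> carrier TL" for a b c
    unfolding TL_simps(8) using that TL_entry base.eta_closed base.eta_assoc
    by (intro base.K.finsum_cong') (auto simp: TL_apply)
qed

lemma dv_carrier: "i \<in> R \<Longrightarrow> \<beta> \<in> carrier \<pi> \<Longrightarrow> dv i \<beta> \<in> carrier (\<pi>\<lparr>carrier := G\<rparr>)"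
  using dv_closed by simp

lemma phi_TL_closed:
  assumes "\<beta> \<in> carrier \<pi>" "x \<in> carrier TL"
  shows "phi TL \<beta> x \<in> carrier TL"
  using assms base.phi_closed[OF dv_carrier] TL_entry[OF assms(2) act_closed]
  by (auto simp: TL_simps(1,9))

lemma phi_TL_hom:
  assumes g: "\<alpha> \<in> carrier \<pi>" "\<beta> \<in> carrier \<pi>" and x: "x \<in> carrier TL"
  shows "phi TL (\<alpha> \<otimes>\<^bsub>\<pi>\<^esub> \<beta>) x = phi TL \<alpha> (phi TL \<beta> x)"
proof (rule TL_ext)
  fix i assume i: "i \<in> R"
  note i' = act_closed[OF i g(1)] and i'' = act_closed[OF act_closed[OF i g(1)] g(2)]
  have "phi TL (\<alpha> \<otimes>\<^bsub>\<pi>\<^esub> \<beta>) x i =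
      phi L (dv i \<alpha> \<otimes>\<^bsub>\<pi>\<^esub> dv (i #>\<^bsub>\<pi>\<^esub> \<alpha>) \<beta>) (x (i #>\<^bsub>\<pi>\<^esub> \<alpha> #>\<^bsub>\<pi>\<^esub> \<beta>))"
    using i by (simp only: TL_apply(6) dv_mult[OF i g] act_act[OF i g])
  also have "\<dots> = phi L (dv i \<alpha>) (phi L (dv (i #>\<^bsub>\<pi>\<^esub> \<alpha>) \<beta>) (x (i #>\<^bsub>\<pi>\<^esub> \<alpha> #>\<^bsub>\<pi>\<^esub> \<beta>)))"
    using base.phi_hom[OF dv_carrier[OF i g(1)] dv_carrier[OF i' g(2)] TL_entry[OF x i'']] by simp
  also have "\<dots> = phi TL \<alpha> (phi TL \<beta> x) i"
    using i i' by (simp only: TL_apply(6))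
  finally show "phi TL (\<alpha> \<otimes>\<^bsub>\<pi>\<^esub> \<beta>) x i = phi TL \<alpha> (phi TL \<beta> x) i" .
qed (use assms phi_TL_closed in auto)

lemma phi_TL_unit: 
  assumes x: "x \<in> carrier TL"
  shows "phi TL \<one>\<^bsub>\<pi>\<^esub> x = x"
proof (rule TL_ext)
  fix i assume i: "i \<in> R"
  have "dv i \<one>\<^bsub>\<pi>\<^esub> = \<one>\<^bsub>\<pi>\<^esub>" using act_one[OF i] rep_closed[OF i] by simp
  then show "phi TL \<one>\<^bsub>\<pi>\<^esub> x i = x i"
    using base.phi_unit[OF TL_entry[OF x i]] i act_one[OF i] by (simp only: TL_apply(6)) simp
qed (use assms phi_TL_closed in auto)

text \<open>
  At each coset \<open>i\<close> the axioms for \<open>\<beta>\<close> follow from those of \<open>L\<close> for \<open>dv i \<beta>\<close>: the rule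
  \<open>dv_mult\<close> gives the homomorphism property, \<open>dv_conj\<close> the effect on degrees, and for a coset fixed
  by \<open>\<beta>\<close> the elements \<open>dv i \<beta>\<close> and \<open>cj i \<beta>\<close> coincide.
\<close>

lemma precrossed_TL: "precrossed_pi_algebra \<pi> K TL"
proof (intro precrossed_pi_algebra.intro precrossed_pi_algebra_axioms.intro)
  show "frobenius_pi_algebra \<pi> K TL" by (rule frobenius_TL)
  show "phi TL (\<alpha> \<otimes>\<^bsub>\<pi>\<^esub> \<beta>) x = phi TL \<alpha> (phi TL \<beta> x)"
    if "\<alpha> \<in> carrier \<pi>" "\<beta> \<in> carrier \<pi>" "x \<in> carrier TL" for \<alpha> \<beta> x
    using phi_TL_hom that .
  show "phi TL \<beta> \<in> ring_iso TL TL" if \<beta>: "\<beta> \<in> carrier \<pi>" for \<beta>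
  proof (rule ring_iso_memI)
    note d = dv_carrier[OF _ \<beta>]
    show "phi TL \<beta> x \<in> carrier TL" if "x \<in> carrier TL" for x using phi_TL_closed[OF \<beta> that] .
    show "phi TL \<beta> (x \<otimes>\<^bsub>TL\<^esub> y) = phi TL \<beta> x \<otimes>\<^bsub>TL\<^esub> phi TL \<beta> y"
      if "x \<in> carrier TL" "y \<in> carrier TL" for x y
      by (rule TL_ext) (use that \<beta> in \<open>simp_all add: phi_TL_closed TL_closed TL_apply act_closed
          base.phi_mult[OF d] TL_entry\<close>)
    show "phi TL \<beta> (x \<oplus>\<^bsub>TL\<^esub> y) = phi TL \<beta> x \<oplus>\<^bsub>TL\<^esub> phi TL \<beta> y"
      if "x \<in> carrier TL" "y \<in> carrier TL" for x y
      by (rule TL_ext) (use that \<beta> in \<open>simp_all add: phi_TL_closed TL_closed TL_apply act_closed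
          base.phi_add[OF d] TL_entry\<close>)
    show "phi TL \<beta> \<one>\<^bsub>TL\<^esub> = \<one>\<^bsub>TL\<^esub>"
      by (rule TL_ext) (use \<beta> in \<open>simp_all add: phi_TL_closed TL_closed TL_apply act_closed
          base.phi_one[OF d]\<close>)
    have "phi TL (inv\<^bsub>\<pi>\<^esub> \<beta>) (phi TL \<beta> x) = x" "phi TL \<beta> (phi TL (inv\<^bsub>\<pi>\<^esub> \<beta>) x) = x" if "x \<in> carrier TL" for x
      using phi_TL_hom[of "inv\<^bsub>\<pi>\<^esub> \<beta>" \<beta> x] phi_TL_hom[of \<beta> "inv\<^bsub>\<pi>\<^esub> \<beta>" x] phi_TL_unit \<beta> that by auto
    then show "bij_betw (phi TL \<beta>) (carrier TL) (carrier TL)"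
      using \<beta> phi_TL_closed by (intro bij_betwI[where g = "phi TL (inv\<^bsub>\<pi>\<^esub> \<beta>)"]) auto
  qed
  show "phi TL \<beta> (k \<odot>\<^bsub>TL\<^esub> x) = k \<odot>\<^bsub>TL\<^esub> phi TL \<beta> x"
    if "\<beta> \<in> carrier \<pi>" "k \<in> carrier K" "x \<in> carrier TL" for \<beta> k x
    by (rule TL_ext) (use that in \<open>simp_all add: phi_TL_closed TL_closed TL_apply act_closed
          base.phi_smult[OF dv_carrier] TL_entry\<close>)
  show "eta TL (phi TL \<beta> x) (phi TL \<beta> y) = eta TL x y"
    if \<beta>: "\<beta> \<in> carrier \<pi>" and x: "x \<in> carrier TL" and y: "y \<in> carrier TL" for \<beta> x y
  proof -
    have "eta TL (phi TL \<beta> x) (phi TL \<beta> y) = (\<Oplus>\<^bsub>K\<^esub>i\<in>R. eta L (x (i #>\<^bsub>\<pi>\<^esub> \<beta>)) (y (i #>\<^bsub>\<pi>\<^esub> \<beta>)))"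
      unfolding TL_simps(8)
      using \<beta> x y base.phi_eta[OF dv_carrier] act_closed TL_entry base.eta_closed
      by (intro base.K.finsum_cong') (auto simp: TL_apply)
    also have "\<dots> = (\<Oplus>\<^bsub>K\<^esub>i\<in>(\<lambda>i. i #>\<^bsub>\<pi>\<^esub> \<beta>) ` R. eta L (x i) (y i))"
      using \<beta> x y act_closed TL_entry base.eta_closed act_inv(1)
      by (intro base.K.finsum_reindex[symmetric]) (auto intro!: inj_on_inverseI[where g = "\<lambda>i. i #>\<^bsub>\<pi>\<^esub> inv\<^bsub>\<pi>\<^esub> \<beta>"])
    also have "(\<lambda>i. i #>\<^bsub>\<pi>\<^esub> \<beta>) ` R = R"
    proof (intro equalityI subsetI)
      fix i assume i: "i \<in> R"
      then show "i \<in> (\<lambda>i. i #>\<^bsub>\<pi>\<^esub> \<beta>) ` R"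
        using act_inv(2)[OF i \<beta>] act_closed[OF i, of "inv\<^bsub>\<pi>\<^esub> \<beta>"] \<beta> by (metis \<pi>.inv_closed image_eqI)
    qed (use act_closed \<beta> in auto)
    finally show ?thesis by (simp add: TL_simps(8))
  qed
  show "phi TL \<beta> a \<in> grade TL (\<beta> \<otimes>\<^bsub>\<pi>\<^esub> \<alpha> \<otimes>\<^bsub>\<pi>\<^esub> inv\<^bsub>\<pi>\<^esub> \<beta>)"
    if g: "\<alpha> \<in> carrier \<pi>" "\<beta> \<in> carrier \<pi>" and a: "a \<in> grade TL \<alpha>" for \<alpha> \<beta> a
    unfolding TL_grade_iff
  proof (intro conjI ballI)
    show "phi TL \<beta> a \<in> extensional R" by (simp add: TL_simps)
    fix i assume i: "i \<in> R"
    let ?c = "cj i (\<beta> \<otimes>\<^bsub>\<pi>\<^esub> \<alpha> \<otimes>\<^bsub>\<pi>\<^esub> inv\<^bsub>\<pi>\<^esub> \<beta>)"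
    note i' = act_closed[OF i g(2)] and d = dv_carrier[OF i g(2)]
    show "phi TL \<beta> a i \<in> (if ?c \<in> G then grade L ?c else {\<zero>\<^bsub>L\<^esub>})"
    proof (cases "cj (i #>\<^bsub>\<pi>\<^esub> \<beta>) \<alpha> \<in> G")
      case True
      have "phi TL \<beta> a i \<in> grade L (dv i \<beta> \<otimes>\<^bsub>\<pi>\<^esub> cj (i #>\<^bsub>\<pi>\<^esub> \<beta>) \<alpha> \<otimes>\<^bsub>\<pi>\<^esub> inv\<^bsub>\<pi>\<^esub> dv i \<beta>)"
        using base.phi_grade[OF _ d TL_gradeD(1)[OF a i' True]] True i inv_G[OF dv_closed[OF i g(2)]]
        by (simp add: TL_apply)
      moreover have "dv i \<beta> \<otimes>\<^bsub>\<pi>\<^esub> cj (i #>\<^bsub>\<pi>\<^esub> \<beta>) \<alpha> \<otimes>\<^bsub>\<pi>\<^esub> inv\<^bsub>\<pi>\<^esub> dv i \<beta> \<in> G"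
        using True dv_closed[OF i g(2)] G_closed by blast
      ultimately show ?thesis unfolding dv_conj[OF i g] by simp
    next
      case False
      then have "phi TL \<beta> a i = \<zero>\<^bsub>L\<^esub>"
        using TL_gradeD(2)[OF a i'] base.phi_zero[OF d] i by (simp add: TL_apply)
      then show ?thesis using base.grade_zero by simp
    qed
  qed
  \<comment> \<open>A homogeneous element of degree \<open>\<beta>\<close> is supported on the cosets fixed by \<open>\<beta>\<close>.\<close>
  have move: "b i = \<zero>\<^bsub>L\<^esub>" if "i \<in> R" "b \<in> grade TL \<beta>" "\<beta> \<in> carrier \<pi>" "i #>\<^bsub>\<pi>\<^esub> \<beta> \<noteq> i" for b i \<beta>
    using TL_gradeD(2)[OF that(2,1)] fixed_iff[OF that(1,3)] that(4) by simp
  show "phi TL \<beta> b = b" if \<beta>: "\<beta> \<in> carrier \<pi>" and b: "b \<in> grade TL \<beta>" for \<beta> b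
  proof (rule TL_ext[OF phi_TL_closed[OF \<beta> TL_grade_carrier[OF b]] TL_grade_carrier[OF b]])
    fix i assume i: "i \<in> R"
    show "phi TL \<beta> b i = b i"
    proof (cases "i #>\<^bsub>\<pi>\<^esub> \<beta> = i")
      case True
      then have "cj i \<beta> \<in> G" using fixed_iff[OF i \<beta>] by simp
      then show ?thesis
        using True i base.phi_id[of "cj i \<beta>" "b i"] TL_gradeD(1)[OF b i] by (simp add: TL_apply)
    next
      case False
      have "(i #>\<^bsub>\<pi>\<^esub> \<beta>) #>\<^bsub>\<pi>\<^esub> \<beta> \<noteq> i #>\<^bsub>\<pi>\<^esub> \<beta>"
        using False act_inv(1)[OF i \<beta>] act_inv(1)[OF act_closed[OF i \<beta>] \<beta>] by metis
      then show ?thesis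
        using move[OF i b \<beta> False] move[OF act_closed[OF i \<beta>] b \<beta>] base.phi_zero[OF dv_carrier[OF i \<beta>]] i
        by (simp add: TL_apply)
    qed
  qed
  show "phi TL \<beta> a \<otimes>\<^bsub>TL\<^esub> b = b \<otimes>\<^bsub>TL\<^esub> a"
    if \<beta>: "\<beta> \<in> carrier \<pi>" and a: "a \<in> carrier TL" and b: "b \<in> grade TL \<beta>" for \<beta> a b
  proof (rule TL_ext)
    note bc = TL_grade_carrier[OF b]
    show "phi TL \<beta> a \<otimes>\<^bsub>TL\<^esub> b \<in> carrier TL" "b \<otimes>\<^bsub>TL\<^esub> a \<in> carrier TL"
      using phi_TL_closed[OF \<beta> a] bc a TL_closed by auto
    fix i assume i: "i \<in> R"
    show "(phi TL \<beta> a \<otimes>\<^bsub>TL\<^esub> b) i = (b \<otimes>\<^bsub>TL\<^esub> a) i"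
    proof (cases "i #>\<^bsub>\<pi>\<^esub> \<beta> = i")
      case True
      then have "cj i \<beta> \<in> G" using fixed_iff[OF i \<beta>] by simp
      then show ?thesis
        using True i base.phi_crossed[of "cj i \<beta>" "a i" "b i"] TL_gradeD(1)[OF b i] TL_entry[OF a i]
        by (simp add: TL_apply)
    next
      case False
      then show ?thesis
        using move[OF i b \<beta> False] i TL_entry[OF a] TL_entry[OF phi_TL_closed[OF \<beta> a] i]
        by (simp add: TL_apply(1))
    qed
  qed
qed

sublocale TL: precrossed_pi_algebra \<pi> K TL by (rule precrossed_TL)

lemma phi_TL_single:
  assumes i: "i \<in> R" and \<beta>: "\<beta> \<in> carrier \<pi>" and a: "a \<in> carrier L"
  shows "phi TL \<beta> (single i a) =
    single (i #>\<^bsub>\<pi>\<^esub> inv\<^bsub>\<pi>\<^esub> \<beta>) (phi L (dv (i #>\<^bsub>\<pi>\<^esub> inv\<^bsub>\<pi>\<^esub> \<beta>) \<beta>) a)"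
proof (rule TL_ext)
  have \<beta>': "inv\<^bsub>\<pi>\<^esub> \<beta> \<in> carrier \<pi>" using \<beta> by simp
  show "phi TL \<beta> (single i a) \<in> carrier TL" using phi_TL_closed[OF \<beta> single_closed[OF a]] .
  show "single (i #>\<^bsub>\<pi>\<^esub> inv\<^bsub>\<pi>\<^esub> \<beta>) (phi L (dv (i #>\<^bsub>\<pi>\<^esub> inv\<^bsub>\<pi>\<^esub> \<beta>) \<beta>) a) \<in> carrier TL"
    using single_closed base.phi_closed[OF dv_carrier[OF act_closed[OF i \<beta>'] \<beta>] a] by blast
  fix j assume j: "j \<in> R"
  have "j #>\<^bsub>\<pi>\<^esub> \<beta> = i \<longleftrightarrow> j = i #>\<^bsub>\<pi>\<^esub> inv\<^bsub>\<pi>\<^esub> \<beta>" using act_eq_iff[OF j i \<beta>] .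
  then show "phi TL \<beta> (single i a) j =
      single (i #>\<^bsub>\<pi>\<^esub> inv\<^bsub>\<pi>\<^esub> \<beta>) (phi L (dv (i #>\<^bsub>\<pi>\<^esub> inv\<^bsub>\<pi>\<^esub> \<beta>) \<beta>) a) j"
    using j act_closed[OF j \<beta>] base.phi_zero[OF dv_carrier[OF j \<beta>]]
    by (auto simp: TL_apply(6) single_apply)
qed

lemma single_mult:
  assumes "i \<in> R" "j \<in> R" "a \<in> carrier L" "b \<in> carrier L"
  shows "single i a \<otimes>\<^bsub>TL\<^esub> single j b = (if i = j then single i (a \<otimes>\<^bsub>L\<^esub> b) else \<zero>\<^bsub>TL\<^esub>)"
proof (rule TL_ext)
  show "single i a \<otimes>\<^bsub>TL\<^esub> single j b \<in> carrier TL"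
    "(if i = j then single i (a \<otimes>\<^bsub>L\<^esub> b) else \<zero>\<^bsub>TL\<^esub>) \<in> carrier TL"
    using single_closed TL_closed assms by simp_all
qed (use assms in \<open>simp add: TL_apply single_apply\<close>)

lemma single_smult:
  assumes "i \<in> R" "c \<in> carrier K" "a \<in> carrier L"
  shows "c \<odot>\<^bsub>TL\<^esub> single i a = single i (c \<odot>\<^bsub>L\<^esub> a)"
  by (rule TL_ext) (use assms in \<open>simp_all add: single_closed TL_closed TL_apply single_apply\<close>)

lemma single_eq_zero_iff:
  assumes "i \<in> R"
  shows "single i a = \<zero>\<^bsub>TL\<^esub> \<longleftrightarrow> a = \<zero>\<^bsub>L\<^esub>"
proof
  assume "single i a = \<zero>\<^bsub>TL\<^esub>"
  then have "single i a i = \<zero>\<^bsub>TL\<^esub> i" by simp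
  then show "a = \<zero>\<^bsub>L\<^esub>" using assms by (simp add: TL_apply single_apply)
qed (auto simp: single_def TL_simps(4))

end

subsection \<open>Transfers of algebras with one-dimensional components\<close>

locale line_transfer = transfer_data +
  assumes one_span: "a \<in> grade L \<one>\<^bsub>\<pi>\<^esub> \<Longrightarrow> \<exists>k\<in>carrier K. a = k \<odot>\<^bsub>L\<^esub> \<one>\<^bsub>L\<^esub>"
    and one_norm: "eta L \<one>\<^bsub>L\<^esub> \<one>\<^bsub>L\<^esub> = \<one>\<^bsub>K\<^esub>"
    and full_support: "g \<in> G \<Longrightarrow> \<exists>a\<in>grade L g. a \<noteq> \<zero>\<^bsub>L\<^esub>"
begin

abbreviation e where "e i \<equiv> single i \<one>\<^bsub>L\<^esub>"

lemma base_one_nonzero: "\<one>\<^bsub>L\<^esub> \<noteq> \<zero>\<^bsub>L\<^esub>"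
  using one_norm base.eta_zero_left[of "\<one>\<^bsub>L\<^esub>"] by auto

lemma e_grade: "i \<in> R \<Longrightarrow> e i \<in> grade TL \<one>\<^bsub>\<pi>\<^esub>"
  using single_grade[of i "\<one>\<^bsub>\<pi>\<^esub>" "\<one>\<^bsub>L\<^esub>"] cj_one G_closed(2) base.grade_one by simp

lemma e_inj: "inj_on e R"
proof (rule inj_onI)
  fix i j assume ij: "i \<in> R" "j \<in> R" "e i = e j"
  then have "e i i = e j i" by simp
  then show "i = j" using ij(1) base_one_nonzero by (auto simp: single_apply split: if_splits)
qed

text \<open>
  The degree-one part of the transfer is the product over all cosets \<open>i\<close> of the lines \<open>K1\<^sub>L\<close>.
\<close>

lemma splitting_TL: "splitting \<pi> K TL (e ` R)"
proof (rule TL.splittingI)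
  show "finite (e ` R)" using finite_cosets by simp
  show "e ` R \<subseteq> grade TL \<one>\<^bsub>\<pi>\<^esub>" using e_grade by auto
  show "\<zero>\<^bsub>TL\<^esub> \<notin> e ` R"
  proof
    assume "\<zero>\<^bsub>TL\<^esub> \<in> e ` R"
    then obtain i where "i \<in> R" "\<zero>\<^bsub>TL\<^esub> = e i" by (rule imageE)
    then show False using single_eq_zero_iff[of i "\<one>\<^bsub>L\<^esub>"] base_one_nonzero by simp
  qed
  fix k l assume "k \<in> e ` R" "l \<in> e ` R"
  then obtain i j where ij: "i \<in> R" "j \<in> R" "k = e i" "l = e j" by auto
  then show "k \<otimes>\<^bsub>TL\<^esub> l = (if k = l then k else \<zero>\<^bsub>TL\<^esub>)"
    using single_mult[of i j] e_inj by (auto simp: inj_on_def)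
next
  fix a assume a: "a \<in> grade TL \<one>\<^bsub>\<pi>\<^esub>"
  note ac = TL_grade_carrier[OF a]
  have "\<forall>i\<in>R. \<exists>k. k \<in> carrier K \<and> a i = k \<odot>\<^bsub>L\<^esub> \<one>\<^bsub>L\<^esub>"
    using TL_gradeD(1)[OF a] cj_one G_closed(2) one_span by (metis (no_types, lifting))
  from bchoice[OF this] obtain k where k: "\<forall>i\<in>R. k i \<in> carrier K \<and> a i = k i \<odot>\<^bsub>L\<^esub> \<one>\<^bsub>L\<^esub>" by (elim exE)
  define c where "c = k \<circ> inv_into R e"
  have ce: "c (e i) = k i" if "i \<in> R" for i 
    unfolding c_def o_apply using inv_into_f_f[OF e_inj that] by simp
  have t: "c x \<odot>\<^bsub>TL\<^esub> x \<in> carrier TL" if "x \<in> e ` R" for x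
    using that ce k single_closed TL_closed(5) by auto
  have "a = (\<Oplus>\<^bsub>TL\<^esub>x\<in>e ` R. c x \<odot>\<^bsub>TL\<^esub> x)"
  proof (rule TL_ext[OF ac])
    show "(\<Oplus>\<^bsub>TL\<^esub>x\<in>e ` R. c x \<odot>\<^bsub>TL\<^esub> x) \<in> carrier TL" using t by (intro TL.finsum_closed) blast
    fix j assume j: "j \<in> R"
    have "(\<Oplus>\<^bsub>TL\<^esub>x\<in>e ` R. c x \<odot>\<^bsub>TL\<^esub> x) j = (\<Oplus>\<^bsub>L\<^esub>x\<in>e ` R. (c x \<odot>\<^bsub>TL\<^esub> x) j)"
      by (rule TL_finsum_apply[OF j t])
    also have "\<dots> = (\<Oplus>\<^bsub>L\<^esub>i\<in>R. (c (e i) \<odot>\<^bsub>TL\<^esub> e i) j)"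
      using e_inj TL_entry[OF t j] by (intro base.L.finsum_reindex) auto
    also have "\<dots> = (\<Oplus>\<^bsub>L\<^esub>i\<in>R. if j = i then a i else \<zero>\<^bsub>L\<^esub>)"
      using j ce k TL_entry[OF ac] by (intro base.L.finsum_cong') (auto simp: TL_apply(5) single_apply)
    also have "\<dots> = a j"
      using j finite_cosets TL_entry[OF ac] by (intro base.L.add.finprod_singleton) auto
    finally show "a j = (\<Oplus>\<^bsub>TL\<^esub>x\<in>e ` R. c x \<odot>\<^bsub>TL\<^esub> x) j" by simp
  qed
  then show "\<exists>c. c \<in> e ` R \<rightarrow> carrier K \<and> a = (\<Oplus>\<^bsub>TL\<^esub>x\<in>e ` R. c x \<odot>\<^bsub>TL\<^esub> x)"
    using ce k by (intro exI[of _ c]) auto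
qed

lemma phi_TL_e: "i \<in> R \<Longrightarrow> \<beta> \<in> carrier \<pi> \<Longrightarrow> phi TL \<beta> (e i) = e (i #>\<^bsub>\<pi>\<^esub> inv\<^bsub>\<pi>\<^esub> \<beta>)"
  using phi_TL_single[of i \<beta> "\<one>\<^bsub>L\<^esub>"] base.phi_one[OF dv_carrier] act_closed by simp

sublocale TL: normalized_splitting \<pi> K TL "e ` R"
proof unfold_locales
  show "splitting \<pi> K TL (e ` R)" by (rule splitting_TL)
  fix x assume "x \<in> e ` R"
  then obtain i where i: "i \<in> R" "x = e i" by auto
  then show "eta TL x x = \<one>\<^bsub>K\<^esub>"
    using eta_TL_single[OF single_closed i(1), of "\<one>\<^bsub>L\<^esub>" "\<one>\<^bsub>L\<^esub>"] one_norm by (simp add: single_apply)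
qed

lemma transfer_idem_eq: "transfer_idem \<pi> G L = e G"
  by (simp add: transfer_idem_def single_def)

lemma fixed_e_iff:
  assumes "i \<in> R" "\<alpha> \<in> carrier \<pi>"
  shows "phi TL \<alpha> (e i) = e i \<longleftrightarrow> cj i \<alpha> \<in> G"
proof -
  have "phi TL \<alpha> (e i) = e i \<longleftrightarrow> i #>\<^bsub>\<pi>\<^esub> inv\<^bsub>\<pi>\<^esub> \<alpha> = i"
    using phi_TL_e[OF assms] e_inj act_closed[OF assms(1), of "inv\<^bsub>\<pi>\<^esub> \<alpha>"] assms by (auto simp: inj_on_def)
  also have "\<dots> \<longleftrightarrow> i #>\<^bsub>\<pi>\<^esub> \<alpha> = i" using act_eq_iff[OF assms(1,1,2)] by auto
  finally show ?thesis using fixed_iff[OF assms] by simp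
qed

text \<open>
  A degree that fixes the coset \<open>i\<close> acts in \<open>L\<close> through an element of \<open>G\<close>, where the grading has a
  nonzero component; so no corner vanishes that should not, and the trace condition holds.
\<close>

sublocale TL: pointed_simple \<pi> K TL "e ` R" "transfer_idem \<pi> G L"
proof (intro pointed_simple.intro pointed_simple_axioms.intro)
  show "normalized_splitting \<pi> K TL (e ` R)" by (rule TL.normalized_splitting_axioms)
  show "crossed_pi_algebra \<pi> K TL"
  proof (rule TL.trace_condition_by_corners)
    fix x \<alpha> assume "x \<in> e ` R" and \<alpha>: "\<alpha> \<in> carrier \<pi>" and fx: "phi TL \<alpha> x = x"
    then obtain i where i: "i \<in> R" "x = e i" by auto
    have g: "cj i \<alpha> \<in> G" using fx fixed_e_iff[OF i(1) \<alpha>] i(2) by simp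
    obtain a where a: "a \<in> grade L (cj i \<alpha>)" "a \<noteq> \<zero>\<^bsub>L\<^esub>" using full_support[OF g] by blast
    note ac = base_grade_carrier[OF g a(1)]
    show "\<exists>a\<in>grade TL \<alpha>. x \<otimes>\<^bsub>TL\<^esub> a = a \<and> a \<noteq> \<zero>\<^bsub>TL\<^esub>"
      using single_grade[OF i(1) \<alpha> g a(1)] single_mult[OF i(1,1) base.L.one_closed ac] ac
        single_eq_zero_iff[OF i(1)] a(2) i(2) by (intro bexI[of _ "single i a"]) auto
  qed
  show "transfer_idem \<pi> G L \<in> e ` R" using G_coset transfer_idem_eq by simp
  fix x assume "x \<in> e ` R"
  then obtain j where j: "j \<in> R" "x = e j" by auto
  have "phi TL (inv\<^bsub>\<pi>\<^esub> \<omega> j) (transfer_idem \<pi> G L) = x"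
    using phi_TL_e[OF G_coset, of "inv\<^bsub>\<pi>\<^esub> \<omega> j"] rep_closed[OF j(1)] coset_rep[OF j(1)] j transfer_idem_eq
    by simp
  then show "\<exists>\<alpha>\<in>carrier \<pi>. phi TL \<alpha> (transfer_idem \<pi> G L) = x"
    using rep_closed[OF j(1)] by (intro bexI[of _ "inv\<^bsub>\<pi>\<^esub> \<omega> j"]) auto
qed

lemma transfer_stabilizer: "idem_stabilizer \<pi> TL (transfer_idem \<pi> G L) = G"
proof -
  have "G #>\<^bsub>\<pi>\<^esub> \<alpha> = G \<longleftrightarrow> \<alpha> \<in> G" if "\<alpha> \<in> carrier \<pi>" for \<alpha>
    using \<pi>.coset_join1[OF _ that G] \<pi>.coset_join2[OF that G] by blast
  then have "phi TL \<alpha> (e G) = e G \<longleftrightarrow> \<alpha> \<in> G" if "\<alpha> \<in> carrier \<pi>" for \<alpha>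
    using fixed_e_iff[OF G_coset that] fixed_iff[OF G_coset that] that by simp
  then show ?thesis using G_carrier unfolding idem_stabilizer_def transfer_idem_eq by blast
qed

end

section \<open>Transfers of twisted group algebras\<close>

locale cocycle_transfer = coset_system \<pi> G \<omega> + tw: twisted "\<pi>\<lparr>carrier := G\<rparr>" K \<theta>
  for \<pi> :: "('g, 'm) monoid_scheme" and G \<omega> and K :: "('k, 'n) ring_scheme" and \<theta>
begin

sublocale line_transfer \<pi> G \<omega> K tw.T
proof (intro line_transfer.intro line_transfer_axioms.intro transfer_data.intro)
  show "coset_system \<pi> G \<omega>" by (rule coset_system_axioms)
  show "precrossed_pi_algebra (\<pi>\<lparr>carrier := G\<rparr>) K tw.T" by (rule tw.precrossed_T)
  show "\<exists>k\<in>carrier K. a = k \<odot>\<^bsub>tw.T\<^esub> \<one>\<^bsub>tw.T\<^esub>" if a: "a \<in> grade tw.T \<one>\<^bsub>\<pi>\<^esub>" for a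
  proof -
    obtain c where "c \<in> carrier K" "a = tw.mon \<one>\<^bsub>\<pi>\<^esub> c" using a by (auto simp: tw.grade_T)
    then show ?thesis using tw.mon_eq_smult_u[of c "\<one>\<^bsub>\<pi>\<^esub>"] by (auto simp: tw.one_T)
  qed
  show "eta tw.T \<one>\<^bsub>tw.T\<^esub> \<one>\<^bsub>tw.T\<^esub> = \<one>\<^bsub>K\<^esub>"
    using tw.eta_T_mon[of "\<one>\<^bsub>\<pi>\<^esub>" "\<one>\<^bsub>\<pi>\<^esub>" "\<one>\<^bsub>K\<^esub>" "\<one>\<^bsub>K\<^esub>"] G_closed(2) tw.normalized by (simp add: tw.one_T)
  show "\<exists>a\<in>grade tw.T g. a \<noteq> \<zero>\<^bsub>tw.T\<^esub>" if "g \<in> G" for g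
    using tw.mon_eq_zero_iff[of g "\<one>\<^bsub>K\<^esub>"] that tw.K.one_not_zero
    by (intro bexI[of _ "tw.u g"]) (auto simp: tw.grade_T)
qed

text \<open>
  The representative of the coset \<open>G\<close> may be a nontrivial element \<open>\<omega>\<close> of \<open>G\<close>. The frame
  \<open>\<phi>\<^sub>\<omega>(l\<^sub>\<alpha>)\<close> compensates for the resulting conjugation of degrees and has the cocycle \<open>\<theta>\<close> itself.
\<close>

lemma transfer_corner_cocycles:
  "corner_cocycles \<pi> K TL (transfer_idem \<pi> G tw.T) = cohomology_class (\<pi>\<lparr>carrier := G\<rparr>) K \<theta>"
proof -
  let ?w = "\<omega> G"
  have w: "?w \<in> G" using representative[OF G_coset] .
  define l where "l \<alpha> = single G (phi tw.T ?w (tw.u \<alpha>))" for \<alpha>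
  have pc: "phi tw.T ?w (tw.u \<alpha>) \<in> carrier tw.T" if "\<alpha> \<in> G" for \<alpha>
    using base.phi_closed[of ?w] w tw.u_closed(1)[of \<alpha>] that by simp
  have cjG: "cj G \<alpha> \<in> G" if "\<alpha> \<in> G" for \<alpha> using w that G_closed by simp
  have "corner_frame \<pi> TL (transfer_idem \<pi> G tw.T) l"
    unfolding corner_frame_def transfer_stabilizer
  proof
    fix \<alpha> assume \<alpha>: "\<alpha> \<in> G"
    have "phi tw.T ?w (tw.u \<alpha>) \<in> grade tw.T (cj G \<alpha>)"
      using base.phi_grade[of \<alpha> ?w "tw.u \<alpha>"] \<alpha> w inv_G[OF w] by (simp add: tw.grade_T)
    then have "l \<alpha> \<in> grade TL \<alpha>"
      unfolding l_def using single_grade[OF G_coset G_carrier[OF \<alpha>] cjG[OF \<alpha>]] by simp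
    moreover have "transfer_idem \<pi> G tw.T \<otimes>\<^bsub>TL\<^esub> l \<alpha> = l \<alpha>"
      unfolding l_def transfer_idem_eq using single_mult[OF G_coset G_coset _ pc[OF \<alpha>]] pc[OF \<alpha>] by simp
    moreover have "l \<alpha> \<noteq> \<zero>\<^bsub>TL\<^esub>"
    proof
      assume "l \<alpha> = \<zero>\<^bsub>TL\<^esub>"
      then have "phi tw.T ?w (tw.u \<alpha>) = phi tw.T ?w \<zero>\<^bsub>tw.T\<^esub>"
        using single_eq_zero_iff[OF G_coset] base.phi_zero[of ?w] w by (simp add: l_def)
      then have "tw.u \<alpha> = \<zero>\<^bsub>tw.T\<^esub>"
        using inj_onD[OF base.phi_inj[of ?w]] w \<alpha> tw.u_closed(1)[of \<alpha>] by simp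
      then show False using tw.mon_eq_zero_iff[of \<alpha> "\<one>\<^bsub>K\<^esub>"] \<alpha> by simp
    qed
    ultimately show "l \<alpha> \<in> grade TL \<alpha> \<and> transfer_idem \<pi> G tw.T \<otimes>\<^bsub>TL\<^esub> l \<alpha> = l \<alpha> \<and> l \<alpha> \<noteq> \<zero>\<^bsub>TL\<^esub>" by blast
  qed
  moreover have "frame_cocycle \<pi> TL (transfer_idem \<pi> G tw.T) l \<theta>"
    unfolding frame_cocycle_def transfer_stabilizer
  proof (intro ballI)
    fix \<alpha> \<beta> assume \<alpha>: "\<alpha> \<in> G" and \<beta>: "\<beta> \<in> G"
    have ab: "\<alpha> \<otimes>\<^bsub>\<pi>\<^esub> \<beta> \<in> G" using G_closed \<alpha> \<beta> by blast
    have t: "\<theta> (\<alpha>, \<beta>) \<in> carrier K" using tw.\<theta>_closed \<alpha> \<beta> by simp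
    have uc: "tw.u \<gamma> \<in> carrier tw.T" if "\<gamma> \<in> G" for \<gamma> using tw.u_closed(1)[of \<gamma>] that by simp
    have uu: "tw.u \<alpha> \<otimes>\<^bsub>tw.T\<^esub> tw.u \<beta> = \<theta> (\<alpha>, \<beta>) \<odot>\<^bsub>tw.T\<^esub> tw.u (\<alpha> \<otimes>\<^bsub>\<pi>\<^esub> \<beta>)"
      using tw.mon_mult[of \<alpha> \<beta> "\<one>\<^bsub>K\<^esub>" "\<one>\<^bsub>K\<^esub>"] \<alpha> \<beta> t by (simp add: tw.mon_smult)
    have "phi tw.T ?w (tw.u \<alpha>) \<otimes>\<^bsub>tw.T\<^esub> phi tw.T ?w (tw.u \<beta>) = phi tw.T ?w (tw.u \<alpha> \<otimes>\<^bsub>tw.T\<^esub> tw.u \<beta>)"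
      using base.phi_mult[of ?w] w uc \<alpha> \<beta> by simp
    also have "\<dots> = \<theta> (\<alpha>, \<beta>) \<odot>\<^bsub>tw.T\<^esub> phi tw.T ?w (tw.u (\<alpha> \<otimes>\<^bsub>\<pi>\<^esub> \<beta>))"
      unfolding uu using base.phi_smult[of ?w] w uc[OF ab] t by simp
    finally show "l \<alpha> \<otimes>\<^bsub>TL\<^esub> l \<beta> = \<theta> (\<alpha>, \<beta>) \<odot>\<^bsub>TL\<^esub> l (\<alpha> \<otimes>\<^bsub>\<pi>\<^esub> \<beta>)"
      unfolding l_def using single_mult[OF G_coset G_coset pc[OF \<alpha>] pc[OF \<beta>]]
        single_smult[OF G_coset t pc[OF ab]] by simp
  qed
  moreover have "\<theta> \<in> G \<times> G \<rightarrow> Units K" using tw.\<theta>_units by auto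
  ultimately show ?thesis
    using TL.corner_cocycles_eq_class[of l \<theta>] transfer_stabilizer by simp
qed

lemma transfer_simple: "(TL, transfer_idem \<pi> G tw.T) \<in> simple_pairs \<pi> K"
  unfolding simple_pairs_iff TL.bas_eq[OF splitting_TL] by (rule TL.pointed_simple_axioms)

lemma transfer_invariant:
  "pair_invariant \<pi> K (TL, transfer_idem \<pi> G tw.T) = (G, cohomology_class (\<pi>\<lparr>carrier := G\<rparr>) K \<theta>)"
  by (simp add: pair_invariant_def transfer_stabilizer transfer_corner_cocycles)

end

section \<open>Coordinates on a pointed simple algebra\<close>

locale framed_simple = pointed_simple \<pi> K L I i0 + ct: cocycle_transfer \<pi> "idem_stabilizer \<pi> L i0" \<omega> K \<theta>
  for \<pi> :: "('g, 'm) monoid_scheme" and K :: "('k, 'n) ring_scheme" and L :: "('g, 'k, 'a) crossed_alg"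
    and I i0 \<omega> \<theta> +
  fixes l
  assumes frame: "corner_frame \<pi> L i0 l" and cocycle: "frame_cocycle \<pi> L i0 l \<theta>"
begin

abbreviation T where "T \<equiv> ct.tw.T"
abbreviation mon where "mon \<equiv> ct.tw.mon"

lemmas l = frameD[OF frame]

lemma l_mult: "\<alpha> \<in> G \<Longrightarrow> \<beta> \<in> G \<Longrightarrow> l \<alpha> \<otimes>\<^bsub>L\<^esub> l \<beta> = \<theta> (\<alpha>, \<beta>) \<odot>\<^bsub>L\<^esub> l (\<alpha> \<otimes>\<^bsub>\<pi>\<^esub> \<beta>)"
  using cocycle by (simp add: frame_cocycle_def)

definition m where "m \<alpha> = (SOME b. b \<in> grade L (inv\<^bsub>\<pi>\<^esub> \<alpha>) \<and> i0 \<otimes>\<^bsub>L\<^esub> b = b \<and> l \<alpha> \<otimes>\<^bsub>L\<^esub> b = i0 \<and> b \<otimes>\<^bsub>L\<^esub> l \<alpha> = i0)"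

lemma m:
  assumes "\<alpha> \<in> G"
  shows "m \<alpha> \<in> grade L (inv\<^bsub>\<pi>\<^esub> \<alpha>)" "i0 \<otimes>\<^bsub>L\<^esub> m \<alpha> = m \<alpha>" "l \<alpha> \<otimes>\<^bsub>L\<^esub> m \<alpha> = i0" "m \<alpha> \<otimes>\<^bsub>L\<^esub> l \<alpha> = i0" "m \<alpha> \<in> carrier L"
proof -
  have "\<exists>b. b \<in> grade L (inv\<^bsub>\<pi>\<^esub> \<alpha>) \<and> i0 \<otimes>\<^bsub>L\<^esub> b = b \<and> l \<alpha> \<otimes>\<^bsub>L\<^esub> b = i0 \<and> b \<otimes>\<^bsub>L\<^esub> l \<alpha> = i0"
    using corner_inverse[OF point stab_carrier[OF assms] l(1-3)[OF assms]] by blast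
  from someI_ex[OF this] show b: "m \<alpha> \<in> grade L (inv\<^bsub>\<pi>\<^esub> \<alpha>)" "i0 \<otimes>\<^bsub>L\<^esub> m \<alpha> = m \<alpha>"
    "l \<alpha> \<otimes>\<^bsub>L\<^esub> m \<alpha> = i0" "m \<alpha> \<otimes>\<^bsub>L\<^esub> l \<alpha> = i0"
    unfolding m_def by auto
  show "m \<alpha> \<in> carrier L" using b(1) grade_in_carrier[of "inv\<^bsub>\<pi>\<^esub> \<alpha>"] stab_carrier[OF assms] by simp
qed

lemma corner_coordinate:
  assumes "\<alpha> \<in> G" "x \<in> grade L \<alpha>"
  shows "i0 \<otimes>\<^bsub>L\<^esub> x = eta L x (m \<alpha>) \<odot>\<^bsub>L\<^esub> l \<alpha>"
  using corner_line[OF point stab_carrier[OF assms(1)] l(1,2)[OF assms(1)] m(1-3)[OF assms(1)] assms(2)] .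

lemma coordinate_eq:
  assumes "\<alpha> \<in> G" "x \<in> grade L \<alpha>" "k \<in> carrier K" "i0 \<otimes>\<^bsub>L\<^esub> x = k \<odot>\<^bsub>L\<^esub> l \<alpha>"
  shows "eta L x (m \<alpha>) = k"
proof (rule smult_cancel[OF _ assms(3) l(4,3)[OF assms(1)]])
  show "eta L x (m \<alpha>) \<in> carrier K"
    using eta_closed m(5)[OF assms(1)] grade_in_carrier[OF stab_carrier[OF assms(1)] assms(2)] by simp
qed (use corner_coordinate[OF assms(1,2)] assms(4) in simp)

lemma corner_outside:
  assumes "\<alpha> \<in> carrier \<pi>" "\<alpha> \<notin> G" "x \<in> grade L \<alpha>"
  shows "i0 \<otimes>\<^bsub>L\<^esub> x = \<zero>\<^bsub>L\<^esub>"
  using corner_zero[OF point assms(1) _ assms(3)] assms(2) by (auto simp: stab_iff assms(1))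

text \<open>
  The coordinates of \<open>i\<^sub>0x\<close> in the frame: pairing with \<open>l\<^sub>\<alpha>\<^sup>-\<^sup>1\<close> extracts the coefficient of \<open>l\<^sub>\<alpha>\<close>. The map
  is a homomorphism from \<open>L\<close> onto the twisted group algebra with kernel \<open>(1 - i\<^sub>0)L\<close>.
\<close>

definition coords where "coords x = (\<lambda>\<alpha>\<in>G. eta L x (m \<alpha>))"

lemma coords_apply: "\<alpha> \<in> G \<Longrightarrow> coords x \<alpha> = eta L x (m \<alpha>)"
  by (simp add: coords_def)

lemma coords_homogeneous:
  assumes \<alpha>: "\<alpha> \<in> carrier \<pi>" and x: "x \<in> grade L \<alpha>"
  shows "coords x = (if \<alpha> \<in> G then mon \<alpha> (eta L x (m \<alpha>)) else \<zero>\<^bsub>T\<^esub>)"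
proof -
  have "eta L x (m \<beta>) = (if \<beta> = \<alpha> then eta L x (m \<alpha>) else \<zero>\<^bsub>K\<^esub>)" if \<beta>: "\<beta> \<in> G" for \<beta>
  proof (cases "\<beta> = \<alpha>")
    case False
    then have "\<alpha> \<otimes>\<^bsub>\<pi>\<^esub> inv\<^bsub>\<pi>\<^esub> \<beta> \<noteq> \<one>\<^bsub>\<pi>\<^esub>"
      using \<alpha> stab_carrier[OF \<beta>] by (metis \<pi>.inv_closed \<pi>.inv_equality \<pi>.inv_inv)
    then show ?thesis using eta_orthogonal[OF \<alpha> _ _ x m(1)[OF \<beta>]] stab_carrier[OF \<beta>] False by simp
  qed simp
  then show ?thesis
    unfolding coords_def twisted_monom_def ct.tw.T_simps by (auto intro!: restrict_ext)
qed

lemma coords_add: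
  assumes "x \<in> carrier L" "y \<in> carrier L"
  shows "coords (x \<oplus>\<^bsub>L\<^esub> y) = coords x \<oplus>\<^bsub>T\<^esub> coords y"
  unfolding coords_def ct.tw.T_simps using assms eta_add m(5) by (auto intro!: restrict_ext)

lemma coords_smult:
  assumes "k \<in> carrier K" "x \<in> carrier L"
  shows "coords (k \<odot>\<^bsub>L\<^esub> x) = k \<odot>\<^bsub>T\<^esub> coords x"
  unfolding coords_def ct.tw.T_simps using assms eta_smult m(5) by (auto intro!: restrict_ext)

lemma coords_zero: "coords \<zero>\<^bsub>L\<^esub> = \<zero>\<^bsub>T\<^esub>"
  unfolding coords_def ct.tw.T_simps using eta_zero_left m(5) by (auto intro!: restrict_ext)

lemma coords_closed:
  assumes "x \<in> carrier L"
  shows "coords x \<in> carrier T"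
  using assms
proof (induction rule: homogeneous_induct)
  case zero
  then show ?case using coords_zero by simp
next
  case (add x y)
  then show ?case using coords_add by simp
next
  case (homogeneous \<alpha> a)
  then show ?case
    using coords_homogeneous ct.tw.mon_carrier eta_closed m(5) grade_in_carrier by auto
qed

lemma coords_corner:
  assumes "x \<in> carrier L"
  shows "coords (i0 \<otimes>\<^bsub>L\<^esub> x) = coords x"
  unfolding coords_def using idem_eta_move[OF point assms] m(2,5) by (auto intro!: restrict_ext)

lemma coords_mult:
  assumes "x \<in> carrier L" "y \<in> carrier L"
  shows "coords (x \<otimes>\<^bsub>L\<^esub> y) = coords x \<otimes>\<^bsub>T\<^esub> coords y"
proof -
  have hh: "coords (x \<otimes>\<^bsub>L\<^esub> y) = coords x \<otimes>\<^bsub>T\<^esub> coords y"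
    if \<alpha>: "\<alpha> \<in> carrier \<pi>" "x \<in> grade L \<alpha>" and \<beta>: "\<beta> \<in> carrier \<pi>" "y \<in> grade L \<beta>" for x y \<alpha> \<beta>
  proof -
    have c: "x \<in> carrier L" "y \<in> carrier L" using \<alpha> \<beta> grade_in_carrier by auto
    have xy: "coords (x \<otimes>\<^bsub>L\<^esub> y) = coords ((i0 \<otimes>\<^bsub>L\<^esub> x) \<otimes>\<^bsub>L\<^esub> (i0 \<otimes>\<^bsub>L\<^esub> y))"
    proof -
      have "(i0 \<otimes>\<^bsub>L\<^esub> x) \<otimes>\<^bsub>L\<^esub> (i0 \<otimes>\<^bsub>L\<^esub> y) = (i0 \<otimes>\<^bsub>L\<^esub> (x \<otimes>\<^bsub>L\<^esub> i0)) \<otimes>\<^bsub>L\<^esub> y"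
        using c point_carrier by (simp add: L.m_assoc)
      also have "x \<otimes>\<^bsub>L\<^esub> i0 = i0 \<otimes>\<^bsub>L\<^esub> x" using idem_central[OF point c(1)] by simp
      also have "i0 \<otimes>\<^bsub>L\<^esub> (i0 \<otimes>\<^bsub>L\<^esub> x) \<otimes>\<^bsub>L\<^esub> y = i0 \<otimes>\<^bsub>L\<^esub> (x \<otimes>\<^bsub>L\<^esub> y)"
        using idem_mult_left[OF point c(1)] c point_carrier by (simp add: L.m_assoc)
      finally show ?thesis using coords_corner c by simp
    qed
    show ?thesis
    proof (cases "\<alpha> \<in> G \<and> \<beta> \<in> G")
      case True
      then have a: "\<alpha> \<in> G" and b: "\<beta> \<in> G" by auto
      note ab = subgroup.m_closed[OF stab_subgroup a b]
      define p where "p = eta L x (m \<alpha>)"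
      define q where "q = eta L y (m \<beta>)"
      have pq: "p \<in> carrier K" "q \<in> carrier K" using c m(5) a b eta_closed by (auto simp: p_def q_def)
      have t: "\<theta> (\<alpha>, \<beta>) \<in> carrier K" using ct.tw.\<theta>_closed a b by simp
      have "(i0 \<otimes>\<^bsub>L\<^esub> x) \<otimes>\<^bsub>L\<^esub> (i0 \<otimes>\<^bsub>L\<^esub> y) = (p \<odot>\<^bsub>L\<^esub> l \<alpha>) \<otimes>\<^bsub>L\<^esub> (q \<odot>\<^bsub>L\<^esub> l \<beta>)"
        using corner_coordinate[OF a \<alpha>(2)] corner_coordinate[OF b \<beta>(2)] by (simp add: p_def q_def)
      also have "\<dots> = p \<odot>\<^bsub>L\<^esub> (q \<odot>\<^bsub>L\<^esub> (l \<alpha> \<otimes>\<^bsub>L\<^esub> l \<beta>))"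
        using pq l(4)[OF a] l(4)[OF b] by (subst smult_mult_left) (simp_all add: smult_mult_right)
      also have "\<dots> = (p \<otimes>\<^bsub>K\<^esub> q \<otimes>\<^bsub>K\<^esub> \<theta> (\<alpha>, \<beta>)) \<odot>\<^bsub>L\<^esub> l (\<alpha> \<otimes>\<^bsub>\<pi>\<^esub> \<beta>)"
        using pq t l(4)[OF ab] by (simp add: l_mult[OF a b] M.smult_assoc1)
      finally have e: "(i0 \<otimes>\<^bsub>L\<^esub> x) \<otimes>\<^bsub>L\<^esub> (i0 \<otimes>\<^bsub>L\<^esub> y) = (p \<otimes>\<^bsub>K\<^esub> q \<otimes>\<^bsub>K\<^esub> \<theta> (\<alpha>, \<beta>)) \<odot>\<^bsub>L\<^esub> l (\<alpha> \<otimes>\<^bsub>\<pi>\<^esub> \<beta>)" .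
      have k: "p \<otimes>\<^bsub>K\<^esub> q \<otimes>\<^bsub>K\<^esub> \<theta> (\<alpha>, \<beta>) \<in> carrier K" using pq t by simp
      have "eta L (l (\<alpha> \<otimes>\<^bsub>\<pi>\<^esub> \<beta>)) (m (\<alpha> \<otimes>\<^bsub>\<pi>\<^esub> \<beta>)) = \<one>\<^bsub>K\<^esub>"
        using coordinate_eq[OF ab l(1)[OF ab], of "\<one>\<^bsub>K\<^esub>"] l(2,4)[OF ab] by simp
      then have cl: "coords (l (\<alpha> \<otimes>\<^bsub>\<pi>\<^esub> \<beta>)) = mon (\<alpha> \<otimes>\<^bsub>\<pi>\<^esub> \<beta>) \<one>\<^bsub>K\<^esub>"
        using coords_homogeneous[OF stab_carrier[OF ab] l(1)[OF ab]] ab by simp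
      have "coords (x \<otimes>\<^bsub>L\<^esub> y) = mon (\<alpha> \<otimes>\<^bsub>\<pi>\<^esub> \<beta>) (p \<otimes>\<^bsub>K\<^esub> q \<otimes>\<^bsub>K\<^esub> \<theta> (\<alpha>, \<beta>))"
        unfolding xy e using coords_smult[OF k l(4)[OF ab]] k by (simp add: cl ct.tw.mon_smult)
      also have "\<dots> = mon \<alpha> p \<otimes>\<^bsub>T\<^esub> mon \<beta> q"
        using ct.tw.mon_mult[of \<alpha> \<beta> p q] a b pq by simp
      finally show ?thesis
        using coords_homogeneous[OF \<alpha>] coords_homogeneous[OF \<beta>] a b by (simp add: p_def q_def)
    next
      case False
      then have "i0 \<otimes>\<^bsub>L\<^esub> x = \<zero>\<^bsub>L\<^esub> \<or> i0 \<otimes>\<^bsub>L\<^esub> y = \<zero>\<^bsub>L\<^esub>"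
        using corner_outside[OF \<alpha>(1) _ \<alpha>(2)] corner_outside[OF \<beta>(1) _ \<beta>(2)] by auto
      then have "coords (x \<otimes>\<^bsub>L\<^esub> y) = \<zero>\<^bsub>T\<^esub>"
        unfolding xy using c point_carrier coords_zero by auto
      moreover have "coords x \<otimes>\<^bsub>T\<^esub> coords y = \<zero>\<^bsub>T\<^esub>"
        using False coords_homogeneous[OF \<alpha>] coords_homogeneous[OF \<beta>] coords_closed[OF c(1)] coords_closed[OF c(2)]
        by auto
      ultimately show ?thesis by simp
    qed
  qed
  have h: "coords (x \<otimes>\<^bsub>L\<^esub> y) = coords x \<otimes>\<^bsub>T\<^esub> coords y"
    if \<alpha>: "\<alpha> \<in> carrier \<pi>" "x \<in> grade L \<alpha>" for x \<alpha>
    using assms(2)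
  proof (induction rule: homogeneous_induct)
    case (homogeneous \<beta> b)
    then show ?case using hh \<alpha> by blast
  qed (use grade_in_carrier[OF \<alpha>] coords_closed coords_zero coords_add in \<open>auto simp: L.r_distr ct.tw.T.r_distr\<close>)
  show ?thesis
    using assms(1)
  proof (induction rule: homogeneous_induct)
    case (homogeneous \<alpha> a)
    then show ?case using h by blast
  qed (use assms(2) coords_closed coords_zero coords_add in \<open>auto simp: L.l_distr ct.tw.T.l_distr\<close>)
qed

lemma coords_l:
  assumes "\<alpha> \<in> G"
  shows "coords (l \<alpha>) = mon \<alpha> \<one>\<^bsub>K\<^esub>"
  using coordinate_eq[OF assms l(1)[OF assms], of "\<one>\<^bsub>K\<^esub>"] l(2,4)[OF assms]
    coords_homogeneous[OF stab_carrier[OF assms] l(1)[OF assms]] assms by simp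

lemma m_one: "m \<one>\<^bsub>\<pi>\<^esub> = i0" and l_one: "l \<one>\<^bsub>\<pi>\<^esub> = i0"
proof -
  note o = subgroup.one_closed[OF stab_subgroup]
  have "l \<one>\<^bsub>\<pi>\<^esub> \<otimes>\<^bsub>L\<^esub> l \<one>\<^bsub>\<pi>\<^esub> = l \<one>\<^bsub>\<pi>\<^esub>"
    using l_mult[OF o o] ct.tw.normalized l(4)[OF o] by simp
  then have "m \<one>\<^bsub>\<pi>\<^esub> \<otimes>\<^bsub>L\<^esub> (l \<one>\<^bsub>\<pi>\<^esub> \<otimes>\<^bsub>L\<^esub> l \<one>\<^bsub>\<pi>\<^esub>) = i0" using m(4)[OF o] by simp
  then show l1: "l \<one>\<^bsub>\<pi>\<^esub> = i0"
    using m(4,5)[OF o] l(2,4)[OF o] by (simp add: L.m_assoc[symmetric])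
  show "m \<one>\<^bsub>\<pi>\<^esub> = i0" using m(2,3)[OF o] l1 by simp
qed

lemma coords_point: "coords i0 = \<one>\<^bsub>T\<^esub>"
  using coords_l[OF subgroup.one_closed[OF stab_subgroup]] l_one by (simp add: ct.tw.one_T)

lemma coords_one: "coords \<one>\<^bsub>L\<^esub> = \<one>\<^bsub>T\<^esub>"
  using coords_corner[OF L.one_closed] coords_point point_carrier by simp

lemma coords_eta:
  assumes "x \<in> carrier L" "y \<in> carrier L"
  shows "eta T (coords x) (coords y) = eta L (i0 \<otimes>\<^bsub>L\<^esub> x) y"
proof -
  note o = subgroup.one_closed[OF stab_subgroup]
  have "eta T (coords x) (coords y) = coords (x \<otimes>\<^bsub>L\<^esub> y) \<one>\<^bsub>\<pi>\<^esub>"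
    using ct.tw.eta_T[OF coords_closed[OF assms(1)] coords_closed[OF assms(2)]] coords_mult[OF assms] by simp
  also have "\<dots> = eta L (x \<otimes>\<^bsub>L\<^esub> y) i0" using coords_apply[OF o] m_one by simp
  also have "\<dots> = eta L x (i0 \<otimes>\<^bsub>L\<^esub> y)"
    using assms point_carrier idem_central[OF point assms(2)] by (simp add: eta_assoc)
  finally show ?thesis using idem_eta_move[OF point assms] by simp
qed

text \<open>
  Apply the homomorphism to \<open>\<phi>\<^sub>g(x)l\<^sub>g = l\<^sub>gx\<close>; the resulting equation characterizes the action on
  the twisted group algebra.
\<close>

lemma coords_phi:
  assumes g: "g \<in> G" and x: "x \<in> carrier L"
  shows "coords (phi L g x) = phi T g (coords x)"
proof (rule ct.tw.phi_T_unique[symmetric])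
  note gc = stab_carrier[OF g]
  show "coords (phi L g x) \<otimes>\<^bsub>T\<^esub> ct.tw.u g = ct.tw.u g \<otimes>\<^bsub>T\<^esub> coords x"
    using coords_mult[OF phi_closed[OF gc x] l(4)[OF g]] coords_mult[OF l(4)[OF g] x]
      phi_crossed[OF gc x l(1)[OF g]] coords_l[OF g] by simp
qed (use g x coords_closed phi_closed stab_carrier in auto)

text \<open>
  The form pairs \<open>i\<^sub>0L\<^sub>\<alpha>\<close> with the line spanned by \<open>l\<^sub>\<alpha>\<^sup>-\<^sup>1\<close>, so vanishing coordinates make \<open>i\<^sub>0x\<close>
  orthogonal to everything.
\<close>

lemma coords_kernel:
  assumes x: "x \<in> carrier L" and 0: "coords x = \<zero>\<^bsub>T\<^esub>"
  shows "i0 \<otimes>\<^bsub>L\<^esub> x = \<zero>\<^bsub>L\<^esub>"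
proof (rule eta_nondegenerate_total)
  show "i0 \<otimes>\<^bsub>L\<^esub> x \<in> carrier L" using x point_carrier by simp
  fix \<beta> b assume \<beta>: "\<beta> \<in> carrier \<pi>" and b: "b \<in> grade L \<beta>"
  have bc: "b \<in> carrier L" using b \<beta> grade_in_carrier by blast
  have "eta L (i0 \<otimes>\<^bsub>L\<^esub> x) b = eta L x (i0 \<otimes>\<^bsub>L\<^esub> b)" using idem_eta_move[OF point x bc] .
  also have "\<dots> = \<zero>\<^bsub>K\<^esub>"
  proof (cases "\<beta> \<in> G")
    case True
    let ?a = "inv\<^bsub>\<pi>\<^esub> \<beta>"
    have a: "?a \<in> G" using True subgroup.m_inv_closed[OF stab_subgroup] by blast
    have "i0 \<otimes>\<^bsub>L\<^esub> b = eta L b (l ?a) \<odot>\<^bsub>L\<^esub> m ?a"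
      using corner_line[OF point \<beta>, of "m ?a" "l ?a" b] m(1,2,4)[OF a] l(1,2)[OF a] b \<beta> by simp
    moreover have "eta L x (m ?a) = \<zero>\<^bsub>K\<^esub>"
      using coords_apply[OF a, of x] 0 a by (simp add: ct.tw.T_zero_apply)
    ultimately show ?thesis
      using x m(5)[OF a] eta_closed[OF bc l(4)[OF a]] by (simp add: eta_smult_right)
  next
    case False
    then show ?thesis using corner_outside[OF \<beta> _ b] x eta_zero_right by simp
  qed
  finally show "eta L (i0 \<otimes>\<^bsub>L\<^esub> x) b = \<zero>\<^bsub>K\<^esub>" .
qed

lemma coords_surj:
  assumes "f \<in> carrier T"
  shows "\<exists>x\<in>carrier L. i0 \<otimes>\<^bsub>L\<^esub> x = x \<and> coords x = f"
  using assms
proof (induction rule: ct.tw.T_induct)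
  case zero
  then show ?case using coords_zero point_carrier by (intro bexI[of _ "\<zero>\<^bsub>L\<^esub>"]) auto
next
  case (add f g)
  then obtain x y where "x \<in> carrier L" "i0 \<otimes>\<^bsub>L\<^esub> x = x" "coords x = f"
    "y \<in> carrier L" "i0 \<otimes>\<^bsub>L\<^esub> y = y" "coords y = g" by auto
  then show ?case
    using coords_add point_carrier by (intro bexI[of _ "x \<oplus>\<^bsub>L\<^esub> y"]) (auto simp: L.r_distr)
next
  case (monomial \<alpha> c)
  then have a: "\<alpha> \<in> G" by simp
  then show ?case
    using monomial l(2,4)[OF a] coords_smult[of c "l \<alpha>"] coords_l[OF a] point_carrier
    by (intro bexI[of _ "c \<odot>\<^bsub>L\<^esub> l \<alpha>"]) (auto simp: smult_mult_right ct.tw.mon_smult)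
qed

end

context framed_simple
begin

text \<open>
  Moving each corner to the one at \<open>i\<^sub>0\<close> and taking coordinates there: the entry at \<open>j\<close> describes
  the part of \<open>x\<close> in the corner of \<open>\<phi>\<^sub>\<omega>\<^sup>-\<^sup>1(i\<^sub>0)\<close>, where \<open>\<omega>\<close> represents \<open>j\<close>.
\<close>

definition to_transfer where "to_transfer x = (\<lambda>j\<in>ct.R. coords (phi L (\<omega> j) x))"

lemma to_transfer_apply: "j \<in> ct.R \<Longrightarrow> to_transfer x j = coords (phi L (\<omega> j) x)"
  by (simp add: to_transfer_def)

lemma rep: "j \<in> ct.R \<Longrightarrow> \<omega> j \<in> carrier \<pi>" "j \<in> ct.R \<Longrightarrow> inv\<^bsub>\<pi>\<^esub> \<omega> j \<in> carrier \<pi>"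
  using ct.rep_closed by auto

lemma cosets_idempotents: "bij_betw (\<lambda>j. phi L (inv\<^bsub>\<pi>\<^esub> \<omega> j) i0) ct.R I"
proof (rule bij_betwI')
  fix i j assume i: "i \<in> ct.R" and j: "j \<in> ct.R"
  have "phi L (inv\<^bsub>\<pi>\<^esub> \<omega> i) i0 = phi L (inv\<^bsub>\<pi>\<^esub> \<omega> j) i0 \<longleftrightarrow> G #>\<^bsub>\<pi>\<^esub> \<omega> j = G #>\<^bsub>\<pi>\<^esub> \<omega> i"
    using phi_eq_iff_stab[OF rep(1)[OF i] rep(1)[OF j]] ct.coset_eq_iff[OF rep(1)[OF j] rep(1)[OF i]] by simp
  then show "phi L (inv\<^bsub>\<pi>\<^esub> \<omega> i) i0 = phi L (inv\<^bsub>\<pi>\<^esub> \<omega> j) i0 \<longleftrightarrow> i = j"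
    using ct.coset_rep[OF i] ct.coset_rep[OF j] by auto
next
  fix j assume "j \<in> ct.R"
  then show "phi L (inv\<^bsub>\<pi>\<^esub> \<omega> j) i0 \<in> I" using idem_phi[OF point rep(2)] by auto
next
  fix k assume "k \<in> I"
  then obtain \<alpha> where \<alpha>: "\<alpha> \<in> carrier \<pi>" "phi L \<alpha> i0 = k" using transitive by blast
  let ?j = "G #>\<^bsub>\<pi>\<^esub> inv\<^bsub>\<pi>\<^esub> \<alpha>"
  have j: "?j \<in> ct.R" using ct.coset_closed \<alpha>(1) by simp
  have "\<omega> ?j \<otimes>\<^bsub>\<pi>\<^esub> inv\<^bsub>\<pi>\<^esub> (inv\<^bsub>\<pi>\<^esub> \<alpha>) \<in> G"
    using ct.coset_eq_iff[of "\<omega> ?j" "inv\<^bsub>\<pi>\<^esub> \<alpha>"] ct.coset_rep[OF j] rep(1)[OF j] \<alpha>(1) by simp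
  then have "phi L (inv\<^bsub>\<pi>\<^esub> (inv\<^bsub>\<pi>\<^esub> \<alpha>)) i0 = phi L (inv\<^bsub>\<pi>\<^esub> \<omega> ?j) i0"
    using phi_eq_iff_stab[of "inv\<^bsub>\<pi>\<^esub> \<alpha>" "\<omega> ?j"] rep(1)[OF j] \<alpha>(1) by simp
  then show "\<exists>j\<in>ct.R. k = phi L (inv\<^bsub>\<pi>\<^esub> \<omega> j) i0" using \<alpha> j by auto
qed

lemma to_transfer_closed: "x \<in> carrier L \<Longrightarrow> to_transfer x \<in> carrier ct.TL"
  unfolding ct.TL_simps(1) to_transfer_def using coords_closed phi_closed rep(1) by auto

lemma corner_transport:
  assumes j: "j \<in> ct.R" and x: "x \<in> carrier L"
  shows "i0 \<otimes>\<^bsub>L\<^esub> phi L (\<omega> j) x = phi L (\<omega> j) (phi L (inv\<^bsub>\<pi>\<^esub> \<omega> j) i0 \<otimes>\<^bsub>L\<^esub> x)"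
  using phi_mult[OF rep(1)[OF j] phi_closed[OF rep(2)[OF j] point_carrier] x]
    phi_inverse(2)[OF rep(1)[OF j] point_carrier] by simp

lemma to_transfer_add:
  assumes "x \<in> carrier L" "y \<in> carrier L"
  shows "to_transfer (x \<oplus>\<^bsub>L\<^esub> y) = to_transfer x \<oplus>\<^bsub>ct.TL\<^esub> to_transfer y"
  by (rule ct.TL_ext) (use assms in \<open>simp_all add: to_transfer_closed ct.TL_closed to_transfer_apply
      ct.TL_apply phi_add[OF rep(1)] phi_closed[OF rep(1)] coords_add\<close>)

text \<open>
  All corners of \<open>z\<close> vanish, and \<open>z\<close> is the sum of its corners.
\<close>

lemma to_transfer_kernel:
  assumes z: "z \<in> carrier L" and 0: "\<And>j. j \<in> ct.R \<Longrightarrow> coords (phi L (\<omega> j) z) = \<zero>\<^bsub>T\<^esub>"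
  shows "z = \<zero>\<^bsub>L\<^esub>"
proof -
  have "k \<otimes>\<^bsub>L\<^esub> z = \<zero>\<^bsub>L\<^esub>" if k: "k \<in> I" for k
  proof -
    have "k \<in> (\<lambda>j. phi L (inv\<^bsub>\<pi>\<^esub> \<omega> j) i0) ` ct.R"
      using cosets_idempotents k unfolding bij_betw_def by simp
    then obtain j where j: "j \<in> ct.R" "k = phi L (inv\<^bsub>\<pi>\<^esub> \<omega> j) i0" by auto
    have "i0 \<otimes>\<^bsub>L\<^esub> phi L (\<omega> j) z = \<zero>\<^bsub>L\<^esub>"
      using coords_kernel[OF phi_closed[OF rep(1)[OF j(1)] z] 0[OF j(1)]] .
    then have "phi L (\<omega> j) (k \<otimes>\<^bsub>L\<^esub> z) = phi L (\<omega> j) \<zero>\<^bsub>L\<^esub>"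
      using corner_transport[OF j(1) z] j phi_zero[OF rep(1)[OF j(1)]] by simp
    then show ?thesis
      using inj_onD[OF phi_inj[OF rep(1)[OF j(1)]]] idem_carrier[OF k] z by simp
  qed
  then have "(\<Oplus>\<^bsub>L\<^esub>k\<in>I. k \<otimes>\<^bsub>L\<^esub> z) = \<zero>\<^bsub>L\<^esub>" by (intro L.add.finprod_one_eqI) auto
  moreover have "(\<Oplus>\<^bsub>L\<^esub>k\<in>I. k \<otimes>\<^bsub>L\<^esub> z) = (\<Oplus>\<^bsub>L\<^esub>k\<in>I. k) \<otimes>\<^bsub>L\<^esub> z"
    using idem_finite z idem_carrier by (intro L.finsum_ldistr[symmetric]) auto
  ultimately show ?thesis using idem_sum z by simp
qed

lemma to_transfer_inj: "inj_on to_transfer (carrier L)"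
proof (rule inj_onI)
  fix x y assume x: "x \<in> carrier L" and y: "y \<in> carrier L" and eq: "to_transfer x = to_transfer y"
  let ?z = "x \<ominus>\<^bsub>L\<^esub> y"
  have z: "?z \<in> carrier L" "?z \<oplus>\<^bsub>L\<^esub> y = x"
    using x y by (auto simp: a_minus_def L.a_assoc L.l_neg)
  have "?z = \<zero>\<^bsub>L\<^esub>"
  proof (rule to_transfer_kernel[OF z(1)])
    fix j assume j: "j \<in> ct.R"
    note c = coords_closed[OF phi_closed[OF rep(1)[OF j]]]
    have "coords (phi L (\<omega> j) ?z) \<oplus>\<^bsub>T\<^esub> coords (phi L (\<omega> j) y) = coords (phi L (\<omega> j) y)"
      using fun_cong[OF eq, of j] j z y
        coords_add[OF phi_closed[OF rep(1)[OF j] z(1)] phi_closed[OF rep(1)[OF j] y]]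
        phi_add[OF rep(1)[OF j] z(1) y] by (simp add: to_transfer_apply)
    then show "coords (phi L (\<omega> j) ?z) = \<zero>\<^bsub>T\<^esub>"
      using c[OF z(1)] c[OF y] by (metis ct.tw.T.add.r_cancel_one)
  qed
  then show "x = y" using z y by simp
qed

lemma to_transfer_surj:
  assumes F: "F \<in> carrier ct.TL"
  shows "\<exists>x\<in>carrier L. to_transfer x = F"
proof -
  have "\<forall>j\<in>ct.R. \<exists>x. x \<in> carrier L \<and> i0 \<otimes>\<^bsub>L\<^esub> x = x \<and> coords x = F j"
    using coords_surj ct.TL_entry[OF F] by blast
  from bchoice[OF this] obtain s where
    s: "\<forall>j\<in>ct.R. s j \<in> carrier L \<and> i0 \<otimes>\<^bsub>L\<^esub> s j = s j \<and> coords (s j) = F j" by (elim exE)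
  let ?t = "\<lambda>j. phi L (inv\<^bsub>\<pi>\<^esub> \<omega> j) (s j)"
  have tc: "?t j \<in> carrier L" if "j \<in> ct.R" for j using s that phi_closed rep(2) by auto
  let ?x = "\<Oplus>\<^bsub>L\<^esub>j\<in>ct.R. ?t j"
  have xc: "?x \<in> carrier L" using tc by (intro L.finsum_closed) auto
  \<comment> \<open>The summand from a coset \<open>j\<close> lies in the corner of the idempotent belonging to \<open>j\<close>, so only the
    entry at \<open>j\<close> sees it.\<close>
  have e: "coords (phi L (\<omega> i) (?t j)) = (if i = j then F j else \<zero>\<^bsub>T\<^esub>)"
    if i: "i \<in> ct.R" and j: "j \<in> ct.R" for i j
  proof (cases "i = j")
    case True
    then show ?thesis using phi_inverse(2)[OF rep(1)[OF j]] s j by auto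
  next
    case False
    have sj: "s j \<in> carrier L" "i0 \<otimes>\<^bsub>L\<^esub> s j = s j" using s j by auto
    let ?p = "phi L (inv\<^bsub>\<pi>\<^esub> \<omega> i) i0" and ?q = "phi L (inv\<^bsub>\<pi>\<^esub> \<omega> j) i0"
    have pq: "?p \<in> I" "?q \<in> I" using idem_phi[OF point rep(2)] i j by auto
    have ne: "?p \<noteq> ?q" using cosets_idempotents i j False unfolding bij_betw_def inj_on_def by blast
    have "?t j = ?q \<otimes>\<^bsub>L\<^esub> ?t j" using phi_mult[OF rep(2)[OF j] point_carrier sj(1)] sj(2) by simp
    then have "?p \<otimes>\<^bsub>L\<^esub> ?t j = (?p \<otimes>\<^bsub>L\<^esub> ?q) \<otimes>\<^bsub>L\<^esub> ?t j"
      using idem_carrier[OF pq(1)] idem_carrier[OF pq(2)] tc[OF j] by (simp add: L.m_assoc)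
    also have "\<dots> = \<zero>\<^bsub>L\<^esub>" using idem_orth[OF pq] ne tc[OF j] by simp
    finally have "i0 \<otimes>\<^bsub>L\<^esub> phi L (\<omega> i) (?t j) = \<zero>\<^bsub>L\<^esub>"
      using corner_transport[OF i tc[OF j]] phi_zero[OF rep(1)[OF i]] by simp
    then show ?thesis
      using coords_corner[OF phi_closed[OF rep(1)[OF i] tc[OF j]]] coords_zero False by simp
  qed
  have "to_transfer ?x = F"
  proof (rule ct.TL_ext[OF to_transfer_closed[OF xc] F])
    fix i assume i: "i \<in> ct.R"
    have Fc: "F j \<in> carrier T" if "j \<in> ct.R" for j using ct.TL_entry[OF F that] .
    have "to_transfer ?x i = coords (\<Oplus>\<^bsub>L\<^esub>j\<in>ct.R. phi L (\<omega> i) (?t j))"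
      using i tc by (simp add: to_transfer_apply phi_finsum[OF rep(1)[OF i]])
    also have "\<dots> = (\<Oplus>\<^bsub>T\<^esub>j\<in>ct.R. coords (phi L (\<omega> i) (?t j)))"
      by (rule finsum_additive(2)[where V = "carrier L"])
        (use tc phi_closed[OF rep(1)[OF i]] coords_closed coords_add in
          \<open>auto simp: L.abelian_group_axioms ct.tw.T.abelian_group_axioms\<close>)
    also have "\<dots> = (\<Oplus>\<^bsub>T\<^esub>j\<in>ct.R. if i = j then F j else \<zero>\<^bsub>T\<^esub>)"
      using e[OF i] Fc by (intro ct.tw.T.finsum_cong') auto
    also have "\<dots> = F i"
      using i ct.finite_cosets Fc by (intro ct.tw.T.add.finprod_singleton) auto
    finally show "to_transfer ?x i = F i" .
  qed
  then show ?thesis using xc by blast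
qed

text \<open>
  The entry at \<open>j\<close> contributes \<open>\<eta>(kx, y)\<close> for the basic idempotent \<open>k\<close> belonging to \<open>j\<close>, and these
  idempotents sum to \<open>1\<close>.
\<close>

lemma to_transfer_eta:
  assumes x: "x \<in> carrier L" and y: "y \<in> carrier L"
  shows "eta ct.TL (to_transfer x) (to_transfer y) = eta L x y"
proof -
  let ?p = "\<lambda>j. phi L (inv\<^bsub>\<pi>\<^esub> \<omega> j) i0"
  have p: "?p j \<in> I" "?p j \<in> carrier L" if "j \<in> ct.R" for j
    using idem_phi[OF point rep(2)[OF that]] idem_carrier by auto
  have t: "eta L (k \<otimes>\<^bsub>L\<^esub> x) y \<in> carrier K" if "k \<in> I" for k
    using idem_carrier[OF that] x y eta_closed by simp
  have "eta T (to_transfer x j) (to_transfer y j) = eta L (?p j \<otimes>\<^bsub>L\<^esub> x) y" if j: "j \<in> ct.R" for j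
  proof -
    note w = rep(1)[OF j]
    have "eta T (to_transfer x j) (to_transfer y j) = eta L (i0 \<otimes>\<^bsub>L\<^esub> phi L (\<omega> j) x) (phi L (\<omega> j) y)"
      using coords_eta[OF phi_closed[OF w x] phi_closed[OF w y]] j by (simp add: to_transfer_apply)
    also have "\<dots> = eta L (?p j \<otimes>\<^bsub>L\<^esub> x) y"
      unfolding corner_transport[OF j x] using p(2)[OF j] x y by (intro phi_eta[OF w]) auto
    finally show ?thesis .
  qed
  then have "eta ct.TL (to_transfer x) (to_transfer y) = (\<Oplus>\<^bsub>K\<^esub>j\<in>ct.R. eta L (?p j \<otimes>\<^bsub>L\<^esub> x) y)"
    unfolding ct.TL_simps(8) using t p(1) by (intro K.finsum_cong') auto
  also have "\<dots> = (\<Oplus>\<^bsub>K\<^esub>k\<in>?p ` ct.R. eta L (k \<otimes>\<^bsub>L\<^esub> x) y)"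
    using cosets_idempotents t p(1) unfolding bij_betw_def by (intro K.finsum_reindex[symmetric]) auto
  also have "?p ` ct.R = I" using cosets_idempotents unfolding bij_betw_def by blast
  also have "(\<Oplus>\<^bsub>K\<^esub>k\<in>I. eta L (k \<otimes>\<^bsub>L\<^esub> x) y) = eta L (\<Oplus>\<^bsub>L\<^esub>k\<in>I. k \<otimes>\<^bsub>L\<^esub> x) y"
    using idem_carrier x y by (intro eta_finsum_left[symmetric]) auto
  also have "(\<Oplus>\<^bsub>L\<^esub>k\<in>I. k \<otimes>\<^bsub>L\<^esub> x) = (\<Oplus>\<^bsub>L\<^esub>k\<in>I. k) \<otimes>\<^bsub>L\<^esub> x"
    using idem_finite x idem_carrier by (intro L.finsum_ldistr[symmetric]) auto
  finally show ?thesis using idem_sum x by simp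
qed

lemma to_transfer_iso: "crossed_iso \<pi> K L ct.TL to_transfer"
  unfolding crossed_iso_def
proof (intro conjI ballI)
  show "to_transfer \<in> ring_iso L ct.TL"
  proof (rule ring_iso_memI)
    show "to_transfer x \<in> carrier ct.TL" if "x \<in> carrier L" for x using to_transfer_closed[OF that] .
    show "to_transfer (x \<otimes>\<^bsub>L\<^esub> y) = to_transfer x \<otimes>\<^bsub>ct.TL\<^esub> to_transfer y"
      if "x \<in> carrier L" "y \<in> carrier L" for x y
      by (rule ct.TL_ext) (use that in \<open>simp_all add: to_transfer_closed ct.TL_closed to_transfer_apply
          ct.TL_apply phi_mult[OF rep(1)] phi_closed[OF rep(1)] coords_mult\<close>)
    show "to_transfer (x \<oplus>\<^bsub>L\<^esub> y) = to_transfer x \<oplus>\<^bsub>ct.TL\<^esub> to_transfer y"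
      if "x \<in> carrier L" "y \<in> carrier L" for x y
      using to_transfer_add[OF that] .
    show "to_transfer \<one>\<^bsub>L\<^esub> = \<one>\<^bsub>ct.TL\<^esub>"
      by (rule ct.TL_ext) (simp_all add: to_transfer_closed ct.TL_closed to_transfer_apply
          ct.TL_apply phi_one[OF rep(1)] coords_one)
    show "bij_betw to_transfer (carrier L) (carrier ct.TL)"
      unfolding bij_betw_def using to_transfer_inj to_transfer_surj to_transfer_closed by blast
  qed
  show "to_transfer (c \<odot>\<^bsub>L\<^esub> x) = c \<odot>\<^bsub>ct.TL\<^esub> to_transfer x" if "c \<in> carrier K" "x \<in> carrier L" for c x
    by (rule ct.TL_ext) (use that in \<open>simp_all add: to_transfer_closed ct.TL_closed to_transfer_apply
        ct.TL_apply phi_smult[OF rep(1)] phi_closed[OF rep(1)] coords_smult\<close>)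
  show "to_transfer ` grade L \<alpha> \<subseteq> grade ct.TL \<alpha>" if \<alpha>: "\<alpha> \<in> carrier \<pi>" for \<alpha>
  proof
    fix F assume "F \<in> to_transfer ` grade L \<alpha>"
    then obtain x where x: "x \<in> grade L \<alpha>" "F = to_transfer x" by auto
    show "F \<in> grade ct.TL \<alpha>"
      unfolding ct.TL_grade_iff
    proof (intro conjI ballI)
      show "F \<in> extensional ct.R" by (simp add: x(2) to_transfer_def)
      fix j assume j: "j \<in> ct.R"
      note g = phi_grade[OF \<alpha> rep(1)[OF j] x(1)] and c = ct.cj_closed[OF j \<alpha>]
      show "F j \<in> (if ct.cj j \<alpha> \<in> G then grade T (ct.cj j \<alpha>) else {\<zero>\<^bsub>T\<^esub>})"
        using coords_homogeneous[OF c g] eta_closed[OF grade_in_carrier[OF c g] m(5)] j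
        by (auto simp: x(2) to_transfer_apply ct.tw.grade_T)
    qed
  qed
  show "eta ct.TL (to_transfer x) (to_transfer y) = eta L x y" if "x \<in> carrier L" "y \<in> carrier L" for x y
    using to_transfer_eta[OF that] .
  show "to_transfer (phi L \<beta> x) = phi ct.TL \<beta> (to_transfer x)"
    if \<beta>: "\<beta> \<in> carrier \<pi>" and x: "x \<in> carrier L" for \<beta> x
  proof (rule ct.TL_ext)
    show "to_transfer (phi L \<beta> x) \<in> carrier ct.TL" "phi ct.TL \<beta> (to_transfer x) \<in> carrier ct.TL"
      using to_transfer_closed phi_closed[OF \<beta>] ct.phi_TL_closed[OF \<beta>] x by auto
    fix j assume j: "j \<in> ct.R"
    note j' = ct.act_closed[OF j \<beta>] and d = ct.dv_closed[OF j \<beta>]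
    have "\<omega> j \<otimes>\<^bsub>\<pi>\<^esub> \<beta> = ct.dv j \<beta> \<otimes>\<^bsub>\<pi>\<^esub> \<omega> (j #>\<^bsub>\<pi>\<^esub> \<beta>)"
      using rep(1)[OF j] rep(1)[OF j'] \<beta> by (simp add: \<pi>.m_assoc)
    then have "phi L (\<omega> j) (phi L \<beta> x) = phi L (ct.dv j \<beta>) (phi L (\<omega> (j #>\<^bsub>\<pi>\<^esub> \<beta>)) x)"
      using phi_hom[OF rep(1)[OF j] \<beta> x] phi_hom[OF stab_carrier[OF d] rep(1)[OF j'] x] by simp
    then show "to_transfer (phi L \<beta> x) j = phi ct.TL \<beta> (to_transfer x) j"
      using coords_phi[OF d phi_closed[OF rep(1)[OF j'] x]] j j' by (simp add: to_transfer_apply ct.TL_apply(6))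
  qed
qed

lemma to_transfer_point: "to_transfer i0 = transfer_idem \<pi> G T"
proof (rule ct.TL_ext)
  show "to_transfer i0 \<in> carrier ct.TL" using to_transfer_closed[OF point_carrier] .
  show "transfer_idem \<pi> G T \<in> carrier ct.TL"
    unfolding ct.transfer_idem_eq by (rule ct.single_closed) simp
  fix j assume j: "j \<in> ct.R"
  note w = rep(1)[OF j]
  show "to_transfer i0 j = transfer_idem \<pi> G T j"
  proof (cases "j = G")
    case True
    then have "\<omega> j \<in> G" using ct.representative[OF j] by simp
    then show ?thesis
      using True j coords_point by (simp add: to_transfer_apply ct.transfer_idem_eq ct.single_apply stab_iff)
  next
    case False
    have "\<omega> j \<notin> G"
    proof
      assume "\<omega> j \<in> G"
      then have "G #>\<^bsub>\<pi>\<^esub> \<omega> j = G" using \<pi>.coset_join2[OF w stab_subgroup] by blast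
      then show False using False ct.coset_rep[OF j] by simp
    qed
    then have ne: "i0 \<noteq> phi L (\<omega> j) i0" using w stab_iff by auto
    have "i0 \<otimes>\<^bsub>L\<^esub> phi L (\<omega> j) i0 = \<zero>\<^bsub>L\<^esub>" using idem_orth[OF point idem_phi[OF point w]] ne by simp
    then show ?thesis
      using coords_corner[OF phi_closed[OF w point_carrier]] coords_zero False j
      by (simp add: to_transfer_apply ct.transfer_idem_eq ct.single_apply)
  qed
qed

end

section \<open>Isomorphism classes\<close>

lemma pair_iso_trans:
  assumes "pair_iso \<pi> K p q" "pair_iso \<pi> K q r"
  shows "pair_iso \<pi> K p r"
proof -
  obtain h where h: "crossed_iso \<pi> K (fst p) (fst q) h" "h (snd p) = snd q"
    using assms(1) by (auto simp: pair_iso_def)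
  obtain k where k: "crossed_iso \<pi> K (fst q) (fst r) k" "k (snd q) = snd r"
    using assms(2) by (auto simp: pair_iso_def)
  have hk: "h \<in> ring_iso (fst p) (fst q)" "k \<in> ring_iso (fst q) (fst r)"
    using h k by (auto simp: crossed_iso_def)
  have "crossed_iso \<pi> K (fst p) (fst r) (k \<circ> h)"
    unfolding crossed_iso_def
  proof (intro conjI)
    show "k \<circ> h \<in> ring_iso (fst p) (fst r)" using ring_iso_set_trans hk by blast
    show "\<forall>\<alpha>\<in>carrier \<pi>. (k \<circ> h) ` grade (fst p) \<alpha> \<subseteq> grade (fst r) \<alpha>"
      using h(1) k(1) unfolding crossed_iso_def by fastforce
  qed (use h(1) k(1) ring_iso_memE(1)[OF hk(1)] in \<open>auto simp: crossed_iso_def\<close>)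
  then show ?thesis using h(2) k(2) unfolding pair_iso_def by (intro exI[of _ "k \<circ> h"]) simp
qed

lemma crossed_iso_reflects_grade:
  assumes L: "pi_algebra \<pi> K L" and L': "pi_algebra \<pi> K L'" and h: "crossed_iso \<pi> K L L' h"
    and \<alpha>: "\<alpha> \<in> carrier \<pi>" and x: "x \<in> carrier L" "h x \<in> grade L' \<alpha>"
  shows "x \<in> grade L \<alpha>"
proof -
  interpret A: pi_algebra \<pi> K L by fact
  interpret B: pi_algebra \<pi> K L' by fact
  have hr: "h \<in> ring_iso L L'" using h by (simp add: crossed_iso_def)
  note hm = ring_iso_memE[OF hr]
  have h0: "h \<zero>\<^bsub>L\<^esub> = \<zero>\<^bsub>L'\<^esub>"
    using hr A.L.ring_axioms B.L.ring_axioms by (intro ring_hom_zero) (auto simp: ring_iso_def)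
  have inj: "inj_on h (carrier L)" using hm(5) by (simp add: bij_betw_def)
  let ?S = "{\<beta>\<in>carrier \<pi>. A.component \<beta> x \<noteq> \<zero>\<^bsub>L\<^esub>}"
  have c: "A.component \<beta> x \<in> carrier L" if "\<beta> \<in> carrier \<pi>" for \<beta>
    using A.component_grade[OF x(1) that] A.grade_in_carrier[OF that] by blast
  have "h x = h (\<Oplus>\<^bsub>L\<^esub>\<beta>\<in>?S. A.component \<beta> x)" using A.component_sum[OF x(1)] by simp
  also have "\<dots> = (\<Oplus>\<^bsub>L'\<^esub>\<beta>\<in>?S. h (A.component \<beta> x))"
    by (rule finsum_additive(2)[where V = "carrier L"])
      (use hm c in \<open>auto simp: A.L.abelian_group_axioms B.L.abelian_group_axioms\<close>)
  finally have hx: "h x = (\<Oplus>\<^bsub>L'\<^esub>\<beta>\<in>?S. h (A.component \<beta> x))" .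
  have hc: "B.component \<beta> (h x) = h (A.component \<beta> x)" if "\<beta> \<in> carrier \<pi>" for \<beta>
  proof (rule B.component_unique[OF A.component_finite[OF x(1)] _ _ _ hx that])
    show "h (A.component \<gamma> x) \<in> grade L' \<gamma>" if "\<gamma> \<in> carrier \<pi>" for \<gamma>
      using h A.component_grade[OF x(1) that] that unfolding crossed_iso_def by blast
  qed (use h0 in auto)
  have "A.component \<beta> x = \<zero>\<^bsub>L\<^esub>" if "\<beta> \<in> carrier \<pi>" "\<beta> \<noteq> \<alpha>" for \<beta>
  proof -
    have "h (A.component \<beta> x) = h \<zero>\<^bsub>L\<^esub>"
      using hc[OF that(1)] B.component_homogeneous[OF \<alpha> that(1) x(2)] that(2) h0 by simp
    then show ?thesis using inj_onD[OF inj] c[OF that(1)] by simp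
  qed
  then have S: "?S \<subseteq> {\<alpha>}" by auto
  then consider "?S = {}" | "?S = {\<alpha>}" by blast
  then show ?thesis
  proof cases
    case 1
    have "x = \<zero>\<^bsub>L\<^esub>" using A.component_sum[OF x(1)] unfolding 1 by simp
    then show ?thesis using A.grade_zero[OF \<alpha>] by simp
  next
    case 2
    then have "x = A.component \<alpha> x" using A.component_sum[OF x(1)] c[OF \<alpha>] by simp
    then show ?thesis using A.component_grade[OF x(1) \<alpha>] by simp
  qed
qed

lemma pair_iso_sym:
  assumes p: "p \<in> simple_pairs \<pi> K" and q: "q \<in> simple_pairs \<pi> K" and iso: "pair_iso \<pi> K p q"
  shows "pair_iso \<pi> K q p"
proof -
  obtain L i where pL: "p = (L, i)" by (cases p)
  obtain L' i' where qL: "q = (L', i')" by (cases q)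
  interpret A: pointed_simple \<pi> K L "bas \<pi> K L" i using p unfolding pL simple_pairs_iff .
  interpret B: pointed_simple \<pi> K L' "bas \<pi> K L'" i' using q unfolding qL simple_pairs_iff .
  obtain h where h: "crossed_iso \<pi> K L L' h" and hi: "h i = i'"
    using iso by (auto simp: pair_iso_def pL qL)
  have hr: "h \<in> ring_iso L L'" using h by (simp add: crossed_iso_def)
  note hm = ring_iso_memE[OF hr]
  have inj: "inj_on h (carrier L)" and im: "h ` carrier L = carrier L'"
    using hm(5) by (auto simp: bij_betw_def)
  let ?k = "inv_into (carrier L) h"
  have kh: "?k (h x) = x" if "x \<in> carrier L" for x using inv_into_f_f[OF inj that] .
  have hk: "h (?k y) = y" "?k y \<in> carrier L" if "y \<in> carrier L'" for y
    using f_inv_into_f[of y h "carrier L"] inv_into_into[of y h "carrier L"] im that by auto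
  have "crossed_iso \<pi> K L' L ?k"
    unfolding crossed_iso_def
  proof (intro conjI ballI)
    show "?k \<in> ring_iso L' L" using ring_iso_set_sym[OF A.L.ring_axioms hr] .
    show "?k (c \<odot>\<^bsub>L'\<^esub> y) = c \<odot>\<^bsub>L\<^esub> ?k y" if "c \<in> carrier K" "y \<in> carrier L'" for c y
    proof -
      have "h (c \<odot>\<^bsub>L\<^esub> ?k y) = c \<odot>\<^bsub>L'\<^esub> y" using h hk[OF that(2)] that(1) by (simp add: crossed_iso_def)
      then show ?thesis using kh[of "c \<odot>\<^bsub>L\<^esub> ?k y"] hk[OF that(2)] that(1) by simp
    qed
    show "?k ` grade L' \<alpha> \<subseteq> grade L \<alpha>" if \<alpha>: "\<alpha> \<in> carrier \<pi>" for \<alpha>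
    proof
      fix x assume "x \<in> ?k ` grade L' \<alpha>"
      then obtain y where y: "y \<in> grade L' \<alpha>" "x = ?k y" by auto
      have yc: "y \<in> carrier L'" using B.grade_in_carrier[OF \<alpha> y(1)] .
      show "x \<in> grade L \<alpha>"
        using crossed_iso_reflects_grade[OF A.pi_algebra_axioms B.pi_algebra_axioms h \<alpha>, of x] hk[OF yc] y by simp
    qed
    show "eta L (?k x) (?k y) = eta L' x y" if "x \<in> carrier L'" "y \<in> carrier L'" for x y
    proof -
      have "eta L' (h (?k x)) (h (?k y)) = eta L (?k x) (?k y)"
        using h hk(2)[OF that(1)] hk(2)[OF that(2)] unfolding crossed_iso_def by blast
      then show ?thesis using hk(1)[OF that(1)] hk(1)[OF that(2)] by simp
    qed
    show "?k (phi L' \<alpha> y) = phi L \<alpha> (?k y)" if \<alpha>: "\<alpha> \<in> carrier \<pi>" and y: "y \<in> carrier L'" for \<alpha> y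
    proof -
      have "h (phi L \<alpha> (?k y)) = phi L' \<alpha> (h (?k y))"
        using h hk(2)[OF y] \<alpha> unfolding crossed_iso_def by blast
      then show ?thesis using kh[OF A.phi_closed[OF \<alpha> hk(2)[OF y]]] hk(1)[OF y] by simp
    qed
  qed
  moreover have "?k i' = i" using kh[OF A.point_carrier] hi by simp
  ultimately show ?thesis unfolding pair_iso_def pL qL by (intro exI[of _ ?k]) simp
qed

lemma cocycle_transferI:
  assumes \<pi>: "group \<pi>" and K: "field K" and C: "(G, \<Theta>) \<in> C_set \<pi> K"
    and choice: "(\<theta>, \<omega>) \<in> transfer_choices \<pi> K G \<Theta>"
  shows "cocycle_transfer \<pi> G \<omega> K \<theta>" and "\<Theta> = cohomology_class (\<pi>\<lparr>carrier := G\<rparr>) K \<theta>"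
proof -
  have G: "subgroup G \<pi>" "finite (rcosets\<^bsub>\<pi>\<^esub> G)" "\<Theta> \<in> carrier (H2 (\<pi>\<lparr>carrier := G\<rparr>) K)"
    using C by (auto simp: C_set_def)
  have ch: "\<theta> \<in> \<Theta>" "\<theta> (\<one>\<^bsub>\<pi>\<^esub>, \<one>\<^bsub>\<pi>\<^esub>) = \<one>\<^bsub>K\<^esub>" "\<And>i. i \<in> rcosets\<^bsub>\<pi>\<^esub> G \<Longrightarrow> \<omega> i \<in> i"
    using choice by (auto simp: transfer_choices_def)
  interpret \<pi>: group \<pi> by fact
  interpret cg: cocycle_group "\<pi>\<lparr>carrier := G\<rparr>" K
    using subgroup.subgroup_is_group[OF G(1) \<pi>] K by (simp add: cocycle_group_def)
  note cl = cg.H2_class[OF G(3) ch(1)]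
  show "\<Theta> = cohomology_class (\<pi>\<lparr>carrier := G\<rparr>) K \<theta>" by (rule cl(2))
  have "coset_system \<pi> G \<omega>" 
    by (intro coset_system.intro coset_system_axioms.intro \<pi> G(1,2) ch(3))
  moreover have "twisted (\<pi>\<lparr>carrier := G\<rparr>) K \<theta>"
    using cl(1) ch(2) cg.cocycle_group_axioms by (simp add: twisted_def twisted_axioms_def)
  ultimately show "cocycle_transfer \<pi> G \<omega> K \<theta>" by (rule cocycle_transfer.intro)
qed

lemma transfer_pair_invariant:
  assumes "group \<pi>" "field K" "(G, \<Theta>) \<in> C_set \<pi> K" "(\<theta>, \<omega>) \<in> transfer_choices \<pi> K G \<Theta>"
  shows "transfer_pair \<pi> K G \<theta> \<omega> \<in> simple_pairs \<pi> K"
    and "pair_invariant \<pi> K (transfer_pair \<pi> K G \<theta> \<omega>) = (G, \<Theta>)"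
proof -
  interpret cocycle_transfer \<pi> G \<omega> K \<theta> using cocycle_transferI(1)[OF assms] .
  have e: "transfer_pair \<pi> K G \<theta> \<omega> = (TL, transfer_idem \<pi> G tw.T)"
    by (simp add: transfer_pair_def Let_def)
  show "transfer_pair \<pi> K G \<theta> \<omega> \<in> simple_pairs \<pi> K" unfolding e by (rule transfer_simple)
  show "pair_invariant \<pi> K (transfer_pair \<pi> K G \<theta> \<omega>) = (G, \<Theta>)"
    unfolding e transfer_invariant using cocycle_transferI(2)[OF assms] by simp
qed

text \<open>
  By definition of the invariant the cocycle \<open>\<theta>\<close> is realized by some frame at the distinguished
  idempotent, and the coordinates in this frame give the isomorphism.
\<close>

lemma pair_iso_transfer_pair:
  assumes \<pi>: "group \<pi>" and K: "field K" and C: "(G, \<Theta>) \<in> C_set \<pi> K"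
    and choice: "(\<theta>, \<omega>) \<in> transfer_choices \<pi> K G \<Theta>"
    and p: "p \<in> simple_pairs \<pi> K" and inv: "pair_invariant \<pi> K p = (G, \<Theta>)"
  shows "pair_iso \<pi> K p (transfer_pair \<pi> K G \<theta> \<omega>)"
proof -
  obtain L i where pL: "p = (L, i)" by (cases p)
  interpret A: pointed_simple \<pi> K L "bas \<pi> K L" i using p unfolding pL simple_pairs_iff .
  have G: "G = idem_stabilizer \<pi> L i" and T: "\<Theta> = corner_cocycles \<pi> K L i"
    using inv by (auto simp: pair_invariant_def pL)
  have "\<theta> \<in> corner_cocycles \<pi> K L i" using choice T by (auto simp: transfer_choices_def)
  then obtain l where l: "corner_frame \<pi> L i l" "frame_cocycle \<pi> L i l \<theta>"
    by (auto simp: corner_cocycles_def)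
  interpret framed_simple \<pi> K L "bas \<pi> K L" i \<omega> \<theta> l
    using cocycle_transferI(1)[OF \<pi> K C choice] l A.pointed_simple_axioms
    unfolding G by (simp add: framed_simple_def framed_simple_axioms_def)
  show ?thesis
    unfolding pair_iso_def pL G transfer_pair_def
    using to_transfer_iso to_transfer_point by (intro exI[of _ to_transfer]) (simp add: Let_def)
qed

lemma transfer_choice_exists:
  assumes \<pi>: "group \<pi>" and K: "field K" and C: "(G, \<Theta>) \<in> C_set \<pi> K"
  obtains \<theta> \<omega> where "(\<theta>, \<omega>) \<in> transfer_choices \<pi> K G \<Theta>"
proof -
  interpret \<pi>: group \<pi> by fact
  have G: "subgroup G \<pi>" "\<Theta> \<in> carrier (H2 (\<pi>\<lparr>carrier := G\<rparr>) K)" using C by (auto simp: C_set_def)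
  interpret cg: cocycle_group "\<pi>\<lparr>carrier := G\<rparr>" K
    using subgroup.subgroup_is_group[OF G(1) \<pi>] K by (simp add: cocycle_group_def)
  obtain \<theta> where "\<theta> \<in> \<Theta>" "\<theta> (\<one>\<^bsub>\<pi>\<^esub>, \<one>\<^bsub>\<pi>\<^esub>) = \<one>\<^bsub>K\<^esub>"
    using cg.H2_normalized[OF G(2)] by auto
  moreover have "\<exists>w. w \<in> i" if "i \<in> rcosets\<^bsub>\<pi>\<^esub> G" for i
    using that \<pi>.rcos_self[OF _ G(1)] by (auto simp: RCOSETS_def)
  then have "\<forall>i\<in>rcosets\<^bsub>\<pi>\<^esub> G. (SOME w. w \<in> i) \<in> i" by (auto intro: someI_ex)
  ultimately show ?thesis
    by (intro that[of \<theta> "\<lambda>i. SOME w. w \<in> i"]) (simp add: transfer_choices_def)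
qed

lemma pair_invariant_C_set:
  assumes "p \<in> simple_pairs \<pi> K"
  shows "pair_invariant \<pi> K p \<in> C_set \<pi> K"
proof -
  obtain L i where pL: "p = (L, i)" by (cases p)
  interpret A: pointed_simple \<pi> K L "bas \<pi> K L" i using assms unfolding pL simple_pairs_iff .
  show ?thesis unfolding pL by (rule A.pair_invariant_in_C)
qed

text \<open>
  Two pairs with the same invariant are isomorphic to one and the same transfer. The two pairs may
  live on different types.
\<close>

theorem pair_iso_iff_invariant:
  assumes \<pi>: "group \<pi>" and K: "field K" and p: "p \<in> simple_pairs \<pi> K" and q: "q \<in> simple_pairs \<pi> K"
  shows "pair_iso \<pi> K p q \<longleftrightarrow> pair_invariant \<pi> K p = pair_invariant \<pi> K q"
proof
  assume eq: "pair_invariant \<pi> K p = pair_invariant \<pi> K q"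
  obtain G \<Theta> where GT: "pair_invariant \<pi> K p = (G, \<Theta>)" by (cases "pair_invariant \<pi> K p")
  have C: "(G, \<Theta>) \<in> C_set \<pi> K" using pair_invariant_C_set[OF p] GT by simp
  obtain \<theta> \<omega> where ch: "(\<theta>, \<omega>) \<in> transfer_choices \<pi> K G \<Theta>" using transfer_choice_exists[OF \<pi> K C] .
  have "pair_iso \<pi> K p (transfer_pair \<pi> K G \<theta> \<omega>)" "pair_iso \<pi> K q (transfer_pair \<pi> K G \<theta> \<omega>)"
    using pair_iso_transfer_pair[OF \<pi> K C ch p] pair_iso_transfer_pair[OF \<pi> K C ch q] GT eq
    by simp_all
  then show "pair_iso \<pi> K p q"
    using pair_iso_trans pair_iso_sym[OF q transfer_pair_invariant(1)[OF \<pi> K C ch]] by blast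
qed (rule pair_iso_invariant[OF p q])

section \<open>The bijection\<close>

lemma group_actionI:
  assumes G: "group G"
    and closed: "\<And>g x. g \<in> carrier G \<Longrightarrow> x \<in> E \<Longrightarrow> \<phi> g x \<in> E"
    and one: "\<And>x. x \<in> E \<Longrightarrow> \<phi> \<one>\<^bsub>G\<^esub> x = x"
    and mult: "\<And>g h x. g \<in> carrier G \<Longrightarrow> h \<in> carrier G \<Longrightarrow> x \<in> E \<Longrightarrow> \<phi> (g \<otimes>\<^bsub>G\<^esub> h) x = \<phi> g (\<phi> h x)"
    and ext: "\<And>g. g \<in> carrier G \<Longrightarrow> \<phi> g \<in> extensional E"
  shows "group_action G E \<phi>"
proof -
  interpret G: group G by fact
  have bij: "\<phi> g \<in> Bij E" if g: "g \<in> carrier G" for g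
  proof -
    have "\<phi> (inv\<^bsub>G\<^esub> g) (\<phi> g x) = x" "\<phi> g (\<phi> (inv\<^bsub>G\<^esub> g) x) = x" if "x \<in> E" for x
      using mult[of "inv\<^bsub>G\<^esub> g" g x] mult[of g "inv\<^bsub>G\<^esub> g" x] one[of x] g that by auto
    then have "bij_betw (\<phi> g) E E"
      using closed g by (intro bij_betwI[where g = "\<phi> (inv\<^bsub>G\<^esub> g)"]) auto
    then show ?thesis using ext[OF g] by (simp add: Bij_def)
  qed
  have "\<phi> \<in> hom G (BijGroup E)"
  proof (rule homI)
    fix g h assume g: "g \<in> carrier G" and h: "h \<in> carrier G"
    have "\<phi> (g \<otimes>\<^bsub>G\<^esub> h) = compose E (\<phi> g) (\<phi> h)"
      using ext[of "g \<otimes>\<^bsub>G\<^esub> h"] mult[OF g h] g h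
      by (intro extensionalityI[where A = E]) (auto simp: compose_def)
    then show "\<phi> (g \<otimes>\<^bsub>G\<^esub> h) = \<phi> g \<otimes>\<^bsub>BijGroup E\<^esub> \<phi> h"
      using bij g h by (simp add: BijGroup_def)
  qed (use bij in \<open>simp add: BijGroup_def\<close>)
  then show ?thesis
    by (intro group_action.intro group_hom.intro group_hom_axioms.intro G group_BijGroup)
qed

text \<open>
  Whatever holds for the action on \<open>C\<close> holds on \<open>D\<close>; only the convention that actions are
  undefined outside their domain has to be assumed.
\<close>

lemma group_action_transport:
  assumes act: "group_action G C \<phi>" and F: "bij_betw F C D"
    and equi: "\<And>g c. g \<in> carrier G \<Longrightarrow> c \<in> C \<Longrightarrow> F (\<phi> g c) = \<psi> g (F c)"
    and ext: "\<And>g. g \<in> carrier G \<Longrightarrow> \<psi> g \<in> extensional D"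
  shows "group_action G D \<psi>"
    and "bij_betw (\<lambda>orb. F ` orb) (orbits G C \<phi>) (orbits G D \<psi>)"
proof -
  interpret group_action G C \<phi> by fact
  have G: "group G" using group_hom by (simp add: group_hom_def)
  interpret G: group G by fact
  have D: "D = F ` C" using F by (simp add: bij_betw_def)
  have closed: "\<phi> g c \<in> C" if "g \<in> carrier G" "c \<in> C" for g c using element_image that by blast
  show "group_action G D \<psi>"
  proof (rule group_actionI[OF G _ _ _ ext])
    show "\<psi> g d \<in> D" if "g \<in> carrier G" "d \<in> D" for g d
      using that equi closed unfolding D by (metis (no_types, lifting) imageE imageI)
    show "\<psi> \<one>\<^bsub>G\<^esub> d = d" if d: "d \<in> D" for d
    proof -
      obtain c where c: "c \<in> C" "d = F c" using d D by auto
      have "\<phi> \<one>\<^bsub>G\<^esub> c = c" using id_eq_one c(1) by (metis restrict_apply')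
      then show ?thesis using equi[OF G.one_closed c(1)] c(2) by simp
    qed
    show "\<psi> (g \<otimes>\<^bsub>G\<^esub> h) d = \<psi> g (\<psi> h d)" if g: "g \<in> carrier G" and h: "h \<in> carrier G" and d: "d \<in> D" for g h d
    proof -
      obtain c where c: "c \<in> C" "d = F c" using d D by auto
      have "\<psi> (g \<otimes>\<^bsub>G\<^esub> h) d = F (\<phi> (g \<otimes>\<^bsub>G\<^esub> h) c)" using equi g h c by simp
      also have "\<phi> (g \<otimes>\<^bsub>G\<^esub> h) c = \<phi> g (\<phi> h c)" using composition_rule[OF c(1) g h] .
      finally show ?thesis using equi g h c closed by simp
    qed
  qed
  have orb: "F ` orbit G \<phi> c = orbit G \<psi> (F c)" "orbit G \<phi> c \<subseteq> C" if "c \<in> C" for c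
    using equi[OF _ that] closed[OF _ that] unfolding orbit_def by (auto simp: image_iff) metis
  show "bij_betw (\<lambda>orb. F ` orb) (orbits G C \<phi>) (orbits G D \<psi>)"
    unfolding bij_betw_def
  proof
    show "inj_on (\<lambda>orb. F ` orb) (orbits G C \<phi>)"
    proof (rule inj_onI)
      fix A B assume A: "A \<in> orbits G C \<phi>" and B: "B \<in> orbits G C \<phi>" and eq: "F ` A = F ` B"
      have "A \<subseteq> C" "B \<subseteq> C" using A B orb(2) unfolding orbits_def by auto
      then show "A = B" using eq F inj_on_image_eq_iff unfolding bij_betw_def by blast
    qed
    show "(\<lambda>orb. F ` orb) ` orbits G C \<phi> = orbits G D \<psi>"
    proof (intro equalityI subsetI)
      fix B assume "B \<in> (\<lambda>orb. F ` orb) ` orbits G C \<phi>"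
      then obtain c where "c \<in> C" "B = F ` orbit G \<phi> c" unfolding orbits_def by auto
      then show "B \<in> orbits G D \<psi>" using orb(1) unfolding orbits_def D by auto
    next
      fix B assume "B \<in> orbits G D \<psi>"
      then obtain c where c: "c \<in> C" "B = orbit G \<psi> (F c)" unfolding orbits_def D by auto
      then show "B \<in> (\<lambda>orb. F ` orb) ` orbits G C \<phi>" using orb(1)[OF c(1)] unfolding orbits_def by auto
    qed
  qed
qed

definition move_point :: "'g \<Rightarrow> ('g, 'k, 'a) crossed_pair \<Rightarrow> ('g, 'k, 'a) crossed_pair" where
  "move_point \<alpha> = (\<lambda>(L, i). (L, phi L \<alpha> i))"

lemma move_point_facts:
  assumes p: "p \<in> simple_pairs \<pi> K"
  shows move_point_closed: "\<alpha> \<in> carrier \<pi> \<Longrightarrow> move_point \<alpha> p \<in> simple_pairs \<pi> K"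
    and move_point_invariant: "\<alpha> \<in> carrier \<pi> \<Longrightarrow>
      pair_invariant \<pi> K (move_point \<alpha> p) = C_action \<pi> K \<alpha> (pair_invariant \<pi> K p)"
    and move_point_one: "move_point \<one>\<^bsub>\<pi>\<^esub> p = p"
    and move_point_mult: "\<alpha> \<in> carrier \<pi> \<Longrightarrow> \<beta> \<in> carrier \<pi> \<Longrightarrow>
      move_point (\<alpha> \<otimes>\<^bsub>\<pi>\<^esub> \<beta>) p = move_point \<alpha> (move_point \<beta> p)"
proof -
  obtain L i where pL: "p = (L, i)" by (cases p)
  interpret A: pointed_simple \<pi> K L "bas \<pi> K L" i using p unfolding pL simple_pairs_iff .
  show "move_point \<alpha> p \<in> simple_pairs \<pi> K" if "\<alpha> \<in> carrier \<pi>"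
    using A.pointed_simple_phi[OF that] by (simp add: move_point_def pL simple_pairs_iff)
  show "pair_invariant \<pi> K (move_point \<alpha> p) = C_action \<pi> K \<alpha> (pair_invariant \<pi> K p)" if "\<alpha> \<in> carrier \<pi>"
    using A.pair_invariant_phi[OF that] A.pair_invariant_in_C
    by (simp add: move_point_def pL C_action_def pair_invariant_def)
  show "move_point \<one>\<^bsub>\<pi>\<^esub> p = p" using A.phi_unit[OF A.point_carrier] by (simp add: move_point_def pL)
  show "move_point (\<alpha> \<otimes>\<^bsub>\<pi>\<^esub> \<beta>) p = move_point \<alpha> (move_point \<beta> p)" if "\<alpha> \<in> carrier \<pi>" "\<beta> \<in> carrier \<pi>"
    using A.phi_hom[OF that A.point_carrier] by (simp add: move_point_def pL)
qed

locale classification = \<pi>: group \<pi> + K: field K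
  for \<pi> :: "('g, 'm) monoid_scheme" and K :: "('k, 'n) ring_scheme"
begin

abbreviation S :: "('g, 'k, ('g, 'k) std) crossed_pair set" where "S \<equiv> simple_pairs \<pi> K"
abbreviation D where "D \<equiv> D_set \<pi> K :: ('g, 'k, ('g, 'k) std) crossed_pair set set"

text \<open>
  The isomorphism classes are the fibers of the invariant, and \<open>C_to_D\<close> maps an invariant to its
  fiber whatever choices are made.
\<close>

definition fiber :: "'g set \<times> ('g \<times> 'g \<Rightarrow> 'k) set \<Rightarrow> ('g, 'k, ('g, 'k) std) crossed_pair set" where
  "fiber c = {p \<in> S. pair_invariant \<pi> K p = c}"

lemma rel_fiber:
  assumes "p \<in> S"
  shows "pair_iso_rel \<pi> K `` {p} = fiber (pair_invariant \<pi> K p)"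
proof (rule Set.set_eqI)
  fix q
  have "pair_iso \<pi> K p q \<longleftrightarrow> pair_invariant \<pi> K q = pair_invariant \<pi> K p" if "q \<in> S"
    using pair_iso_iff_invariant[OF \<pi>.is_group K.field_axioms assms that] by auto
  then show "q \<in> pair_iso_rel \<pi> K `` {p} \<longleftrightarrow> q \<in> fiber (pair_invariant \<pi> K p)"
    using assms by (cases "q \<in> S") (simp_all add: pair_iso_rel_def fiber_def)
qed

lemma choice_transfer_pair:
  assumes "(G, \<Theta>) \<in> C_set \<pi> K" "(\<theta>, \<omega>) \<in> transfer_choices \<pi> K G \<Theta>"
  shows "transfer_pair \<pi> K G \<theta> \<omega> \<in> fiber (G, \<Theta>)"
  using transfer_pair_invariant[OF \<pi>.is_group K.field_axioms assms] by (simp add: fiber_def)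

lemma C_to_D_eq_fiber:
  assumes "c \<in> C_set \<pi> K"
  shows "C_to_D \<pi> K c = fiber c"
proof -
  obtain G \<Theta> where c: "c = (G, \<Theta>)" by (cases c)
  have C: "(G, \<Theta>) \<in> C_set \<pi> K" using assms c by simp
  have "pair_iso_rel \<pi> K `` {transfer_pair \<pi> K G \<theta> \<omega>} = fiber c"
    if "(\<theta>, \<omega>) \<in> transfer_choices \<pi> K G \<Theta>" for \<theta> \<omega>
    using choice_transfer_pair[OF C that] rel_fiber[of "transfer_pair \<pi> K G \<theta> \<omega>"] c by (simp add: fiber_def)
  moreover obtain \<theta> \<omega> where "(\<theta>, \<omega>) \<in> transfer_choices \<pi> K G \<Theta>"
    using transfer_choice_exists[OF \<pi>.is_group K.field_axioms C] .
  ultimately show ?thesis unfolding C_to_D_def c by fastforce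
qed

lemma fiber_nonempty:
  assumes "c \<in> C_set \<pi> K"
  obtains p where "p \<in> S" "pair_invariant \<pi> K p = c"
proof -
  obtain G \<Theta> where c: "c = (G, \<Theta>)" by (cases c)
  have C: "(G, \<Theta>) \<in> C_set \<pi> K" using assms c by simp
  obtain \<theta> \<omega> where "(\<theta>, \<omega>) \<in> transfer_choices \<pi> K G \<Theta>"
    using transfer_choice_exists[OF \<pi>.is_group K.field_axioms C] .
  from choice_transfer_pair[OF C this] show ?thesis
    using c by (intro that[of "transfer_pair \<pi> K G \<theta> \<omega>"]) (simp_all add: fiber_def)
qed

lemma D_eq: "D = fiber ` C_set \<pi> K"
proof (intro equalityI subsetI)
  fix d assume "d \<in> D"
  then obtain p where "p \<in> S" "d = pair_iso_rel \<pi> K `` {p}" unfolding D_set_def by (rule quotientE)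
  then show "d \<in> fiber ` C_set \<pi> K" using rel_fiber pair_invariant_C_set by blast
next
  fix d assume "d \<in> fiber ` C_set \<pi> K"
  then obtain c where c: "c \<in> C_set \<pi> K" "d = fiber c" by auto
  obtain p where "p \<in> S" "pair_invariant \<pi> K p = c" using fiber_nonempty[OF c(1)] .
  then show "d \<in> D" unfolding D_set_def using rel_fiber c quotientI by metis
qed

lemma bij_C_to_D: "bij_betw (C_to_D \<pi> K) (C_set \<pi> K) D"
proof -
  have "inj_on fiber (C_set \<pi> K)"
  proof (rule inj_onI)
    fix c c' assume c: "c \<in> C_set \<pi> K" and "c' \<in> C_set \<pi> K" and eq: "fiber c = fiber c'"
    obtain p where "p \<in> S" "pair_invariant \<pi> K p = c" using fiber_nonempty[OF c] .
    then have "p \<in> fiber c'" using eq by (auto simp: fiber_def)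
    then show "c = c'" using \<open>pair_invariant \<pi> K p = c\<close> by (simp add: fiber_def)
  qed
  then have "bij_betw fiber (C_set \<pi> K) D" using D_eq by (simp add: bij_betw_def)
  then show ?thesis using C_to_D_eq_fiber by (subst bij_betw_cong[of _ _ fiber]) auto
qed

text \<open>
  Every element of \<open>C(\<pi>)\<close> is the invariant of some pair, so the axioms of an action are inherited
  from those for moving the distinguished idempotent.
\<close>

lemma C_group_action: "group_action \<pi> (C_set \<pi> K) (C_action \<pi> K)"
proof (rule group_actionI[OF \<pi>.is_group])
  fix c assume c: "c \<in> C_set \<pi> K"
  obtain p where p: "p \<in> S" "pair_invariant \<pi> K p = c" using fiber_nonempty[OF c] .
  show cl: "C_action \<pi> K \<alpha> c \<in> C_set \<pi> K" if "\<alpha> \<in> carrier \<pi>" for \<alpha>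
    using move_point_invariant[OF p(1) that] pair_invariant_C_set[OF move_point_closed[OF p(1) that]] p(2)
    by simp
  show "C_action \<pi> K \<one>\<^bsub>\<pi>\<^esub> c = c"
    using move_point_invariant[OF p(1) \<pi>.one_closed] move_point_one[OF p(1)] p(2) by simp
  show "C_action \<pi> K (\<alpha> \<otimes>\<^bsub>\<pi>\<^esub> \<beta>) c = C_action \<pi> K \<alpha> (C_action \<pi> K \<beta> c)"
    if a: "\<alpha> \<in> carrier \<pi>" and b: "\<beta> \<in> carrier \<pi>" for \<alpha> \<beta>
    using move_point_invariant[OF p(1) \<pi>.m_closed[OF a b]] move_point_mult[OF p(1) a b]
      move_point_invariant[OF move_point_closed[OF p(1) b] a] move_point_invariant[OF p(1) b] p(2) by simp
next
  show "C_action \<pi> K \<alpha> \<in> extensional (C_set \<pi> K)" for \<alpha> by (simp add: C_action_def)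
qed

lemma move_fiber:
  assumes c: "c \<in> C_set \<pi> K" and \<alpha>: "\<alpha> \<in> carrier \<pi>"
  shows "move_point \<alpha> ` fiber c = fiber (C_action \<pi> K \<alpha> c)"
proof -
  have \<alpha>': "inv\<^bsub>\<pi>\<^esub> \<alpha> \<in> carrier \<pi>" using \<alpha> by simp
  have sub: "move_point \<beta> ` fiber c \<subseteq> fiber (C_action \<pi> K \<beta> c)" if "\<beta> \<in> carrier \<pi>" for \<beta> c
    using move_point_closed[OF _ that] move_point_invariant[OF _ that] by (auto simp: fiber_def)
  interpret C: group_action \<pi> "C_set \<pi> K" "C_action \<pi> K" by (rule C_group_action)
  have inv: "C_action \<pi> K (inv\<^bsub>\<pi>\<^esub> \<alpha>) (C_action \<pi> K \<alpha> c) = c"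
    using C.orbit_sym_aux[OF \<alpha> c] by simp
  have "q \<in> move_point \<alpha> ` fiber c" if q: "q \<in> fiber (C_action \<pi> K \<alpha> c)" for q
  proof
    have qS: "q \<in> S" using q by (simp add: fiber_def)
    show "move_point (inv\<^bsub>\<pi>\<^esub> \<alpha>) q \<in> fiber c" using sub[OF \<alpha>', of "C_action \<pi> K \<alpha> c"] q inv by auto
    show "q = move_point \<alpha> (move_point (inv\<^bsub>\<pi>\<^esub> \<alpha>) q)"
      using move_point_mult[OF qS \<alpha> \<alpha>'] move_point_one[OF qS] \<alpha> by simp
  qed
  then show ?thesis using sub[OF \<alpha>] by blast
qed

lemma C_to_D_equivariant:
  assumes \<alpha>: "\<alpha> \<in> carrier \<pi>" and c: "c \<in> C_set \<pi> K"
  shows "C_to_D \<pi> K (C_action \<pi> K \<alpha> c) = D_action \<pi> K \<alpha> (C_to_D \<pi> K c)"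
proof -
  interpret C: group_action \<pi> "C_set \<pi> K" "C_action \<pi> K" by (rule C_group_action)
  have "fiber c \<in> D" using D_eq c by auto
  then have "D_action \<pi> K \<alpha> (fiber c) = move_point \<alpha> ` fiber c"
    by (simp add: D_action_def move_point_def)
  then show ?thesis
    using move_fiber[OF c \<alpha>] C_to_D_eq_fiber[OF c] C_to_D_eq_fiber[OF C.element_image[OF \<alpha> c refl]] by simp
qed

lemma unique_class:
  fixes p :: "('g, 'k, 'a) crossed_pair"
  assumes p: "p \<in> simple_pairs \<pi> K"
  shows "\<exists>!d. d \<in> D \<and> (\<exists>q\<in>d. pair_iso \<pi> K p q)"
proof -
  let ?c = "pair_invariant \<pi> K p"
  have c: "?c \<in> C_set \<pi> K" by (rule pair_invariant_C_set[OF p])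
  have iff: "pair_iso \<pi> K p q \<longleftrightarrow> pair_invariant \<pi> K p = pair_invariant \<pi> K q" if "q \<in> S" for q
    using pair_iso_iff_invariant[OF \<pi>.is_group K.field_axioms p that] .
  show ?thesis
  proof (rule ex1I[of _ "fiber ?c"])
    obtain q where q: "q \<in> S" "pair_invariant \<pi> K q = ?c" using fiber_nonempty[OF c] .
    have "q \<in> fiber ?c" "pair_iso \<pi> K p q" using q iff[OF q(1)] by (simp_all add: fiber_def)
    moreover have "fiber ?c \<in> D" using c D_eq by blast
    ultimately show "fiber ?c \<in> D \<and> (\<exists>q\<in>fiber ?c. pair_iso \<pi> K p q)" by blast
    fix d assume "d \<in> D \<and> (\<exists>q\<in>d. pair_iso \<pi> K p q)"
    then obtain c' q where q: "d = fiber c'" "q \<in> fiber c'" "pair_iso \<pi> K p q" using D_eq by blast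
    then have "q \<in> S" "pair_invariant \<pi> K q = c'" by (simp_all add: fiber_def)
    then show "d = fiber ?c" using iff q by simp
  qed
qed

end

theorem theorem3p6:
  fixes \<pi> :: "('g, 'm) monoid_scheme" and K :: "('k, 'n) ring_scheme"
  assumes "group \<pi>" and "field K" and "char_zero K"
  shows "group_action \<pi> (C_set \<pi> K) (C_action \<pi> K) \<and>
    group_action \<pi> (D_set \<pi> K :: ('g, 'k, ('g, 'k) std) crossed_pair set set) (D_action \<pi> K) \<and>
    (\<forall>p \<in> (simple_pairs \<pi> K :: ('g, 'k, 'a) crossed_pair set).
       \<exists>!d. d \<in> (D_set \<pi> K :: ('g, 'k, ('g, 'k) std) crossed_pair set set) \<and>
            (\<exists>q\<in>d. pair_iso \<pi> K p q)) \<and>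
    (\<forall>(G, \<Theta>) \<in> C_set \<pi> K. \<forall>(\<theta>, \<omega>) \<in> transfer_choices \<pi> K G \<Theta>.
       transfer_pair \<pi> K G \<theta> \<omega> \<in> C_to_D \<pi> K (G, \<Theta>)) \<and>
    bij_betw (C_to_D \<pi> K) (C_set \<pi> K) (D_set \<pi> K) \<and>
    (\<forall>\<alpha>\<in>carrier \<pi>. \<forall>c\<in>C_set \<pi> K.
       C_to_D \<pi> K (C_action \<pi> K \<alpha> c) = D_action \<pi> K \<alpha> (C_to_D \<pi> K c)) \<and>
    bij_betw (\<lambda>orb. C_to_D \<pi> K ` orb)
      (orbits \<pi> (C_set \<pi> K) (C_action \<pi> K)) (orbits \<pi> (D_set \<pi> K) (D_action \<pi> K))"
proof -
  interpret classification \<pi> K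
    using assms(1,2) by (rule classification.intro)
  have ext: "D_action \<pi> K \<alpha> \<in> extensional D" for \<alpha> by (simp add: D_action_def)
  note transport = group_action_transport[OF C_group_action bij_C_to_D C_to_D_equivariant ext]
  have "transfer_pair \<pi> K G \<theta> \<omega> \<in> C_to_D \<pi> K (G, \<Theta>)"
    if "(G, \<Theta>) \<in> C_set \<pi> K" "(\<theta>, \<omega>) \<in> transfer_choices \<pi> K G \<Theta>" for G \<Theta> \<theta> \<omega>
    using choice_transfer_pair[OF that] C_to_D_eq_fiber[OF that(1)] by simp
  then have choices: "\<forall>(G, \<Theta>)\<in>C_set \<pi> K. \<forall>(\<theta>, \<omega>)\<in>transfer_choices \<pi> K G \<Theta>.
      transfer_pair \<pi> K G \<theta> \<omega> \<in> C_to_D \<pi> K (G, \<Theta>)"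
    by blast
  show ?thesis
    by (intro conjI C_group_action transport choices bij_C_to_D ballI unique_class C_to_D_equivariant)
qed

end
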